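(* Let $G=(\mathcal V,\mathcal E)$ be a finite undirected graph with finite label sets and potentials $\theta$, and run the pruning algorithm described in the context. Since $\mathcal V$ is finite and $|A^t|$ is monotonically decreasing, the algorithm converges in at most $|\mathcal V|$ steps. Each subproblem of the algorithm can be solved in polynomial time; as the number of iterations is at most $|\mathcal V|$, the algorithm itself is polynomial as well. After termination, its output $(A^\ast,x^\ast)$ satisfies $$\delta(x^\ast)\in\operatorname*{arg\,min}_{\mu\in\Lambda_{A^\ast}}\hat E_{A^\ast,x^\ast}(\mu),$$ and hence $x^\ast$ is persistent on $A^\ast$: it coincides on $A^\ast$ with a minimizer of $E_{\mathcal V}$ over $X_{\mathcal V}$.
   Context: For $A\subset\mathcal V$, $X_A=\prod_{v\in A}X_v$, where $X_v$ is the finite label set of node $v$; $\theta_u:X_u\to\mathbb R$ and $\theta_{uv}:X_u\times X_v\to\mathbb R$ are the unary and pairwise potentials (edges are undirected, so $\theta_{uv}(x_u,x_v)$ and $\theta_{vu}(x_v,x_u)$ denote the same number). $E_A(x)=\sum_{u\in A}\theta_u(x_u)+\sum_{uv\in\mathcal E:\,u,v\in A}\theta_{uv}(x_u,x_v)$. Boundary nodes: $\partial\mathcal V_A=\{u\in A:\exists v\in\mathcal V\setminus A,\ uv\in\mathcal E\}$; boundary edges: $\partial\mathcal E_A=\{uv\in\mathcal E:u\in A,\ v\in\mathcal V\setminus A\}$. For $uv\in\partial\mathcal E_A$ with $u\in\partial\mathcal V_A$ and a test label $y_u$: $\hat\theta_{uv,y_u}(x_u)=\max_{x_v\in X_v}\theta_{uv}(x_u,x_v)$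 if $x_u=y_u$, and $\hat\theta_{uv,y_u}(x_u)=\min_{x_v\in X_v}\theta_{uv}(x_u,x_v)$ if $x_u\neq y_u$. $\hat E_{A,y}(x)=E_A(x)+\sum_{uv\in\partial\mathcal E_A:\,u\in\partial\mathcal V_A}\hat\theta_{uv,y_u}(x_u)$ (only the restriction of $y$ to $\partial\mathcal V_A$ matters). The local polytope $\Lambda_A$ is the set of nonnegative vectors $\mu$ with components $\mu_v(x_v)$ ($v\in A$, $x_v\in X_v$) and $\mu_{uv}(x_u,x_v)$ ($uv\in\mathcal E$, $u,v\in A$) such that $\sum_{x_v\in X_v}\mu_v(x_v)=1$, $\sum_{x_v\in X_v}\mu_{uv}(x_u,x_v)=\mu_u(x_u)$ and $\sum_{x_u\in X_u}\mu_{uv}(x_u,x_v)=\mu_v(x_v)$. For $x\in X_A$, $\delta(x)\in\Lambda_A$ is its indicator vector. Energies that are sums of unary and pairwise terms are extended linearly to $\Lambda_A$ (each $f_v$ becomes $\sum_{x_v}f_v(x_v)\mu_v(x_v)$, each $f_{uv}$ becomes $\sum_{x_u,x_v}f_{uv}(x_u,x_v)\mu_{uv}(x_u,x_v)$). Pruning algorithm. Initialize: choose $\mu^0\in\operatorname{arg\,min}_{\mu\in\Lambda_{\mathcal V}}E_{\mathcal V}(\mu)$, set $A^0=\{u\in\mathcal V:\mu^0_u\in\{0,1\}^{|X_u|}\}$, $t=0$. Repeat: (1) let $x^t\in X_{A^t}$ be given by $\mu^t_u(x^t_u)=1$, $u\in A^t$; (2) choose $\mu^{t+1}\in\operatorname{arg\,min}_{\mu\in\Lambda_{A^t}}\hat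 E_{A^t,x^t}(\mu)$; (3) set $t:=t+1$; (4) $W^t=\{u\in\partial\mathcal V_{A^{t-1}}:\mu^t_u(x^{t-1}_u)\neq1\}$; (5) $A^t=\{u\in A^{t-1}:\mu^t_u\in\{0,1\}^{|X_u|}\}\setminus W^t$; until $A^t=A^{t-1}$. Output $A^\ast=A^t$ and $x^\ast\in X_{A^\ast}$ with $\mu^t_u(x^\ast_u)=1$ for $u\in A^\ast$.
   Formalization: The loop may run |V|+1 times when A* is empty (one node, two equal labels), so the bound is |V| iterations not counting the last one, which only detects A^t=A^{t-1}, and |V| in all if A* is nonempty; polynomial time is meant for rational potentials, in bit size. *)

theory Defs
  imports
    Complex_Main
    "HOL-Library.FuncSet"
    "HOL-Library.Log_Nat"
    "HOL-Computational_Algebra.Polynomial"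
begin

section \<open>Graphical models\<close>

text \<open>
  Each undirected edge is stored once, in an arbitrary orientation: \<open>edges\<close> contains exactly one
  of \<open>(u, v)\<close> and \<open>(v, u)\<close>.  Undirected access is through \<open>adjacent\<close> and \<open>edge_potential\<close>.
\<close>

record ('v, 'l) model =
  nodes :: "'v set"
  edges :: "('v \<times> 'v) set"
  labels :: "'v \<Rightarrow> 'l set"
  unary :: "'v \<Rightarrow> 'l \<Rightarrow> real"
  pairwise :: "'v \<times> 'v \<Rightarrow> 'l \<Rightarrow> 'l \<Rightarrow> real"

definition wf_model :: "('v, 'l) model \<Rightarrow> bool" where
  "wf_model M \<longleftrightarrow>
     finite (nodes M) \<and> edges M \<subseteq> nodes M \<times> nodes M \<and>
     (\<forall>u v. (u, v) \<in> edges M \<longrightarrow> u \<noteq> v \<and> (v, u) \<notin> edges M) \<and>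
     (\<forall>v\<in>nodes M. finite (labels M v) \<and> labels M v \<noteq> {})"

definition adjacent :: "('v, 'l) model \<Rightarrow> 'v \<Rightarrow> 'v \<Rightarrow> bool" where
  "adjacent M u v \<longleftrightarrow> (u, v) \<in> edges M \<or> (v, u) \<in> edges M"

definition edge_potential :: "('v, 'l) model \<Rightarrow> 'v \<Rightarrow> 'v \<Rightarrow> 'l \<Rightarrow> 'l \<Rightarrow> real" where
  "edge_potential M u v a b =
     (if (u, v) \<in> edges M then pairwise M (u, v) a b else pairwise M (v, u) b a)"

definition edges_within :: "('v, 'l) model \<Rightarrow> 'v set \<Rightarrow> ('v \<times> 'v) set" where
  "edges_within M A = {(u, v) \<in> edges M. u \<in> A \<and> v \<in> A}"

definition boundary_nodes :: "('v, 'l) model \<Rightarrow> 'v set \<Rightarrow> 'v set" where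
  "boundary_nodes M A = {u \<in> A. \<exists>v \<in> nodes M - A. adjacent M u v}"

text \<open>Boundary edges are listed with the endpoint inside \<open>A\<close> first.\<close>

definition boundary_edges :: "('v, 'l) model \<Rightarrow> 'v set \<Rightarrow> ('v \<times> 'v) set" where
  "boundary_edges M A = {(u, v). u \<in> A \<and> v \<in> nodes M - A \<and> adjacent M u v}"

text \<open>Labelings of \<open>A\<close>; values outside \<open>A\<close> are irrelevant.\<close>

definition labelings :: "('v, 'l) model \<Rightarrow> 'v set \<Rightarrow> ('v \<Rightarrow> 'l) set" where
  "labelings M A = Pi A (labels M)"

definition energy :: "('v, 'l) model \<Rightarrow> 'v set \<Rightarrow> ('v \<Rightarrow> 'l) \<Rightarrow> real" where
  "energy M A x =
     (\<Sum>u\<in>A. unary M u (x u)) + (\<Sum>(u, v)\<in>edges_within M A. pairwise M (u, v) (x u) (x v))"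

section \<open>Local polytope relaxation\<close>

text \<open>
  A relaxed labeling is a pair \<open>(\<mu>\<^sub>1, \<mu>\<^sub>2)\<close> of unary and pairwise components.  Components that do
  not belong to the node set under consideration are unconstrained and never read.
\<close>

type_synonym ('v, 'l) relaxed = "('v \<Rightarrow> 'l \<Rightarrow> real) \<times> ('v \<times> 'v \<Rightarrow> 'l \<Rightarrow> 'l \<Rightarrow> real)"

definition local_polytope :: "('v, 'l) model \<Rightarrow> 'v set \<Rightarrow> ('v, 'l) relaxed set" where
  "local_polytope M A = {(\<mu>1, \<mu>2).
     (\<forall>v\<in>A. (\<forall>a\<in>labels M v. 0 \<le> \<mu>1 v a) \<and> (\<Sum>a\<in>labels M v. \<mu>1 v a) = 1) \<and>
     (\<forall>(u, v)\<in>edges_within M A.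
        (\<forall>a\<in>labels M u. \<forall>b\<in>labels M v. 0 \<le> \<mu>2 (u, v) a b) \<and>
        (\<forall>a\<in>labels M u. (\<Sum>b\<in>labels M v. \<mu>2 (u, v) a b) = \<mu>1 u a) \<and>
        (\<forall>b\<in>labels M v. (\<Sum>a\<in>labels M u. \<mu>2 (u, v) a b) = \<mu>1 v b))}"

definition indicator_vector :: "('v \<Rightarrow> 'l) \<Rightarrow> ('v, 'l) relaxed" where
  "indicator_vector x =
     (\<lambda>v a. of_bool (x v = a), \<lambda>(u, v) a b. of_bool (x u = a \<and> x v = b))"

definition relaxed_energy :: "('v, 'l) model \<Rightarrow> 'v set \<Rightarrow> ('v, 'l) relaxed \<Rightarrow> real" where
  "relaxed_energy M A = (\<lambda>(\<mu>1, \<mu>2).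
     (\<Sum>u\<in>A. \<Sum>a\<in>labels M u. unary M u a * \<mu>1 u a) +
     (\<Sum>(u, v)\<in>edges_within M A. \<Sum>a\<in>labels M u. \<Sum>b\<in>labels M v.
        pairwise M (u, v) a b * \<mu>2 (u, v) a b))"

definition boundary_potential :: "('v, 'l) model \<Rightarrow> 'v \<Rightarrow> 'v \<Rightarrow> 'l \<Rightarrow> 'l \<Rightarrow> real" where
  "boundary_potential M u v y a =
     (if a = y then Max (edge_potential M u v a ` labels M v)
      else Min (edge_potential M u v a ` labels M v))"

definition relaxed_boundary_energy ::
    "('v, 'l) model \<Rightarrow> 'v set \<Rightarrow> ('v \<Rightarrow> 'l) \<Rightarrow> ('v, 'l) relaxed \<Rightarrow> real" where
  "relaxed_boundary_energy M A y \<mu> =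
     relaxed_energy M A \<mu> +
     (\<Sum>(u, v)\<in>boundary_edges M A. \<Sum>a\<in>labels M u. boundary_potential M u v (y u) a * fst \<mu> u a)"

definition minimizers :: "('a \<Rightarrow> real) \<Rightarrow> 'a set \<Rightarrow> 'a set" where
  "minimizers f S = {x. is_arg_min f (\<lambda>x. x \<in> S) x}"

definition persistent :: "('v, 'l) model \<Rightarrow> 'v set \<Rightarrow> ('v \<Rightarrow> 'l) \<Rightarrow> bool" where
  "persistent M A x \<longleftrightarrow>
     (\<exists>z \<in> minimizers (energy M (nodes M)) (labelings M (nodes M)). \<forall>v\<in>A. z v = x v)"

section \<open>The pruning algorithm\<close>

definition integral_nodes :: "('v, 'l) model \<Rightarrow> 'v set \<Rightarrow> ('v, 'l) relaxed \<Rightarrow> 'v set" where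
  "integral_nodes M S \<mu> = {u \<in> S. \<forall>a\<in>labels M u. fst \<mu> u a \<in> {0, 1}}"

definition rounds_to ::
    "('v, 'l) model \<Rightarrow> 'v set \<Rightarrow> ('v, 'l) relaxed \<Rightarrow> ('v \<Rightarrow> 'l) \<Rightarrow> bool" where
  "rounds_to M A \<mu> x \<longleftrightarrow> x \<in> labelings M A \<and> (\<forall>u\<in>A. fst \<mu> u (x u) = 1)"

definition pruning_init :: "('v, 'l) model \<Rightarrow> ('v, 'l) relaxed \<Rightarrow> 'v set \<Rightarrow> bool" where
  "pruning_init M \<mu> A \<longleftrightarrow>
     \<mu> \<in> minimizers (relaxed_energy M (nodes M)) (local_polytope M (nodes M)) \<and>
     A = integral_nodes M (nodes M) \<mu>"

definition pruning_step ::
    "('v, 'l) model \<Rightarrow> ('v, 'l) relaxed \<Rightarrow> 'v set \<Rightarrow> ('v \<Rightarrow> 'l) \<Rightarrow>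
     ('v, 'l) relaxed \<Rightarrow> 'v set \<Rightarrow> bool" where
  "pruning_step M \<mu> A x \<mu>' A' \<longleftrightarrow>
     rounds_to M A \<mu> x \<and>
     \<mu>' \<in> minimizers (relaxed_boundary_energy M A x) (local_polytope M A) \<and>
     A' = integral_nodes M A \<mu>' - {u \<in> boundary_nodes M A. fst \<mu>' u (x u) \<noteq> 1}"

text \<open>
  \<open>pruning_trace M \<mu> A x n\<close>: the algorithm has executed the loop body \<open>n\<close> times, producing
  \<open>\<mu> 0, \<dots>, \<mu> n\<close>, \<open>A 0, \<dots>, A n\<close> and \<open>x 0, \<dots>, x (n - 1)\<close>; the exit condition of the loop was
  false before its last execution.
\<close>

definition halted :: "(nat \<Rightarrow> 'v set) \<Rightarrow> nat \<Rightarrow> bool" where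
  "halted A n \<longleftrightarrow> 1 \<le> n \<and> A n = A (n - 1)"

definition pruning_trace ::
    "('v, 'l) model \<Rightarrow> (nat \<Rightarrow> ('v, 'l) relaxed) \<Rightarrow> (nat \<Rightarrow> 'v set) \<Rightarrow>
     (nat \<Rightarrow> 'v \<Rightarrow> 'l) \<Rightarrow> nat \<Rightarrow> bool" where
  "pruning_trace M \<mu> A x n \<longleftrightarrow>
     pruning_init M (\<mu> 0) (A 0) \<and>
     (\<forall>t<n. pruning_step M (\<mu> t) (A t) (x t) (\<mu> (Suc t)) (A (Suc t)) \<and> \<not> halted A t)"

definition pruning_output :: "('v, 'l) model \<Rightarrow> 'v set \<Rightarrow> ('v \<Rightarrow> 'l) \<Rightarrow> bool" where
  "pruning_output M A' x' \<longleftrightarrow>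
     (\<exists>\<mu> A x n. pruning_trace M \<mu> A x n \<and> halted A n \<and> A' = A n \<and> rounds_to M (A n) (\<mu> n) x')"

section \<open>Polynomial time\<close>

text \<open>
  Programs operate on S-expressions over integers.  Every elementary operation is charged the
  square of the bit size of the data it is applied to, which pays for copying, comparison and
  schoolbook integer arithmetic; hence the model is polynomially equivalent to Turing machines.
\<close>

datatype val = Num int | Pr val val

primrec bits :: "val \<Rightarrow> nat" where
  "bits (Num i) = 1 + floorlog 2 (nat \<bar>i\<bar>)"
| "bits (Pr v w) = 1 + bits v + bits w"

datatype primop = Ident | Literal int | Proj1 | Proj2 | IsPair | Plus | Minus | Times | Divide | Less

text \<open>Ill-typed applications return \<open>Num 0\<close>.\<close>

fun apply_primop :: "primop \<Rightarrow> val \<Rightarrow> val" where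
  "apply_primop Ident v = v"
| "apply_primop (Literal i) v = Num i"
| "apply_primop Proj1 (Pr v w) = v"
| "apply_primop Proj2 (Pr v w) = w"
| "apply_primop IsPair (Pr v w) = Num 1"
| "apply_primop Plus (Pr (Num i) (Num j)) = Num (i + j)"
| "apply_primop Minus (Pr (Num i) (Num j)) = Num (i - j)"
| "apply_primop Times (Pr (Num i) (Num j)) = Num (i * j)"
| "apply_primop Divide (Pr (Num i) (Num j)) = Num (i div j)"
| "apply_primop Less (Pr (Num i) (Num j)) = Num (of_bool (i < j))"
| "apply_primop _ _ = Num 0"

datatype program =
    Prim primop
  | Seq program program
  | Fork program program
  | Cond program program program
  | Loop program program

text \<open>
  \<open>exec p v w t\<close>: on input \<open>v\<close>, program \<open>p\<close> halts with output \<open>w\<close> after \<open>t\<close> time units.  A test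
  counts as false iff it returns \<open>Num 0\<close>; \<open>Loop p q\<close> runs \<open>q\<close> while the test \<open>p\<close> is true.
\<close>

inductive exec :: "program \<Rightarrow> val \<Rightarrow> val \<Rightarrow> nat \<Rightarrow> bool" where
  Prim: "exec (Prim f) v (apply_primop f v) ((bits v)^2)"
| Seq: "exec p v w s \<Longrightarrow> exec q w z t \<Longrightarrow> exec (Seq p q) v z (s + t)"
| Fork: "exec p v w s \<Longrightarrow> exec q v z t \<Longrightarrow> exec (Fork p q) v (Pr w z) (s + t + (bits v)^2)"
| CondTrue: "exec p v c s \<Longrightarrow> c \<noteq> Num 0 \<Longrightarrow> exec q v w t \<Longrightarrow>
    exec (Cond p q r) v w (s + t + (bits v)^2)"
| CondFalse: "exec p v (Num 0) s \<Longrightarrow> exec r v w t \<Longrightarrow>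
    exec (Cond p q r) v w (s + t + (bits v)^2)"
| LoopTrue: "exec p v c s \<Longrightarrow> c \<noteq> Num 0 \<Longrightarrow> exec q v w t \<Longrightarrow> exec (Loop p q) w z u \<Longrightarrow>
    exec (Loop p q) v z (s + t + u + (bits v)^2)"
| LoopFalse: "exec p v (Num 0) s \<Longrightarrow> exec (Loop p q) v v (s + (bits v)^2)"

text \<open>
  A search problem is given by its set of instances, their encoding, and the relation between
  instances and acceptable outputs.
\<close>

definition poly_time_solvable :: "'i set \<Rightarrow> ('i \<Rightarrow> val) \<Rightarrow> ('i \<Rightarrow> val \<Rightarrow> bool) \<Rightarrow> bool" where
  "poly_time_solvable I enc R \<longleftrightarrow>
     (\<exists>p (b :: nat poly). \<forall>i\<in>I. \<exists>w t. exec p (enc i) w t \<and> R i w \<and> t \<le> poly b (bits (enc i)))"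

definition enc_nat :: "nat \<Rightarrow> val" where
  "enc_nat n = Num (int n)"

definition enc_rat :: "rat \<Rightarrow> val" where
  "enc_rat q = (let (n, d) = quotient_of q in Pr (Num n) (Num d))"

definition enc_pair :: "('a \<Rightarrow> val) \<Rightarrow> ('b \<Rightarrow> val) \<Rightarrow> 'a \<times> 'b \<Rightarrow> val" where
  "enc_pair f g = (\<lambda>(a, b). Pr (f a) (g b))"

definition enc_list :: "('a \<Rightarrow> val) \<Rightarrow> 'a list \<Rightarrow> val" where
  "enc_list f xs = foldr (\<lambda>x. Pr (f x)) xs (Num 0)"

section \<open>Rational instances and their encodings\<close>

text \<open>
  In \<open>(U, P)\<close>, the nodes are the positions in \<open>U\<close>, the labels of node \<open>v\<close> are the positions in
  \<open>U ! v\<close>, and \<open>P\<close> associates with each edge the table (a list of rows) of its potential.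
\<close>

type_synonym inst = "rat list list \<times> ((nat \<times> nat) \<times> rat list list) list"

definition model_of :: "inst \<Rightarrow> (nat, nat) model" where
  "model_of = (\<lambda>(U, P). \<lparr>
     nodes = {..<length U},
     edges = set (map fst P),
     labels = (\<lambda>v. {..<length (U ! v)}),
     unary = (\<lambda>v a. real_of_rat (U ! v ! a)),
     pairwise = (\<lambda>e a b. real_of_rat (the (map_of P e) ! a ! b))\<rparr>)"

definition instances :: "inst set" where
  "instances = {(U, P). wf_model (model_of (U, P)) \<and> distinct (map fst P) \<and>
     (\<forall>((u, v), T)\<in>set P. length T = length (U ! u) \<and> (\<forall>r\<in>set T. length r = length (U ! v)))}"

definition enc_inst :: "inst \<Rightarrow> val" where
  "enc_inst = enc_pair (enc_list (enc_list enc_rat))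
     (enc_list (enc_pair (enc_pair enc_nat enc_nat) (enc_list (enc_list enc_rat))))"

text \<open>A node set \<open>A\<close> with a labeling of \<open>A\<close> is given by the list of its (node, label) pairs.\<close>

type_synonym partial_labeling = "(nat \<times> nat) list"

definition domain_of :: "partial_labeling \<Rightarrow> nat set" where
  "domain_of zs = set (map fst zs)"

definition labeling_of :: "partial_labeling \<Rightarrow> nat \<Rightarrow> nat" where
  "labeling_of zs u = the (map_of zs u)"

definition enc_partial_labeling :: "partial_labeling \<Rightarrow> val" where
  "enc_partial_labeling = enc_list (enc_pair enc_nat enc_nat)"

definition partial_labelings :: "inst \<Rightarrow> partial_labeling set" where
  "partial_labelings I = {zs. distinct (map fst zs) \<and> domain_of zs \<subseteq> nodes (model_of I) \<and>
     labeling_of zs \<in> labelings (model_of I) (domain_of zs)}"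

text \<open>
  Rational relaxed labelings are given by lists of entries \<open>((u, a), q)\<close> and
  \<open>(((u, v), (a, b)), q)\<close>; components not listed are zero.
\<close>

type_synonym rational_relaxed =
  "((nat \<times> nat) \<times> rat) list \<times> (((nat \<times> nat) \<times> (nat \<times> nat)) \<times> rat) list"

definition lookup_entry :: "('k \<times> rat) list \<Rightarrow> 'k \<Rightarrow> real" where
  "lookup_entry m k = (case map_of m k of None \<Rightarrow> 0 | Some q \<Rightarrow> real_of_rat q)"

definition relaxed_of :: "rational_relaxed \<Rightarrow> (nat, nat) relaxed" where
  "relaxed_of = (\<lambda>(m1, m2).
     (\<lambda>u a. lookup_entry m1 (u, a), \<lambda>e a b. lookup_entry m2 (e, (a, b))))"

definition enc_rational_relaxed :: "rational_relaxed \<Rightarrow> val" where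
  "enc_rational_relaxed = enc_pair
     (enc_list (enc_pair (enc_pair enc_nat enc_nat) enc_rat))
     (enc_list (enc_pair (enc_pair (enc_pair enc_nat enc_nat) (enc_pair enc_nat enc_nat)) enc_rat))"

text \<open>
  The subproblems.  The initial one is the case \<open>A = nodes M\<close>, where there are no boundary edges.
\<close>

definition subproblem_instances :: "(inst \<times> partial_labeling) set" where
  "subproblem_instances = (SIGMA I:instances. partial_labelings I)"

definition solves_subproblem :: "inst \<times> partial_labeling \<Rightarrow> val \<Rightarrow> bool" where
  "solves_subproblem = (\<lambda>(I, zs) w. \<exists>m. w = enc_rational_relaxed m \<and>
     relaxed_of m \<in> minimizers
       (relaxed_boundary_energy (model_of I) (domain_of zs) (labeling_of zs))
       (local_polytope (model_of I) (domain_of zs)))"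

text \<open>
  The output is the record of a complete run: entry \<open>t\<close> lists \<open>A t\<close> with the labeling \<open>x t\<close>, and
  \<open>\<mu> t\<close>; the last entry contains the output \<open>(A', x')\<close> of the algorithm.
\<close>

definition solves_pruning :: "inst \<Rightarrow> val \<Rightarrow> bool" where
  "solves_pruning I w \<longleftrightarrow> (\<exists>h n \<mu> A x.
     w = enc_list (enc_pair enc_partial_labeling enc_rational_relaxed) h \<and>
     length h = Suc n \<and> fst ` set h \<subseteq> partial_labelings I \<and>
     (\<forall>t\<le>n. \<mu> t = relaxed_of (snd (h ! t)) \<and> A t = domain_of (fst (h ! t)) \<and>
            x t = labeling_of (fst (h ! t))) \<and>
     pruning_trace (model_of I) \<mu> A x n \<and> halted A n \<and>
     rounds_to (model_of I) (A n) (\<mu> n) (x n))"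

end

(*
  Persistence.  At termination the minimizer of the last subproblem is integral and agrees with
  the test labeling on the boundary, so it is the indicator vector of x*.  Overwriting any labeling
  z by x* on A* does not increase the energy: on a boundary edge the change is at most the change
  of the boundary potential, and the boundary energy of x* on A* is minimal.

  Polynomial time.  A subproblem is a linear program; by strong duality it amounts to finding a
  vector of maximal support in a cone {x >= 0, A x = 0}.  This cone problem is solved by a
  perceptron with coordinate rescaling (in the style of Chubanov): let z be the projection of y
  on ker A.  While some z_k <= 0, increase y_k; then |z|^2 <= sum y, and once y_k = 4 n^2 the
  Cauchy-Schwarz inequality bounds x_k by 1/2 on ker A within the unit box, so that coordinate k
  can be rescaled by 2.  A coordinate that has been rescaled too often vanishes on the whole cone.
  Both that threshold and the size of the integers in the projection are controlled by Siegel's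
  lemma, applied to the normal equations of the projection.
*)
theory Submission
  imports Defs "HOL-Analysis.Analysis"
begin


section \<open>Polynomial-time functions\<close>

text \<open>The obstacle is bit size rather than the number of iterations: every loop must keep its
  integers polynomially long. No determinants are used. Siegel's lemma gives some short integer
  multiple of a projection, and a primitive vector on the same ray divides it; so the
  orthogonalization stays short although it never sees the Siegel solution. The scale factors of the
  cone solver are powers of two, so that halving is exact until it reaches 1, and the next halving
  gives 0, the mark of a vanishing coordinate. Programs are not written out: \<open>ptime\<close> is
  closed under the usual constructions, and a functional definition is compiled by applying closure
  rules. Maximal support is what makes the homogenized optimality conditions useful: the
  homogenizing variable is positive in some solution, hence in the computed one, and can be divided
  out. In the iteration count, the last pass removes nothing and only detects stability; when the
  final set is empty, it could come on top of |V| removals, whence the bound on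
  \<open>n - 1\<close>.\<close>

class enc = fixes enc :: "'a \<Rightarrow> val"

instantiation val :: enc begin
definition enc_val :: "val \<Rightarrow> val" where "enc_val v = v"
instance ..
end

instantiation int :: enc begin
definition enc_int :: "int \<Rightarrow> val" where "enc_int i = Num i"
instance ..
end

instantiation nat :: enc begin
definition enc_nat_inst: "enc (n::nat) = enc_nat n"
instance ..
end

instantiation rat :: enc begin
definition enc_rat_inst: "enc (q::rat) = enc_rat q"
instance ..
end

instantiation bool :: enc begin
definition enc_bool :: "bool \<Rightarrow> val" where "enc_bool b = Num (of_bool b)"
instance ..
end

instantiation prod :: (enc, enc) enc begin
definition enc_prod :: "'a \<times> 'b \<Rightarrow> val" where "enc_prod = enc_pair enc enc"
instance ..
end

instantiation list :: (enc) enc begin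
definition enc_list_inst: "enc (xs::'a list) = enc_list enc xs"
instance ..
end

lemma enc_Pair [simp]: "enc (a, b) = Pr (enc a) (enc b)"
  by (simp add: enc_prod_def enc_pair_def)

lemma enc_Nil [simp]: "enc ([]::'a::enc list) = Num 0"
  by (simp add: enc_list_inst enc_list_def)

lemma enc_Cons [simp]: "enc (x # xs) = Pr (enc x) (enc xs)"
  by (simp add: enc_list_inst enc_list_def)

lemma enc_nat_simp: "enc (n::nat) = Num (int n)"
  by (simp add: enc_nat_inst enc_nat_def)

lemma enc_pair_enc: "enc_pair enc enc = (enc :: 'a::enc \<times> 'b::enc \<Rightarrow> val)"
  by (simp add: enc_prod_def)

lemma enc_list_enc: "enc_list enc = (enc :: 'a::enc list \<Rightarrow> val)"
  by (simp add: enc_list_inst fun_eq_iff)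

lemma enc_rat_enc: "enc_rat = enc" and enc_nat_enc: "enc_nat = enc"
  by (simp_all add: enc_rat_inst enc_nat_inst fun_eq_iff)

section \<open>Bit sizes of integers and the growth caused by a program\<close>

lemma bits_pos [simp]: "0 < bits v" "Suc 0 \<le> bits v"
  by (induction v) auto

lemma bits_Num_le_iff: "bits (Num i) \<le> Suc k \<longleftrightarrow> \<bar>i\<bar> < 2 ^ k"
proof -
  have "floorlog 2 (nat \<bar>i\<bar>) \<le> k \<longleftrightarrow> nat \<bar>i\<bar> < 2 ^ k"
    by (auto simp: floorlog_le_iff)
  also have "\<dots> \<longleftrightarrow> \<bar>i\<bar> < 2 ^ k"
    using nat_less_iff[of "\<bar>i\<bar>" "2^k"] by simp
  finally show ?thesis by simp
qed

lemma abs_less_bits: "\<bar>i\<bar> < 2 ^ (bits (Num i) - 1)"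
  using bits_Num_le_iff[of i "bits (Num i) - 1"] by simp

lemma bits_Num_mono: "\<bar>i\<bar> \<le> \<bar>j\<bar> \<Longrightarrow> bits (Num i) \<le> bits (Num j)"
  using bits_Num_le_iff[of i "bits (Num j) - 1"] abs_less_bits[of j] by simp

text \<open>Subadditivity without a carry term: \<open>bits\<close> charges one unit for each leaf
  in addition to the digits, and that unit of the second summand pays for the carry.\<close>

lemma bits_Num_add: "bits (Num (i + j)) \<le> bits (Num i) + bits (Num j)"
proof -
  let ?a = "bits (Num i) - 1" and ?b = "bits (Num j) - 1"
  have "\<bar>i + j\<bar> \<le> \<bar>i\<bar> + \<bar>j\<bar>" by simp
  also have "\<dots> < 2 ^ ?a + 2 ^ ?b" using abs_less_bits[of i] abs_less_bits[of j] by simp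
  also have "\<dots> \<le> 2 ^ (?a + ?b) + 2 ^ (?a + ?b)"
    by (intro add_mono power_increasing) auto
  also have "\<dots> = 2 ^ (Suc (?a + ?b))" by simp
  finally have "bits (Num (i + j)) \<le> Suc (Suc (?a + ?b))" by (simp only: bits_Num_le_iff)
  thus ?thesis by simp
qed

lemma bits_Num_diff: "bits (Num (i - j)) \<le> bits (Num i) + bits (Num j)"
  using bits_Num_add[of i "-j"] by simp

lemma bits_Num_mult: "bits (Num (i * j)) \<le> bits (Num i) + bits (Num j)"
proof -
  let ?a = "bits (Num i) - 1" and ?b = "bits (Num j) - 1"
  have "\<bar>i * j\<bar> < 2 ^ ?a * 2 ^ ?b"
    unfolding abs_mult using abs_less_bits[of i] abs_less_bits[of j]
    by (intro mult_strict_mono') auto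
  hence "bits (Num (i * j)) \<le> Suc (?a + ?b)" by (simp only: bits_Num_le_iff power_add)
  thus ?thesis by simp
qed

text \<open>\<open>div\<close> rounds down, so a negative quotient may exceed the exact one in
  absolute value; rounding cannot pass the integer \<open>i\<close> itself. A negative divisor is
  reduced to a positive one by changing both signs.\<close>

lemma abs_div_le: "\<bar>i div j\<bar> \<le> \<bar>i :: int\<bar>"
proof (cases "j = 0")
  case False
  have *: "\<bar>a div b\<bar> \<le> \<bar>a\<bar>" if "b > 0" for a b :: int
  proof (cases "a \<ge> 0")
    case True
    thus ?thesis using that zdiv_mono2[of a 1 b] pos_imp_zdiv_nonneg_iff[of b a] by auto
  next
    case a: False
    have "a \<le> a div b"
      using a that zdiv_mono2_neg[of a 1 b] by simp
    moreover have "a div b < 0" using a that by (simp add: pos_imp_zdiv_neg_iff)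
    ultimately show ?thesis using a by simp
  qed
  show ?thesis
  proof (cases "j > 0")
    case True thus ?thesis by (rule *)
  next
    case neg: False
    have "i div j = (-i) div (-j)" by simp
    thus ?thesis using *[of "-j" "-i"] neg False by simp
  qed
qed simp

text \<open>The rate at which data can grow per time unit. A literal is the one operation whose
  output may be long on a short input; the \<open>2\<close> covers pairing and the constants that
  other operations return.\<close>

primrec literal_bound :: "program \<Rightarrow> nat" where
  "literal_bound (Prim f) = (case f of Literal i \<Rightarrow> 2 + bits (Num i) | _ \<Rightarrow> 2)"
| "literal_bound (Seq p q) = max (literal_bound p) (literal_bound q)"
| "literal_bound (Fork p q) = max (literal_bound p) (literal_bound q)"
| "literal_bound (Cond p q r) = max (literal_bound p) (max (literal_bound q) (literal_bound r))"
| "literal_bound (Loop p q) = max (literal_bound p) (literal_bound q)"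

lemma literal_bound_ge: "2 \<le> literal_bound p"
  by (induction p) (auto split: primop.split)

lemma bits_apply_primop:
  "bits (apply_primop f v) \<le> bits v + literal_bound (Prim f)"
proof (induction f v rule: apply_primop.induct)
  case (6 i j) show ?case using bits_Num_add[of i j] by simp
next
  case (7 i j) show ?case using bits_Num_diff[of i j] by simp
next
  case (8 i j) show ?case using bits_Num_mult[of i j] by simp
next
  case (9 i j) show ?case using bits_Num_mono[OF abs_div_le, of i j] by simp
qed (auto simp: floorlog_def)

text \<open>Every elementary operation is charged at least the size of its data, so time pays for
  output size linearly. Hence a polynomial time bound also bounds the result, which is what
  composition of programs requires.\<close>

lemma exec_bits_aux: "exec p v w t \<Longrightarrow> literal_bound p \<le> c \<Longrightarrow> bits w \<le> bits v + c * t"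
proof (induction rule: exec.induct)
  case (Prim f v)
  have "bits (apply_primop f v) \<le> bits v + c * 1" using bits_apply_primop[of f v] Prim by simp
  also have "\<dots> \<le> bits v + c * (bits v)^2"
    by (intro add_mono mult_mono) (auto simp: Suc_leI)
  finally show ?case .
next
  case (Fork p v w s q z t)
  have c: "2 \<le> c" using Fork.prems literal_bound_ge[of "Fork p q"] by linarith
  have "bits (Pr w z) \<le> 1 + (bits v + c * s) + (bits v + c * t)" using Fork by simp
  also have "\<dots> \<le> bits v + (c * s + c * t + 2 * bits v)" using bits_pos(2)[of v] by linarith
  also have "2 * bits v \<le> c * (bits v)^2"
    using c bits_pos[of v] by (intro mult_mono) (auto simp: power2_eq_square)
  finally show ?case by (simp add: algebra_simps)
qed (auto simp: algebra_simps intro: trans_le_add1)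

lemmas exec_bits = exec_bits_aux[OF _ order_refl]

lemma poly_nat_mono: "x \<le> y \<Longrightarrow> poly (b::nat poly) x \<le> poly b y"
  by (induction b) (auto intro!: add_mono mult_mono)

section \<open>Polynomial bounds and polynomial-time computable functions\<close>

definition psize :: "'a::enc set \<Rightarrow> ('a \<Rightarrow> nat) \<Rightarrow> bool" where
  "psize D g \<longleftrightarrow> (\<exists>b::nat poly. \<forall>a\<in>D. g a \<le> poly b (bits (enc a)))"

text \<open>One program has to be correct and fast on \<open>D\<close> only; elsewhere it may even
  diverge. Domains admit partial operations such as \<open>hd\<close> and \<open>nth\<close>, and
  loops whose states satisfy an invariant. The time \<open>T\<close> is a function of the argument
  itself, bounded through \<open>psize\<close>.\<close>

definition ptime :: "'a::enc set \<Rightarrow> ('a \<Rightarrow> 'b::enc) \<Rightarrow> bool" where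
  "ptime D f \<longleftrightarrow> (\<exists>p T. psize D T \<and> (\<forall>a\<in>D. exec p (enc a) (enc (f a)) (T a)))"

named_theorems ps
named_theorems pt

lemma psize_mono: "psize D g \<Longrightarrow> (\<And>a. a \<in> D \<Longrightarrow> h a \<le> g a) \<Longrightarrow> psize D h"
  unfolding psize_def by (meson order_trans)

lemma psize_subset: "psize E g \<Longrightarrow> D \<subseteq> E \<Longrightarrow> psize D g"
  unfolding psize_def by blast

lemma psize_const [ps]: "psize D (\<lambda>_. c)"
  unfolding psize_def by (rule exI[of _ "[:c:]"]) simp

lemma psize_add [ps]: "psize D f \<Longrightarrow> psize D g \<Longrightarrow> psize D (\<lambda>a. f a + g a)"
  unfolding psize_def
proof (elim exE)
  fix b b' :: "nat poly"
  assume "\<forall>a\<in>D. f a \<le> poly b (bits (enc a))" "\<forall>a\<in>D. g a \<le> poly b' (bits (enc a))"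
  thus "\<exists>b. \<forall>a\<in>D. f a + g a \<le> poly b (bits (enc a))"
    by (intro exI[of _ "b + b'"]) (auto intro!: add_mono)
qed

lemma psize_mult [ps]: "psize D f \<Longrightarrow> psize D g \<Longrightarrow> psize D (\<lambda>a. f a * g a)"
  unfolding psize_def
proof (elim exE)
  fix b b' :: "nat poly"
  assume "\<forall>a\<in>D. f a \<le> poly b (bits (enc a))" "\<forall>a\<in>D. g a \<le> poly b' (bits (enc a))"
  thus "\<exists>b. \<forall>a\<in>D. f a * g a \<le> poly b (bits (enc a))"
    by (intro exI[of _ "b * b'"]) (auto intro!: mult_mono)
qed

lemma psize_Suc [ps]: "psize D f \<Longrightarrow> psize D (\<lambda>a. Suc (f a))"
  using psize_add[OF psize_const[of D 1]] by simp

lemma psize_power [ps]: "psize D f \<Longrightarrow> psize D (\<lambda>a. f a ^ k)"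
  by (induction k) (auto intro!: ps)

lemma psize_bits_id [ps]: "psize D (\<lambda>a. bits (enc a))"
  unfolding psize_def by (rule exI[of _ "[:0, 1:]"]) simp

lemma psize_comp:
  assumes "psize E g" "psize D (\<lambda>a. bits (enc (f a)))" "\<And>a. a \<in> D \<Longrightarrow> f a \<in> E"
  shows "psize D (\<lambda>a. g (f a))"
proof -
  from assms(1) obtain b :: "nat poly" where b: "\<forall>a\<in>E. g a \<le> poly b (bits (enc a))"
    by (auto simp: psize_def)
  from assms(2) obtain b' :: "nat poly" where b': "\<forall>a\<in>D. bits (enc (f a)) \<le> poly b' (bits (enc a))"
    by (auto simp: psize_def)
  have "g (f a) \<le> poly (pcompose b b') (bits (enc a))" if "a \<in> D" for a
    using b b' assms(3)[OF that] that poly_nat_mono[of "bits (enc (f a))" _ b]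
    by (fastforce simp: poly_pcompose intro: order_trans)
  thus ?thesis unfolding psize_def by blast
qed

lemma ptimeI:
  "psize D T \<Longrightarrow> (\<And>a. a \<in> D \<Longrightarrow> exec p (enc a) (enc (f a)) (T a)) \<Longrightarrow> ptime D f"
  unfolding ptime_def by blast

lemma ptime_psize: "ptime D f \<Longrightarrow> psize D (\<lambda>a. bits (enc (f a)))"
proof -
  assume "ptime D f"
  then obtain p T where T: "psize D T" "\<And>a. a\<in>D \<Longrightarrow> exec p (enc a) (enc (f a)) (T a)"
    unfolding ptime_def by blast
  have "psize D (\<lambda>a. bits (enc a) + literal_bound p * T a)" by (intro ps T)
  thus ?thesis by (rule psize_mono) (use T(2) exec_bits in blast)
qed

lemma ptime_subset: "ptime E f \<Longrightarrow> D \<subseteq> E \<Longrightarrow> ptime D f"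
  unfolding ptime_def using psize_subset by (meson subsetD)

lemma ptime_cong: "(\<And>a. a \<in> D \<Longrightarrow> f a = g a) \<Longrightarrow> ptime D f = ptime D g"
  unfolding ptime_def by auto

text \<open>Computability depends on encodings alone. Conversions between types with a common
  representation, such as \<open>int\<close> or \<open>quotient_of\<close>, therefore cost
  nothing.\<close>

lemma ptime_enc_cong:
  "ptime D f \<Longrightarrow> (\<And>a. a \<in> D \<Longrightarrow> enc (g a) = enc (f a)) \<Longrightarrow> ptime D g"
  unfolding ptime_def by auto

lemma ptime_prim:
  assumes "\<And>a. a \<in> D \<Longrightarrow> apply_primop f (enc a) = enc (g a)"
  shows "ptime D g"
proof (rule ptimeI)
  show "psize D (\<lambda>a. (bits (enc a))^2)" by (intro ps)
  show "exec (Prim f) (enc a) (enc (g a)) ((bits (enc a))^2)" if "a \<in> D" for a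
    using exec.Prim[of f "enc a"] assms[OF that] by simp
qed

lemma ptime_id [pt]: "ptime D (\<lambda>x. x)"
  by (rule ptime_prim[of _ Ident]) simp

lemma ptime_comp:
  assumes "ptime E g" "ptime D f" "\<And>a. a \<in> D \<Longrightarrow> f a \<in> E"
  shows "ptime D (\<lambda>a. g (f a))"
proof -
  from assms(1) obtain p T where p: "psize E T" "\<And>a. a\<in>E \<Longrightarrow> exec p (enc a) (enc (g a)) (T a)"
    unfolding ptime_def by blast
  from assms(2) obtain q S where q: "psize D S" "\<And>a. a\<in>D \<Longrightarrow> exec q (enc a) (enc (f a)) (S a)"
    unfolding ptime_def by blast
  show ?thesis
  proof (rule ptimeI)
    show "psize D (\<lambda>a. S a + T (f a))"
      by (intro ps q psize_comp[OF p(1)] ptime_psize assms)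
    show "exec (Seq q p) (enc a) (enc (g (f a))) (S a + T (f a))" if "a \<in> D" for a
      by (rule exec.Seq[OF q(2)[OF that] p(2)[OF assms(3)[OF that]]])
  qed
qed

lemma ptime_comp1: "ptime UNIV g \<Longrightarrow> ptime D f \<Longrightarrow> ptime D (\<lambda>a. g (f a))"
  by (rule ptime_comp) auto

lemma ptime_Pair [pt]:
  assumes "ptime D f" "ptime D g"
  shows "ptime D (\<lambda>a. (f a, g a))"
proof -
  from assms(1) obtain p T where p: "psize D T" "\<And>a. a\<in>D \<Longrightarrow> exec p (enc a) (enc (f a)) (T a)"
    unfolding ptime_def by blast
  from assms(2) obtain q S where q: "psize D S" "\<And>a. a\<in>D \<Longrightarrow> exec q (enc a) (enc (g a)) (S a)"
    unfolding ptime_def by blast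
  show ?thesis
  proof (rule ptimeI)
    show "psize D (\<lambda>a. T a + S a + (bits (enc a))^2)" by (intro ps p q)
    show "exec (Fork p q) (enc a) (enc (f a, g a)) (T a + S a + (bits (enc a))^2)" if "a \<in> D" for a
      using exec.Fork[OF p(2) q(2), OF that that] by simp
  qed
qed

lemma ptime_comp2:
  "ptime UNIV (\<lambda>x. h (fst x) (snd x)) \<Longrightarrow> ptime D f \<Longrightarrow> ptime D g \<Longrightarrow> ptime D (\<lambda>a. h (f a) (g a))"
  using ptime_comp1[of "\<lambda>x. h (fst x) (snd x)" D "\<lambda>a. (f a, g a)"] ptime_Pair[of D f g] by simp

lemma ptime_comp3:
  "ptime UNIV (\<lambda>x. h (fst x) (fst (snd x)) (snd (snd x))) \<Longrightarrow> ptime D f \<Longrightarrow> ptime D g \<Longrightarrow> ptime D k \<Longrightarrow>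
   ptime D (\<lambda>a. h (f a) (g a) (k a))"
  using ptime_comp1[of "\<lambda>x. h (fst x) (fst (snd x)) (snd (snd x))" D "\<lambda>a. (f a, g a, k a)"]
    ptime_Pair[of D f "\<lambda>a. (g a, k a)"] ptime_Pair[of D g k] by simp

lemma ptime_fst [pt]: "ptime D f \<Longrightarrow> ptime D (\<lambda>a. fst (f a))"
  by (rule ptime_comp1[of fst]) (rule ptime_prim[of _ Proj1], auto)

lemma ptime_snd [pt]: "ptime D f \<Longrightarrow> ptime D (\<lambda>a. snd (f a))"
  by (rule ptime_comp1[of snd]) (rule ptime_prim[of _ Proj2], auto)

lemma ptime_const [pt]: "ptime D (\<lambda>_. c)"
proof -
  have *: "ptime D (\<lambda>_. v :: val)" for v
  proof (induction v)
    case (Num i)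
    show ?case by (rule ptime_prim[of _ "Literal i"]) (simp add: enc_val_def)
  next
    case (Pr v w)
    show ?case by (rule ptime_enc_cong[OF ptime_Pair[OF Pr]]) (simp add: enc_val_def)
  qed
  show ?thesis by (rule ptime_enc_cong[OF *[of "enc c"]]) (simp add: enc_val_def)
qed

text \<open>Each branch is compiled on the part of \<open>D\<close> where it is taken, so that a
  test can guard a partial operation. The sum of the polynomials of the two branches bounds
  both.\<close>

lemma ptime_if_strong:
  assumes "ptime D c" "ptime {a\<in>D. c a} f" "ptime {a\<in>D. \<not> c a} g"
  shows "ptime D (\<lambda>a. if c a then f a else g a)"
proof -
  from assms(1) obtain r R where r: "psize D R" "\<And>a. a\<in>D \<Longrightarrow> exec r (enc a) (enc (c a)) (R a)"
    unfolding ptime_def by blast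
  from assms(2) obtain p T where p: "psize {a\<in>D. c a} T"
      "\<And>a. a\<in>D \<Longrightarrow> c a \<Longrightarrow> exec p (enc a) (enc (f a)) (T a)"
    unfolding ptime_def by blast
  from assms(3) obtain q S where q: "psize {a\<in>D. \<not> c a} S"
      "\<And>a. a\<in>D \<Longrightarrow> \<not> c a \<Longrightarrow> exec q (enc a) (enc (g a)) (S a)"
    unfolding ptime_def by blast
  have "psize D (\<lambda>a. if c a then T a else S a)"
  proof -
    from p(1) obtain b where b: "\<And>a. a\<in>D \<Longrightarrow> c a \<Longrightarrow> T a \<le> poly b (bits (enc a))" by (auto simp: psize_def)
    from q(1) obtain b' where b': "\<And>a. a\<in>D \<Longrightarrow> \<not> c a \<Longrightarrow> S a \<le> poly b' (bits (enc a))" by (auto simp: psize_def)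
    show ?thesis unfolding psize_def
      by (rule exI[of _ "b + b'"]) (auto dest: b b' intro: trans_le_add1 trans_le_add2)
  qed
  show ?thesis
  proof (rule ptimeI)
    show "psize D (\<lambda>a. R a + (if c a then T a else S a) + (bits (enc a))^2)" by (intro ps r) fact
    show "exec (Cond r p q) (enc a) (enc (if c a then f a else g a))
        (R a + (if c a then T a else S a) + (bits (enc a))^2)" if a: "a \<in> D" for a
    proof (cases "c a")
      case True
      thus ?thesis using exec.CondTrue[OF r(2)[OF a] _ p(2)[OF a True]] by (simp add: enc_bool_def)
    next
      case False
      hence "enc (c a) = Num 0" by (simp add: enc_bool_def)
      with r(2)[OF a] have "exec r (enc a) (Num 0) (R a)" by simp
      from exec.CondFalse[OF this q(2)[OF a False]] show ?thesis using False by simp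
    qed
  qed
qed

lemma ptime_if [pt]:
  "ptime D c \<Longrightarrow> ptime D f \<Longrightarrow> ptime D g \<Longrightarrow> ptime D (\<lambda>a. if c a then f a else g a)"
  by (rule ptime_if_strong) (auto elim: ptime_subset)

lemma ptime_not [pt]: "ptime D f \<Longrightarrow> ptime D (\<lambda>a. \<not> f a)"
  using ptime_if[of D f "\<lambda>_. False" "\<lambda>_. True"] ptime_const[of D False] ptime_const[of D True]
  by (simp add: if_bool_eq_conj)

lemma ptime_conj [pt]: "ptime D f \<Longrightarrow> ptime D g \<Longrightarrow> ptime D (\<lambda>a. f a \<and> g a)"
  using ptime_if[of D f g "\<lambda>_. False"] ptime_const[of D False]
  by (simp add: if_bool_eq_disj)

lemma ptime_disj [pt]: "ptime D f \<Longrightarrow> ptime D g \<Longrightarrow> ptime D (\<lambda>a. f a \<or> g a)"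
  using ptime_not[OF ptime_conj[OF ptime_not[of D f] ptime_not[of D g]]] by simp

text \<open>The time is at most \<open>Suc (K a)\<close> rounds, each at the cost of the largest
  state. A bound \<open>S\<close> on all intermediate states has to be supplied along with the
  number of rounds: a step of polynomial cost may double its data, and iteration would then make
  them exponentially long.\<close>

lemma ptime_while:
  fixes f :: "'a::enc \<Rightarrow> 'a"
  assumes c: "ptime E c" and f: "ptime E f" and K: "psize D K" and S: "psize D S"
    and ex: "\<And>a. a \<in> D \<Longrightarrow> \<exists>k\<le>K a. (\<forall>i\<le>k. (f^^i) a \<in> E \<and> bits (enc ((f^^i) a)) \<le> S a) \<and>
      (\<forall>i<k. c ((f^^i) a)) \<and> \<not> c ((f^^k) a) \<and> g a = (f^^k) a"
  shows "ptime D g"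
proof -
  from c obtain r R where r: "psize E R" "\<And>a. a\<in>E \<Longrightarrow> exec r (enc a) (enc (c a)) (R a)"
    unfolding ptime_def by blast
  from f obtain p T where p: "psize E T" "\<And>a. a\<in>E \<Longrightarrow> exec p (enc a) (enc (f a)) (T a)"
    unfolding ptime_def by blast
  from r(1) obtain bR where bR: "\<And>a. a\<in>E \<Longrightarrow> R a \<le> poly bR (bits (enc a))" by (auto simp: psize_def)
  from p(1) obtain bT where bT: "\<And>a. a\<in>E \<Longrightarrow> T a \<le> poly bT (bits (enc a))" by (auto simp: psize_def)
  \<comment> \<open>The price of one round on a state of size at most \<open>s\<close>: test, body
    and the charge of the loop itself.\<close>
  define W where "W s = poly bR s + poly bT s + s^2" for s
  have Wmono: "W x \<le> W y" if "x \<le> y" for x y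
    using that unfolding W_def by (intro add_mono poly_nat_mono power_mono) auto
  have loop: "\<exists>t. exec (Loop r p) (enc a) (enc ((f^^k) a)) t \<and> t \<le> Suc k * W s"
    if "\<forall>i\<le>k. (f^^i) a \<in> E \<and> bits (enc ((f^^i) a)) \<le> s" "\<forall>i<k. c ((f^^i) a)" "\<not> c ((f^^k) a)" for a k s
    using that
  proof (induction k arbitrary: a)
    case 0
    hence "enc (c a) = Num 0" "a \<in> E" by (auto simp: enc_bool_def)
    with exec.LoopFalse[of r "enc a" "R a" p] r(2)[of a]
    have "exec (Loop r p) (enc a) (enc a) (R a + (bits (enc a))^2)" by simp
    moreover have "R a + (bits (enc a))^2 \<le> W (bits (enc a))" using bR[OF \<open>a \<in> E\<close>] by (simp add: W_def)
    moreover have "\<dots> \<le> W s" using 0 by (intro Wmono) auto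
    ultimately show ?case by (auto intro!: exI[of _ "R a + (bits (enc a))^2"])
  next
    case (Suc k)
    have a: "a \<in> E" "bits (enc a) \<le> s" "c a" using Suc.prems by (force dest: spec[of _ 0])+
    have "\<exists>t. exec (Loop r p) (enc (f a)) (enc ((f^^k) (f a))) t \<and> t \<le> Suc k * W s"
    proof (rule Suc.IH)
      show "\<forall>i\<le>k. (f ^^ i) (f a) \<in> E \<and> bits (enc ((f ^^ i) (f a))) \<le> s"
      proof (intro allI impI)
        fix i assume "i \<le> k"
        thus "(f ^^ i) (f a) \<in> E \<and> bits (enc ((f ^^ i) (f a))) \<le> s"
          using Suc.prems(1)[rule_format, of "Suc i"] by (simp add: funpow_swap1)
      qed
      show "\<forall>i<k. c ((f ^^ i) (f a))"
      proof (intro allI impI)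
        fix i assume "i < k"
        thus "c ((f ^^ i) (f a))"
          using Suc.prems(2)[rule_format, of "Suc i"] by (simp add: funpow_swap1)
      qed
      show "\<not> c ((f ^^ k) (f a))" using Suc.prems(3) by (simp add: funpow_swap1)
    qed
    then obtain t where t: "exec (Loop r p) (enc (f a)) (enc ((f^^Suc k) a)) t" "t \<le> Suc k * W s"
      by (auto simp: funpow_swap1)
    have "exec (Loop r p) (enc a) (enc ((f^^Suc k) a)) (R a + T a + t + (bits (enc a))^2)"
      by (rule exec.LoopTrue[OF r(2) _ p(2) t(1)]) (use a in \<open>auto simp: enc_bool_def\<close>)
    moreover have "R a + T a + (bits (enc a))^2 \<le> W s"
      using bR[OF a(1)] bT[OF a(1)] Wmono[OF a(2)] unfolding W_def by linarith
    ultimately show ?case using t(2) by (intro exI[of _ "R a + T a + t + (bits (enc a))^2"]) auto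
  qed
  define P where "P a t \<longleftrightarrow> exec (Loop r p) (enc a) (enc (g a)) t \<and> t \<le> Suc (K a) * W (S a)" for a t
  have "\<exists>t. P a t" if aD: "a \<in> D" for a
  proof -
    obtain k where k: "k \<le> K a" "\<forall>i\<le>k. (f^^i) a \<in> E \<and> bits (enc ((f^^i) a)) \<le> S a"
      "\<forall>i<k. c ((f^^i) a)" "\<not> c ((f^^k) a)" "g a = (f^^k) a" using ex[OF aD] by blast
    from loop[OF k(2-4)] obtain t where "exec (Loop r p) (enc a) (enc ((f^^k) a)) t" "t \<le> Suc k * W (S a)" by blast
    moreover have "Suc k * W (S a) \<le> Suc (K a) * W (S a)" using k(1) by simp
    ultimately show ?thesis unfolding P_def k(5) using order_trans by blast
  qed
  then obtain t where t: "\<And>a. a \<in> D \<Longrightarrow> P a (t a)" by metis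
  have "psize D (\<lambda>a. Suc (K a) * W (S a))"
  proof -
    from S obtain bS where bS: "\<And>a. a\<in>D \<Longrightarrow> S a \<le> poly bS (bits (enc a))" by (auto simp: psize_def)
    have "psize D (\<lambda>a. W (poly bS (bits (enc a))))"
      unfolding psize_def W_def
      by (rule exI[of _ "pcompose bR bS + pcompose bT bS + bS^2"]) (simp add: poly_pcompose)
    hence "psize D (\<lambda>a. W (S a))" by (rule psize_mono) (use bS Wmono in auto)
    thus ?thesis by (intro ps K)
  qed
  hence "psize D t" by (rule psize_mono) (use t in \<open>auto simp: P_def\<close>)
  thus ?thesis by (rule ptimeI) (use t in \<open>auto simp: P_def\<close>)
qed


subsection \<open>Arithmetic\<close>

lemma ptime_add_int [pt]: "ptime D f \<Longrightarrow> ptime D g \<Longrightarrow> ptime D (\<lambda>a. f a + g a :: int)"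
  by (rule ptime_comp2[of "(+)"]) (rule ptime_prim[of _ Plus], auto simp: enc_int_def)

lemma ptime_diff_int [pt]: "ptime D f \<Longrightarrow> ptime D g \<Longrightarrow> ptime D (\<lambda>a. f a - g a :: int)"
  by (rule ptime_comp2[of "(-)"]) (rule ptime_prim[of _ Minus], auto simp: enc_int_def)

lemma ptime_mult_int [pt]: "ptime D f \<Longrightarrow> ptime D g \<Longrightarrow> ptime D (\<lambda>a. f a * g a :: int)"
  by (rule ptime_comp2[of "(*)"]) (rule ptime_prim[of _ Times], auto simp: enc_int_def)

lemma ptime_div_int [pt]: "ptime D f \<Longrightarrow> ptime D g \<Longrightarrow> ptime D (\<lambda>a. f a div g a :: int)"
  by (rule ptime_comp2[of "(div)"]) (rule ptime_prim[of _ Divide], auto simp: enc_int_def)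

lemma ptime_less_int [pt]: "ptime D f \<Longrightarrow> ptime D g \<Longrightarrow> ptime D (\<lambda>a. (f a :: int) < g a)"
  by (rule ptime_comp2[of "(<)"]) (rule ptime_prim[of _ Less], auto simp: enc_int_def enc_bool_def)

lemma ptime_uminus_int [pt]: "ptime D f \<Longrightarrow> ptime D (\<lambda>a. - f a :: int)"
  using ptime_diff_int[OF ptime_const[of D 0]] by simp

lemma ptime_mod_int [pt]: "ptime D f \<Longrightarrow> ptime D g \<Longrightarrow> ptime D (\<lambda>a. f a mod g a :: int)"
  unfolding minus_div_mult_eq_mod[symmetric] by (intro pt)

lemma ptime_le_int [pt]: "ptime D f \<Longrightarrow> ptime D g \<Longrightarrow> ptime D (\<lambda>a. (f a :: int) \<le> g a)"
  unfolding linorder_not_less[symmetric] by (intro pt)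

lemma ptime_eq_int [pt]: "ptime D f \<Longrightarrow> ptime D g \<Longrightarrow> ptime D (\<lambda>a. (f a :: int) = g a)"
  unfolding order_eq_iff by (intro pt)

lemma ptime_abs_int [pt]: "ptime D f \<Longrightarrow> ptime D (\<lambda>a. \<bar>f a\<bar> :: int)"
  unfolding abs_if by (intro pt)

lemma ptime_int [pt]: "ptime D f \<Longrightarrow> ptime D (\<lambda>a. int (f a))"
  by (rule ptime_enc_cong) (auto simp: enc_int_def enc_nat_simp)

lemma ptime_nat_eqI: "ptime D (\<lambda>a. int (f a)) \<Longrightarrow> ptime D f"
  by (rule ptime_enc_cong) (auto simp: enc_int_def enc_nat_simp)

lemma ptime_add_nat [pt]: "ptime D f \<Longrightarrow> ptime D g \<Longrightarrow> ptime D (\<lambda>a. f a + g a :: nat)"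
  by (rule ptime_nat_eqI) (simp only: of_nat_add, intro pt)

lemma ptime_eq_nat [pt]: "ptime D f \<Longrightarrow> ptime D g \<Longrightarrow> ptime D (\<lambda>a. (f a :: nat) = g a)"
  unfolding of_nat_eq_iff[where 'a = int, symmetric] by (intro pt)

lemma ptime_eq_nat2 [pt]: "ptime D f \<Longrightarrow> ptime D g \<Longrightarrow> ptime D (\<lambda>a. (f a :: nat \<times> nat) = g a)"
  unfolding prod_eq_iff by (intro ptime_conj ptime_eq_nat ptime_fst ptime_snd)

lemma ptime_eq_nat4 [pt]:
  "ptime D f \<Longrightarrow> ptime D g \<Longrightarrow> ptime D (\<lambda>a. (f a :: (nat \<times> nat) \<times> (nat \<times> nat)) = g a)"
  unfolding prod_eq_iff[of "_ :: (nat \<times> nat) \<times> (nat \<times> nat)"]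
  by (intro ptime_conj ptime_eq_nat2 ptime_fst ptime_snd)

subsection \<open>Lists\<close>

lemma ptime_Cons [pt]: "ptime D f \<Longrightarrow> ptime D g \<Longrightarrow> ptime D (\<lambda>a. f a # g a)"
  by (rule ptime_enc_cong[OF ptime_Pair]) auto

lemma ptime_hd: "ptime D f \<Longrightarrow> (\<And>a. a \<in> D \<Longrightarrow> f a \<noteq> []) \<Longrightarrow> ptime D (\<lambda>a. hd (f a))"
proof (rule ptime_comp[of "{xs. xs \<noteq> []}"])
  show "ptime {xs. xs \<noteq> []} (hd :: 'b list \<Rightarrow> 'b)"
    by (rule ptime_prim[of _ Proj1]) (auto simp: neq_Nil_conv)
qed auto

lemma ptime_tl [pt]: "ptime D f \<Longrightarrow> ptime D (\<lambda>a. tl (f a))"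
proof (rule ptime_comp1[of tl])
  show "ptime UNIV (tl :: 'b list \<Rightarrow> 'b list)"
  proof (rule ptime_prim[of _ Proj2])
    fix xs :: "'b list" show "apply_primop Proj2 (enc xs) = enc (tl xs)"
      by (cases xs) auto
  qed
qed auto

lemma ptime_not_Nil [pt]: "ptime D f \<Longrightarrow> ptime D (\<lambda>a. f a \<noteq> [])"
proof (rule ptime_comp1[of "\<lambda>x. x \<noteq> []"])
  show "ptime UNIV (\<lambda>x::'b list. x \<noteq> [])"
  proof (rule ptime_prim[of _ IsPair])
    fix xs :: "'b list" show "apply_primop IsPair (enc xs) = enc (xs \<noteq> [])"
      by (cases xs) (auto simp: enc_bool_def)
  qed
qed auto

lemma ptime_Nil [pt]: "ptime D f \<Longrightarrow> ptime D (\<lambda>a. f a = [])"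
  using ptime_not[OF ptime_not_Nil[of D f]] by simp

lemma bits_list: "bits (enc xs) = 1 + (\<Sum>x\<leftarrow>xs. 1 + bits (enc x))"
  by (induction xs) (auto simp: floorlog_def)

lemma bits_take: "bits (enc (take i xs)) \<le> bits (enc xs)"
proof (induction xs arbitrary: i)
  case (Cons x xs)
  thus ?case by (cases i) (auto simp: floorlog_def)
qed auto

lemma bits_drop: "bits (enc (drop i xs)) \<le> bits (enc xs)"
  by (induction xs arbitrary: i) (auto simp: drop_Cons le_SucI trans_le_add2 split: nat.split)

lemma bits_in_set: "x \<in> set xs \<Longrightarrow> bits (enc x) \<le> bits (enc xs)"
  by (induction xs) (auto intro: le_SucI trans_le_add2)

lemma length_le_bits: "length xs \<le> bits (enc xs)"
  by (induction xs) auto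

lemma bits_append: "bits (enc (xs @ ys)) \<le> bits (enc xs) + bits (enc ys)"
  by (induction xs) auto

lemma bits_rev: "bits (enc (rev xs)) = bits (enc xs)"
  unfolding bits_list by (simp add: rev_map[symmetric])

lemma bits_list_le:
  assumes "\<And>x. x \<in> set xs \<Longrightarrow> bits (enc x) \<le> m"
  shows "bits (enc xs) \<le> 1 + length xs * Suc m"
  using assms
proof (induction xs)
  case (Cons x xs)
  hence "bits (enc xs) \<le> 1 + length xs * Suc m" "bits (enc x) \<le> m" by auto
  thus ?case by simp
qed (simp add: floorlog_def)

text \<open>Replaces a bound in the size of an auxiliary object by one in the size of the input,
  uniformly over all objects of polynomial size. This is how the outputs of one procedure are
  bounded for all arguments that a loop will feed to it.\<close>

lemma psize_uniform:
  assumes "psize E h" "psize D S"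
  obtains M where "psize D M" "\<And>a e. a \<in> D \<Longrightarrow> e \<in> E \<Longrightarrow> bits (enc e) \<le> S a \<Longrightarrow> h e \<le> M a"
proof -
  from assms obtain b b' where b: "\<And>e. e \<in> E \<Longrightarrow> h e \<le> poly b (bits (enc e))"
     "\<And>a. a \<in> D \<Longrightarrow> S a \<le> poly b' (bits (enc a))" by (auto simp: psize_def)
  show ?thesis
  proof (rule that[of "\<lambda>a. poly (pcompose b b') (bits (enc a))"])
    show "psize D (\<lambda>a. poly (pcompose b b') (bits (enc a)))" by (auto simp: psize_def)
    show "h e \<le> poly (pcompose b b') (bits (enc a))"
      if "a \<in> D" "e \<in> E" "bits (enc e) \<le> S a" for a e
      using b(1)[OF that(2)] poly_nat_mono[of "bits (enc e)" "poly b' (bits (enc a))" b]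
        b(2)[OF that(1)] that(3) by (simp add: poly_pcompose)
  qed
qed

text \<open>The loop state consists of the input, the unread suffix and the accumulator; the input
  is kept because \<open>F\<close> depends on it. The accumulator must be bounded after every
  prefix, since a fold over a cheap operation can grow exponentially, as repeated squaring
  does.\<close>

lemma ptime_foldl:
  assumes xs: "ptime D xs" and ini: "ptime D ini"
    and F: "ptime E (\<lambda>z. F (fst z) (fst (snd z)) (snd (snd z)))"
    and S: "psize D S"
    and dom: "\<And>a i. a \<in> D \<Longrightarrow> i < length (xs a) \<Longrightarrow>
        (a, foldl (F a) (ini a) (take i (xs a)), xs a ! i) \<in> E"
    and bd: "\<And>a i. a \<in> D \<Longrightarrow> i \<le> length (xs a) \<Longrightarrow>
        bits (enc (foldl (F a) (ini a) (take i (xs a)))) \<le> S a"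
  shows "ptime D (\<lambda>a. foldl (F a) (ini a) (xs a))"
proof -
  define st where "st a i = (a, drop i (xs a), foldl (F a) (ini a) (take i (xs a)))" for a i
  define D' where "D' = (\<lambda>a. st a 0) ` D"
  define E' where "E' = {st a i | a i. a \<in> D \<and> i \<le> length (xs a)}"
  define c where "c s \<longleftrightarrow> fst (snd s) \<noteq> []" for s :: "'a \<times> 'b list \<times> 'c"
  define f where "f s = (if fst (snd s) \<noteq> [] then (fst s, tl (fst (snd s)), F (fst s) (snd (snd s)) (hd (fst (snd s)))) else s)"
    for s :: "'a \<times> 'b list \<times> 'c"
  have pc: "ptime E' c" unfolding c_def by (intro pt)
  have F': "ptime {s \<in> E'. fst (snd s) \<noteq> []} (\<lambda>s. F (fst s) (snd (snd s)) (hd (fst (snd s))))"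
  proof -
    have "ptime {s \<in> E'. fst (snd s) \<noteq> []} (\<lambda>s. (fst s, snd (snd s), hd (fst (snd s))))"
      by (intro pt ptime_hd) auto
    moreover have "(fst s, snd (snd s), hd (fst (snd s))) \<in> E" if "s \<in> {s \<in> E'. fst (snd s) \<noteq> []}" for s
      using that by (auto simp: E'_def st_def hd_drop_conv_nth intro!: dom)
    ultimately have "ptime {s \<in> E'. fst (snd s) \<noteq> []}
        (\<lambda>s. (\<lambda>z. F (fst z) (fst (snd z)) (snd (snd z))) (fst s, snd (snd s), hd (fst (snd s))))"
      by (rule ptime_comp[OF F])
    thus ?thesis by simp
  qed
  have pf: "ptime E' f" unfolding f_def
    by (rule ptime_if_strong) (intro pt F' ptime_hd | simp)+
  have step: "f (st a i) = st a (Suc i)" if "i < length (xs a)" for a i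
    using that by (auto simp: f_def st_def take_Suc_conv_app_nth hd_drop_conv_nth drop_Suc tl_drop)
  have iter: "(f ^^ i) (st a 0) = st a i" if "i \<le> length (xs a)" for a i
    using that by (induction i) (auto simp: step)
  have "ptime D' (\<lambda>s. (fst s, [] :: 'b list, foldl (F (fst s)) (ini (fst s)) (xs (fst s))))"
  proof (rule ptime_while[OF pc pf])
    show "psize D' (\<lambda>s. bits (enc s))" by (intro ps)
    have "psize D' (\<lambda>s. S (fst s))"
    proof -
      obtain b where b: "\<And>a. a \<in> D \<Longrightarrow> S a \<le> poly b (bits (enc a))" using S by (auto simp: psize_def)
      have "S a \<le> poly b (bits (enc (st a 0)))" if "a \<in> D" for a
        using b[OF that] poly_nat_mono[of "bits (enc a)" "bits (enc (st a 0))" b]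
        by (simp add: st_def le_SucI)
      thus ?thesis unfolding psize_def D'_def by (intro exI[of _ b]) (auto simp: st_def)
    qed
    thus "psize D' (\<lambda>s. 2 + bits (enc s) + S (fst s))" by (intro ps)
    fix s assume "s \<in> D'"
    then obtain a where a: "a \<in> D" "s = st a 0" by (auto simp: D'_def)
    have len: "length (xs a) \<le> bits (enc s)"
      using length_le_bits[of "xs a"] a by (simp add: st_def)
    have sz: "bits (enc (st a i)) \<le> 2 + bits (enc s) + S (fst s)" if "i \<le> length (xs a)" for i
      using bd[OF a(1) that] bits_drop[of i "xs a"] a(2) by (simp add: st_def)
    show "\<exists>k\<le>bits (enc s). (\<forall>i\<le>k. (f ^^ i) s \<in> E' \<and> bits (enc ((f ^^ i) s)) \<le> 2 + bits (enc s) + S (fst s)) \<and>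
        (\<forall>i<k. c ((f ^^ i) s)) \<and> \<not> c ((f ^^ k) s) \<and>
        (fst s, [], foldl (F (fst s)) (ini (fst s)) (xs (fst s))) = (f ^^ k) s"
    proof (intro exI[of _ "length (xs a)"] conjI allI impI)
      show "length (xs a) \<le> bits (enc s)" by (rule len)
      show "(f ^^ i) s \<in> E'" if "i \<le> length (xs a)" for i
        unfolding a(2) iter[OF that] using a(1) that by (auto simp: E'_def)
      show "bits (enc ((f ^^ i) s)) \<le> 2 + bits (enc s) + S (fst s)" if "i \<le> length (xs a)" for i
        using sz[OF that] iter[OF that] a(2) by simp
      show "c ((f ^^ i) s)" if "i < length (xs a)" for i
        unfolding a(2) iter[OF less_imp_le[OF that]] using that by (simp add: c_def st_def)
      show "\<not> c ((f ^^ length (xs a)) s)"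
        unfolding a(2) iter[OF order_refl] by (simp add: c_def st_def)
      show "(fst s, [], foldl (F (fst s)) (ini (fst s)) (xs (fst s))) = (f ^^ length (xs a)) s"
        unfolding a(2) iter[OF order_refl] by (simp add: st_def)
    qed
  qed
  moreover have "ptime D (\<lambda>a. st a 0)"
    unfolding st_def by (auto intro!: pt xs ini)
  ultimately have "ptime D (\<lambda>a. (\<lambda>s. (fst s, [] :: 'b list, foldl (F (fst s)) (ini (fst s)) (xs (fst s)))) (st a 0))"
    by (rule ptime_comp) (auto simp: D'_def)
  from ptime_snd[OF ptime_snd[OF this]] show ?thesis by (simp add: st_def)
qed

lemma ptime_rev_append: "ptime D f \<Longrightarrow> ptime D g \<Longrightarrow> ptime D (\<lambda>a. rev (f a) @ g a)"
proof -
  assume fg: "ptime D f" "ptime D g"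
  have eq: "foldl (\<lambda>acc x. x # acc) ys xs = rev xs @ ys" for xs ys :: "'b list"
    by (induction xs arbitrary: ys) auto
  have "ptime D (\<lambda>a. foldl (\<lambda>acc x. x # acc) (g a) (f a))"
  proof (rule ptime_foldl[OF fg])
    show "ptime UNIV (\<lambda>z::'a \<times> 'b list \<times> 'b. snd (snd z) # fst (snd z))" by (intro pt)
    show "psize D (\<lambda>a. bits (enc (f a)) + bits (enc (g a)))" by (intro ps ptime_psize fg)
    show "bits (enc (foldl (\<lambda>acc x. x # acc) (g a) (take i (f a)))) \<le> bits (enc (f a)) + bits (enc (g a))" for a i
      using bits_append[of "rev (take i (f a))" "g a"] bits_take[of i "f a"] unfolding eq bits_rev by simp
  qed auto
  thus ?thesis by (simp add: eq)
qed

lemma ptime_rev [pt]: "ptime D f \<Longrightarrow> ptime D (\<lambda>a. rev (f a))"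
  using ptime_rev_append[of D f "\<lambda>_. []"] ptime_const[of D "[]"] by simp

lemma ptime_append [pt]: "ptime D f \<Longrightarrow> ptime D g \<Longrightarrow> ptime D (\<lambda>a. f a @ g a)"
  using ptime_rev_append[OF ptime_rev[of D f]] by simp

text \<open>\<open>g\<close> is compiled only for elements that occur in the list of the given
  input. Membership is what later supplies the index bounds of lookups inside a map.\<close>

lemma ptime_map:
  assumes xs: "ptime D xs" and g: "ptime {z. fst z \<in> D \<and> snd z \<in> set (xs (fst z))} (\<lambda>z. g (fst z) (snd z))"
  shows "ptime D (\<lambda>a. map (g a) (xs a))"
proof -
  let ?E = "{z. fst z \<in> D \<and> snd z \<in> set (xs (fst z))}"
  have eq: "foldl (\<lambda>acc x. g a x # acc) [] xs = rev (map (g a) xs)" for a xs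
    by (induction xs rule: rev_induct) auto
  have "psize D (\<lambda>a. 1 + bits (enc a) + bits (enc (xs a)))" by (intro ps ptime_psize xs)
  from psize_uniform[OF ptime_psize[OF g] this] obtain M where M: "psize D M"
    "\<And>a e. a \<in> D \<Longrightarrow> e \<in> ?E \<Longrightarrow> bits (enc e) \<le> 1 + bits (enc a) + bits (enc (xs a)) \<Longrightarrow>
        bits (enc (g (fst e) (snd e))) \<le> M a" by blast
  have M': "bits (enc (g a x)) \<le> M a" if "a \<in> D" "x \<in> set (xs a)" for a x
    using M(2)[of a "(a, x)"] that bits_in_set[of x "xs a"] by simp
  have "ptime D (\<lambda>a. foldl (\<lambda>acc x. g a x # acc) [] (xs a))"
  proof (rule ptime_foldl[OF xs])
    let ?E' = "{z :: 'a \<times> 'c list \<times> 'b. (fst z, snd (snd z)) \<in> ?E}"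
    show "ptime ?E' (\<lambda>z. g (fst z) (snd (snd z)) # fst (snd z))"
    proof (intro pt)
      have "ptime ?E' (\<lambda>z. (\<lambda>z. g (fst z) (snd z)) (fst z, snd (snd z)))"
        by (rule ptime_comp[OF g]) (intro pt | simp)+
      thus "ptime ?E' (\<lambda>z. g (fst z) (snd (snd z)))" by simp
    qed
    show "psize D (\<lambda>a. 1 + bits (enc (xs a)) * Suc (M a))" by (intro ps M ptime_psize xs)
    fix a i assume a: "a \<in> D" and i: "i \<le> length (xs a)"
    have "bits (enc (rev (map (g a) (take i (xs a))))) \<le> 1 + length (take i (xs a)) * Suc (M a)"
      unfolding bits_rev by (rule order_trans[OF bits_list_le[where m = "M a"]])
         (auto intro!: M' a dest: in_set_takeD)
    also have "\<dots> \<le> 1 + bits (enc (xs a)) * Suc (M a)"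
      using length_le_bits[of "xs a"] by (intro add_mono mult_mono) auto
    finally show "bits (enc (foldl (\<lambda>acc x. g a x # acc) [] (take i (xs a)))) \<le> 1 + bits (enc (xs a)) * Suc (M a)"
      unfolding eq .
  qed (auto intro: pt)
  from ptime_rev[OF this] show ?thesis by (simp add: eq)
qed

lemma ptime_map' [pt]:
  assumes xs: "ptime D xs" and g: "ptime UNIV (\<lambda>z. g (fst z) (snd z))"
  shows "ptime D (\<lambda>a. map (g a) (xs a))"
  by (rule ptime_map[OF xs ptime_subset[OF g]]) auto

lemma ptime_concat [pt]: "ptime D f \<Longrightarrow> ptime D (\<lambda>a. concat (f a))"
proof -
  assume f: "ptime D f"
  have eq: "foldl (@) [] xss = concat xss" for xss :: "'b list list"
    by (induction xss rule: rev_induct) auto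
  have sz: "bits (enc (concat xss)) \<le> bits (enc xss)" for xss :: "'b list list"
  proof (induction xss)
    case (Cons xs xss)
    thus ?case using bits_append[of xs "concat xss"] by simp
  qed auto
  have "ptime D (\<lambda>a. foldl (@) [] (f a))"
  proof (rule ptime_foldl[OF f])
    show "ptime UNIV (\<lambda>z::'a \<times> 'b list \<times> 'b list. fst (snd z) @ snd (snd z))" by (intro pt)
    show "psize D (\<lambda>a. bits (enc (f a)))" by (intro ps ptime_psize f)
    show "bits (enc (foldl (@) [] (take i (f a)))) \<le> bits (enc (f a))" for a i
      using sz[of "take i (f a)"] bits_take[of i "f a"] by (simp add: eq)
  qed (auto intro: pt)
  thus ?thesis by (simp add: eq)
qed

lemma ptime_filter:
  assumes xs: "ptime D xs" and g: "ptime {z. fst z \<in> D \<and> snd z \<in> set (xs (fst z))} (\<lambda>z. P (fst z) (snd z))"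
  shows "ptime D (\<lambda>a. filter (P a) (xs a))"
proof -
  have eq: "filter Q ys = concat (map (\<lambda>x. if Q x then [x] else []) ys)" for Q and ys :: "'b list"
    by (induction ys) auto
  show ?thesis unfolding eq by (rule ptime_concat, rule ptime_map[OF xs], rule ptime_if[OF g]) (intro pt)+
qed

lemma ptime_filter' [pt]:
  assumes xs: "ptime D xs" and g: "ptime UNIV (\<lambda>z. P (fst z) (snd z))"
  shows "ptime D (\<lambda>a. filter (P a) (xs a))"
  by (rule ptime_filter[OF xs ptime_subset[OF g]]) auto

lemma bits_of_nat: "bits (Num (int k)) \<le> Suc k"
  by (simp only: bits_Num_le_iff) (simp add: of_nat_less_two_power)

lemma ptime_length [pt]: "ptime D f \<Longrightarrow> ptime D (\<lambda>a. length (f a))"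
proof -
  assume f: "ptime D f"
  have eq: "foldl (\<lambda>n _. n + 1) (0::nat) xs = length xs" for xs :: "'b list"
    by (induction xs rule: rev_induct) auto
  have "ptime D (\<lambda>a. foldl (\<lambda>n _. n + 1) (0::nat) (f a))"
  proof (rule ptime_foldl[OF f])
    show "ptime UNIV (\<lambda>z::'a \<times> nat \<times> 'b. fst (snd z) + 1)" by (intro pt)
    show "psize D (\<lambda>a. Suc (bits (enc (f a))))" by (intro ps ptime_psize f)
    show "bits (enc (foldl (\<lambda>n _. n + 1) (0::nat) (take i (f a)))) \<le> Suc (bits (enc (f a)))" for a i
      using bits_of_nat[of "length (take i (f a))"] length_le_bits[of "take i (f a)"] bits_take[of i "f a"]
      unfolding eq enc_nat_simp by linarith
  qed (auto intro: pt)
  thus ?thesis unfolding eq .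
qed

lemma bits_sum_list: "bits (Num (sum_list xs)) \<le> bits (enc xs)"
proof (induction xs)
  case (Cons x xs)
  thus ?case using bits_Num_add[of x "sum_list xs"] by (simp add: enc_int_def)
qed (simp add: floorlog_def)

lemma ptime_sum_list [pt]: "ptime D f \<Longrightarrow> ptime D (\<lambda>a. sum_list (f a) :: int)"
proof -
  assume f: "ptime D f"
  have eq: "foldl (+) 0 xs = sum_list xs" for xs :: "int list"
    by (induction xs rule: rev_induct) auto
  have "ptime D (\<lambda>a. foldl (+) 0 (f a))"
  proof (rule ptime_foldl[OF f])
    show "ptime UNIV (\<lambda>z::'a \<times> int \<times> int. fst (snd z) + snd (snd z))" by (intro pt)
    show "psize D (\<lambda>a. Suc (bits (enc (f a))))" by (intro ps ptime_psize f)
    show "bits (enc (foldl (+) 0 (take i (f a)))) \<le> Suc (bits (enc (f a)))" for a i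
      using bits_sum_list[of "take i (f a)"] bits_take[of i "f a"]
      unfolding eq enc_int_def by linarith
  qed (auto intro: pt)
  thus ?thesis by (simp add: eq)
qed

lemma bits_prod_list: "bits (Num (prod_list xs)) \<le> Suc (bits (enc xs))"
proof (induction xs)
  case (Cons x xs)
  thus ?case using bits_Num_mult[of x "prod_list xs"] by (simp add: enc_int_def)
qed (simp add: floorlog_def)

lemma ptime_prod_list [pt]: "ptime D f \<Longrightarrow> ptime D (\<lambda>a. prod_list (f a) :: int)"
proof -
  assume f: "ptime D f"
  have eq: "foldl (*) 1 xs = prod_list xs" for xs :: "int list"
    by (induction xs rule: rev_induct) auto
  have "ptime D (\<lambda>a. foldl (*) 1 (f a))"
  proof (rule ptime_foldl[OF f])
    show "ptime UNIV (\<lambda>z::'a \<times> int \<times> int. fst (snd z) * snd (snd z))" by (intro pt)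
    show "psize D (\<lambda>a. Suc (bits (enc (f a))))" by (intro ps ptime_psize f)
    show "bits (enc (foldl (*) 1 (take i (f a)))) \<le> Suc (bits (enc (f a)))" for a i
      using bits_prod_list[of "take i (f a)"] bits_take[of i "f a"]
      unfolding eq enc_int_def by linarith
  qed (auto intro: pt)
  thus ?thesis by (simp add: eq)
qed

text \<open>There is no random access, so a fold counts positions. The initial value
  \<open>hd (f a)\<close> is a placeholder whose size is covered by that of the list, which keeps
  the accumulator bounded before position \<open>n a\<close> is reached.\<close>

lemma ptime_nth:
  assumes f: "ptime D f" and n: "ptime D n" and less: "\<And>a. a \<in> D \<Longrightarrow> n a < length (f a)"
  shows "ptime D (\<lambda>a. f a ! n a)"
proof -
  define F where "F a s x = (fst s + 1, if fst s = n a then x else snd s)" for a :: 'a and s :: "nat \<times> 'b" and x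
  have eq: "foldl (F a) (0, r) xs = (length xs, if n a < length xs then xs ! n a else r)" for a r xs
    by (induction xs rule: rev_induct) (auto simp: F_def nth_append)
  have "ptime D (\<lambda>a. foldl (F a) (0, hd (f a)) (f a))"
  proof (rule ptime_foldl[OF f])
    show "ptime D (\<lambda>a. (0, hd (f a)))" by (intro pt ptime_hd f) (use less in fastforce)
    let ?E = "{z::'a \<times> (nat \<times> 'b) \<times> 'b. fst z \<in> D}"
    show "ptime ?E (\<lambda>z. F (fst z) (fst (snd z)) (snd (snd z)))"
      unfolding F_def by (intro pt ptime_comp[OF n]) auto
    show "psize D (\<lambda>a. 2 + bits (enc (f a)) + bits (enc (f a)))" by (intro ps ptime_psize f)
    fix a i assume a: "a \<in> D"
    define r where "r = snd (foldl (F a) (0, hd (f a)) (take i (f a)))"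
    have "r \<in> set (f a)"
      unfolding r_def eq using less[OF a] by (auto intro: hd_in_set)
    hence "bits (enc r) \<le> bits (enc (f a))" by (rule bits_in_set)
    moreover have "foldl (F a) (0, hd (f a)) (take i (f a)) = (length (take i (f a)), r)"
      unfolding r_def eq by simp
    ultimately show "bits (enc (foldl (F a) (0, hd (f a)) (take i (f a)))) \<le> 2 + bits (enc (f a)) + bits (enc (f a))"
      using bits_of_nat[of "length (take i (f a))"] length_le_bits[of "take i (f a)"] bits_take[of i "f a"]
      by (simp add: enc_nat_simp del: length_take bits.simps(1))
  qed auto
  from ptime_snd[OF this] show ?thesis
    by (rule ptime_cong[THEN iffD1, rotated]) (simp add: eq less)
qed

lemma ptime_zip [pt]:
  assumes f: "ptime D f" and g: "ptime D g"
  shows "ptime D (\<lambda>a. zip (f a) (g a))"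
proof -
  define F where "F s x = (if fst s \<noteq> [] then (tl (fst s), (x, hd (fst s)) # snd s) else s)"
    for s :: "'c list \<times> ('b \<times> 'c) list" and x :: 'b
  have eq: "foldl F (ys, []) xs = (drop (length xs) ys, rev (zip xs ys))" for xs ys
  proof (induction xs rule: rev_induct)
    case (snoc x xs)
    have step: "foldl F (ys, []) (xs @ [x]) = F (drop (length xs) ys, rev (zip xs ys)) x"
      by (simp add: snoc)
    show ?case
    proof (cases "length xs < length ys")
      case True
      have "zip (xs @ [x]) ys = zip xs ys @ [(x, ys ! length xs)]"
        using True take_zip[of "length xs" xs ys]
        by (simp add: zip_append1 hd_drop_conv_nth Cons_nth_drop_Suc[symmetric])
      thus ?thesis unfolding step using True by (simp add: F_def hd_drop_conv_nth drop_Suc tl_drop)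
    next
      case False
      thus ?thesis unfolding step by (simp add: F_def zip_append1)
    qed
  qed simp
  have sz: "bits (enc (zip xs ys)) \<le> bits (enc xs) + bits (enc ys)" for xs :: "'b list" and ys :: "'c list"
    by (induction xs ys rule: list_induct2') auto
  have "ptime D (\<lambda>a. foldl F (g a, []) (f a))"
  proof (rule ptime_foldl[OF f])
    show "ptime D (\<lambda>a. (g a, []))" by (intro pt g)
    show "ptime UNIV (\<lambda>z::'a \<times> ('c list \<times> ('b \<times> 'c) list) \<times> 'b. F (fst (snd z)) (snd (snd z)))"
      unfolding F_def by (rule ptime_if_strong) (intro pt ptime_hd | simp)+
    show "psize D (\<lambda>a. 1 + bits (enc (g a)) + (bits (enc (f a)) + bits (enc (g a))))" by (intro ps ptime_psize f g)
    show "bits (enc (foldl F (g a, []) (take i (f a)))) \<le> 1 + bits (enc (g a)) + (bits (enc (f a)) + bits (enc (g a)))" for a i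
      using sz[of "take i (f a)" "g a"] bits_take[of i "f a"] bits_drop[of _ "g a"]
      unfolding eq by (simp add: bits_rev add_mono)
  qed auto
  from ptime_rev[OF ptime_snd[OF this]] show ?thesis by (simp add: eq)
qed

text \<open>The range is tied to a list. For a number given in binary, \<open>[0..<n]\<close> would
  be exponentially longer than \<open>n\<close>.\<close>

lemma ptime_upt [pt]:
  assumes f: "ptime D f"
  shows "ptime D (\<lambda>a. [0..<length (f a)])"
proof -
  have eq: "foldl (\<lambda>s x. length s # s) [] xs = rev [0..<length xs]" for xs :: "'b list"
    by (induction xs rule: rev_induct) auto
  have "ptime D (\<lambda>a. foldl (\<lambda>s x. length s # s) [] (f a))"
  proof (rule ptime_foldl[OF f])
    show "ptime UNIV (\<lambda>z::'a \<times> nat list \<times> 'b. length (fst (snd z)) # fst (snd z))" by (intro pt)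
    show "psize D (\<lambda>a. 1 + bits (enc (f a)) * Suc (Suc (bits (enc (f a)))))" by (intro ps ptime_psize f)
    fix a i
    have len: "length (take i (f a)) \<le> bits (enc (f a))"
      using length_le_bits[of "take i (f a)"] bits_take[of i "f a"] by linarith
    have "bits (enc [0..<length (take i (f a))]) \<le> 1 + length [0..<length (take i (f a))] * Suc (Suc (bits (enc (f a))))"
    proof (rule bits_list_le)
      fix x assume "x \<in> set [0..<length (take i (f a))]"
      hence "x \<le> bits (enc (f a))" using len by (simp del: length_take)
      thus "bits (enc x) \<le> Suc (bits (enc (f a)))" using bits_of_nat[of x] by (simp add: enc_nat_simp)
    qed
    also have "\<dots> \<le> 1 + bits (enc (f a)) * Suc (Suc (bits (enc (f a))))"
      using len by (intro add_mono mult_mono) auto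
    finally show "bits (enc (foldl (\<lambda>s x. length s # s) [] (take i (f a)))) \<le> 1 + bits (enc (f a)) * Suc (Suc (bits (enc (f a))))"
      unfolding eq bits_rev .
  qed (auto intro: pt)
  from ptime_rev[OF this] show ?thesis by (simp add: eq)
qed

lemma list_update_conv_map: "xs[k := v] = map (\<lambda>i. if i = k then v else xs ! i) [0..<length xs]"
  by (rule nth_equalityI) (auto simp: nth_list_update)

lemma ptime_list_update [pt]:
  assumes f: "ptime D f" and k: "ptime D k" and v: "ptime D v"
  shows "ptime D (\<lambda>a. (f a)[k a := v a])"
  unfolding list_update_conv_map
  by (rule ptime_map) (intro pt f ptime_nth ptime_comp[OF f] ptime_comp[OF k] ptime_comp[OF v] | simp)+

lemma map_of_conv_filter:
  "k \<in> set (map fst ps) \<Longrightarrow> the (map_of ps k) = snd (hd (filter (\<lambda>p. fst p = k) ps))"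
  by (induction ps) auto

text \<open>A maximum is the first element that no element exceeds; two nested filters compute
  it.\<close>

lemma Max_conv_filter:
  assumes "xs \<noteq> []"
  shows "filter (\<lambda>x. filter (\<lambda>y. x < y) xs = []) xs \<noteq> []" (is "?L \<noteq> []")
    and "hd (filter (\<lambda>x. filter (\<lambda>y. x < y) xs = []) xs) = Max (set xs :: int set)"
proof -
  have "Max (set xs) \<in> set ?L" using assms by (auto simp: filter_empty_conv not_less)
  hence ne: "?L \<noteq> []" by (metis empty_iff empty_set)
  thus "?L \<noteq> []" .
  from hd_in_set[OF ne] have "hd ?L \<in> set ?L" .
  thus "hd ?L = Max (set xs)" by (auto simp: filter_empty_conv not_less intro!: Max_eqI[symmetric])
qed

lemma ptime_Max_set:
  assumes f: "ptime D f" and ne: "\<And>a. a \<in> D \<Longrightarrow> f a \<noteq> []"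
  shows "ptime D (\<lambda>a. Max (set (f a)) :: int)"
proof -
  have "ptime D (\<lambda>a. hd (filter (\<lambda>x. filter (\<lambda>y. x < y) (f a) = []) (f a)))"
    by (rule ptime_hd, rule ptime_filter[OF f])
       (use Max_conv_filter ne in \<open>(intro pt ptime_comp[OF f] | force)+\<close>)
  thus ?thesis by (rule ptime_cong[THEN iffD1, rotated]) (simp add: Max_conv_filter ne)
qed

lemma ptime_Min_set:
  assumes f: "ptime D f" and ne: "\<And>a. a \<in> D \<Longrightarrow> f a \<noteq> []"
  shows "ptime D (\<lambda>a. Min (set (f a)) :: int)"
proof -
  have "ptime D (\<lambda>a. - Max (set (map uminus (f a))))"
    by (intro ptime_uminus_int ptime_Max_set pt f) (use ne in auto)
  moreover have "- Max (set (map uminus xs)) = Min (set xs)" if "xs \<noteq> []" for xs :: "int list"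
  proof -
    have "Max (uminus ` set xs) = - Min (set xs)"
      using that by (intro Max_eqI) auto
    thus ?thesis by simp
  qed
  ultimately show ?thesis
    using ptime_cong[of D "\<lambda>a. - Max (set (map uminus (f a)))" "\<lambda>a. Min (set (f a))"] ne by blast
qed


section \<open>Integer points in kernels\<close>

text \<open>Pigeonhole: the integer points of the box \<open>{0..X}^J\<close> outnumber those of the
  box \<open>{-K..K}^I\<close> that contains their images, and the difference of two points with
  equal image is the solution. \<open>X\<close> is chosen so that \<open>(2K + 1)^|I| \<le> X (X +
  1)^|I| < (X + 1)^(|I| + 1) \<le> (X + 1)^|J|\<close>.\<close>

lemma siegel:
  fixes c :: "'i \<Rightarrow> 'j \<Rightarrow> int" and B :: int
  assumes fin: "finite I" "finite J" and card: "card I < card J"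
    and B: "\<And>i j. i \<in> I \<Longrightarrow> j \<in> J \<Longrightarrow> \<bar>c i j\<bar> \<le> B" and B0: "B \<ge> 0"
  shows "\<exists>v. (\<forall>i\<in>I. (\<Sum>j\<in>J. c i j * v j) = 0) \<and> (\<exists>j\<in>J. v j \<noteq> 0) \<and>
    (\<forall>j\<in>J. \<bar>v j\<bar> \<le> (2 * int (card J) * B + 1) ^ card I)"
proof -
  define X where "X = (2 * int (card J) * B + 1) ^ card I"
  define K where "K = int (card J) * B * X"
  have X: "X \<ge> 1" and K: "K \<ge> 0" using B0 unfolding X_def K_def by simp_all
  define \<Phi> where "\<Phi> x = restrict (\<lambda>i. \<Sum>j\<in>J. c i j * x j) I" for x :: "'j \<Rightarrow> int"
  have "\<Phi> ` (PiE J (\<lambda>_. {0..X})) \<subseteq> PiE I (\<lambda>_. {-K..K})"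
  proof (intro image_subsetI PiE_I)
    fix x i assume x: "x \<in> PiE J (\<lambda>_. {0..X})" and i: "i \<in> I"
    have "\<bar>\<Sum>j\<in>J. c i j * x j\<bar> \<le> (\<Sum>j\<in>J. B * X)"
      using x i B B0 by (intro order_trans[OF sum_abs] sum_mono) (auto simp: abs_mult PiE_iff intro!: mult_mono)
    thus "\<Phi> x i \<in> {-K..K}" using i by (simp add: \<Phi>_def K_def abs_le_iff)
  qed (simp add: \<Phi>_def)
  hence "card (\<Phi> ` (PiE J (\<lambda>_. {0..X}))) \<le> card (PiE I (\<lambda>_. {-K..K}))"
    by (intro card_mono finite_PiE fin) auto
  also have "\<dots> = nat (2 * K + 1) ^ card I"
    using K by (simp add: card_PiE fin)
  also have "\<dots> < nat (X + 1) ^ card J"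
  proof -
    have "(2 * K + 1) ^ card I \<le> ((2 * int (card J) * B + 1) * (X + 1)) ^ card I"
      using B0 X K by (intro power_mono) (auto simp: K_def algebra_simps)
    also have "\<dots> = X * (X + 1) ^ card I" by (simp add: power_mult_distrib X_def)
    also have "\<dots> < (X + 1) ^ Suc (card I)" using X by simp
    also have "\<dots> \<le> (X + 1) ^ card J" using X card by (intro power_increasing) auto
    finally have "nat ((2 * K + 1) ^ card I) < nat ((X + 1) ^ card J)" using X by simp
    thus ?thesis using X K by (subst (asm) (1 2) nat_power_eq) auto
  qed
  also have "\<dots> = card (PiE J (\<lambda>_. {0..X}))" by (simp add: card_PiE fin)
  finally have "\<not> inj_on \<Phi> (PiE J (\<lambda>_. {0..X}))" by (rule pigeonhole)
  then obtain x y where xy: "x \<in> PiE J (\<lambda>_. {0..X})" "y \<in> PiE J (\<lambda>_. {0..X})" "x \<noteq> y" "\<Phi> x = \<Phi> y"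
    by (auto simp: inj_on_def)
  show ?thesis
  proof (intro exI[of _ "\<lambda>j. x j - y j"] conjI ballI)
    fix i assume i: "i \<in> I"
    have "\<Phi> x i = \<Phi> y i" using xy(4) by simp
    thus "(\<Sum>j\<in>J. c i j * (x j - y j)) = 0" using i by (simp add: \<Phi>_def algebra_simps sum_subtractf)
  next
    show "\<exists>j\<in>J. x j - y j \<noteq> 0" using xy(1-3) PiE_ext[of x J "\<lambda>_. {0..X}" y] by auto
  next
    fix j assume "j \<in> J"
    hence "x j \<in> {0..X}" "y j \<in> {0..X}" using xy(1,2) by (auto simp: PiE_iff)
    thus "\<bar>x j - y j\<bar> \<le> (2 * int (card J) * B + 1) ^ card I" unfolding X_def[symmetric] by auto
  qed
qed

text \<open>Vectors of dimension \<open>n\<close> are functions on \<open>nat\<close> of which the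
  first \<open>n\<close> values count; equality of vectors is therefore stated
  coordinatewise.\<close>

definition ip :: "nat \<Rightarrow> (nat \<Rightarrow> 'a::comm_ring_1) \<Rightarrow> (nat \<Rightarrow> 'a) \<Rightarrow> 'a" where
  "ip n u v = (\<Sum>i<n. u i * v i)"

abbreviation ri :: "(nat \<Rightarrow> int) \<Rightarrow> nat \<Rightarrow> real" where
  "ri a \<equiv> \<lambda>i. real_of_int (a i)"

definition kern :: "nat \<Rightarrow> (nat \<Rightarrow> int) set \<Rightarrow> (nat \<Rightarrow> real) set" where
  "kern n R = {x. \<forall>a\<in>R. ip n (ri a) x = 0}"

definition unit_fun :: "nat \<Rightarrow> nat \<Rightarrow> int" where
  "unit_fun k i = of_bool (i = k)"

lemma ip_commute: "ip n u v = ip n v u"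
  by (simp add: ip_def mult.commute)

lemma ip_add: "ip n (\<lambda>i. u i + v i) x = ip n u x + ip n v x"
  and ip_diff: "ip n (\<lambda>i. u i - v i) x = ip n u x - ip n v x"
  and ip_scale: "ip n (\<lambda>i. c * u i) x = c * ip n u x"
  and ip_minus: "ip n (\<lambda>i. - u i) x = - ip n u x"
  and ip_sum: "ip n (\<lambda>i. \<Sum>s\<in>S. f s i) x = (\<Sum>s\<in>S. ip n (f s) x)"
  by (simp_all add: ip_def algebra_simps sum.distrib sum_subtractf sum_distrib_left sum_distrib_right
      sum_negf sum.swap[of _ S])

lemma ip_add_right: "ip n x (\<lambda>i. u i + v i) = ip n x u + ip n x v"
  and ip_diff_right: "ip n x (\<lambda>i. u i - v i) = ip n x u - ip n x v"
  and ip_scale_right: "ip n x (\<lambda>i. c * u i) = c * ip n x u"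
  and ip_minus_right: "ip n x (\<lambda>i. - u i) = - ip n x u"
  by (simp_all add: ip_commute[of n x] ip_add ip_diff ip_scale ip_minus)

lemma ip_cong: "(\<And>i. i < n \<Longrightarrow> u i = u' i) \<Longrightarrow> (\<And>i. i < n \<Longrightarrow> v i = v' i) \<Longrightarrow> ip n u v = ip n u' v'"
  unfolding ip_def by (rule sum.cong) auto

lemma ip_unit: "k < n \<Longrightarrow> ip n (ri (unit_fun k)) x = x k"
  by (simp add: ip_def unit_fun_def)

lemma ip_of_int: "ip n (ri a) (ri b) = real_of_int (ip n a b)"
  by (simp add: ip_def)

lemma ip_self_nonneg: "ip n x x \<ge> (0 :: real)"
  unfolding ip_def by (intro sum_nonneg) auto

lemma ip_self_eq_0: "ip n x x = (0 :: real) \<Longrightarrow> i < n \<Longrightarrow> x i = 0"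
  unfolding ip_def by (subst (asm) sum_nonneg_eq_0_iff) auto

lemma kern_add: "x \<in> kern n R \<Longrightarrow> y \<in> kern n R \<Longrightarrow> (\<lambda>i. x i + y i) \<in> kern n R"
  and kern_diff: "x \<in> kern n R \<Longrightarrow> y \<in> kern n R \<Longrightarrow> (\<lambda>i. x i - y i) \<in> kern n R"
  and kern_scale: "x \<in> kern n R \<Longrightarrow> (\<lambda>i. c * x i) \<in> kern n R"
  and kern_minus: "x \<in> kern n R \<Longrightarrow> (\<lambda>i. - x i) \<in> kern n R"
  by (simp_all add: kern_def ip_add_right ip_diff_right ip_scale_right ip_minus_right)

lemma kern_cong: "(\<And>i. i < n \<Longrightarrow> x i = y i) \<Longrightarrow> x \<in> kern n R \<longleftrightarrow> y \<in> kern n R"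
  unfolding kern_def using ip_cong[of n _ _ x y] by auto

text \<open>Siegel's bound for \<open>m\<close> equations in \<open>m + 1\<close> unknowns whose
  coefficients are inner products, at most \<open>n * B\<^sup>2\<close>, times
  \<open>(m + 1) * B\<close> for recombining \<open>m\<close> rows and the vector \<open>y\<close>
  with the solution as coefficients.\<close>

definition height_bound :: "nat \<Rightarrow> nat \<Rightarrow> int \<Rightarrow> int" where
  "height_bound m n B = (int m + 1) * B * (2 * (int m + 1) * (int n * B\<^sup>2) + 1) ^ m"

text \<open>A subset of least cardinality with the same kernel takes the part of a basis of the row
  space.\<close>

lemma exists_minimal_rows:
  assumes "finite R"
  obtains R' where "R' \<subseteq> R" "kern n R' = kern n R" "\<And>S. S \<subset> R' \<Longrightarrow> kern n S \<noteq> kern n R"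
proof -
  obtain R' where R': "R' \<subseteq> R \<and> kern n R' = kern n R"
     and min: "\<And>S. S \<subseteq> R \<and> kern n S = kern n R \<Longrightarrow> card R' \<le> card S"
    using ex_has_least_nat[of "\<lambda>S. S \<subseteq> R \<and> kern n S = kern n R" R card] by auto
  show ?thesis
  proof (rule that[of R'])
    fix S assume S: "S \<subset> R'"
    hence "card S < card R'" using R' assms by (meson finite_subset psubset_card_mono)
    thus "kern n S \<noteq> kern n R" using min[of S] S R' by auto
  qed (use R' in auto)
qed

text \<open>
  The projection of \<open>y\<close> on the kernel is \<open>y - \<Sum> \<lambda>\<^sub>b b\<close>, where \<open>\<lambda>\<close> solves the normal equations.
  These, homogenized by \<open>\<tau>\<close>, have one more unknown than equations, so Siegel's lemma yields a
  small solution; \<open>\<tau> \<noteq> 0\<close> because a minimal set of rows is linearly independent.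
\<close>

lemma projection_bound:
  assumes fin: "finite R" and m: "card R \<le> m"
    and RB: "\<And>a i. a \<in> R \<Longrightarrow> i < n \<Longrightarrow> \<bar>a i\<bar> \<le> B" and yB: "\<And>i. i < n \<Longrightarrow> \<bar>y i\<bar> \<le> B" and B: "B \<ge> 1"
  obtains \<tau> p where "\<tau> > 0" "\<And>i. i < n \<Longrightarrow> \<bar>p i\<bar> \<le> height_bound m n B" "ri p \<in> kern n R"
     "\<And>x. x \<in> kern n R \<Longrightarrow> ip n (ri p) x = real_of_int \<tau> * ip n (ri y) x"
proof -
  obtain R' where R': "R' \<subseteq> R" "kern n R' = kern n R"
    and min: "\<And>S. S \<subset> R' \<Longrightarrow> kern n S \<noteq> kern n R" using exists_minimal_rows[OF fin] by metis
  have fR': "finite R'" using R' fin finite_subset by blast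
  define r where "r = card R'"
  have rm: "r \<le> m" unfolding r_def using card_mono[OF fin R'(1)] m by simp
  \<comment> \<open>The unknowns: \<open>None\<close> is \<open>\<tau>\<close>, and
    \<open>Some b\<close> is the coefficient of the row \<open>b\<close>. The equation of row
    \<open>a\<close> says that \<open>p = \<tau> y - \<Sum> v_b b\<close> is orthogonal to
    \<open>a\<close>.\<close>
  define J where "J = insert None (Some ` R')"
  have J: "finite J" "card J = Suc r" unfolding J_def r_def by (auto simp: fR' card_image)
  define c where "c a j = (case j of None \<Rightarrow> ip n a y | Some b \<Rightarrow> - ip n a b)" for a :: "nat \<Rightarrow> int" and j
  have ipB: "\<bar>ip n a b\<bar> \<le> int n * B\<^sup>2" if "\<And>i. i < n \<Longrightarrow> \<bar>a i\<bar> \<le> B" "\<And>i. i < n \<Longrightarrow> \<bar>b i\<bar> \<le> B"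
    for a b :: "nat \<Rightarrow> int"
  proof -
    have "\<bar>ip n a b\<bar> \<le> (\<Sum>i<n. B * B)"
      unfolding ip_def using that B by (intro order_trans[OF sum_abs] sum_mono) (auto simp: abs_mult intro!: mult_mono)
    thus ?thesis by (simp add: power2_eq_square)
  qed
  have cB: "\<bar>c a j\<bar> \<le> int n * B\<^sup>2" if "a \<in> R'" "j \<in> J" for a j
    using that subsetD[OF R'(1)] RB yB by (auto simp: c_def J_def intro!: ipB)
  have "\<exists>v. (\<forall>a\<in>R'. (\<Sum>j\<in>J. c a j * v j) = 0) \<and> (\<exists>j\<in>J. v j \<noteq> 0) \<and>
    (\<forall>j\<in>J. \<bar>v j\<bar> \<le> (2 * int (card J) * (int n * B\<^sup>2) + 1) ^ card R')"
    by (rule siegel[OF fR' J(1) _ cB]) (use J B in \<open>auto simp: r_def\<close>)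
  then obtain v where v: "\<And>a. a \<in> R' \<Longrightarrow> (\<Sum>j\<in>J. c a j * v j) = 0" "\<exists>j\<in>J. v j \<noteq> 0"
    "\<And>j. j \<in> J \<Longrightarrow> \<bar>v j\<bar> \<le> (2 * int (Suc r) * (int n * B\<^sup>2) + 1) ^ r" unfolding J(2) r_def by blast
  define X where "X = (2 * (int m + 1) * (int n * B\<^sup>2) + 1) ^ m"
  have vX: "\<bar>v j\<bar> \<le> X" if "j \<in> J" for j
  proof -
    have "(2 * int (Suc r) * (int n * B\<^sup>2) + 1) ^ r \<le> (2 * (int m + 1) * (int n * B\<^sup>2) + 1) ^ r"
      using rm B by (intro power_mono add_mono mult_mono) auto
    also have "\<dots> \<le> X" unfolding X_def using rm B by (intro power_increasing) auto
    finally show ?thesis using v(3)[OF that] by linarith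
  qed
  define \<tau> where "\<tau> = v None"
  define p where "p i = \<tau> * y i - (\<Sum>b\<in>R'. v (Some b) * b i)" for i
  have sumJ: "(\<Sum>j\<in>J. f j) = f None + (\<Sum>b\<in>R'. f (Some b))" for f :: "_ \<Rightarrow> int"
    unfolding J_def by (subst sum.insert) (auto simp: fR' sum.reindex)
  have pR: "ip n a p = 0" if "a \<in> R'" for a
  proof -
    have "ip n a p = \<tau> * ip n a y - (\<Sum>b\<in>R'. v (Some b) * ip n a b)"
      unfolding p_def ip_diff_right ip_scale_right
      by (subst (2) ip_commute) (simp only: ip_sum ip_scale, simp add: ip_commute)
    also have "\<dots> = (\<Sum>j\<in>J. c a j * v j)"
      unfolding sumJ by (simp add: c_def \<tau>_def sum_negf mult.commute)
    finally show ?thesis using v(1)[OF that] by simp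
  qed
  have pk: "ri p \<in> kern n R"
  proof -
    have "ri p \<in> kern n R'" unfolding kern_def by (auto simp: ip_of_int pR)
    thus ?thesis by (simp add: R'(2))
  qed
  have pproj: "ip n (ri p) x = real_of_int \<tau> * ip n (ri y) x - (\<Sum>b\<in>R'. real_of_int (v (Some b)) * ip n (ri b) x)" for x
  proof -
    have "ri p = (\<lambda>i. real_of_int \<tau> * ri y i - (\<Sum>b\<in>R'. real_of_int (v (Some b)) * ri b i))"
      by (rule ext) (simp add: p_def)
    thus ?thesis by (simp only: ip_diff ip_scale ip_sum)
  qed
  have pproj': "ip n (ri p) x = real_of_int \<tau> * ip n (ri y) x" if "x \<in> kern n R" for x
  proof -
    have "x \<in> kern n R'" using that by (simp add: R'(2))
    hence "(\<Sum>b\<in>R'. real_of_int (v (Some b)) * ip n (ri b) x) = 0"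
      by (intro sum.neutral) (simp add: kern_def)
    thus ?thesis unfolding pproj by simp
  qed
  have \<tau>: "\<tau> \<noteq> 0"
  proof
    \<comment> \<open>With \<open>\<tau> = 0\<close>, \<open>p\<close> lies in the kernel and is
      orthogonal to it, so it vanishes. This is a linear relation among the rows in which
      \<open>b0\<close> has a nonzero coefficient; dropping \<open>b0\<close> would not change the
      kernel, against minimality.\<close>
    assume 0: "\<tau> = 0"
    obtain b0 where b0: "b0 \<in> R'" "v (Some b0) \<noteq> 0" using v(2) 0 by (auto simp: J_def \<tau>_def)
    have "ip n (ri p) (ri p) = 0" using pproj'[OF pk] 0 by simp
    hence p0: "p i = 0" if "i < n" for i using ip_self_eq_0[OF _ that, of "ri p"] by simp
    have "kern n (R' - {b0}) = kern n R"
    proof (intro equalityI subsetI)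
      fix x assume x: "x \<in> kern n (R' - {b0})"
      have "0 = ip n (ri p) x" by (simp add: ip_def p0)
      also have "\<dots> = - (\<Sum>b\<in>R'. real_of_int (v (Some b)) * ip n (ri b) x)" unfolding pproj 0 by simp
      also have "(\<Sum>b\<in>R'. real_of_int (v (Some b)) * ip n (ri b) x) = real_of_int (v (Some b0)) * ip n (ri b0) x"
        using x by (subst sum.remove[OF fR' b0(1)]) (simp add: kern_def)
      finally have "x \<in> kern n R'" using b0 x by (auto simp: kern_def)
      thus "x \<in> kern n R" by (simp add: R'(2))
    next
      fix x assume "x \<in> kern n R"
      hence "x \<in> kern n R'" by (simp add: R'(2))
      thus "x \<in> kern n (R' - {b0})" by (auto simp: kern_def)
    qed
    thus False using min[of "R' - {b0}"] b0 by auto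
  qed
  have pB: "\<bar>p i\<bar> \<le> height_bound m n B" if "i < n" for i
  proof -
    have X0: "X \<ge> 0" unfolding X_def using B by simp
    have "\<bar>p i\<bar> \<le> \<bar>\<tau> * y i\<bar> + (\<Sum>b\<in>R'. \<bar>v (Some b) * b i\<bar>)"
      unfolding p_def using sum_abs[of "\<lambda>b. v (Some b) * b i" R'] by linarith
    also have "\<dots> \<le> X * B + (\<Sum>b\<in>R'. X * B)"
      unfolding abs_mult \<tau>_def using R' RB yB that X0
      by (intro add_mono mult_mono sum_mono vX) (auto simp: J_def)
    also have "\<dots> = (int r + 1) * B * X" by (simp add: r_def algebra_simps)
    also have "\<dots> \<le> (int m + 1) * B * X" using rm B X0 by (intro mult_mono) auto
    finally show ?thesis unfolding height_bound_def X_def .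
  qed
  show ?thesis
  proof (cases "\<tau> > 0")
    case True
    thus ?thesis using that[of \<tau> p] pB pk pproj' by blast
  next
    case False
    \<comment> \<open>Siegel's lemma leaves the sign of \<open>\<tau>\<close> open; negating both
      \<open>\<tau>\<close> and \<open>p\<close> makes it positive.\<close>
    have "ri (\<lambda>i. - p i) \<in> kern n R" using kern_minus[OF pk] by simp
    moreover have "ip n (ri (\<lambda>i. - p i)) x = real_of_int (- \<tau>) * ip n (ri y) x" if "x \<in> kern n R" for x
      using pproj'[OF that] by (simp add: ip_minus)
    ultimately show ?thesis using that[of "-\<tau>" "\<lambda>i. - p i"] pB False \<tau> by auto
  qed
qed

text \<open>
  A nonnegative kernel vector \<open>x\<close> with \<open>x k > 0\<close> and minimal support spans the kernel vectors that
  vanish off its support.  Hence the projection of the \<open>k\<close>-th unit vector on these is a positive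
  multiple of \<open>x\<close>, to which the previous bound applies.
\<close>

lemma vertex_bound:
  assumes fin: "finite R" and m: "card R \<le> m"
    and RB: "\<And>a i. a \<in> R \<Longrightarrow> i < n \<Longrightarrow> \<bar>a i\<bar> \<le> B" and B: "B \<ge> 1"
    and x0: "x0 \<in> kern n R" "\<And>i. i < n \<Longrightarrow> x0 i \<ge> 0" "k < n" "x0 k > 0"
  shows "\<exists>x\<in>kern n R. (\<forall>i<n. 0 \<le> x i \<and> x i \<le> 1) \<and> x k * real_of_int (height_bound (m + n) n B) \<ge> 1"
proof -
  define supp where "supp x = {i. i < n \<and> x i \<noteq> (0::real)}" for x
  define good where "good x \<longleftrightarrow> x \<in> kern n R \<and> (\<forall>i<n. x i \<ge> 0) \<and> x k > 0" for x
  have "good x0" using x0 by (auto simp: good_def)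
  then obtain x where x: "good x" and min: "\<And>y. good y \<Longrightarrow> card (supp x) \<le> card (supp y)"
    using ex_has_least_nat[of good x0 "\<lambda>x. card (supp x)"] by blast
  have fs: "finite (supp x)" for x by (simp add: supp_def)
  \<comment> \<open>The unit rows force the coordinates outside the support of \<open>x\<close> to
    vanish.\<close>
  define RS where "RS = R \<union> unit_fun ` ({..<n} - supp x)"
  have kRS: "u \<in> kern n RS \<longleftrightarrow> u \<in> kern n R \<and> (\<forall>i<n. x i = 0 \<longrightarrow> u i = 0)" for u
    unfolding RS_def kern_def by (auto simp: ip_unit supp_def ball_Un)
  \<comment> \<open>Ratio test: subtracting the largest multiple of \<open>v\<close> that keeps
    \<open>x\<close> nonnegative annihilates a coordinate of its support, while
    \<open>v k = 0\<close> keeps \<open>x k\<close> positive. A positive entry of \<open>v\<close>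
    would thus contradict minimality of the support.\<close>
  have no_pos: "v i \<le> 0" if v: "v \<in> kern n RS" "v k = 0" "i < n" for v i
  proof (rule ccontr)
    assume "\<not> v i \<le> 0"
    define Q where "Q = {i. i < n \<and> v i > 0}"
    have Q: "finite Q" "Q \<noteq> {}" using \<open>\<not> v i \<le> 0\<close> that by (auto simp: Q_def)
    define t where "t = Min ((\<lambda>i. x i / v i) ` Q)"
    have t: "t \<le> x i / v i" if "i \<in> Q" for i unfolding t_def using that Q by simp
    have "t \<in> (\<lambda>i. x i / v i) ` Q" unfolding t_def using Q by (intro Min_in) auto
    then obtain i0 where i0: "i0 \<in> Q" "t = x i0 / v i0" by auto
    have t0: "t \<ge> 0" using i0 x by (auto simp: Q_def good_def)
    define y where "y i = x i - t * v i" for i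
    have "y \<in> kern n R" unfolding y_def using x v(1) by (intro kern_diff kern_scale) (auto simp: good_def kRS)
    moreover have "y i \<ge> 0" if "i < n" for i
    proof (cases "v i > 0")
      case True
      thus ?thesis using t[of i] that by (simp add: Q_def y_def field_simps)
    next
      case False
      have "t * v i \<le> 0" using False t0 by (simp add: mult_nonneg_nonpos)
      moreover have "x i \<ge> 0" using x that by (simp add: good_def)
      ultimately show ?thesis by (simp add: y_def)
    qed
    moreover have "y k > 0" using x v(2) by (simp add: y_def good_def)
    ultimately have "good y" by (simp add: good_def)
    have "supp y \<subseteq> supp x" using v(1) by (auto simp: kRS supp_def y_def)
    moreover have "i0 \<in> supp x"
      using v(1) i0 by (auto simp: kRS supp_def Q_def)
    moreover have "i0 \<notin> supp y" using i0 by (simp add: supp_def y_def Q_def)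
    ultimately have "supp y \<subset> supp x" by blast
    hence "card (supp y) < card (supp x)" by (intro psubset_card_mono fs)
    thus False using min[OF \<open>good y\<close>] by simp
  qed
  \<comment> \<open>The difference \<open>u - (u k / x k) x\<close> vanishes at \<open>k\<close>;
    the preceding fact for it and for its negative makes it zero.\<close>
  have one_dim: "u i = u k / x k * x i" if u: "u \<in> kern n RS" and i: "i < n" for u i
  proof -
    define v where "v i = u i - u k / x k * x i" for i
    have xk: "x k > 0" using x by (simp add: good_def)
    have v: "v \<in> kern n RS" unfolding v_def
      using u x by (intro kern_diff kern_scale) (auto simp: good_def kRS)
    have "v k = 0" using xk by (simp add: v_def)
    with no_pos[OF v _ i] no_pos[OF kern_minus[OF v] _ i] show ?thesis by (simp add: v_def)
  qed
  have cRS: "finite RS" "card RS \<le> m + n"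
  proof -
    show "finite RS" using fin by (simp add: RS_def)
    have "card RS \<le> card R + card (unit_fun ` ({..<n} - supp x))" unfolding RS_def by (rule card_Un_le)
    also have "card (unit_fun ` ({..<n} - supp x)) \<le> card {..<n}"
      by (rule order_trans[OF card_image_le card_mono]) auto
    finally show "card RS \<le> m + n" using m by simp
  qed
  obtain \<tau> p where p: "\<tau> > 0" "\<And>i. i < n \<Longrightarrow> \<bar>p i\<bar> \<le> height_bound (m + n) n B" "ri p \<in> kern n RS"
     "\<And>x. x \<in> kern n RS \<Longrightarrow> ip n (ri p) x = real_of_int \<tau> * ip n (ri (unit_fun k)) x"
  proof (rule projection_bound[OF cRS _ _ B, where y = "unit_fun k"])
    show "\<bar>a i\<bar> \<le> B" if "a \<in> RS" "i < n" for a i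
      using that RB B by (auto simp: RS_def unit_fun_def)
    show "\<bar>unit_fun k i\<bar> \<le> B" for i using B by (simp add: unit_fun_def)
  qed blast
  have xRS: "x \<in> kern n RS" using x by (simp add: kRS good_def)
  \<comment> \<open>\<open>p = s x\<close> by one-dimensionality, and the pairing with
    \<open>x\<close> shows \<open>s > 0\<close>. So the entries of \<open>p / H\<close> lie between
    0 and 1, and the \<open>k\<close>-th one is at least \<open>1 / H\<close>, because the positive
    number \<open>p k\<close> is an integer.\<close>
  define s where "s = p k / x k"
  have ps: "real_of_int (p i) = s * x i" if "i < n" for i using one_dim[OF p(3) that] by (simp add: s_def)
  have "ip n (ri p) x = s * ip n x x"
    using ip_cong[of n "ri p" "\<lambda>i. s * x i" x x] by (simp add: ps ip_scale)
  hence "s * ip n x x = real_of_int \<tau> * x k" using p(4)[OF xRS] x0(3) by (simp add: ip_unit)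
  moreover have "real_of_int \<tau> * x k > 0" using p(1) x by (simp add: good_def)
  ultimately have "s * ip n x x > 0" by linarith
  hence s: "s > 0" using ip_self_nonneg[of n x] by (metis mult_nonneg_nonpos2 not_le mult.commute)
  define H where "H = height_bound (m + n) n B"
  have "p k > 0" using ps[OF x0(3)] s x by (simp add: good_def flip: of_int_0_less_iff[where 'a = real])
  hence H: "H \<ge> 1" using p(2)[OF x0(3)] by (simp add: H_def)
  show ?thesis
  proof (rule bexI[of _ "\<lambda>i. (1 / real_of_int H) * ri p i"])
    have "real_of_int (p i) / real_of_int H \<le> 1" if "i < n" for i
      using p(2)[OF that] H by (simp add: H_def[symmetric])
    moreover have "real_of_int (p i) / real_of_int H \<ge> 0" if "i < n" for i
      using ps[OF that] s x that H by (simp add: good_def)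
    moreover have "real_of_int (p k) \<ge> 1" using \<open>p k > 0\<close> by simp
    ultimately show "(\<forall>i<n. 0 \<le> (1 / real_of_int H) * ri p i \<and> (1 / real_of_int H) * ri p i \<le> 1) \<and>
        1 \<le> (1 / real_of_int H) * ri p k * real_of_int (height_bound (m + n) n B)"
      using H by (auto simp: H_def[symmetric])
    show "(\<lambda>i. (1 / real_of_int H) * ri p i) \<in> kern n R"
      using p(3) by (intro kern_scale) (simp add: kRS)
  qed
qed

section \<open>Projections and rescaling\<close>

text \<open>Orthogonal projection on the kernel, described by inner products with kernel vectors; no
  inverse of a Gram matrix appears.\<close>

definition isproj :: "nat \<Rightarrow> (nat \<Rightarrow> int) set \<Rightarrow> (nat \<Rightarrow> real) \<Rightarrow> (nat \<Rightarrow> real) \<Rightarrow> bool" where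
  "isproj n R y z \<longleftrightarrow> z \<in> kern n R \<and> (\<forall>x\<in>kern n R. ip n z x = ip n y x)"

lemma isproj_unique:
  assumes "isproj n R y z" "isproj n R y z'" "i < n"
  shows "z i = z' i"
proof -
  have "(\<lambda>i. z i - z' i) \<in> kern n R" using assms by (intro kern_diff) (auto simp: isproj_def)
  hence "ip n (\<lambda>i. z i - z' i) (\<lambda>i. z i - z' i) = 0" using assms by (simp add: isproj_def ip_diff)
  from ip_self_eq_0[OF this assms(3)] show ?thesis by simp
qed

text \<open>Divides the integer multiple of \<open>projection_bound\<close> by
  \<open>\<tau>\<close>; the largest of finitely many entries serves as \<open>B\<close>.\<close>

lemma isproj_exists:
  assumes "finite R"
  shows "\<exists>z. isproj n R (ri y) z"
proof -
  define B where "B = Max (insert 1 ((\<lambda>(a, i). \<bar>a i\<bar>) ` (insert y R \<times> {..<n})))"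
  have fin: "finite (insert 1 ((\<lambda>(a, i). \<bar>a i\<bar>) ` (insert y R \<times> {..<n})))" using assms by simp
  have B: "B \<ge> 1" unfolding B_def using fin by (intro Max_ge) auto
  have BB: "\<bar>a i\<bar> \<le> B" if "a \<in> insert y R" "i < n" for a i
    unfolding B_def using that by (intro Max_ge fin) (force intro!: image_eqI[of _ _ "(a, i)"])
  obtain \<tau> p where p: "\<tau> > 0" "ri p \<in> kern n R"
     "\<And>x. x \<in> kern n R \<Longrightarrow> ip n (ri p) x = real_of_int \<tau> * ip n (ri y) x"
    using projection_bound[OF assms order_refl, of n B y] BB B by (metis insertI1 insertI2)
  have "isproj n R (ri y) (\<lambda>i. (1 / real_of_int \<tau>) * ri p i)"
    unfolding isproj_def
  proof (intro conjI ballI)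
    show "(\<lambda>i. (1 / real_of_int \<tau>) * ri p i) \<in> kern n R" by (intro kern_scale p)
    fix x assume "x \<in> kern n R"
    show "ip n (\<lambda>i. (1 / real_of_int \<tau>) * ri p i) x = ip n (ri y) x"
      unfolding ip_scale p(3)[OF \<open>x \<in> kern n R\<close>] using p(1) by simp
  qed
  thus ?thesis by blast
qed

text \<open>The perceptron update. With \<open>e\<close> the projection of the \<open>k\<close>-th
  unit vector, the new projection is \<open>z + e\<close>, and
  \<open>|z + e|^2 = |z|^2 + 2 z_k + e_k\<close>. Here \<open>e_k = |e|^2 \<ge> e_k^2\<close> gives
  \<open>e_k \<le> 1\<close>, and \<open>z_k \<le> 0\<close>.\<close>

lemma isproj_increment:
  assumes R: "finite R" and z: "isproj n R (ri y) z" "ip n z z \<le> s" and k: "k < n" "z k \<le> 0"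
  shows "\<exists>z'. isproj n R (ri (y(k := y k + 1))) z' \<and> ip n z' z' \<le> s + 1"
proof -
  obtain e where e: "isproj n R (ri (unit_fun k)) e" using isproj_exists[OF R] by blast
  have ek: "ip n x e = x k" if "x \<in> kern n R" for x
    using e that k by (simp add: isproj_def ip_unit ip_commute[of n x e])
  have eK: "e \<in> kern n R" and zK: "z \<in> kern n R" using e z by (auto simp: isproj_def)
  have "(e k)\<^sup>2 \<le> ip n e e"
    unfolding ip_def power2_eq_square using k by (intro member_le_sum[of k "{..<n}" "\<lambda>i. e i * e i"]) auto
  hence "(e k)\<^sup>2 \<le> e k" using ek[OF eK] by simp
  hence "e k * (e k - 1) \<le> 0" by (simp add: power2_eq_square algebra_simps)
  hence "e k \<le> 1" using mult_pos_pos[of "e k" "e k - 1"] by linarith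
  moreover have "ip n (\<lambda>i. z i + e i) (\<lambda>i. z i + e i) = ip n z z + 2 * z k + e k"
    using ek[OF eK] ek[OF zK] by (simp add: ip_add ip_add_right ip_commute[of n e z])
  moreover have "isproj n R (ri (y(k := y k + 1))) (\<lambda>i. z i + e i)"
  proof -
    have "ri (y(k := y k + 1)) = (\<lambda>i. ri y i + ri (unit_fun k) i)"
      by (rule ext) (simp add: unit_fun_def)
    thus ?thesis using z e unfolding isproj_def
      by (simp only: ip_add) (auto intro: kern_add simp: ip_add)
  qed
  ultimately show ?thesis using z(2) k(2) by (intro exI[of _ "\<lambda>i. z i + e i"]) auto
qed

text \<open>On the kernel \<open>y\<close> and \<open>z\<close> have the same inner products, so
  \<open>y_k x_k \<le> <z, x> \<le> |z| |x|\<close>. Here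
  \<open>|z|^2 \<le> \<Sum> y \<le> 4 n^3\<close> and \<open>|x|^2 \<le> n\<close>, hence
  \<open>y_k x_k \<le> 2 n^2\<close>. The threshold \<open>4 n^2\<close> is twice this
  bound.\<close>

lemma rescale_bound:
  assumes z: "isproj n R y z" "ip n z z \<le> (\<Sum>i<n. y i)"
    and y: "\<And>i. i < n \<Longrightarrow> 0 \<le> y i \<and> y i \<le> 4 * (real n)\<^sup>2" and k: "k < n" "y k = 4 * (real n)\<^sup>2"
    and x: "x \<in> kern n R" "\<And>i. i < n \<Longrightarrow> 0 \<le> x i \<and> x i \<le> 1"
  shows "x k \<le> 1 / 2"
proof -
  have n: "real n > 0" using k by simp
  have "y k * x k \<le> ip n y x"
    unfolding ip_def using k x y by (intro member_le_sum[of k "{..<n}" "\<lambda>i. y i * x i"]) auto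
  also have "\<dots> = ip n z x" using z x by (simp add: isproj_def)
  finally have "(y k * x k)\<^sup>2 \<le> (ip n z x)\<^sup>2"
    using y[OF k(1)] x(2)[OF k(1)] by (intro power_mono) auto
  also have "\<dots> \<le> (\<Sum>i<n. (z i)\<^sup>2) * (\<Sum>i<n. (x i)\<^sup>2)"
    unfolding ip_def by (rule Cauchy_Schwarz_ineq_sum)
  also have "\<dots> \<le> (real n * (4 * (real n)\<^sup>2)) * real n"
  proof (rule mult_mono)
    have "(\<Sum>i<n. (z i)\<^sup>2) = ip n z z" by (simp add: ip_def power2_eq_square)
    also have "\<dots> \<le> (\<Sum>i<n. y i)" by (rule z(2))
    also have "\<dots> \<le> (\<Sum>i<n. 4 * (real n)\<^sup>2)" using y by (intro sum_mono) auto
    finally show "(\<Sum>i<n. (z i)\<^sup>2) \<le> real n * (4 * (real n)\<^sup>2)" by simp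
    have "(\<Sum>i<n. (x i)\<^sup>2) \<le> (\<Sum>i<n. 1)" using x(2) by (intro sum_mono) (auto simp: power_le_one)
    thus "(\<Sum>i<n. (x i)\<^sup>2) \<le> real n" by simp
  qed (auto intro: sum_nonneg)
  finally have "(4 * (real n)\<^sup>2) * (4 * (real n)\<^sup>2) * (x k)\<^sup>2 \<le> (4 * (real n)\<^sup>2) * (real n)\<^sup>2"
    unfolding k by (simp add: power2_eq_square algebra_simps)
  hence "(x k)\<^sup>2 \<le> 1 / 4" using n by (simp add: field_simps power2_eq_square)
  hence "(x k)\<^sup>2 \<le> (1 / 2)\<^sup>2" by (simp add: power2_eq_square)
  thus ?thesis by (rule power2_le_imp_le) simp
qed


section \<open>Integer Gram-Schmidt orthogonalization\<close>

declare bits.simps(1) [simp del]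

lemma bits_Num_0 [simp]: "bits (Num 0) = 1" and bits_Num_1 [simp]: "bits (Num 1) = 2"
  by (simp_all add: bits.simps floorlog_def)

section \<open>Euclid's algorithm and primitive vectors\<close>

lemma bits_gcd: "bits (Num (gcd a b)) \<le> max (bits (Num a)) (bits (Num b))"
proof (cases "a = 0")
  case True
  thus ?thesis using bits_Num_mono[of "gcd a b" b] by simp
next
  case False
  hence "gcd a b \<le> \<bar>a\<bar>" using gcd_le1_int[of "\<bar>a\<bar>" b] by simp
  thus ?thesis using bits_Num_mono[of "gcd a b" a] by simp
qed

definition euclid_step :: "int \<times> int \<Rightarrow> int \<times> int" where
  "euclid_step p = (snd p, fst p mod snd p)"

text \<open>The product of the two entries at least halves in each step, because
  \<open>2 * (a mod b) \<le> a\<close> for \<open>0 < b \<le> a\<close>. The number of steps is thus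
  bounded by the binary logarithm of the product, which is linear in the bit sizes.\<close>

lemma euclid_steps:
  assumes "0 \<le> b" "b \<le> a" "a * b < 2 ^ m"
  shows "\<exists>k\<le>m. (\<forall>i\<le>k. 0 \<le> snd ((euclid_step ^^ i) (a, b)) \<and>
      snd ((euclid_step ^^ i) (a, b)) \<le> fst ((euclid_step ^^ i) (a, b)) \<and>
      fst ((euclid_step ^^ i) (a, b)) \<le> a) \<and>
    (\<forall>i<k. snd ((euclid_step ^^ i) (a, b)) \<noteq> 0) \<and> (euclid_step ^^ k) (a, b) = (gcd a b, 0)"
  using assms
proof (induction m arbitrary: a b)
  case 0
  hence "b = 0" using mult_mono[of 1 a 1 b] by (cases "b = 0") auto
  thus ?case using 0 by auto
next
  case (Suc m)
  show ?case
  proof (cases "b = 0")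
    case True thus ?thesis using Suc.prems by (intro exI[of _ 0]) auto
  next
    case False
    hence b: "b > 0" using Suc.prems by simp
    have r: "0 \<le> a mod b" "a mod b < b" using b by simp_all
    have "a div b \<ge> 1" using b Suc.prems pos_imp_zdiv_pos_iff[of b a] by simp
    hence "1 * b \<le> (a div b) * b" using b by (intro mult_right_mono) auto
    hence "2 * (a mod b) \<le> a" using r div_mult_mod_eq[of a b] by linarith
    hence "b * (2 * (a mod b)) \<le> b * a" using b by (intro mult_left_mono) auto
    hence "b * (a mod b) < 2 ^ m" using Suc.prems(3) by (simp add: mult.commute)
    from Suc.IH[OF r(1) less_imp_le[OF r(2)] this] obtain k where k: "k \<le> m"
      "\<And>i. i \<le> k \<Longrightarrow> 0 \<le> snd ((euclid_step ^^ i) (b, a mod b)) \<and>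
      snd ((euclid_step ^^ i) (b, a mod b)) \<le> fst ((euclid_step ^^ i) (b, a mod b)) \<and>
      fst ((euclid_step ^^ i) (b, a mod b)) \<le> b"
      "\<And>i. i < k \<Longrightarrow> snd ((euclid_step ^^ i) (b, a mod b)) \<noteq> 0"
      "(euclid_step ^^ k) (b, a mod b) = (gcd b (a mod b), 0)" by blast
    have step: "(euclid_step ^^ Suc i) (a, b) = (euclid_step ^^ i) (b, a mod b)" for i
      unfolding funpow_Suc_right comp_def by (simp add: euclid_step_def)
    show ?thesis
    proof (intro exI[of _ "Suc k"] conjI allI impI)
      show "Suc k \<le> Suc m" using k by simp
      show "(euclid_step ^^ Suc k) (a, b) = (gcd a b, 0)"
        unfolding step k(4) by (metis gcd_red_int)
      fix i
      show "0 \<le> snd ((euclid_step ^^ i) (a, b))" if "i \<le> Suc k"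
        using that k(2)[of "i - 1"] Suc.prems step[of "i - 1"] by (cases i) auto
      show "snd ((euclid_step ^^ i) (a, b)) \<le> fst ((euclid_step ^^ i) (a, b))" if "i \<le> Suc k"
        using that k(2)[of "i - 1"] Suc.prems step[of "i - 1"] by (cases i) auto
      show "fst ((euclid_step ^^ i) (a, b)) \<le> a" if "i \<le> Suc k"
        using that k(2)[of "i - 1"] Suc.prems step[of "i - 1"] by (cases i) auto
      show "snd ((euclid_step ^^ i) (a, b)) \<noteq> 0" if "i < Suc k"
        using that k(3)[of "i - 1"] False step[of "i - 1"] by (cases i) auto
    qed
  qed
qed

lemma ptime_gcd [pt]:
  assumes f: "ptime D f" and g: "ptime D g"
  shows "ptime D (\<lambda>a. gcd (f a) (g a) :: int)"
proof -
  let ?E = "{p :: int \<times> int. 0 \<le> snd p \<and> snd p \<le> fst p}"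
  have "ptime ?E (\<lambda>p. (gcd (fst p) (snd p), 0 :: int))"
  proof (rule ptime_while[where c = "\<lambda>p. snd p \<noteq> 0" and f = euclid_step])
    show "ptime ?E (\<lambda>p. snd p \<noteq> 0)" by (intro pt)
    show "ptime ?E euclid_step" unfolding euclid_step_def by (intro pt)
    show "psize ?E (\<lambda>p. bits (enc p))" "psize ?E (\<lambda>p. 1 + 2 * bits (enc p))" by (intro ps)+
    fix p assume "p \<in> ?E"
    then obtain a b where p: "p = (a, b)" "0 \<le> b" "b \<le> a" by (cases p) auto
    have "a * b < 2 ^ (bits (Num a) - 1) * 2 ^ (bits (Num b) - 1)"
      using abs_less_bits[of a] abs_less_bits[of b] p by (intro mult_strict_mono) auto
    also have "\<dots> \<le> 2 ^ (bits (enc p))"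
      unfolding power_add[symmetric] using p by (intro power_increasing) (auto simp: enc_int_def)
    finally have "a * b < 2 ^ (bits (enc p))" .
    from euclid_steps[OF p(2,3) this] obtain k where k: "k \<le> bits (enc p)"
      "\<And>i. i \<le> k \<Longrightarrow> 0 \<le> snd ((euclid_step ^^ i) (a, b)) \<and>
      snd ((euclid_step ^^ i) (a, b)) \<le> fst ((euclid_step ^^ i) (a, b)) \<and>
      fst ((euclid_step ^^ i) (a, b)) \<le> a"
      "\<And>i. i < k \<Longrightarrow> snd ((euclid_step ^^ i) (a, b)) \<noteq> 0"
      "(euclid_step ^^ k) (a, b) = (gcd a b, 0)" by blast
    show "\<exists>k\<le>bits (enc p). (\<forall>i\<le>k. (euclid_step ^^ i) p \<in> ?E \<and> bits (enc ((euclid_step ^^ i) p)) \<le> 1 + 2 * bits (enc p)) \<and>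
        (\<forall>i<k. snd ((euclid_step ^^ i) p) \<noteq> 0) \<and> \<not> snd ((euclid_step ^^ k) p) \<noteq> 0 \<and>
        (gcd (fst p) (snd p), 0) = (euclid_step ^^ k) p"
    proof (intro exI[of _ k] conjI allI impI)
      fix i assume i: "i \<le> k"
      obtain x y where xy: "(euclid_step ^^ i) (a, b) = (x, y)" by fastforce
      have "0 \<le> y" "y \<le> x" "x \<le> a" using k(2)[OF i] unfolding xy by auto
      thus "bits (enc ((euclid_step ^^ i) p)) \<le> 1 + 2 * bits (enc p)"
        using bits_Num_mono[of x a] bits_Num_mono[of y a] unfolding p xy by (simp add: enc_int_def)
    qed (use k p in auto)
  qed
  moreover have "ptime D (\<lambda>a. if \<bar>f a\<bar> < \<bar>g a\<bar> then (\<bar>g a\<bar>, \<bar>f a\<bar>) else (\<bar>f a\<bar>, \<bar>g a\<bar>))"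
    by (intro pt f g)
  ultimately have "ptime D (\<lambda>a. (\<lambda>p. (gcd (fst p) (snd p), 0 :: int))
      (if \<bar>f a\<bar> < \<bar>g a\<bar> then (\<bar>g a\<bar>, \<bar>f a\<bar>) else (\<bar>f a\<bar>, \<bar>g a\<bar>)))"
    by (rule ptime_comp) auto
  from ptime_fst[OF this] show ?thesis
    by (rule ptime_cong[THEN iffD1, rotated]) (auto simp: gcd.commute)
qed

definition icontent :: "int list \<Rightarrow> int" where
  "icontent u = foldl gcd 0 u"

lemma icontent_simps [simp]: "icontent [] = 0" "icontent (u @ [x]) = gcd (icontent u) x"
  by (simp_all add: icontent_def)

lemma icontent_nonneg: "icontent u \<ge> 0"
  by (induction u rule: rev_induct) auto

lemma dvd_icontent_iff: "d dvd icontent u \<longleftrightarrow> (\<forall>x\<in>set u. d dvd x)"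
  by (induction u rule: rev_induct) auto

text \<open>By distributivity of the gcd. For content 1, a number that divides every
  \<open>m * x\<close> divides \<open>m\<close>; the size bound for primitive vectors uses it in
  this form.\<close>

lemma dvd_mult_icontent: "(\<And>x. x \<in> set u \<Longrightarrow> d dvd m * x) \<Longrightarrow> d dvd m * icontent u"
proof (induction u rule: rev_induct)
  case (snoc x u)
  hence "d dvd gcd (m * icontent u) (m * x)" by simp
  also have "\<dots> dvd m * icontent (u @ [x])" by (simp add: gcd_mult_distrib_int[symmetric])
  finally show ?case .
qed simp

lemma icontent_eq_0_iff: "icontent u = 0 \<longleftrightarrow> (\<forall>x\<in>set u. x = 0)"
  using dvd_icontent_iff[of 0 u] by simp

lemma bits_icontent: "bits (Num (icontent u)) \<le> bits (enc u) + 1"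
proof (induction u rule: rev_induct)
  case (snoc x u)
  have "bits (Num (icontent (u @ [x]))) \<le> max (bits (Num (icontent u))) (bits (Num x))"
    using bits_gcd[of "icontent u" x] by simp
  thus ?case using snoc by (simp add: bits_list enc_int_def)
qed simp

lemma ptime_icontent [pt]: "ptime D f \<Longrightarrow> ptime D (\<lambda>a. icontent (f a))"
  unfolding icontent_def
proof (rule ptime_foldl)
  assume f: "ptime D f"
  show "ptime D f" by fact
  show "ptime UNIV (\<lambda>z::'a \<times> int \<times> int. gcd (fst (snd z)) (snd (snd z)))" by (intro pt)
  show "psize D (\<lambda>a. Suc (bits (enc (f a))))" by (intro ps ptime_psize f)
  show "bits (enc (foldl gcd 0 (take i (f a)))) \<le> Suc (bits (enc (f a)))" for a i
    using bits_icontent[of "take i (f a)"] bits_take[of i "f a"] by (simp add: icontent_def enc_int_def)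
qed (auto intro: pt)

definition dot :: "'a::comm_ring_1 list \<Rightarrow> 'a list \<Rightarrow> 'a" where
  "dot u v = sum_list (map2 (*) u v)"

text \<open>
  The vectors of the orthogonalization are only needed up to positive factors.  Making them
  primitive keeps them small: a primitive vector divides every parallel integer vector.
\<close>

definition primitive :: "int list \<Rightarrow> int list" where
  "primitive u = map (\<lambda>x. x div icontent u) u"

text \<open>A Gram-Schmidt step multiplied by the positive number \<open>dot b b\<close>, which
  keeps it integral and preserves the direction. \<open>b = 0\<close> occurs when a row depends on
  its predecessors.\<close>

definition reduce :: "int list \<Rightarrow> int list \<Rightarrow> int list" where
  "reduce u b = (if dot b b = 0 then u
     else primitive (map2 (\<lambda>x y. dot b b * x - dot u b * y) u b))"

text \<open>Modified Gram-Schmidt: the inner products refer to the already reduced vector, so that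
  it may be made primitive between two reductions.\<close>

definition project :: "int list list \<Rightarrow> int list \<Rightarrow> int list" where
  "project B u = foldl reduce u B"

definition gram :: "int list list \<Rightarrow> int list list" where
  "gram A = foldl (\<lambda>B a. B @ [project B a]) [] A"

lemma ptime_dot [pt]: "ptime D f \<Longrightarrow> ptime D g \<Longrightarrow> ptime D (\<lambda>a. dot (f a) (g a) :: int)"
  unfolding dot_def case_prod_unfold by (intro pt)

lemma ptime_primitive [pt]: "ptime D f \<Longrightarrow> ptime D (\<lambda>a. primitive (f a))"
  by (rule ptime_comp1[of primitive]) (auto simp: primitive_def[abs_def] intro!: pt)

lemma ptime_reduce [pt]: "ptime D f \<Longrightarrow> ptime D g \<Longrightarrow> ptime D (\<lambda>a. reduce (f a) (g a))"
  by (rule ptime_comp2[of reduce]) (auto simp: reduce_def[abs_def] case_prod_unfold intro!: pt)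

lemma length_primitive [simp]: "length (primitive u) = length u"
  by (simp add: primitive_def)

lemma project_simps [simp]: "project [] u = u" "project (B @ [b]) u = reduce (project B u) b"
  by (simp_all add: project_def)

lemma gram_simps [simp]: "gram [] = []" "gram (A @ [a]) = gram A @ [project (gram A) a]"
  by (simp_all add: gram_def)

lemma length_gram [simp]: "length (gram A) = length A"
  by (induction A rule: rev_induct) auto

text \<open>Every intermediate result is the final result for a prefix of the matrix. One bound for
  complete projections thus covers all accumulators.\<close>

lemma take_gram: "take i (gram A) = gram (take i A)"
proof (induction A rule: rev_induct)
  case (snoc a A)
  show ?case using snoc by (cases "i \<le> length A") auto
qed simp

lemma gram_nth: "i < length A \<Longrightarrow> gram A ! i = project (gram (take i A)) (A ! i)"
  using take_gram[of "Suc i" A] take_gram[of i A]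
  by (simp add: take_Suc_conv_app_nth)

lemma dot_ip: "length u = n \<Longrightarrow> length v = n \<Longrightarrow> dot u v = ip n (nth u) (nth v)"
  by (simp add: dot_def ip_def sum_list_sum_nth lessThan_atLeast0)

lemma icontent_primitive: "icontent u \<noteq> 0 \<Longrightarrow> icontent (primitive u) = 1"
proof -
  assume ne: "icontent u \<noteq> 0"
  have "icontent (primitive u) * icontent u dvd icontent u"
    unfolding dvd_icontent_iff
  proof
    fix x assume x: "x \<in> set u"
    hence "icontent (primitive u) dvd x div icontent u"
      using dvd_icontent_iff[of "icontent (primitive u)" "primitive u"] by (auto simp: primitive_def)
    moreover have "icontent u dvd x" using x dvd_icontent_iff[of "icontent u" u] by auto
    ultimately show "icontent (primitive u) * icontent u dvd x" using ne by (simp add: dvd_div_iff_mult)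
  qed
  hence "icontent (primitive u) dvd 1" using ne by simp
  thus ?thesis using icontent_nonneg[of "primitive u"] zdvd1_eq by auto
qed

lemma primitive_mult: "i < length u \<Longrightarrow> u ! i = icontent u * primitive u ! i"
  using dvd_icontent_iff[of "icontent u" u] by (auto simp: primitive_def)

text \<open>A positive multiple of the orthogonal projection of \<open>y\<close>. The factor is real
  and unspecified; the cone solver depends on signs and directions, which a positive factor
  preserves.\<close>

definition proj_mult :: "nat \<Rightarrow> (nat \<Rightarrow> int) set \<Rightarrow> (nat \<Rightarrow> int) \<Rightarrow> int list \<Rightarrow> bool" where
  "proj_mult n R y u \<longleftrightarrow> length u = n \<and> ri (nth u) \<in> kern n R \<and>
     (\<exists>c>0. \<forall>x\<in>kern n R. ip n (ri (nth u)) x = c * ip n (ri y) x)"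

lemma proj_mult_primitive: "proj_mult n R y u \<Longrightarrow> proj_mult n R y (primitive u)"
proof -
  assume *: "proj_mult n R y u"
  then obtain c where u: "length u = n" "ri (nth u) \<in> kern n R" and c: "c > 0"
     "\<And>x. x\<in>kern n R \<Longrightarrow> ip n (ri (nth u)) x = c * ip n (ri y) x" by (auto simp: proj_mult_def)
  show ?thesis
  proof (cases "icontent u = 0")
    case True
    hence "primitive u = u" unfolding primitive_def
      by (intro map_idI) (metis True div_by_0 icontent_eq_0_iff)
    thus ?thesis using * by simp
  next
    case False
    hence pos: "icontent u > 0" using icontent_nonneg[of u] by simp
    have eq: "ri (nth (primitive u)) i = (1 / real_of_int (icontent u)) * ri (nth u) i" if "i < n" for i
      using primitive_mult[of i u] that u pos by (simp add: field_simps)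
    have "ri (nth (primitive u)) \<in> kern n R"
      by (rule kern_cong[THEN iffD2, OF _ kern_scale[OF u(2)]]) (rule eq)
    moreover have "ip n (ri (nth (primitive u))) x = (c / real_of_int (icontent u)) * ip n (ri y) x"
      if "x \<in> kern n R" for x
    proof -
      have "ip n (ri (nth (primitive u))) x = ip n (\<lambda>i. (1 / real_of_int (icontent u)) * ri (nth u) i) x"
        by (rule ip_cong[OF eq refl])
      thus ?thesis using c(2)[OF that] unfolding ip_scale by simp
    qed
    ultimately show ?thesis using u c pos unfolding proj_mult_def
      by (intro conjI exI[of _ "c / real_of_int (icontent u)"]) auto
  qed
qed

text \<open>On \<open>kern n R\<close> the row \<open>a\<close> and its projected multiple
  \<open>b\<close> have proportional inner products, so imposing \<open>a\<close> amounts to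
  imposing orthogonality to \<open>b\<close>. If \<open>b = 0\<close>, then \<open>a\<close> already
  vanishes there and \<open>u\<close> remains.\<close>

lemma proj_mult_reduce:
  assumes b: "proj_mult n R a b" and u: "proj_mult n R y u"
  shows "proj_mult n (insert a R) y (reduce u b)"
proof -
  obtain ca where lb: "length b = n" and bk: "ri (nth b) \<in> kern n R" and ca: "ca > 0"
     "\<And>x. x\<in>kern n R \<Longrightarrow> ip n (ri (nth b)) x = ca * ip n (ri a) x" using b by (auto simp: proj_mult_def)
  obtain c where lu: "length u = n" and uk: "ri (nth u) \<in> kern n R" and c: "c > 0"
     "\<And>x. x\<in>kern n R \<Longrightarrow> ip n (ri (nth u)) x = c * ip n (ri y) x" using u by (auto simp: proj_mult_def)
  have k: "x \<in> kern n (insert a R) \<longleftrightarrow> x \<in> kern n R \<and> ip n (ri (nth b)) x = 0" for x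
    using ca by (auto simp: kern_def)
  show ?thesis
  proof (cases "dot b b = 0")
    case True
    hence "ip n (ri (nth b)) (ri (nth b)) = 0" by (simp add: dot_ip[OF lb lb] ip_of_int)
    hence "b ! i = 0" if "i < n" for i using ip_self_eq_0[OF _ that, of "ri (nth b)"] by simp
    hence "ip n (ri (nth b)) x = 0" for x by (simp add: ip_def)
    hence "kern n (insert a R) = kern n R" using k by blast
    thus ?thesis using u True by (simp add: reduce_def proj_mult_def)
  next
    case False
    define s t where "s = dot b b" and "t = dot u b"
    define v where "v = map2 (\<lambda>x y. s * x - t * y) u b"
    have lv: "length v = n" by (simp add: v_def lu lb)
    have vi: "ri (nth v) i = real_of_int s * ri (nth u) i - real_of_int t * ri (nth b) i" if "i < n" for i
      using that lu lb by (simp add: v_def)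
    have ipv: "ip n (ri (nth v)) x = real_of_int s * ip n (ri (nth u)) x - real_of_int t * ip n (ri (nth b)) x" for x
    proof -
      have "ip n (ri (nth v)) x = ip n (\<lambda>i. real_of_int s * ri (nth u) i - real_of_int t * ri (nth b) i) x"
        by (rule ip_cong[OF vi refl])
      thus ?thesis unfolding ip_diff ip_scale .
    qed
    have s: "real_of_int s = ip n (ri (nth b)) (ri (nth b))" "real_of_int t = ip n (ri (nth u)) (ri (nth b))"
      unfolding s_def t_def dot_ip[OF lb lb] dot_ip[OF lu lb] ip_of_int by simp_all
    have spos: "s > 0" using False ip_self_nonneg[of n "ri (nth b)"] s(1)[symmetric] by (simp add: s_def)
    have "ri (nth v) \<in> kern n R"
      by (rule kern_cong[THEN iffD2, OF _ kern_diff[OF kern_scale[OF uk] kern_scale[OF bk]]]) (rule vi)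
    moreover have "ip n (ri (nth b)) (ri (nth v)) = 0"
      by (subst ip_commute) (simp add: ipv s mult.commute)
    ultimately have vk: "ri (nth v) \<in> kern n (insert a R)" by (simp add: k)
    have "proj_mult n (insert a R) y v"
      unfolding proj_mult_def using lv vk c spos
      by (intro conjI exI[of _ "real_of_int s * c"]) (auto simp: ipv k)
    from proj_mult_primitive[OF this] show ?thesis using False by (simp add: reduce_def v_def s_def t_def)
  qed
qed

lemma proj_mult_gram:
  assumes "\<And>a. a \<in> set A \<Longrightarrow> length a = n" "length u = n"
  shows "proj_mult n (nth ` set A) (nth u) (project (gram A) u)"
  using assms
proof (induction A arbitrary: u rule: rev_induct)
  case Nil
  thus ?case by (auto simp: proj_mult_def kern_def intro: exI[of _ 1])
next
  case (snoc a A)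
  have "proj_mult n (insert (nth a) (nth ` set A)) (nth u) (reduce (project (gram A) u) (project (gram A) a))"
    by (rule proj_mult_reduce; rule snoc.IH) (use snoc.prems in auto)
  thus ?case by simp
qed

text \<open>Either no reduction has taken place and \<open>u\<close> is still the input, or the last
  one made it primitive. Content 0 belongs to the zero vector.\<close>

lemma project_primitive: "project B u = u \<or> icontent (project B u) \<in> {0, 1}"
proof (induction B rule: rev_induct)
  case (snoc b B)
  have "icontent (primitive v) \<in> {0, 1}" for v
    using icontent_primitive[of v] icontent_eq_0_iff[of v] by (cases "icontent v = 0") (auto simp: primitive_def icontent_eq_0_iff)
  thus ?case using snoc by (auto simp: reduce_def)
qed simp

lemma height_bound_ge: "B \<ge> 1 \<Longrightarrow> B \<le> height_bound m n B"
proof -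
  assume B: "B \<ge> 1"
  have "1 * B * 1 \<le> (int m + 1) * B * (2 * (int m + 1) * (int n * B\<^sup>2) + 1) ^ m"
    using B by (intro mult_mono one_le_power) auto
  thus ?thesis by (simp add: height_bound_def)
qed

lemma height_bound_mono: "B \<ge> 1 \<Longrightarrow> m \<le> m' \<Longrightarrow> n \<le> n' \<Longrightarrow> B \<le> B' \<Longrightarrow> height_bound m n B \<le> height_bound m' n' B'"
  unfolding height_bound_def
  by (intro mult_mono add_mono order_trans[OF power_mono power_increasing] power_mono) auto

text \<open>Both \<open>u\<close> and the short vector \<open>p\<close> of
  \<open>projection_bound\<close> are positive multiples of the projection:
  \<open>c p - \<tau> u\<close> lies in the kernel and is orthogonal to itself. A primitive vector
  divides any integer vector on its line, so \<open>u\<close> is entrywise no larger than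
  \<open>p\<close>.\<close>

lemma proj_mult_bound:
  assumes fin: "finite R" and m: "card R \<le> m"
    and RB: "\<And>a i. a \<in> R \<Longrightarrow> i < n \<Longrightarrow> \<bar>a i\<bar> \<le> B" and yB: "\<And>i. i < n \<Longrightarrow> \<bar>y i\<bar> \<le> B" and B: "B \<ge> 1"
    and u: "proj_mult n R y u" "icontent u \<in> {0, 1}" and i: "i < n"
  shows "\<bar>u ! i\<bar> \<le> height_bound m n B"
proof -
  obtain \<tau> p where p: "\<tau> > 0" "\<And>i. i < n \<Longrightarrow> \<bar>p i\<bar> \<le> height_bound m n B" "ri p \<in> kern n R"
     "\<And>x. x \<in> kern n R \<Longrightarrow> ip n (ri p) x = real_of_int \<tau> * ip n (ri y) x"
  proof (rule projection_bound[of R m n B y])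
    show "finite R" "card R \<le> m" "B \<ge> 1" by fact+
    show "\<bar>a i\<bar> \<le> B" if "a \<in> R" "i < n" for a i using RB that .
    show "\<bar>y i\<bar> \<le> B" if "i < n" for i using yB that .
  qed blast
  obtain c where lu: "length u = n" and uk: "ri (nth u) \<in> kern n R" and c: "c > 0"
     "\<And>x. x\<in>kern n R \<Longrightarrow> ip n (ri (nth u)) x = c * ip n (ri y) x" using u by (auto simp: proj_mult_def)
  define w where "w i = c * ri p i - real_of_int \<tau> * ri (nth u) i" for i
  have wk: "w \<in> kern n R" unfolding w_def by (intro kern_diff kern_scale p uk)
  have "ip n w x = c * ip n (ri p) x - real_of_int \<tau> * ip n (ri (nth u)) x" for x
    unfolding w_def ip_diff ip_scale ..
  hence "ip n w w = 0" using p(4)[OF wk] c(2)[OF wk] by simp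
  hence eq: "c * p j = real_of_int \<tau> * u ! j" if "j < n" for j
    using ip_self_eq_0[OF _ that, of w] by (simp add: w_def)
  have H0: "height_bound m n B \<ge> 0" using height_bound_ge[OF B, of m n] B by linarith
  show ?thesis
  proof (cases "u ! i = 0")
    case False
    have cu: "icontent u = 1"
    proof -
      have "icontent u \<noteq> 0" using False i lu by (auto simp: icontent_eq_0_iff)
      thus ?thesis using u(2) by simp
    qed
    have cross: "p j * u ! i = u ! j * p i" if "j < n" for j
    proof -
      have "(c * p j) * (real_of_int \<tau> * u ! i) = (real_of_int \<tau> * u ! j) * (c * p i)"
        by (simp only: eq[OF that] eq[OF i])
      hence "c * real_of_int \<tau> * (p j * u ! i) = c * real_of_int \<tau> * (u ! j * p i)"
        by (simp add: mult_ac)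
      hence "real_of_int (p j * u ! i) = real_of_int (u ! j * p i)" using c p(1) by simp
      thus ?thesis by linarith
    qed
    \<comment> \<open>Proportionality reads \<open>p_i u_j = p_j u_i\<close>, so \<open>u_i\<close>
      divides \<open>p_i u_j\<close> for every \<open>j\<close>, and with content 1 it divides
      \<open>p_i\<close>.\<close>
    have "u ! i dvd p i * icontent u"
    proof (rule dvd_mult_icontent)
      fix x assume "x \<in> set u"
      then obtain j where j: "j < n" "x = u ! j" using lu by (auto simp: in_set_conv_nth)
      have "p i * x = p j * u ! i" using cross[OF j(1)] j(2) by (simp add: mult.commute)
      thus "u ! i dvd p i * x" by simp
    qed
    hence "u ! i dvd p i" using cu by simp
    moreover have "p i \<noteq> 0" using eq[OF i] False p(1) by auto
    ultimately have "\<bar>u ! i\<bar> \<le> \<bar>p i\<bar>" by (rule dvd_imp_le_int[rotated])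
    thus ?thesis using p(2)[OF i] by simp
  qed (use H0 in simp)
qed

lemma abs_le_enc: "x \<in> set u \<Longrightarrow> \<bar>x\<bar> \<le> 2 ^ bits (enc (u :: int list))"
proof -
  assume "x \<in> set u"
  hence "bits (Num x) \<le> bits (enc u)" using bits_in_set[of x u] by (simp add: enc_int_def)
  hence "\<bar>x\<bar> < 2 ^ (bits (enc u))" unfolding bits_Num_le_iff[symmetric] by simp
  thus ?thesis by simp
qed

text \<open>A single size \<open>s\<close> bounds the number of rows and the dimension, and
  \<open>2 ^ s\<close> bounds the entries. An unreduced input is bounded directly, a primitive
  vector by \<open>proj_mult_bound\<close>.\<close>

lemma project_gram_bound:
  assumes A: "\<And>a. a \<in> set A \<Longrightarrow> length a = n" and u: "length u = n"
    and s: "bits (enc A) \<le> s" "bits (enc u) \<le> s" and x: "x \<in> set (project (gram A) u)"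
  shows "\<bar>x\<bar> \<le> height_bound s s (2 ^ s)"
proof -
  have p2: "(1::int) \<le> 2 ^ s" by simp
  have uB: "\<bar>x\<bar> \<le> 2 ^ s" if "x \<in> set u" for x
  proof -
    have "(2::int) ^ bits (enc u) \<le> 2 ^ s" using s(2) by (intro power_increasing) auto
    thus ?thesis using abs_le_enc[OF that] by linarith
  qed
  have AB: "\<bar>x\<bar> \<le> 2 ^ s" if "a \<in> set A" "x \<in> set a" for a x
  proof -
    have "(2::int) ^ bits (enc a) \<le> 2 ^ s" using bits_in_set[OF that(1)] s(1) by (intro power_increasing) auto
    thus ?thesis using abs_le_enc[OF that(2)] by linarith
  qed
  have ns: "n \<le> s" using length_le_bits[of u] u s(2) by simp
  have ms: "card (nth ` set A) \<le> s"
  proof -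
    have "card (nth ` set A) \<le> card (set A)" by (rule card_image_le) simp
    thus ?thesis using card_length[of A] length_le_bits[of A] s(1) by linarith
  qed
  from project_primitive[of "gram A" u] show ?thesis
  proof
    assume "project (gram A) u = u"
    hence "\<bar>x\<bar> \<le> 2 ^ s" using uB x by simp
    thus ?thesis using height_bound_ge[OF p2, of s s] by linarith
  next
    assume c: "icontent (project (gram A) u) \<in> {0, 1}"
    have pm: "proj_mult n (nth ` set A) (nth u) (project (gram A) u)" by (rule proj_mult_gram[OF A u])
    obtain i where i: "i < n" "x = project (gram A) u ! i"
      using x pm by (auto simp: proj_mult_def in_set_conv_nth)
    have "\<bar>project (gram A) u ! i\<bar> \<le> height_bound s n (2 ^ s)"
    proof (rule proj_mult_bound[OF _ ms _ _ p2 pm c i(1)])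
      fix a j assume a: "a \<in> nth ` set A" and j: "j < n"
      then obtain b where b: "b \<in> set A" "a = nth b" by blast
      thus "\<bar>a j\<bar> \<le> 2 ^ s" using AB[OF b(1)] A[OF b(1)] j by simp
    next
      fix j assume "j < n"
      thus "\<bar>u ! j\<bar> \<le> 2 ^ s" using uB u by simp
    qed simp
    also have "\<dots> \<le> height_bound s s (2 ^ s)" using ns by (intro height_bound_mono) auto
    finally show ?thesis using i by simp
  qed
qed

lemma bits_Num_power: "bits (Num (i ^ k)) \<le> 2 + k * bits (Num i)"
proof (induction k)
  case (Suc k)
  thus ?case using bits_Num_mult[of i "i ^ k"] by simp
qed simp

text \<open>The height is exponential in \<open>s\<close>, but its bit size is quadratic: the
  exponent \<open>s\<close> multiplies the bit size of the base, which is linear in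
  \<open>s\<close>. The summands are those of the rules for products and powers.\<close>

lemma bits_height_bound:
  "bits (Num (height_bound s s (2 ^ s))) \<le> (s + 4) + (4 + 4 * s) + (2 + s * (4 + (s + 4) + (s + 4) + (2 + 2 * (4 + 4 * s)) + 4))"
proof -
  have n: "bits (Num (int k)) \<le> k + 1" for k using bits_of_nat[of k] by simp
  have two: "bits (Num (2 ^ s)) \<le> 4 + 4 * s"
  proof -
    have "s * bits (Num 2) \<le> s * 3" using n[of 2] by (intro mult_left_mono) auto
    thus ?thesis using bits_Num_power[of 2 s] by linarith
  qed
  have m1: "bits (Num (int s + 1)) \<le> s + 4" using n[of "s + 1"] by (simp add: add.commute)
  have sq: "bits (Num ((2 ^ s)\<^sup>2)) \<le> 2 + 2 * (4 + 4 * s)"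
    by (rule order_trans[OF bits_Num_power add_left_mono[OF mult_left_mono[OF two]]]) simp
  have "bits (Num (2 * (int s + 1) * (int s * (2 ^ s)\<^sup>2) + 1)) \<le> 4 + (s + 4) + (s + 4) + (2 + 2 * (4 + 4 * s)) + 4"
    using bits_Num_add[of "2 * (int s + 1) * (int s * (2 ^ s)\<^sup>2)" 1]
      bits_Num_mult[of "2 * (int s + 1)" "int s * (2 ^ s)\<^sup>2"] bits_Num_mult[of 2 "int s + 1"]
      bits_Num_mult[of "int s" "(2 ^ s)\<^sup>2"] n[of 1] n[of 2] n[of s] m1 sq
    unfolding of_nat_numeral of_nat_1 by linarith
  hence "s * bits (Num (2 * (int s + 1) * (int s * (2 ^ s)\<^sup>2) + 1)) \<le> s * (4 + (s + 4) + (s + 4) + (2 + 2 * (4 + 4 * s)) + 4)"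
    by (rule mult_left_mono) simp
  thus ?thesis unfolding height_bound_def
    using bits_Num_mult[of "(int s + 1) * 2 ^ s" "(2 * (int s + 1) * (int s * (2 ^ s)\<^sup>2) + 1) ^ s"]
      bits_Num_mult[of "int s + 1" "2 ^ s"] m1 two
      bits_Num_power[of "2 * (int s + 1) * (int s * (2 ^ s)\<^sup>2) + 1" s] by linarith
qed

lemma psize_height_bound: "psize D f \<Longrightarrow> psize D (\<lambda>a. bits (Num (height_bound (f a) (f a) (2 ^ f a))))"
  by (rule psize_mono[OF _ bits_height_bound]) (intro ps)

definition same_lengths :: "int list list \<Rightarrow> nat \<Rightarrow> bool" where
  "same_lengths A n \<longleftrightarrow> (\<forall>a\<in>set A. length a = n)"

text \<open>The original matrix is carried in the argument as a reference for sizes: the vectors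
  arising from \<open>gram (take j A)\<close> are bounded in terms of \<open>A\<close>, not of the
  orthogonalized rows.\<close>

lemma ptime_project_aux:
  "ptime {z. same_lengths (fst z) (length (snd (snd z))) \<and> (\<exists>j\<le>length (fst z). fst (snd z) = gram (take j (fst z)))}
     (\<lambda>z. project (fst (snd z)) (snd (snd z)))" (is "ptime ?D _")
  unfolding project_def
proof (rule ptime_foldl)
  define S where "S z = bits (enc z)" for z :: "int list list \<times> int list list \<times> int list"
  define H where "H z = bits (Num (height_bound (S z) (S z) (2 ^ S z)))" for z
  have S: "psize ?D S" unfolding S_def by (intro ps)
  hence "psize ?D H" unfolding H_def by (rule psize_height_bound)
  with S show "psize ?D (\<lambda>z. 1 + S z * Suc (H z))" by (intro ps)
  fix z i assume z: "z \<in> ?D" and i: "i \<le> length (fst (snd z))"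
  obtain A B u where z': "z = (A, B, u)" by (cases z)
  obtain j where j: "B = gram (take j A)" "same_lengths A (length u)" using z z' by auto
  let ?A = "take (min i j) A"
  have B: "take i B = gram ?A" by (simp add: j take_gram)
  have A: "length a = length u" if "a \<in> set A" for a using j(2) that by (auto simp: same_lengths_def)
  have A': "length a = length u" if "a \<in> set ?A" for a using A that by (auto dest: in_set_takeD)
  have s: "bits (enc ?A) \<le> S z" "bits (enc u) \<le> S z"
    using bits_take[of "min i j" A] by (auto simp: S_def z')
  have "bits (enc (project (gram ?A) u)) \<le> 1 + length (project (gram ?A) u) * Suc (H z)"
  proof (rule bits_list_le)
    fix x assume x: "x \<in> set (project (gram ?A) u)"
    have "\<bar>x\<bar> \<le> height_bound (S z) (S z) (2 ^ S z)"
      by (rule project_gram_bound[OF A' refl s x])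
    thus "bits (enc x) \<le> H z" unfolding H_def enc_int_def by (intro bits_Num_mono) simp
  qed
  also have "length (project (gram ?A) u) = length u"
    using proj_mult_gram[OF A' refl] by (simp add: proj_mult_def)
  also have "1 + length u * Suc (H z) \<le> 1 + S z * Suc (H z)"
    using length_le_bits[of u] s(2) by (intro add_mono mult_right_mono) auto
  finally show "bits (enc (foldl reduce (snd (snd z)) (take i (fst (snd z))))) \<le> 1 + S z * Suc (H z)"
    unfolding project_def[symmetric] by (simp add: z' B)
qed (auto intro!: pt)

lemma ptime_gram: "ptime {A. \<exists>n. same_lengths A n} gram"
  unfolding gram_def[abs_def]
proof (rule ptime_foldl)
  let ?E = "{z. same_lengths (fst z) (length (snd (snd z))) \<and> (\<exists>j\<le>length (fst z). fst (snd z) = gram (take j (fst z)))}"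
  show "ptime ?E (\<lambda>z. fst (snd z) @ [project (fst (snd z)) (snd (snd z))])"
    by (intro pt ptime_project_aux)
  define S where "S A = bits (enc A)" for A :: "int list list"
  define H where "H z = bits (Num (height_bound (S z) (S z) (2 ^ S z)))" for z
  have S: "psize {A. \<exists>n. same_lengths A n} S" unfolding S_def by (intro ps)
  hence H: "psize {A. \<exists>n. same_lengths A n} H" unfolding H_def by (rule psize_height_bound)
  show "psize {A. \<exists>n. same_lengths A n} (\<lambda>A. 1 + S A * Suc (1 + S A * Suc (H A)))" by (intro ps S H)
  fix A :: "int list list" and i
  assume "A \<in> {A. \<exists>n. same_lengths A n}"
  then obtain n where A: "\<And>a. a \<in> set A \<Longrightarrow> length a = n" by (auto simp: same_lengths_def)
  have gr: "foldl (\<lambda>B a. B @ [project B a]) [] (take i A) = gram (take i A)" by (simp add: gram_def)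
  show "(A, foldl (\<lambda>B a. B @ [project B a]) [] (take i A), A ! i) \<in> ?E" if "i < length A"
    using that A unfolding gr by (auto simp: same_lengths_def intro: exI[of _ i])
  assume i: "i \<le> length A"
  have "bits (enc (gram (take i A))) \<le> 1 + length (gram (take i A)) * Suc (1 + S A * Suc (H A))"
  proof (rule bits_list_le)
    fix v assume "v \<in> set (gram (take i A))"
    then obtain j where j: "j < length A" "v = gram (take i A) ! j" "j < length (take i A)"
      by (auto simp: in_set_conv_nth)
    hence v: "v = project (gram (take j A)) (A ! j)" using gram_nth[OF j(3)] by simp
    have A': "length a = n" if "a \<in> set (take j A)" for a using A that by (auto dest: in_set_takeD)
    have s: "bits (enc (take j A)) \<le> S A" "bits (enc (A ! j)) \<le> S A"
      using bits_take[of j A] bits_in_set[of "A ! j" A] j by (auto simp: S_def)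
    have ln: "length (A ! j) = n" using A j by simp
    have "bits (enc v) \<le> 1 + length v * Suc (H A)"
    proof (rule bits_list_le)
      fix x assume "x \<in> set v"
      hence "\<bar>x\<bar> \<le> height_bound (S A) (S A) (2 ^ S A)"
        using project_gram_bound[OF A' ln s] v by blast
      thus "bits (enc x) \<le> H A" unfolding H_def enc_int_def by (intro bits_Num_mono) simp
    qed
    also have "length v = length (A ! j)"
      using proj_mult_gram[OF A' ln] ln v by (simp add: proj_mult_def)
    also have "1 + length (A ! j) * Suc (H A) \<le> 1 + S A * Suc (H A)"
      using length_le_bits[of "A ! j"] s(2) by (intro add_mono mult_right_mono) auto
    finally show "bits (enc v) \<le> 1 + S A * Suc (H A)" .
  qed
  also have "\<dots> \<le> 1 + S A * Suc (1 + S A * Suc (H A))"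
    using length_le_bits[of A] by (intro add_mono mult_right_mono) (auto simp: S_def)
  finally show "bits (enc (foldl (\<lambda>B a. B @ [project B a]) [] (take i A))) \<le> 1 + S A * Suc (1 + S A * Suc (H A))"
    unfolding gr .
qed (auto intro!: pt)

lemma ptime_project:
  assumes f: "ptime D f" and g: "ptime D g" and len: "\<And>a. a \<in> D \<Longrightarrow> same_lengths (f a) (length (g a))"
  shows "ptime D (\<lambda>a. project (gram (f a)) (g a))"
proof -
  have "ptime D (\<lambda>a. gram (f a))" by (rule ptime_comp[OF ptime_gram f]) (use len in blast)
  hence "ptime D (\<lambda>a. (f a, gram (f a), g a))" by (intro pt f g)
  from ptime_comp[OF ptime_project_aux this] show ?thesis using len by fastforce
qed


section \<open>Nonnegative kernel vectors of maximal support\<close>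

definition run_until :: "('a \<Rightarrow> bool) \<Rightarrow> ('a \<Rightarrow> 'a) \<Rightarrow> 'a \<Rightarrow> 'a" where
  "run_until c f s = (f ^^ (LEAST k. \<not> c ((f ^^ k) s))) s"

lemma run_until_steps:
  fixes m :: "'a \<Rightarrow> nat"
  assumes step: "\<And>s. P s \<Longrightarrow> c s \<Longrightarrow> P (f s) \<and> m (f s) < m s" and "P s"
  shows "\<exists>k\<le>m s. (\<forall>i\<le>k. P ((f ^^ i) s)) \<and> (\<forall>i<k. c ((f ^^ i) s)) \<and> \<not> c ((f ^^ k) s) \<and>
    run_until c f s = (f ^^ k) s"
proof -
  have "\<exists>k\<le>m s. (\<forall>i\<le>k. P ((f ^^ i) s)) \<and> (\<forall>i<k. c ((f ^^ i) s)) \<and> \<not> c ((f ^^ k) s)"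
    using assms(2)
  proof (induction "m s" arbitrary: s rule: less_induct)
    case less
    show ?case
    proof (cases "c s")
      case False
      thus ?thesis using less.prems by (intro exI[of _ 0]) auto
    next
      case True
      note st = step[OF less.prems True]
      from less.hyps[OF conjunct2[OF st] conjunct1[OF st]] obtain k where k: "k \<le> m (f s)"
        "\<And>i. i \<le> k \<Longrightarrow> P ((f ^^ i) (f s))" "\<And>i. i < k \<Longrightarrow> c ((f ^^ i) (f s))" "\<not> c ((f ^^ k) (f s))" by blast
      have shift: "(f ^^ Suc i) s = (f ^^ i) (f s)" for i by (simp add: funpow_swap1)
      show ?thesis
      proof (intro exI[of _ "Suc k"] conjI allI impI)
        show "Suc k \<le> m s" using k(1) st by simp
        show "\<not> c ((f ^^ Suc k) s)" using k(4) unfolding shift .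
        show "P ((f ^^ i) s)" if "i \<le> Suc k" for i
          using that k(2)[of "i - 1"] less.prems shift[of "i - 1"] by (cases i) auto
        show "c ((f ^^ i) s)" if "i < Suc k" for i
          using that k(3)[of "i - 1"] True shift[of "i - 1"] by (cases i) auto
      qed
    qed
  qed
  then obtain k where k: "k \<le> m s" "\<forall>i\<le>k. P ((f ^^ i) s)" "\<forall>i<k. c ((f ^^ i) s)" "\<not> c ((f ^^ k) s)" by blast
  have "(LEAST k. \<not> c ((f ^^ k) s)) = k"
    using k by (intro Least_equality) (auto simp: not_less[symmetric])
  thus ?thesis using k by (intro exI[of _ k]) (auto simp: run_until_def)
qed

text \<open>The invariant \<open>P a s\<close> also mentions the initial state, so it can bound the
  size of \<open>s\<close> in terms of the input. A numerical measure replaces an explicit count of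
  rounds.\<close>

lemma ptime_run_until:
  fixes f :: "'a::enc \<Rightarrow> 'a"
  assumes c: "ptime E c" and f: "ptime E f" and m: "psize D m" and S: "psize D S"
    and step: "\<And>a s. a \<in> D \<Longrightarrow> P a s \<Longrightarrow> c s \<Longrightarrow> P a (f s) \<and> m (f s) < m s"
    and init: "\<And>a. a \<in> D \<Longrightarrow> P a a"
    and dom: "\<And>a s. a \<in> D \<Longrightarrow> P a s \<Longrightarrow> s \<in> E \<and> bits (enc s) \<le> S a"
  shows "ptime D (run_until c f)"
proof (rule ptime_while[OF c f m S])
  fix a assume a: "a \<in> D"
  from run_until_steps[of "P a" c f m a, OF step[OF a] init[OF a]] obtain k where k: "k \<le> m a"
    "\<forall>i\<le>k. P a ((f ^^ i) a)" "\<forall>i<k. c ((f ^^ i) a)" "\<not> c ((f ^^ k) a)" "run_until c f a = (f ^^ k) a" by blast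
  thus "\<exists>k\<le>m a. (\<forall>i\<le>k. (f ^^ i) a \<in> E \<and> bits (enc ((f ^^ i) a)) \<le> S a) \<and>
      (\<forall>i<k. c ((f ^^ i) a)) \<and> \<not> c ((f ^^ k) a) \<and> run_until c f a = (f ^^ k) a"
    using dom[OF a] by blast
qed

text \<open>The weights of the cone solver start at a power of two: halving with \<open>div\<close>
  is then exact down to 1, and one more halving gives 0.\<close>

definition pow2_above :: "int \<Rightarrow> int" where
  "pow2_above z = 2 ^ (LEAST i. z \<le> 2 ^ i)"

lemma le_power_bits: "z \<le> 2 ^ bits (Num z)"
proof -
  have "(2::int) ^ (bits (Num z) - 1) \<le> 2 ^ bits (Num z)" by (intro power_increasing) auto
  thus ?thesis using abs_less_bits[of z] by linarith
qed

lemma pow2_above: "z \<le> pow2_above z" "\<exists>e. pow2_above z = 2 ^ e"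
proof -
  have "z \<le> 2 ^ bits (Num z)" by (rule le_power_bits)
  thus "z \<le> pow2_above z" unfolding pow2_above_def by (rule LeastI)
qed (auto simp: pow2_above_def)

lemma ptime_pow2_above [pt]: "ptime D f \<Longrightarrow> ptime D (\<lambda>a. pow2_above (f a))"
proof -
  assume f: "ptime D f"
  define g where "g = (\<lambda>s::int \<times> int. (2 * fst s, snd s))"
  have gi: "(g ^^ i) (1, z) = (2 ^ i, z)" for i z by (induction i) (auto simp: g_def)
  have "ptime {s :: int \<times> int. fst s = 1} (\<lambda>s. (pow2_above (snd s), snd s))"
  proof (rule ptime_while[where c = "\<lambda>s. fst s < snd s" and f = g and E = UNIV])
    show "ptime UNIV (\<lambda>s::int \<times> int. fst s < snd s)" "ptime UNIV g" unfolding g_def by (intro pt)+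
    show "psize {s::int \<times> int. fst s = 1} (\<lambda>s. bits (enc s))"
      "psize {s::int \<times> int. fst s = 1} (\<lambda>s. 1 + (4 + bits (enc s)) + bits (enc s))" by (intro ps)+
    fix s :: "int \<times> int" assume "s \<in> {s. fst s = 1}"
    then obtain z where s: "s = (1, z)" by (cases s) auto
    define k where "k = (LEAST i. z \<le> (2::int) ^ i)"
    have kb: "k \<le> bits (Num z)" unfolding k_def
      by (intro Least_le le_power_bits)
    have sz: "bits (Num (2 ^ i)) \<le> 4 + bits (Num z)" if "i \<le> k" for i
    proof -
      have "\<bar>2 ^ i\<bar> < (2::int) ^ Suc i" by simp
      hence "bits (Num (2 ^ i)) \<le> Suc (Suc i)" by (simp only: bits_Num_le_iff)
      thus ?thesis using that kb by simp
    qed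
    show "\<exists>k\<le>bits (enc s). (\<forall>i\<le>k. (g ^^ i) s \<in> UNIV \<and> bits (enc ((g ^^ i) s)) \<le> 1 + (4 + bits (enc s)) + bits (enc s)) \<and>
        (\<forall>i<k. fst ((g ^^ i) s) < snd ((g ^^ i) s)) \<and> \<not> fst ((g ^^ k) s) < snd ((g ^^ k) s) \<and>
        (pow2_above (snd s), snd s) = (g ^^ k) s"
    proof (intro exI[of _ k] conjI allI impI)
      show "k \<le> bits (enc s)" using kb s by (simp add: enc_int_def)
      show "bits (enc ((g ^^ i) s)) \<le> 1 + (4 + bits (enc s)) + bits (enc s)" if "i \<le> k" for i
        using sz[OF that] by (simp add: s gi enc_int_def)
      show "fst ((g ^^ i) s) < snd ((g ^^ i) s)" if "i < k" for i
        using not_less_Least[of i "\<lambda>i. z \<le> 2 ^ i"] that by (simp add: s gi k_def)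
      show "\<not> fst ((g ^^ k) s) < snd ((g ^^ k) s)"
        using pow2_above(1)[of z] by (simp add: s gi k_def pow2_above_def)
      show "(pow2_above (snd s), snd s) = (g ^^ k) s" by (simp add: s gi k_def pow2_above_def)
    qed simp
  qed
  moreover have "ptime D (\<lambda>a. (1 :: int, f a))" by (intro pt f)
  ultimately have "ptime D (\<lambda>a. (\<lambda>s. (pow2_above (snd s), snd s)) (1 :: int, f a))"
    by (rule ptime_comp) auto
  from ptime_fst[OF this] show ?thesis by simp
qed

text \<open>
  A state \<open>(A, w, y)\<close> stands for the problem with columns scaled by \<open>w\<close>.  Initially \<open>w\<close> is the
  constant \<open>W\<close>, a power of two exceeding the vertex bound, and every kernel vector \<open>x\<close> in the
  unit box satisfies \<open>x k * W \<le> w ! k\<close> throughout.  Thus \<open>w ! k = 0\<close> records that coordinate \<open>k\<close>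
  vanishes on the cone.
\<close>

type_synonym cone_state = "int list list \<times> int list \<times> int list"

definition scale_rows :: "int list \<Rightarrow> int list list \<Rightarrow> int list list" where
  "scale_rows w A = map (map2 (*) w) A"

definition cone_proj :: "cone_state \<Rightarrow> int list" where
  "cone_proj s = project (gram (scale_rows (fst (snd s)) (fst s))) (snd (snd s))"

text \<open>Coordinates with weight 0 are already known to vanish on the cone and are exempt. If the
  list is empty, the projection is strictly positive wherever the weight is not 0.\<close>

definition violated :: "cone_state \<Rightarrow> nat list" where
  "violated s = filter (\<lambda>i. fst (snd s) ! i \<noteq> 0 \<and> cone_proj s ! i \<le> 0) [0..<length (snd (snd s))]"

text \<open>When \<open>y k\<close> would reach \<open>4 n^2\<close>, the weight is halved instead
  and \<open>y\<close> restarts at 0, since the projection now refers to a differently scaled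
  matrix. The incremented value is not stored in this case.\<close>

definition cone_update :: "cone_state \<Rightarrow> nat \<Rightarrow> cone_state" where
  "cone_update s k =
     (if 4 * (int (length (snd (snd s))) * int (length (snd (snd s)))) \<le> snd (snd s) ! k + 1
      then (fst s, (fst (snd s))[k := fst (snd s) ! k div 2], map (\<lambda>_. 0) (snd (snd s)))
      else (fst s, fst (snd s), (snd (snd s))[k := snd (snd s) ! k + 1]))"

definition cone_step :: "cone_state \<Rightarrow> cone_state" where
  "cone_step s = (if violated s = [] then s else cone_update s (hd (violated s)))"

text \<open>A sum of absolute values, being easy to compute; the \<open>1\<close> makes it a
  legitimate \<open>B\<close> even for the zero matrix.\<close>

definition entry_bound :: "int list list \<Rightarrow> int" where
  "entry_bound A = 1 + sum_list (map (\<lambda>r. sum_list (map abs r)) A)"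

text \<open>The bound of \<open>vertex_bound\<close>. \<open>t\<close> is a template whose length is
  the number of unknowns; a list in place of a number keeps the dimension in unary.\<close>

definition vertex_height :: "int list list \<Rightarrow> int list \<Rightarrow> int" where
  "vertex_height A t = height_bound (length A + length t) (length t) (entry_bound A)"

definition cone_init :: "int list list \<Rightarrow> int list \<Rightarrow> cone_state" where
  "cone_init A t = (A, map (\<lambda>_. pow2_above (vertex_height A t)) t, map (\<lambda>_. 0) t)"

definition cone_solve :: "int list list \<Rightarrow> int list \<Rightarrow> int list" where
  "cone_solve A t =
    (let s = run_until (\<lambda>s. violated s \<noteq> []) cone_step (cone_init A t) in map2 (*) (fst (snd s)) (cone_proj s))"

definition cone_wf :: "cone_state set" where
  "cone_wf = {s. length (fst (snd s)) = length (snd (snd s)) \<and> same_lengths (fst s) (length (snd (snd s)))}"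

lemma same_lengths_scale_rows: "length w = n \<Longrightarrow> same_lengths A n \<Longrightarrow> same_lengths (scale_rows w A) n"
  by (auto simp: same_lengths_def scale_rows_def)

lemma length_cone_proj: "s \<in> cone_wf \<Longrightarrow> length (cone_proj s) = length (snd (snd s))"
  using proj_mult_gram[of "scale_rows (fst (snd s)) (fst s)" "length (snd (snd s))" "snd (snd s)"]
    same_lengths_scale_rows[of "fst (snd s)" "length (snd (snd s))" "fst s"]
  by (auto simp: cone_proj_def cone_wf_def same_lengths_def proj_mult_def)

lemma ptime_scale_rows [pt]: "ptime D f \<Longrightarrow> ptime D g \<Longrightarrow> ptime D (\<lambda>a. scale_rows (f a) (g a))"
  by (rule ptime_comp2[of scale_rows]) (auto simp: scale_rows_def[abs_def] case_prod_unfold intro!: pt)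

lemma ptime_cone_proj: "ptime cone_wf cone_proj"
  unfolding cone_proj_def[abs_def]
  by (rule ptime_project) (intro pt | auto simp: cone_wf_def same_lengths_scale_rows)+

lemma ptime_violated: "ptime cone_wf violated"
  unfolding violated_def[abs_def]
proof (rule ptime_filter)
  let ?E = "{z. fst z \<in> cone_wf \<and> snd z \<in> set [0..<length (snd (snd (fst z)))]}"
  show "ptime ?E (\<lambda>z. fst (snd (fst z)) ! snd z \<noteq> 0 \<and> cone_proj (fst z) ! snd z \<le> 0)"
    by (intro pt ptime_nth ptime_comp[OF ptime_cone_proj])
       (auto simp: length_cone_proj, auto simp: cone_wf_def)
qed (intro pt)

lemma violated_less: "k \<in> set (violated s) \<Longrightarrow> k < length (snd (snd s))"
  by (auto simp: violated_def)

lemma ptime_cone_step: "ptime cone_wf cone_step"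
  unfolding cone_step_def[abs_def]
proof (rule ptime_if_strong)
  let ?D = "{s \<in> cone_wf. violated s \<noteq> []}"
  show "ptime cone_wf (\<lambda>s. violated s = [])" by (intro pt ptime_violated)
  have v: "ptime ?D (\<lambda>s. hd (violated s))"
    by (intro ptime_hd ptime_subset[OF ptime_violated]) auto
  show "ptime ?D (\<lambda>s. cone_update s (hd (violated s)))"
    unfolding cone_update_def
    by (intro pt v ptime_nth) (auto simp: cone_wf_def intro!: violated_less[OF hd_in_set])
qed (intro pt)

text \<open>A power whose exponent is a list length is a product over that list; in this form
  \<open>height_bound\<close> is computed in polynomial time.\<close>

lemma prod_list_const: "prod_list (map (\<lambda>_. c) xs) = (c :: int) ^ length xs"
  by (induction xs) auto

lemma ptime_entry_bound [pt]: "ptime D f \<Longrightarrow> ptime D (\<lambda>a. entry_bound (f a))"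
  by (rule ptime_comp1[of entry_bound]) (auto simp: entry_bound_def[abs_def] intro!: pt)

lemma ptime_cone_init: "ptime UNIV (\<lambda>z. cone_init (fst z) (snd z))"
proof -
  have h: "vertex_height A t = (int (length A + length t) + 1) * entry_bound A *
      prod_list (map (\<lambda>_. 2 * (int (length A + length t) + 1) * (int (length t) * (entry_bound A * entry_bound A)) + 1)
        (map (\<lambda>_. 0::int) A @ map (\<lambda>_. 0) t))" for A t
    unfolding vertex_height_def height_bound_def prod_list_const by (simp add: power2_eq_square)
  show ?thesis unfolding cone_init_def h by (intro pt)
qed

text \<open>The last two clauses drive the proof: the box clause relates the weights to the cone,
  and the estimate \<open>|z|^2 \<le> \<Sum> y\<close> is the perceptron invariant. The bound on
  \<open>y\<close> is strict because an entry that would reach it triggers a rescaling.\<close>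

definition cone_inv :: "int list list \<Rightarrow> int list \<Rightarrow> cone_state \<Rightarrow> bool" where
  "cone_inv A t s \<longleftrightarrow> (let n = length t; W = pow2_above (vertex_height A t); w = fst (snd s); y = snd (snd s) in
     fst s = A \<and> length w = n \<and> length y = n \<and>
     (\<forall>k<n. w ! k = 0 \<or> (\<exists>e. w ! k = 2 ^ e)) \<and> (\<forall>k<n. w ! k \<le> W) \<and>
     (\<forall>k<n. 0 \<le> y ! k \<and> y ! k < 4 * (int n)\<^sup>2) \<and>
     (\<forall>x\<in>kern n (nth ` set A). (\<forall>i<n. 0 \<le> x i \<and> x i \<le> 1) \<longrightarrow> (\<forall>k<n. x k * W \<le> w ! k)) \<and>
     (\<exists>z. isproj n (nth ` set (scale_rows w A)) (ri (nth y)) z \<and> ip n z z \<le> (\<Sum>i<n. real_of_int (y ! i))))"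

text \<open>Lexicographic order as a number. A rescaling removes one binary digit from a weight;
  between rescalings the sum of \<open>y\<close> grows and stays within
  \<open>n * (4 * n\<^sup>2)\<close>. The factor \<open>Suc (n * (4 * n\<^sup>2))\<close> makes one
  digit outweigh the loss of all increments in a restart.\<close>

definition cone_potential :: "cone_state \<Rightarrow> nat" where
  "cone_potential s = (let n = length (snd (snd s)) in
     (\<Sum>i<n. floorlog 2 (nat (fst (snd s) ! i))) * Suc (n * (4 * n\<^sup>2)) +
     (n * (4 * n\<^sup>2) - (\<Sum>i<n. nat (snd (snd s) ! i))))"

lemma kern_scale_rows:
  assumes "same_lengths A n" "length w = n"
  shows "x \<in> kern n (nth ` set (scale_rows w A)) \<longleftrightarrow> (\<lambda>i. real_of_int (w ! i) * x i) \<in> kern n (nth ` set A)"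
proof -
  have "ip n (ri (nth (map2 (*) w a))) x = ip n (ri (nth a)) (\<lambda>i. real_of_int (w ! i) * x i)" if "a \<in> set A" for a
  proof -
    have "length a = n" using assms(1) that by (auto simp: same_lengths_def)
    thus ?thesis unfolding ip_def using assms(2) by (intro sum.cong) auto
  qed
  thus ?thesis by (auto simp: kern_def scale_rows_def)
qed

lemma entry_bound_ge: "a \<in> set A \<Longrightarrow> i < length a \<Longrightarrow> \<bar>a ! i\<bar> \<le> entry_bound A" "entry_bound A \<ge> 1"
proof -
  show "entry_bound A \<ge> 1" by (auto simp: entry_bound_def intro!: sum_list_nonneg)
  assume a: "a \<in> set A" and i: "i < length a"
  have "\<bar>a ! i\<bar> \<le> sum_list (map abs a)" using i by (intro member_le_sum_list) auto
  also have "\<dots> \<le> sum_list (map (\<lambda>r. sum_list (map abs r)) A)"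
    using a by (intro member_le_sum_list) (auto intro!: sum_list_nonneg)
  finally show "\<bar>a ! i\<bar> \<le> entry_bound A" by (simp add: entry_bound_def)
qed

text \<open>If coordinate \<open>k\<close> is positive somewhere on the cone, it reaches
  \<open>1 / W\<close> inside the unit box. Contrapositively, once every cone vector in the box
  satisfies \<open>x k * W < 1\<close>, the coordinate vanishes on the cone.\<close>

lemma cone_vertex:
  assumes A: "same_lengths A (length t)" and x: "x \<in> kern (length t) (nth ` set A)"
    "\<And>i. i < length t \<Longrightarrow> x i \<ge> 0" "k < length t" "x k > 0"
  obtains x' where "x' \<in> kern (length t) (nth ` set A)" "\<And>i. i < length t \<Longrightarrow> 0 \<le> x' i \<and> x' i \<le> 1"
    "x' k * pow2_above (vertex_height A t) \<ge> 1"
proof -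
  have c: "card (nth ` set A) \<le> length A"
    using card_image_le[of "set A" nth] card_length[of A] by simp
  have "\<exists>x'\<in>kern (length t) (nth ` set A). (\<forall>i<length t. 0 \<le> x' i \<and> x' i \<le> 1) \<and>
      x' k * real_of_int (height_bound (length A + length t) (length t) (entry_bound A)) \<ge> 1"
  proof (rule vertex_bound[OF _ c _ entry_bound_ge(2) x])
    fix a i assume "a \<in> nth ` set A" "i < length t"
    then obtain b where "b \<in> set A" "a = nth b" by blast
    thus "\<bar>a i\<bar> \<le> entry_bound A" using entry_bound_ge(1)[of b A i] A \<open>i < length t\<close>
      by (auto simp: same_lengths_def)
  qed auto
  then obtain x' where x': "x' \<in> kern (length t) (nth ` set A)" "\<And>i. i < length t \<Longrightarrow> 0 \<le> x' i \<and> x' i \<le> 1"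
      "x' k * real_of_int (vertex_height A t) \<ge> 1" by (auto simp: vertex_height_def)
  have "x' k * real_of_int (vertex_height A t) \<le> x' k * real_of_int (pow2_above (vertex_height A t))"
    using x'(2)[OF x(3)] pow2_above(1)[of "vertex_height A t"] by (intro mult_left_mono) auto
  hence "x' k * pow2_above (vertex_height A t) \<ge> 1" using x'(3) by linarith
  show ?thesis by (rule that[OF x'(1)]) fact+
qed

lemma cone_inv_init:
  assumes "same_lengths A (length t)"
  shows "cone_inv A t (cone_init A t)"
proof -
  let ?W = "pow2_above (vertex_height A t)"
  have W: "\<exists>e. ?W = 2 ^ e" "?W > 0" using pow2_above(2)[of "vertex_height A t"] by auto
  have "x k * ?W \<le> ?W" if "0 \<le> x k" "x k \<le> 1" for x :: "nat \<Rightarrow> real" and k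
    using that W(2) mult_right_mono[of "x k" 1 "real_of_int ?W"] by simp
  moreover have "isproj (length t) R (\<lambda>i. 0) (\<lambda>i. 0)" for R
    by (simp add: isproj_def kern_def ip_def)
  hence "isproj (length t) R (ri (nth (map (\<lambda>_. 0) t))) (\<lambda>i. 0)" for R
    using ip_cong[of "length t" "ri (nth (map (\<lambda>_. 0) t))" "\<lambda>_. 0"] by (simp add: isproj_def)
  hence "\<exists>z. isproj (length t) R (ri (nth (map (\<lambda>_. 0) t))) z \<and>
      ip (length t) z z \<le> (\<Sum>i<length t. real_of_int (map (\<lambda>_. 0) t ! i))" for R
    by (intro exI[of _ "\<lambda>i. 0"]) (simp add: ip_def)
  ultimately show ?thesis using W unfolding cone_inv_def cone_init_def Let_def by auto
qed

text \<open>The computed integer vector and the real projection \<open>z\<close> of the invariant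
  differ by a positive factor, so sign tests on the former are statements about the latter.\<close>

lemma cone_proj_sign:
  assumes inv: "cone_inv A t s" and A: "same_lengths A (length t)"
  obtains z c where "c > 0" "isproj (length t) (nth ` set (scale_rows (fst (snd s)) A)) (ri (nth (snd (snd s)))) z"
    "ip (length t) z z \<le> (\<Sum>i<length t. real_of_int (snd (snd s) ! i))"
    "\<And>i. i < length t \<Longrightarrow> real_of_int (cone_proj s ! i) = c * z i" "length (cone_proj s) = length t"
proof -
  let ?R = "nth ` set (scale_rows (fst (snd s)) A)"
  obtain z where z: "isproj (length t) ?R (ri (nth (snd (snd s)))) z"
    "ip (length t) z z \<le> (\<Sum>i<length t. real_of_int (snd (snd s) ! i))"
    and len: "length (fst (snd s)) = length t" "length (snd (snd s)) = length t" "fst s = A"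
    using inv by (auto simp: cone_inv_def Let_def)
  have "proj_mult (length t) ?R (nth (snd (snd s))) (cone_proj s)"
    unfolding cone_proj_def len(3) using same_lengths_scale_rows[OF len(1) A] len
    by (intro proj_mult_gram) (auto simp: same_lengths_def)
  then obtain c where c: "c > 0" "length (cone_proj s) = length t" "ri (nth (cone_proj s)) \<in> kern (length t) ?R"
    "\<And>x. x \<in> kern (length t) ?R \<Longrightarrow> ip (length t) (ri (nth (cone_proj s))) x = c * ip (length t) (ri (nth (snd (snd s)))) x"
    by (auto simp: proj_mult_def)
  have "isproj (length t) ?R (ri (nth (snd (snd s)))) (\<lambda>i. (1 / c) * ri (nth (cone_proj s)) i)"
    unfolding isproj_def
  proof (intro conjI ballI)
    show "(\<lambda>i. (1 / c) * ri (nth (cone_proj s)) i) \<in> kern (length t) ?R" by (intro kern_scale c)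
    fix x assume x: "x \<in> kern (length t) ?R"
    show "ip (length t) (\<lambda>i. (1 / c) * ri (nth (cone_proj s)) i) x = ip (length t) (ri (nth (snd (snd s)))) x"
      unfolding ip_scale c(4)[OF x] using c(1) by simp
  qed
  from isproj_unique[OF this z(1)] have "real_of_int (cone_proj s ! i) = c * z i" if "i < length t" for i
    using that c(1) by (simp add: field_simps)
  thus ?thesis using that c z by blast
qed

lemma cone_inv_step:
  assumes inv: "cone_inv A t s" and A: "same_lengths A (length t)" and viol: "violated s \<noteq> []"
  shows "cone_inv A t (cone_step s)" "cone_potential (cone_step s) < cone_potential s"
proof -
  define n where "n = length t"
  define W where "W = pow2_above (vertex_height A t)"
  obtain w y where s: "s = (A, w, y)" using inv by (cases s) (auto simp: cone_inv_def Let_def)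
  define k where "k = hd (violated s)"
  have kd: "hd (violated (A, w, y)) = k" by (simp add: k_def s)
  have len: "length w = n" "length y = n" and wpow: "\<And>k. k < n \<Longrightarrow> w ! k = 0 \<or> (\<exists>e. w ! k = 2 ^ e)"
    and wW: "\<And>k. k < n \<Longrightarrow> w ! k \<le> W" and yb: "\<And>k. k < n \<Longrightarrow> 0 \<le> y ! k \<and> y ! k < 4 * (int n)\<^sup>2"
    and box: "\<And>x k. x\<in>kern n (nth ` set A) \<Longrightarrow> (\<And>i. i < n \<Longrightarrow> 0 \<le> x i \<and> x i \<le> 1) \<Longrightarrow> k < n \<Longrightarrow> x k * W \<le> w ! k"
    using inv unfolding s cone_inv_def Let_def n_def W_def by auto
  let ?R = "nth ` set (scale_rows w A)"
  obtain z c where c: "c > 0" and z: "isproj n ?R (ri (nth y)) z" "ip n z z \<le> (\<Sum>i<n. real_of_int (y ! i))"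
    "\<And>i. i < n \<Longrightarrow> real_of_int (cone_proj s ! i) = c * z i"
    by (rule cone_proj_sign[OF inv A, unfolded s fst_conv snd_conv, folded n_def s]) (rule that; assumption)
  have "k \<in> set (violated s)" unfolding k_def using viol by simp
  hence k: "k < n" "w ! k \<noteq> 0" "cone_proj s ! k \<le> 0" unfolding violated_def by (auto simp: s len)
  have "real_of_int (cone_proj s ! k) \<le> 0" using k(3) by simp
  hence zk: "z k \<le> 0" using z(3)[OF k(1)] c by (simp add: mult_le_0_iff)
  obtain e where e: "w ! k = 2 ^ e" using wpow[OF k(1)] k(2) by auto
  have fR: "finite ?R" by simp
  obtain z' where z': "isproj n ?R (ri ((nth y)(k := y ! k + 1))) z'" "ip n z' z' \<le> (\<Sum>i<n. real_of_int (y ! i)) + 1"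
    using isproj_increment[OF fR z(1,2) k(1) zk] by blast
  define y' where "y' = y[k := y ! k + 1]"
  have y': "nth y' i = ((nth y)(k := y ! k + 1)) i" if "i < n" for i
    using that len by (simp add: y'_def nth_list_update)
  \<comment> \<open>Generic in \<open>f\<close>: the real sum enters the norm estimate, the integer
    sum the potential.\<close>
  have sumy': "(\<Sum>i<n. f (y' ! i)) = (\<Sum>i<n. f (y ! i)) + 1"
    if "\<And>j. j \<ge> 0 \<Longrightarrow> f (j + 1) = f j + 1" for f :: "int \<Rightarrow> 'b::comm_ring_1"
  proof -
    have "(\<Sum>i<n. f (y' ! i)) = (\<Sum>i<n. f (y ! i) + of_bool (i = k))"
      using yb that by (intro sum.cong) (auto simp: y' k)
    also have "\<dots> = (\<Sum>i<n. f (y ! i)) + 1" using k(1) by (simp add: sum.distrib)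
    finally show ?thesis .
  qed
  have proj': "isproj n ?R (ri (nth y')) z'"
  proof -
    have "ip n (ri (nth y')) x = ip n (ri ((nth y)(k := y ! k + 1))) x" for x
      using y' by (intro ip_cong) auto
    thus ?thesis using z'(1) unfolding isproj_def by simp
  qed
  have sumy'_real: "ip n z' z' \<le> (\<Sum>i<n. real_of_int (y' ! i))"
    using z'(2) sumy'[of real_of_int] by simp
  have nat_sum: "int (\<Sum>i<n. nat (v ! i)) = (\<Sum>i<n. v ! i)" if "\<And>i. i < n \<Longrightarrow> v ! i \<ge> 0" for v :: "int list"
    using that by (simp add: of_nat_sum)
  have sum_le: "(\<Sum>i<n. nat (y ! i)) \<le> n * (4 * n\<^sup>2)"
  proof -
    have "(\<Sum>i<n. nat (y ! i)) \<le> (\<Sum>i<n. 4 * n\<^sup>2)"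
      using yb by (intro sum_mono) (auto simp: nat_le_iff intro: less_imp_le)
    thus ?thesis by simp
  qed
  have y'k: "y' ! k = y ! k + 1" using k len by (simp add: y'_def)
  have "cone_inv A t (cone_step s) \<and> cone_potential (cone_step s) < cone_potential s"
  proof (cases "4 * (int n)\<^sup>2 \<le> y ! k + 1")
    case False
    have step: "cone_step s = (A, w, y')"
      using False viol by (simp add: cone_step_def cone_update_def kd s len y'_def power2_eq_square)
    have yb': "0 \<le> y' ! i \<and> y' ! i < 4 * (int n)\<^sup>2" if "i < n" for i
      using yb[OF that] False by (auto simp: y'[OF that])
    have "cone_inv A t (A, w, y')"
      unfolding cone_inv_def Let_def n_def[symmetric] W_def[symmetric]
      using len wpow wW yb' box proj' sumy'_real by (auto simp: y'_def[symmetric] length_list_update) (auto simp: y'_def)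
    moreover have "(\<Sum>i<n. nat (y' ! i)) = (\<Sum>i<n. nat (y ! i)) + 1"
    proof -
      have "int (\<Sum>i<n. nat (y' ! i)) = int ((\<Sum>i<n. nat (y ! i)) + 1)"
        using nat_sum[of y'] nat_sum[of y] yb' yb sumy'[of "\<lambda>i. i"] by simp
      thus ?thesis by linarith
    qed
    moreover have "(\<Sum>i<n. nat (y' ! i)) \<le> n * (4 * n\<^sup>2)"
    proof -
      have "(\<Sum>i<n. nat (y' ! i)) \<le> (\<Sum>i<n. 4 * n\<^sup>2)"
        using yb' by (intro sum_mono) (auto simp: nat_le_iff intro: less_imp_le)
      thus ?thesis by simp
    qed
    ultimately show ?thesis unfolding step by (auto simp: cone_potential_def Let_def s len y'_def)
  next
    case True
    define w' where "w' = w[k := w ! k div 2]"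
    have step: "cone_step s = (A, w', map (\<lambda>_. 0) y)"
      using True viol by (simp add: cone_step_def cone_update_def kd s len w'_def power2_eq_square)
    have yk: "y' ! k = 4 * (int n)\<^sup>2" using True yb[OF k(1)] y'k by linarith
    \<comment> \<open>For the incremented vector \<open>y'\<close>, whose entry \<open>k\<close> is
      exactly \<open>4 n^2\<close>, the estimate applies in the scaled coordinates.\<close>
    have half: "x' k \<le> 1 / 2" if "x' \<in> kern n ?R" "\<And>i. i < n \<Longrightarrow> 0 \<le> x' i \<and> x' i \<le> 1" for x'
    proof (rule rescale_bound[OF proj' sumy'_real _ k(1) _ that])
      show "ri (nth y') k = 4 * (real n)\<^sup>2" using yk by simp
      fix i assume i: "i < n"
      have "0 \<le> y' ! i \<and> y' ! i \<le> 4 * (int n)\<^sup>2"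
        using yb[OF i] yk y'k by (auto simp: y'[OF i])
      hence "0 \<le> y' ! i \<and> real_of_int (y' ! i) \<le> real_of_int (4 * (int n)\<^sup>2)"
        by (simp only: of_int_le_iff)
      thus "0 \<le> ri (nth y') i \<and> ri (nth y') i \<le> 4 * (real n)\<^sup>2" by simp
    qed
    have Wpos: "W > 0" using pow2_above(2)[of "vertex_height A t"] by (auto simp: W_def)
    have shrink: "x k * W \<le> real_of_int (w ! k) / 2"
      if x: "x \<in> kern n (nth ` set A)" "\<And>i. i < n \<Longrightarrow> 0 \<le> x i \<and> x i \<le> 1" for x
    proof -
      \<comment> \<open>The scaled coordinates of \<open>x W\<close>; by the box clause they lie in
        the unit box. A zero weight forces \<open>x i = 0\<close>, which agrees with the value 0 of
        the division by zero.\<close>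
      define x' where "x' i = x i * W / real_of_int (w ! i)" for i
      have w0: "x i = 0" if "i < n" "w ! i = 0" for i
      proof -
        have "x i * W \<le> 0" using box[OF x that(1)] that(2) by simp
        thus ?thesis using x(2)[OF that(1)] Wpos by (simp add: mult_le_0_iff)
      qed
      have eq: "real_of_int (w ! i) * x' i = real_of_int W * x i" if "i < n" for i
        using w0[OF that] by (cases "w ! i = 0") (auto simp: x'_def)
      have "(\<lambda>i. real_of_int (w ! i) * x' i) \<in> kern n (nth ` set A)"
        by (rule kern_cong[THEN iffD2, OF _ kern_scale[OF x(1)]]) (rule eq)
      hence "x' \<in> kern n ?R" using kern_scale_rows[OF A[folded n_def] len(1)] by simp
      moreover have "0 \<le> x' i \<and> x' i \<le> 1" if "i < n" for i
        using wpow[OF that] box[OF x that] x(2)[OF that] Wpos by (auto simp: x'_def field_simps)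
      ultimately have "x' k \<le> 1 / 2" by (rule half)
      thus ?thesis using e by (simp add: x'_def field_simps)
    qed
    have shrink': "x k * W \<le> real_of_int (w ! k div 2)"
      if x: "x \<in> kern n (nth ` set A)" "\<And>i. i < n \<Longrightarrow> 0 \<le> x i \<and> x i \<le> 1" for x
    proof (cases e)
      case (Suc e')
      thus ?thesis using shrink[OF x] e by simp
    next
      case 0
      \<comment> \<open>Here the weight is 1, and halving it gives 0, so the coordinate has to
        vanish on the cone: otherwise some vector in the box has \<open>x' k * W \<ge> 1\<close>,
        although all of them satisfy \<open>x k * W \<le> 1 / 2\<close>.\<close>
      have "x k = 0"
      proof (rule ccontr)
        assume "x k \<noteq> 0"
        hence "x k > 0" using x(2)[OF k(1)] by simp
        then obtain x' where x': "x' \<in> kern n (nth ` set A)" "\<And>i. i < n \<Longrightarrow> 0 \<le> x' i \<and> x' i \<le> 1"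
           "x' k * W \<ge> 1"
          using cone_vertex[OF A, of x k] x k unfolding n_def W_def by auto
        thus False using shrink[OF x'(1,2)] e 0 by simp
      qed
      thus ?thesis using e by simp
    qed
    have wi: "w' ! i = (if i = k then w ! k div 2 else w ! i)" if "i < n" for i
      using that len by (simp add: w'_def nth_list_update)
    have wpow': "w' ! i = 0 \<or> (\<exists>e. w' ! i = 2 ^ e)" if "i < n" for i
      using wpow[OF that] e by (cases e) (auto simp: wi[OF that])
    have wW': "w' ! i \<le> W" if "i < n" for i
    proof -
      have "w ! k > 0" using e by simp
      hence "w ! k div 2 \<le> w ! k" by presburger
      thus ?thesis using wW[OF that] wW[OF k(1)] by (auto simp: wi[OF that])
    qed
    have box': "x i * W \<le> w' ! i" if "x\<in>kern n (nth ` set A)" "\<And>i. i < n \<Longrightarrow> 0 \<le> x i \<and> x i \<le> 1" "i < n" for x i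
      using box[OF that] shrink'[OF that(1,2)] by (auto simp: wi[OF that(3)])
    have n0: "int n > 0" using k by simp
    have "isproj n R (ri (nth (map (\<lambda>_. 0) y))) (\<lambda>i. 0)" for R
    proof -
      have "ip n (ri (nth (map (\<lambda>_. 0) y))) x = 0" for x
        unfolding ip_def using len by (intro sum.neutral) auto
      thus ?thesis by (simp add: isproj_def kern_def ip_def)
    qed
    hence zero: "\<exists>z. isproj n R (ri (nth (map (\<lambda>_. 0) y))) z \<and> ip n z z \<le> (\<Sum>i<n. real_of_int (map (\<lambda>_. 0) y ! i))" for R
      using len by (intro exI[of _ "\<lambda>i. 0"]) (auto simp: ip_def)
    have lw': "length w' = n" by (simp add: w'_def len)
    have "cone_inv A t (A, w', map (\<lambda>_. 0) y)"
      unfolding cone_inv_def Let_def n_def[symmetric] W_def[symmetric]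
      using len lw' wpow' wW' box' zero n0 by auto
    moreover have "cone_potential (A, w', map (\<lambda>_. 0) y) < cone_potential s"
    proof -
      \<comment> \<open>Halving a power of two removes one binary digit; the step from 1 to 0
        conforms, because \<open>floorlog 2 0 = 0\<close>.\<close>
      have fl: "floorlog 2 (nat (w ! k)) = Suc (floorlog 2 (nat (w' ! k)))"
      proof (cases e)
        case 0 thus ?thesis using e by (simp add: wi[OF k(1)] floorlog_def)
      next
        case (Suc e')
        have "floorlog 2 (nat (2 ^ j)) = Suc j" for j
          by (simp add: floorlog_def nat_power_eq floorlog_power log_nat_power)
        note fl = this
        have "w' ! k = 2 ^ e'" using e Suc by (simp add: wi[OF k(1)])
        thus ?thesis using fl[of e'] fl[of e] Suc unfolding e by simp
      qed
      have "(\<Sum>i<n. floorlog 2 (nat (w ! i))) = (\<Sum>i<n. floorlog 2 (nat (w' ! i)) + of_bool (i = k))"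
        using fl by (intro sum.cong) (auto simp: wi)
      also have "\<dots> = Suc (\<Sum>i<n. floorlog 2 (nat (w' ! i)))" using k(1) by (simp add: sum.distrib)
      finally have S: "(\<Sum>i<n. floorlog 2 (nat (w ! i))) = Suc (\<Sum>i<n. floorlog 2 (nat (w' ! i)))" .
      have "(\<Sum>i<n. nat (map (\<lambda>_. 0) y ! i)) = 0" using len by simp
      thus ?thesis by (simp add: cone_potential_def Let_def s len S)
    qed
    ultimately show ?thesis unfolding step by blast
  qed
  thus "cone_inv A t (cone_step s)" "cone_potential (cone_step s) < cone_potential s" by auto
qed

text \<open>At exit the projection is positive at all coordinates of nonzero weight, and
  multiplication by \<open>w\<close> turns it into a kernel vector of the unscaled matrix. A
  coordinate of weight 0 is positive nowhere on the cone, since \<open>cone_vertex\<close> would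
  contradict the box clause.\<close>

theorem cone_solve_correct:
  assumes A: "same_lengths A (length t)"
  shows "length (cone_solve A t) = length t"
    and "a \<in> set A \<Longrightarrow> dot a (cone_solve A t) = 0"
    and "i < length t \<Longrightarrow> cone_solve A t ! i \<ge> 0"
    and "\<lbrakk>x \<in> kern (length t) (nth ` set A); \<And>i. i < length t \<Longrightarrow> x i \<ge> 0; k < length t; x k > 0\<rbrakk> \<Longrightarrow>
      cone_solve A t ! k > 0"
proof -
  define s where "s = run_until (\<lambda>s. violated s \<noteq> []) cone_step (cone_init A t)"
  from run_until_steps[of "cone_inv A t" "\<lambda>s. violated s \<noteq> []" cone_step cone_potential "cone_init A t",
      OF _ cone_inv_init[OF A]] cone_inv_step[OF _ A]
  have "cone_inv A t s \<and> violated s = []" unfolding s_def by auto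
  hence inv: "cone_inv A t s" and viol: "violated s = []" by auto
  define n where "n = length t"
  obtain w y where s: "s = (A, w, y)" using inv by (cases s) (auto simp: cone_inv_def Let_def)
  have len: "length w = n" "length y = n" and wpow: "\<And>k. k < n \<Longrightarrow> w ! k = 0 \<or> (\<exists>e. w ! k = 2 ^ e)"
    and box: "\<And>x k. x\<in>kern n (nth ` set A) \<Longrightarrow> (\<And>i. i < n \<Longrightarrow> 0 \<le> x i \<and> x i \<le> 1) \<Longrightarrow> k < n \<Longrightarrow>
        x k * pow2_above (vertex_height A t) \<le> w ! k"
    using inv unfolding s cone_inv_def Let_def n_def by auto
  obtain z c where c: "c > 0" and z: "isproj n (nth ` set (scale_rows w A)) (ri (nth y)) z"
    "\<And>i. i < n \<Longrightarrow> real_of_int (cone_proj s ! i) = c * z i" "length (cone_proj s) = n"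
    by (rule cone_proj_sign[OF inv A, unfolded s fst_conv snd_conv, folded n_def s]) (rule that; assumption)
  have sol: "cone_solve A t = map2 (*) w (cone_proj s)" by (simp add: cone_solve_def s_def[symmetric] Let_def) (simp add: s)
  show l: "length (cone_solve A t) = length t" using z len by (simp add: sol n_def)
  have nth: "cone_solve A t ! i = w ! i * cone_proj s ! i" if "i < n" for i using that z len by (simp add: sol)
  have pos: "cone_proj s ! i > 0" if "i < n" "w ! i \<noteq> 0" for i
    using viol that by (auto simp: violated_def filter_empty_conv s len not_le)
  show "cone_solve A t ! i \<ge> 0" if "i < length t" for i
    using wpow[of i] pos[of i] that nth[of i] by (auto simp: n_def)
  show "dot a (cone_solve A t) = 0" if a: "a \<in> set A"
  proof -
    have la: "length a = n" using A a by (auto simp: same_lengths_def n_def)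
    have "(\<lambda>i. real_of_int (w ! i) * (c * z i)) \<in> kern n (nth ` set A)"
      using z(1) kern_scale_rows[OF A[folded n_def] len(1), of "\<lambda>i. c * z i"] kern_scale[of z n _ c] by (simp add: isproj_def)
    hence "ip n (ri (nth a)) (\<lambda>i. real_of_int (w ! i) * (c * z i)) = 0" using a by (auto simp: kern_def)
    also have "ip n (ri (nth a)) (\<lambda>i. real_of_int (w ! i) * (c * z i)) = ip n (ri (nth a)) (ri (nth (cone_solve A t)))"
      by (rule ip_cong) (simp_all add: nth z)
    finally show ?thesis using l by (simp add: dot_ip[OF la, of "cone_solve A t"] n_def ip_of_int)
  qed
  show "cone_solve A t ! k > 0" if x: "x \<in> kern (length t) (nth ` set A)"
     "\<And>i. i < length t \<Longrightarrow> x i \<ge> 0" "k < length t" "x k > 0"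
  proof -
    obtain x' where x': "x' \<in> kern n (nth ` set A)" "\<And>i. i < n \<Longrightarrow> 0 \<le> x' i \<and> x' i \<le> 1"
           "x' k * pow2_above (vertex_height A t) \<ge> 1"
      using cone_vertex[OF A x] unfolding n_def by auto
    have kn: "k < n" using x by (simp add: n_def)
    from box[OF x'(1,2) kn] x'(3) have "w ! k \<noteq> 0" by auto
    hence "w ! k > 0" using wpow[OF kn] by auto
    thus ?thesis using pos[OF kn] nth[OF kn] by simp
  qed
qed

lemma ptime_cone_solve:
  assumes f: "ptime D f" and g: "ptime D g" and len: "\<And>a. a \<in> D \<Longrightarrow> same_lengths (f a) (length (g a))"
  shows "ptime D (\<lambda>a. cone_solve (f a) (g a))"
proof -
  \<comment> \<open>The size bounds are proved for initial states. Their encoding contains the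
    weight \<open>W\<close> once per unknown, so the digits of all later weights are bounded by the
    input size \<open>N a\<close>.\<close>
  define I where "I = {cone_init A t | A t. same_lengths A (length t)}"
  define P where "P a s \<longleftrightarrow> (\<exists>A t. a = cone_init A t \<and> same_lengths A (length t) \<and> cone_inv A t s)" for a s
  define N where "N a = bits (enc a)" for a :: cone_state
  define S where "S a = 2 + N a + (1 + N a * Suc (N a)) + (1 + N a * Suc (Suc (4 * N a ^ 2)))" for a :: cone_state
  have run: "ptime I (run_until (\<lambda>s. violated s \<noteq> []) cone_step)"
  proof (rule ptime_run_until[of cone_wf _ _ _ cone_potential S P])
    show "ptime cone_wf (\<lambda>s. violated s \<noteq> [])" by (intro pt ptime_violated)
    show "ptime cone_wf cone_step" by (rule ptime_cone_step)
    have "psize I (\<lambda>a. (N a * N a) * Suc (N a * (4 * N a ^ 2)) + N a * (4 * N a ^ 2))"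
      unfolding N_def by (intro ps)
    thus "psize I cone_potential"
    proof (rule psize_mono)
      fix a assume "a \<in> I"
      then obtain A t where a: "a = cone_init A t" by (auto simp: I_def)
      define n where "n = length (snd (snd a))"
      have n: "n \<le> N a" unfolding n_def N_def using length_le_bits[of "snd (snd a)"] by (cases a) auto
      have ln: "length (fst (snd a)) = n" by (simp add: n_def a cone_init_def)
      have "floorlog 2 (nat (fst (snd a) ! i)) \<le> N a" if "i < n" for i
      proof -
        have "fst (snd a) ! i \<ge> 0" using that pow2_above(2)[of "vertex_height A t"]
          by (auto simp: a cone_init_def n_def)
        hence "floorlog 2 (nat (fst (snd a) ! i)) \<le> bits (Num (fst (snd a) ! i))" by (simp add: bits.simps)
        also have "\<dots> \<le> bits (enc (fst (snd a)))"
          using bits_in_set[of "fst (snd a) ! i" "fst (snd a)"] that ln by (simp add: enc_int_def)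
        also have "\<dots> \<le> N a" unfolding N_def by (cases a) auto
        finally show ?thesis .
      qed
      hence "(\<Sum>i<n. floorlog 2 (nat (fst (snd a) ! i))) \<le> (\<Sum>i<n. N a)" by (intro sum_mono) auto
      also have "\<dots> \<le> N a * N a" using n by simp
      finally have "(\<Sum>i<n. floorlog 2 (nat (fst (snd a) ! i))) * Suc (n * (4 * n\<^sup>2)) \<le> (N a * N a) * Suc (N a * (4 * (N a)\<^sup>2))"
        using n by (intro mult_mono Suc_le_mono[THEN iffD2] power_mono) auto
      moreover have "n * (4 * n\<^sup>2) \<le> N a * (4 * (N a)\<^sup>2)" using n by (intro mult_mono power_mono) auto
      ultimately show "cone_potential a \<le> (N a * N a) * Suc (N a * (4 * N a ^ 2)) + N a * (4 * N a ^ 2)"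
        unfolding cone_potential_def Let_def n_def[symmetric] by linarith
    qed
    show "psize I S" unfolding S_def N_def by (intro ps)
    fix a assume aI: "a \<in> I"
    then obtain A t where a: "a = cone_init A t" "same_lengths A (length t)" by (auto simp: I_def)
    show "P a a" using cone_inv_init a unfolding P_def by blast
    fix s
    show "P a (cone_step s) \<and> cone_potential (cone_step s) < cone_potential s" if "P a s" "violated s \<noteq> []"
      using that cone_inv_step unfolding P_def by blast
    assume "P a s"
    then obtain A t where a: "a = cone_init A t" and A: "same_lengths A (length t)" and inv: "cone_inv A t s"
      by (auto simp: P_def)
    define n where "n = length t"
    obtain w y where s: "s = (A, w, y)" using inv by (cases s) (auto simp: cone_inv_def Let_def)
    have len: "length w = n" "length y = n" and wpow: "\<And>k. k < n \<Longrightarrow> w ! k = 0 \<or> (\<exists>e. w ! k = 2 ^ e)"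
      and wW: "\<And>k. k < n \<Longrightarrow> w ! k \<le> pow2_above (vertex_height A t)"
      and yb: "\<And>k. k < n \<Longrightarrow> 0 \<le> y ! k \<and> y ! k < 4 * (int n)\<^sup>2"
      using inv unfolding s cone_inv_def Let_def n_def by auto
    have n: "n \<le> N a" unfolding N_def using length_le_bits[of "snd (snd a)"] by (simp add: a cone_init_def n_def)
    have NA: "bits (enc A) \<le> N a" by (simp add: N_def a cone_init_def)
    have "bits (enc w) \<le> 1 + length w * Suc (N a)"
    proof (rule bits_list_le)
      fix x assume "x \<in> set w"
      then obtain k where k: "k < n" "x = w ! k" by (auto simp: in_set_conv_nth len)
      have "bits (enc x) \<le> bits (Num (pow2_above (vertex_height A t)))"
        unfolding enc_int_def using wpow[OF k(1)] wW[OF k(1)] k(2) by (intro bits_Num_mono) auto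
      also have "\<dots> = bits (enc (map (\<lambda>_. pow2_above (vertex_height A t)) t ! k))"
        using k by (simp add: n_def enc_int_def)
      also have "\<dots> \<le> bits (enc (map (\<lambda>_. pow2_above (vertex_height A t)) t))"
        using k by (intro bits_in_set nth_mem) (simp add: n_def)
      also have "\<dots> \<le> N a" by (simp add: N_def a cone_init_def)
      finally show "bits (enc x) \<le> N a" .
    qed
    also have "\<dots> \<le> 1 + N a * Suc (N a)" using n len by (intro add_mono mult_right_mono) auto
    finally have bw: "bits (enc w) \<le> 1 + N a * Suc (N a)" .
    have "bits (enc y) \<le> 1 + length y * Suc (Suc (4 * (N a)\<^sup>2))"
    proof (rule bits_list_le)
      fix x assume "x \<in> set y"
      then obtain k where k: "k < n" "x = y ! k" by (auto simp: in_set_conv_nth len)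
      have "(int n)\<^sup>2 \<le> (int (N a))\<^sup>2" using n by (intro power_mono) auto
      hence "0 \<le> x" "x \<le> 4 * (int (N a))\<^sup>2" using yb[OF k(1)] k(2) by linarith+
      hence "\<bar>x\<bar> \<le> \<bar>int (4 * (N a)\<^sup>2)\<bar>" by simp
      from bits_Num_mono[OF this] show "bits (enc x) \<le> Suc (4 * (N a)\<^sup>2)"
        unfolding enc_int_def using bits_of_nat[of "4 * (N a)\<^sup>2"] by linarith
    qed
    also have "\<dots> \<le> 1 + N a * Suc (Suc (4 * (N a)\<^sup>2))" using n len by (intro add_mono mult_right_mono) auto
    finally have "bits (enc y) \<le> 1 + N a * Suc (Suc (4 * (N a)\<^sup>2))" .
    hence "bits (enc s) \<le> S a" using bw NA by (simp add: s S_def)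
    moreover have "s \<in> cone_wf" using A len by (simp add: s cone_wf_def n_def)
    ultimately show "s \<in> cone_wf \<and> bits (enc s) \<le> S a" by blast
  qed
  have init: "ptime D (\<lambda>a. cone_init (f a) (g a))"
    by (rule ptime_comp2[OF ptime_cone_init f g])
  have fin: "ptime D (\<lambda>a. run_until (\<lambda>s. violated s \<noteq> []) cone_step (cone_init (f a) (g a)))"
    by (rule ptime_comp[OF run init]) (use len in \<open>auto simp: I_def\<close>)
  have wf: "run_until (\<lambda>s. violated s \<noteq> []) cone_step (cone_init A t) \<in> cone_wf" if "same_lengths A (length t)" for A t
  proof -
    from run_until_steps[of "cone_inv A t" "\<lambda>s. violated s \<noteq> []" cone_step cone_potential "cone_init A t",
      OF _ cone_inv_init[OF that]] cone_inv_step[OF _ that]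
    have "cone_inv A t (run_until (\<lambda>s. violated s \<noteq> []) cone_step (cone_init A t))" by auto
    thus ?thesis using that by (auto simp: cone_inv_def cone_wf_def Let_def)
  qed
  show ?thesis unfolding cone_solve_def Let_def case_prod_unfold
    by (intro pt fin ptime_comp[OF ptime_cone_proj fin] wf len)
qed


section \<open>Linear programming\<close>

text \<open>A pair \<open>(a, b)\<close> stands for the inequality
  \<open>\<Sum> a v * y v \<le> b\<close>; the set consists of the inequalities derived from
  \<open>S\<close> by nonnegative combination.\<close>

inductive_set conic_comb :: "(('v \<Rightarrow> real) \<times> real) set \<Rightarrow> (('v \<Rightarrow> real) \<times> real) set" for S where
  base: "s \<in> S \<Longrightarrow> s \<in> conic_comb S"
| add: "s \<in> conic_comb S \<Longrightarrow> s' \<in> conic_comb S \<Longrightarrow> (\<lambda>v. fst s v + fst s' v, snd s + snd s') \<in> conic_comb S"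
| scale: "s \<in> conic_comb S \<Longrightarrow> c \<ge> 0 \<Longrightarrow> (\<lambda>v. c * fst s v, c * snd s) \<in> conic_comb S"

lemma conic_comb_trans: "s \<in> conic_comb T \<Longrightarrow> T \<subseteq> conic_comb S \<Longrightarrow> s \<in> conic_comb S"
  by (induction rule: conic_comb.induct) (auto intro: conic_comb.intros)

lemma finite_separate:
  assumes "finite L" "finite U" "\<And>l u. l \<in> L \<Longrightarrow> u \<in> U \<Longrightarrow> l \<le> (u::real)"
  obtains t where "\<And>l. l \<in> L \<Longrightarrow> l \<le> t" "\<And>u. u \<in> U \<Longrightarrow> t \<le> u"
proof (cases "L = {}")
  case True
  show ?thesis
  proof (cases "U = {}")
    case False
    thus ?thesis using that[of "Min U"] True assms by auto
  qed (use True that in auto)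
next
  case False
  show ?thesis by (rule that[of "Max L"]) (use False assms in \<open>auto simp: Max_le_iff\<close>)
qed

text \<open>Fourier-Motzkin elimination of the variables in \<open>V\<close>. An inequality with a
  positive coefficient at \<open>x\<close> is an upper bound for \<open>y x\<close>, one with a
  negative coefficient a lower bound; the eliminated system says that every lower bound is at most
  every upper bound. A contradiction found there is a conic combination of the original
  inequalities.\<close>

lemma farkas:
  assumes "finite V" "finite S"
  shows "(\<exists>y. \<forall>s\<in>S. (\<Sum>v\<in>V. fst s v * y v) \<le> snd s) \<or>
    (\<exists>s\<in>conic_comb S. (\<forall>v\<in>V. fst s v = 0) \<and> snd s < 0)"
  using assms
proof (induction V arbitrary: S rule: finite_induct)
  case empty
  show ?case
  proof (cases "\<forall>s\<in>S. 0 \<le> snd s")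
    case False
    thus ?thesis by (auto simp: not_le intro: conic_comb.base)
  qed auto
next
  case (insert x V)
  \<comment> \<open>Scaled to coefficients \<open>1\<close> and \<open>-1\<close> at
    \<open>x\<close>, so that \<open>x\<close> cancels in the sum.\<close>
  define comb where "comb p q = (\<lambda>v. fst p v / fst p x + fst q v / (- fst q x), snd p / fst p x + snd q / (- fst q x))"
    for p q :: "('a \<Rightarrow> real) \<times> real"
  define P N Z where "P = {s\<in>S. fst s x > 0}" and "N = {s\<in>S. fst s x < 0}" and "Z = {s\<in>S. fst s x = 0}"
  define S' where "S' = Z \<union> (\<lambda>(p, q). comb p q) ` (P \<times> N)"
  have fin: "finite P" "finite N" "finite S'" using insert.prems by (auto simp: P_def N_def Z_def S'_def)
  have comb_in: "comb p q \<in> conic_comb S" if "p \<in> P" "q \<in> N" for p q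
  proof -
    have "(\<lambda>v. (1 / fst p x) * fst p v, (1 / fst p x) * snd p) \<in> conic_comb S"
      using that by (intro conic_comb.scale conic_comb.base) (auto simp: P_def)
    moreover have "(\<lambda>v. (1 / (- fst q x)) * fst q v, (1 / (- fst q x)) * snd q) \<in> conic_comb S"
      using that by (intro conic_comb.scale conic_comb.base) (auto simp: N_def)
    ultimately show ?thesis using conic_comb.add by (fastforce simp: comb_def)
  qed
  hence sub: "S' \<subseteq> conic_comb S" by (auto simp: S'_def Z_def intro: conic_comb.base)
  have x0: "fst s x = 0" if "s \<in> conic_comb S'" for s
    using that by (induction rule: conic_comb.induct) (auto simp: S'_def Z_def P_def N_def comb_def)
  from insert.IH[OF fin(3)] show ?case
  proof
    assume "\<exists>s\<in>conic_comb S'. (\<forall>v\<in>V. fst s v = 0) \<and> snd s < 0"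
    then obtain s where "s \<in> conic_comb S'" "\<forall>v\<in>V. fst s v = 0" "snd s < 0" by blast
    hence "s \<in> conic_comb S" "\<forall>v\<in>insert x V. fst s v = 0" "snd s < 0"
      using x0[of s] conic_comb_trans[OF _ sub, of s] by auto
    thus ?thesis by blast
  next
    assume "\<exists>y. \<forall>s\<in>S'. (\<Sum>v\<in>V. fst s v * y v) \<le> snd s"
    then obtain y where y: "\<And>s. s\<in>S' \<Longrightarrow> (\<Sum>v\<in>V. fst s v * y v) \<le> snd s" by blast
    \<comment> \<open>The bound that \<open>s\<close> puts on the value at \<open>x\<close> once the
      other values are fixed.\<close>
    define r where "r s = (snd s - (\<Sum>v\<in>V. fst s v * y v)) / fst s x" for s :: "('a \<Rightarrow> real) \<times> real"
    have rle: "r q \<le> r p" if "p \<in> P" "q \<in> N" for p q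
    proof -
      have "(\<Sum>v\<in>V. fst (comb p q) v * y v) = (\<Sum>v\<in>V. fst p v * y v) / fst p x + (\<Sum>v\<in>V. fst q v * y v) / (- fst q x)"
        unfolding sum_divide_distrib sum.distrib[symmetric] by (intro sum.cong) (auto simp: comb_def field_simps)
      moreover have "(\<Sum>v\<in>V. fst (comb p q) v * y v) \<le> snd (comb p q)"
        using that by (intro y) (auto simp: S'_def)
      ultimately show ?thesis by (simp add: comb_def r_def diff_divide_distrib)
    qed
    have "\<exists>t. (\<forall>q\<in>N. r q \<le> t) \<and> (\<forall>p\<in>P. t \<le> r p)"
    proof (rule finite_separate[of "r ` N" "r ` P"])
      show "finite (r ` N)" "finite (r ` P)" using fin by simp_all
      show "l \<le> u" if "l \<in> r ` N" "u \<in> r ` P" for l u using that rle by blast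
    qed blast
    then obtain t where t: "\<And>q. q \<in> N \<Longrightarrow> r q \<le> t" "\<And>p. p \<in> P \<Longrightarrow> t \<le> r p" by blast
    have "(\<Sum>v\<in>insert x V. fst s v * (y(x := t)) v) \<le> snd s" if s: "s \<in> S" for s
    proof -
      have eq: "(\<Sum>v\<in>insert x V. fst s v * (y(x := t)) v) = fst s x * t + (\<Sum>v\<in>V. fst s v * y v)"
        using insert.hyps by (auto intro!: sum.cong)
      consider "s \<in> P" | "s \<in> N" | "s \<in> Z" using s by (force simp: P_def N_def Z_def)
      thus ?thesis
      proof cases
        case 1 thus ?thesis unfolding eq using t(2)[of s] by (simp add: r_def P_def field_simps)
      next
        case 2 thus ?thesis unfolding eq using t(1)[of s] by (simp add: r_def N_def field_simps)
      next
        case 3 thus ?thesis unfolding eq using y[of s] by (simp add: S'_def Z_def)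
      qed
    qed
    thus ?thesis by blast
  qed
qed

lemma conic_comb_multipliers:
  assumes "s \<in> conic_comb (f ` I)" "finite I"
  shows "\<exists>l. (\<forall>i\<in>I. l i \<ge> 0) \<and> (\<forall>v. fst s v = (\<Sum>i\<in>I. l i * fst (f i) v)) \<and> snd s = (\<Sum>i\<in>I. l i * snd (f i))"
  using assms(1)
proof (induction rule: conic_comb.induct)
  case (base s)
  then obtain i where "i \<in> I" "s = f i" by blast
  thus ?case using assms(2)
    by (intro exI[of _ "\<lambda>j. of_bool (j = i)"]) (auto simp: of_bool_def if_distrib[of "\<lambda>x. x * _"] cong: if_cong)
next
  case (add s s')
  then obtain l l' where "\<forall>i\<in>I. l i \<ge> 0" "\<forall>v. fst s v = (\<Sum>i\<in>I. l i * fst (f i) v)" "snd s = (\<Sum>i\<in>I. l i * snd (f i))"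
    "\<forall>i\<in>I. l' i \<ge> 0" "\<forall>v. fst s' v = (\<Sum>i\<in>I. l' i * fst (f i) v)" "snd s' = (\<Sum>i\<in>I. l' i * snd (f i))" by blast
  thus ?case by (intro exI[of _ "\<lambda>i. l i + l' i"]) (auto simp: distrib_right sum.distrib)
next
  case (scale s c)
  then obtain l where "\<forall>i\<in>I. l i \<ge> 0" "\<forall>v. fst s v = (\<Sum>i\<in>I. l i * fst (f i) v)" "snd s = (\<Sum>i\<in>I. l i * snd (f i))" by blast
  thus ?case using scale(2) by (intro exI[of _ "\<lambda>i. c * l i"]) (auto simp: sum_distrib_left mult.assoc)
qed

definition lp_feasible :: "'k set \<Rightarrow> 'r set \<Rightarrow> ('r \<Rightarrow> 'k \<Rightarrow> real) \<Rightarrow> ('r \<Rightarrow> real) \<Rightarrow> ('k \<Rightarrow> real) \<Rightarrow> bool" where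
  "lp_feasible K R A b x \<longleftrightarrow> (\<forall>k\<in>K. x k \<ge> 0) \<and> (\<forall>r\<in>R. (\<Sum>k\<in>K. A r k * x k) = b r)"

text \<open>Farkas for the system \<open>A^T y \<le> c\<close>,
  \<open>- b y \<le> - \<gamma>\<close> with \<open>\<gamma>\<close> the optimum. A refutation
  consists of \<open>z \<ge> 0\<close> and \<open>\<tau> \<ge> 0\<close> with
  \<open>A z = \<tau> b\<close> and \<open>c z < \<tau> \<gamma>\<close>. If
  \<open>\<tau> > 0\<close>, then \<open>z / \<tau>\<close> beats the optimum; if
  \<open>\<tau> = 0\<close>, then \<open>x + z\<close> does.\<close>

lemma strong_duality:
  fixes A :: "'r \<Rightarrow> 'k \<Rightarrow> real"
  assumes fin: "finite K" "finite R" and x: "lp_feasible K R A b x"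
    and opt: "\<And>x'. lp_feasible K R A b x' \<Longrightarrow> (\<Sum>k\<in>K. c k * x k) \<le> (\<Sum>k\<in>K. c k * x' k)"
  obtains y where "\<And>k. k \<in> K \<Longrightarrow> (\<Sum>r\<in>R. A r k * y r) \<le> c k" "(\<Sum>k\<in>K. c k * x k) \<le> (\<Sum>r\<in>R. b r * y r)"
proof -
  define \<gamma> where "\<gamma> = (\<Sum>k\<in>K. c k * x k)"
  define f where "f i = (case i of Some k \<Rightarrow> (\<lambda>r. A r k, c k) | None \<Rightarrow> (\<lambda>r. - b r, - \<gamma>))" for i
  define I where "I = insert None (Some ` K)"
  have finI: "finite I" using fin by (simp add: I_def)
  have sumI: "(\<Sum>i\<in>I. g i) = g None + (\<Sum>k\<in>K. g (Some k))" for g :: "_ \<Rightarrow> real"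
    unfolding I_def by (subst sum.insert) (auto simp: fin sum.reindex)
  have "\<not> (\<exists>s\<in>conic_comb (f ` I). (\<forall>r\<in>R. fst s r = 0) \<and> snd s < 0)"
  proof
    assume "\<exists>s\<in>conic_comb (f ` I). (\<forall>r\<in>R. fst s r = 0) \<and> snd s < 0"
    then obtain s where s: "s \<in> conic_comb (f ` I)" "\<forall>r\<in>R. fst s r = 0" "snd s < 0" by blast
    obtain l where l: "\<forall>i\<in>I. l i \<ge> 0" "\<forall>v. fst s v = (\<Sum>i\<in>I. l i * fst (f i) v)" "snd s = (\<Sum>i\<in>I. l i * snd (f i))"
      using conic_comb_multipliers[OF s(1) finI] by blast
    define \<tau> where "\<tau> = l None"
    define z where "z k = l (Some k)" for k
    have pos: "\<tau> \<ge> 0" "\<And>k. k \<in> K \<Longrightarrow> z k \<ge> 0" using l(1) by (auto simp: I_def \<tau>_def z_def)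
    have z: "(\<Sum>k\<in>K. A r k * z k) = \<tau> * b r" if "r \<in> R" for r
      using l(2)[rule_format, of r] s(2) that unfolding sumI by (simp add: f_def \<tau>_def z_def mult.commute)
    have cz: "(\<Sum>k\<in>K. c k * z k) < \<tau> * \<gamma>"
      using s(3) unfolding l(3) sumI by (simp add: f_def \<tau>_def z_def mult.commute)
    show False
    proof (cases "\<tau> = 0")
      case False
      hence t: "\<tau> > 0" using pos by simp
      have "lp_feasible K R A b (\<lambda>k. z k / \<tau>)"
        unfolding lp_feasible_def using pos z t by (auto simp: sum_divide_distrib[symmetric])
      from opt[OF this] have "\<gamma> \<le> (\<Sum>k\<in>K. c k * z k) / \<tau>" by (simp add: \<gamma>_def sum_divide_distrib)
      thus False using cz t by (simp add: field_simps)
    next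
      case True
      have "lp_feasible K R A b (\<lambda>k. x k + z k)"
        using x z True pos unfolding lp_feasible_def by (auto simp: algebra_simps sum.distrib)
      from opt[OF this] show False using cz True by (simp add: algebra_simps sum.distrib)
    qed
  qed
  with farkas[OF fin(2), of "f ` I"] finI obtain y where y: "\<forall>s\<in>f ` I. (\<Sum>r\<in>R. fst s r * y r) \<le> snd s" by auto
  show ?thesis
  proof (rule that[of y])
    show "(\<Sum>r\<in>R. A r k * y r) \<le> c k" if "k \<in> K" for k
    proof -
      have "f (Some k) \<in> f ` I" using that by (auto simp: I_def)
      from y[rule_format, OF this] show ?thesis by (simp add: f_def)
    qed
    have "f None \<in> f ` I" by (auto simp: I_def)
    from y[rule_format, OF this] show "(\<Sum>k\<in>K. c k * x k) \<le> (\<Sum>r\<in>R. b r * y r)"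
      by (simp add: f_def \<gamma>_def sum_negf)
  qed
qed

text \<open>
  The homogenized optimality conditions of \<open>min c\<cdot>x, Ax = b, x \<ge> 0\<close>, with unknowns
  \<open>(t, x, y\<^sup>+, y\<^sup>-, s)\<close>: \<open>Ax = tb\<close>, \<open>A\<^sup>T(y\<^sup>+ - y\<^sup>-) + s = tc\<close> and \<open>c\<cdot>x = b\<cdot>(y\<^sup>+ - y\<^sup>-)\<close>.
\<close>

definition kkt_rows :: "'k list \<Rightarrow> 'r list \<Rightarrow> ('r \<Rightarrow> 'k \<Rightarrow> int) \<Rightarrow> ('r \<Rightarrow> int) \<Rightarrow> ('k \<Rightarrow> int) \<Rightarrow> int list list" where
  "kkt_rows ks rs coef rhs cost =
     map (\<lambda>r. (- rhs r) # map (coef r) ks @ map (\<lambda>_. 0) rs @ map (\<lambda>_. 0) rs @ map (\<lambda>_. 0) ks) rs @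
     map (\<lambda>k. (- cost k) # map (\<lambda>_. 0) ks @ map (\<lambda>r. coef r k) rs @ map (\<lambda>r. - coef r k) rs @
        map (\<lambda>k'. if k' = k then 1 else 0) ks) ks @
     [0 # map cost ks @ map (\<lambda>r. - rhs r) rs @ map rhs rs @ map (\<lambda>_. 0) ks]"

definition lp_solve :: "'k list \<Rightarrow> 'r list \<Rightarrow> ('r \<Rightarrow> 'k \<Rightarrow> int) \<Rightarrow> ('r \<Rightarrow> int) \<Rightarrow> ('k \<Rightarrow> int) \<Rightarrow> int list" where
  "lp_solve ks rs coef rhs cost =
     cone_solve (kkt_rows ks rs coef rhs cost)
       (0 # map (\<lambda>_. 0) ks @ map (\<lambda>_. 0) rs @ map (\<lambda>_. 0) rs @ map (\<lambda>_. 0) ks)"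

lemma dot_Cons: "dot (a # u) (b # v) = a * b + dot u v"
  by (simp add: dot_def)

lemma dot_append: "length u = length u' \<Longrightarrow> dot (u @ v) (u' @ v') = dot u u' + dot v v'"
  by (simp add: dot_def)

lemma dot_map: "distinct ks \<Longrightarrow> dot (map f ks) (map g ks) = (\<Sum>k\<in>set ks. f k * g k)"
  by (simp add: dot_def zip_map_map zip_same_conv_map comp_def sum_list_distinct_conv_sum_set)

text \<open>Names the entries of a block by its distinct keys, so that the solution vector can be
  split into functions on the unknowns.\<close>

lemma list_as_map:
  assumes "distinct ks" "length l = length ks"
  shows "l = map (\<lambda>k. the (map_of (zip ks l) k)) ks"
proof (rule nth_equalityI)
  fix i assume "i < length l"
  hence "map_of (zip ks l) (ks ! i) = Some (l ! i)"
    using assms by (intro map_of_is_SomeI) (auto simp: in_set_zip)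
  thus "l ! i = map (\<lambda>k. the (map_of (zip ks l) k)) ks ! i" using \<open>i < length l\<close> assms by simp
qed (use assms in simp)

lemma same_lengths_kkt:
  "same_lengths (kkt_rows ks rs coef rhs cost)
    (length (0 # map (\<lambda>_. 0 :: int) ks @ map (\<lambda>_. 0) rs @ map (\<lambda>_. 0) rs @ map (\<lambda>_. 0) ks))"
  by (auto simp: same_lengths_def kkt_rows_def)


text \<open>Strong duality provides a cone vector with \<open>t = 1\<close>; maximal support makes
  \<open>t\<close> positive in the computed vector, too. Dividing by \<open>t\<close> gives a primal
  solution, and its optimality is weak duality with the computed dual values.\<close>

lemma lp_solve_correct:
  fixes coef :: "'r \<Rightarrow> 'k \<Rightarrow> int"
  assumes d: "distinct ks" "distinct rs"
    and feas: "lp_feasible (set ks) (set rs) (\<lambda>r k. of_int (coef r k)) (\<lambda>r. of_int (rhs r)) x0"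
    and opt: "\<And>x'. lp_feasible (set ks) (set rs) (\<lambda>r k. of_int (coef r k)) (\<lambda>r. of_int (rhs r)) x' \<Longrightarrow>
      (\<Sum>k\<in>set ks. of_int (cost k) * x0 k) \<le> (\<Sum>k\<in>set ks. of_int (cost k) * x' k)"
  obtains t x vs where "lp_solve ks rs coef rhs cost = t # map x ks @ vs" "t > 0"
    "lp_feasible (set ks) (set rs) (\<lambda>r k. of_int (coef r k)) (\<lambda>r. of_int (rhs r)) (\<lambda>k. of_int (x k) / of_int t)"
    "\<And>x'. lp_feasible (set ks) (set rs) (\<lambda>r k. of_int (coef r k)) (\<lambda>r. of_int (rhs r)) x' \<Longrightarrow>
      (\<Sum>k\<in>set ks. of_int (cost k) * (of_int (x k) / of_int t)) \<le> (\<Sum>k\<in>set ks. of_int (cost k) * x' k)"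
proof -
  let ?K = "set ks" and ?R = "set rs"
  define tmpl where "tmpl = (0 # map (\<lambda>_. 0 :: int) ks @ map (\<lambda>_. 0) rs @ map (\<lambda>_. 0) rs @ map (\<lambda>_. 0) ks)"
  define rows where "rows = kkt_rows ks rs coef rhs cost"
  have same: "same_lengths rows (length tmpl)" unfolding rows_def tmpl_def by (rule same_lengths_kkt)
  have sol: "lp_solve ks rs coef rhs cost = cone_solve rows tmpl" by (simp add: lp_solve_def rows_def tmpl_def)
  note cs = cone_solve_correct[OF same, folded sol]
  obtain y where y: "\<And>k. k \<in> ?K \<Longrightarrow> (\<Sum>r\<in>?R. of_int (coef r k) * y r) \<le> (of_int (cost k) :: real)"
    "(\<Sum>k\<in>?K. of_int (cost k) * x0 k) \<le> (\<Sum>r\<in>?R. of_int (rhs r) * y r)"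
    using strong_duality[OF _ _ feas opt] by auto
  define sl where "sl k = of_int (cost k) - (\<Sum>r\<in>?R. of_int (coef r k) * y r)" for k
  \<comment> \<open>Weak duality as an identity: cost is dual value plus slack terms.\<close>
  have slack: "(\<Sum>k\<in>?K. of_int (cost k) * z k) = (\<Sum>r\<in>?R. of_int (rhs r) * y r) + (\<Sum>k\<in>?K. sl k * z k)"
    if "lp_feasible ?K ?R (\<lambda>r k. of_int (coef r k)) (\<lambda>r. of_int (rhs r)) z" for z
  proof -
    have "(\<Sum>k\<in>?K. of_int (cost k) * z k) - (\<Sum>k\<in>?K. sl k * z k) = (\<Sum>k\<in>?K. \<Sum>r\<in>?R. of_int (coef r k) * y r * z k)"
      unfolding sl_def sum_subtractf[symmetric] by (intro sum.cong) (auto simp: algebra_simps sum_distrib_left sum_distrib_right)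
    also have "\<dots> = (\<Sum>r\<in>?R. \<Sum>k\<in>?K. of_int (coef r k) * y r * z k)" by (rule sum.swap)
    also have "\<dots> = (\<Sum>r\<in>?R. (\<Sum>k\<in>?K. of_int (coef r k) * z k) * y r)"
      unfolding sum_distrib_right by (intro sum.cong refl) (simp add: mult_ac)
    also have "\<dots> = (\<Sum>r\<in>?R. of_int (rhs r) * y r)" using that by (simp add: lp_feasible_def)
    finally show ?thesis by simp
  qed
  have eq: "(\<Sum>k\<in>?K. of_int (cost k) * x0 k) = (\<Sum>r\<in>?R. of_int (rhs r) * y r)"
  proof -
    have "(\<Sum>k\<in>?K. sl k * x0 k) \<ge> 0"
      using y(1) feas by (intro sum_nonneg mult_nonneg_nonneg) (auto simp: sl_def lp_feasible_def)
    thus ?thesis using slack[OF feas] y(2) by linarith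
  qed
  \<comment> \<open>The certificate with \<open>t = 1\<close>: the optimum, the positive and
    negative parts of the dual solution, and the slacks.\<close>
  define g where "g = 1 # map x0 ks @ map (\<lambda>r. max (y r) 0) rs @ map (\<lambda>r. max (- y r) 0) rs @ map sl ks"
  have lg: "length g = length tmpl" by (simp add: g_def tmpl_def)
  have yy: "max (y r) 0 - max (- y r) 0 = y r" for r by (simp add: max_def)
  have yy': "a * max (y r) 0 - a * max (- y r) 0 = a * y r" for a r
    unfolding right_diff_distrib[symmetric] yy ..
  have yys: "(\<Sum>r\<in>?R. h r * max (y r) 0) - (\<Sum>r\<in>?R. h r * max (- y r) 0) = (\<Sum>r\<in>?R. h r * y r)" for h
    unfolding sum_subtractf[symmetric] yy' ..
  have dots: "dot (map real_of_int a) g = 0" if a: "a \<in> set rows" for a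
  proof -
    have f: "dot (map real_of_int (c # map f1 ks @ map f2 rs @ map f3 rs @ map f4 ks)) g =
        of_int c + (\<Sum>k\<in>?K. of_int (f1 k) * x0 k) + (\<Sum>r\<in>?R. of_int (f2 r) * max (y r) 0) +
        (\<Sum>r\<in>?R. of_int (f3 r) * max (- y r) 0) + (\<Sum>k\<in>?K. of_int (f4 k) * sl k)" for c f1 f2 f3 f4
      unfolding g_def by (simp add: dot_Cons dot_append dot_map d comp_def)
    from a consider r where "r \<in> ?R" "a = (- rhs r) # map (coef r) ks @ map (\<lambda>_. 0) rs @ map (\<lambda>_. 0) rs @ map (\<lambda>_. 0) ks"
      | k where "k \<in> ?K" "a = (- cost k) # map (\<lambda>_. 0) ks @ map (\<lambda>r. coef r k) rs @ map (\<lambda>r. - coef r k) rs @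
        map (\<lambda>k'. if k' = k then 1 else 0) ks"
      | "a = 0 # map cost ks @ map (\<lambda>r. - rhs r) rs @ map rhs rs @ map (\<lambda>_. 0) ks"
      by (auto simp: rows_def kkt_rows_def)
    thus ?thesis
    proof cases
      case 1
      show ?thesis unfolding 1(2) f using feas 1(1) by (simp add: lp_feasible_def)
    next
      case 2
      have "(\<Sum>k'\<in>?K. of_int (if k' = k then 1 else 0) * sl k') = (\<Sum>k'\<in>?K. if k' = k then sl k' else 0)"
        by (intro sum.cong) auto
      also have "\<dots> = sl k" using 2(1) by simp
      finally show ?thesis unfolding 2(2) f
        using yys[of "\<lambda>r. of_int (coef r k)"] by (simp add: sl_def sum_negf)
    next
      case 3
      show ?thesis unfolding 3 f using yys[of "\<lambda>r. of_int (rhs r)"] by (simp add: eq sum_negf)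
    qed
  qed
  have gk: "nth g \<in> kern (length tmpl) (nth ` set rows)"
  proof -
    have "ip (length tmpl) (ri (nth a)) (nth g) = 0" if a: "a \<in> set rows" for a
    proof -
      have la: "length a = length tmpl" using same a by (auto simp: same_lengths_def)
      have "ip (length tmpl) (ri (nth a)) (nth g) = ip (length tmpl) (nth (map real_of_int a)) (nth g)"
        using la by (intro ip_cong) auto
      also have "\<dots> = 0" using dot_ip[of "map real_of_int a" "length tmpl" g] la lg dots[OF a] by simp
      finally show ?thesis .
    qed
    thus ?thesis by (auto simp: kern_def)
  qed
  have gpos: "g ! i \<ge> 0" if "i < length tmpl" for i
  proof -
    have "\<forall>z\<in>set g. z \<ge> 0" using feas y(1) by (auto simp: g_def lp_feasible_def sl_def)
    thus ?thesis using that lg by simp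
  qed
  define v where "v = lp_solve ks rs coef rhs cost"
  have lv: "length v = length tmpl" using cs(1) by (simp add: v_def)
  have v0: "v ! 0 > 0" unfolding v_def by (rule cs(4)[OF gk gpos]) (auto simp: tmpl_def g_def)
  define n m where "n = length ks" and "m = length rs"
  have lv': "length v = Suc (n + m + m + n)" by (simp add: lv tmpl_def n_def m_def)
  \<comment> \<open>The computed vector is cut into its five blocks, and those after
    \<open>t\<close> are read as functions of their keys.\<close>
  obtain t v1 where v1: "v = t # v1" "length v1 = n + m + m + n" using lv' by (cases v) auto
  define x where "x k = the (map_of (zip ks (take n v1)) k)" for k
  define yp where "yp r = the (map_of (zip rs (take m (drop n v1))) r)" for r
  define ym where "ym r = the (map_of (zip rs (take m (drop (n + m) v1))) r)" for r
  define s where "s k = the (map_of (zip ks (drop (n + m + m) v1)) k)" for k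
  have split: "drop i v1 = take m (drop i v1) @ drop (i + m) v1" for i
    using append_take_drop_id[of m "drop i v1"] by (simp add: add.commute)
  have "v1 = take n v1 @ drop n v1" by simp
  also have "drop n v1 = take m (drop n v1) @ drop (n + m) v1" by (rule split)
  also have "drop (n + m) v1 = take m (drop (n + m) v1) @ drop (n + m + m) v1" by (rule split)
  also have "take n v1 = map x ks" unfolding x_def by (rule list_as_map[OF d(1)]) (simp add: v1 n_def)
  also have "take m (drop n v1) = map yp rs" unfolding yp_def by (rule list_as_map[OF d(2)]) (simp add: v1 m_def)
  also have "take m (drop (n + m) v1) = map ym rs" unfolding ym_def by (rule list_as_map[OF d(2)]) (simp add: v1 m_def)
  also have "drop (n + m + m) v1 = map s ks" unfolding s_def by (rule list_as_map[OF d(1)]) (simp add: v1 n_def)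
  finally have v: "v = t # map x ks @ map yp rs @ map ym rs @ map s ks" using v1 by simp
  have t: "t > 0" using v0 v by simp
  have "\<forall>z\<in>set v. z \<ge> 0" using cs(3) lv by (auto simp: v_def[symmetric] in_set_conv_nth)
  hence pos: "\<And>k. k \<in> ?K \<Longrightarrow> x k \<ge> 0" "\<And>k. k \<in> ?K \<Longrightarrow> s k \<ge> 0" unfolding v by auto
  have f: "dot (c # map f1 ks @ map f2 rs @ map f3 rs @ map f4 ks) v =
        c * t + (\<Sum>k\<in>?K. f1 k * x k) + (\<Sum>r\<in>?R. f2 r * yp r) +
        (\<Sum>r\<in>?R. f3 r * ym r) + (\<Sum>k\<in>?K. f4 k * s k)" for c f1 f2 f3 f4
      unfolding v by (simp add: dot_Cons dot_append dot_map d comp_def)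
  define yd where "yd r = yp r - ym r" for r
  have yd: "(\<Sum>r\<in>?R. h r * yd r) = (\<Sum>r\<in>?R. h r * yp r) - (\<Sum>r\<in>?R. h r * ym r)" for h
    by (simp add: yd_def right_diff_distrib sum_subtractf)
  have dv: "dot a v = 0" if "a \<in> set rows" for a
    using cs(2)[OF that] by (simp add: v_def)
  have P: "(\<Sum>k\<in>?K. coef r k * x k) = rhs r * t" if "r \<in> ?R" for r
  proof -
    have "(- rhs r) # map (coef r) ks @ map (\<lambda>_. 0) rs @ map (\<lambda>_. 0) rs @ map (\<lambda>_. 0) ks \<in> set rows"
      using that by (auto simp: rows_def kkt_rows_def)
    from dv[OF this] show ?thesis unfolding f by simp
  qed
  have D: "cost k * t = (\<Sum>r\<in>?R. coef r k * yd r) + s k" if "k \<in> ?K" for k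
  proof -
    have "(- cost k) # map (\<lambda>_. 0) ks @ map (\<lambda>r. coef r k) rs @ map (\<lambda>r. - coef r k) rs @
        map (\<lambda>k'. if k' = k then 1 else 0) ks \<in> set rows"
      using that by (auto simp: rows_def kkt_rows_def)
    from dv[OF this] have "- cost k * t + (\<Sum>r\<in>?R. coef r k * yp r) - (\<Sum>r\<in>?R. coef r k * ym r) +
        (\<Sum>k'\<in>?K. (if k' = k then 1 else 0) * s k') = 0"
      unfolding f by (simp add: sum_negf)
    moreover have "(\<Sum>k'\<in>?K. (if k' = k then 1 else 0) * s k') = (\<Sum>k'\<in>?K. if k' = k then s k' else 0)"
      by (intro sum.cong) auto
    hence "(\<Sum>k'\<in>?K. (if k' = k then 1 else 0) * s k') = s k" using that by simp
    ultimately show ?thesis unfolding yd by linarith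
  qed
  have C: "(\<Sum>k\<in>?K. cost k * x k) = (\<Sum>r\<in>?R. rhs r * yd r)"
  proof -
    have "0 # map cost ks @ map (\<lambda>r. - rhs r) rs @ map rhs rs @ map (\<lambda>_. 0) ks \<in> set rows"
      by (auto simp: rows_def kkt_rows_def)
    from dv[OF this] show ?thesis unfolding f yd by (simp add: sum_negf)
  qed
  have tr: "real_of_int t > 0" using t by simp
  show ?thesis
  proof (rule that[of t x "map yp rs @ map ym rs @ map s ks"])
    show "lp_solve ks rs coef rhs cost = t # map x ks @ map yp rs @ map ym rs @ map s ks" using v by (simp add: v_def)
    show "t > 0" by fact
    have "(\<Sum>k\<in>?K. real_of_int (coef r k) * (real_of_int (x k) / real_of_int t)) = real_of_int (rhs r)" if "r \<in> ?R" for r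
    proof -
      have "(\<Sum>k\<in>?K. real_of_int (coef r k) * (real_of_int (x k) / real_of_int t)) =
          real_of_int (\<Sum>k\<in>?K. coef r k * x k) / real_of_int t"
        by (simp add: sum_divide_distrib)
      thus ?thesis unfolding P[OF that] using tr by simp
    qed
    thus "lp_feasible ?K ?R (\<lambda>r k. of_int (coef r k)) (\<lambda>r. of_int (rhs r)) (\<lambda>k. of_int (x k) / of_int t)"
      using pos tr unfolding lp_feasible_def by auto
    fix x' :: "'k \<Rightarrow> real"
    assume x': "lp_feasible ?K ?R (\<lambda>r k. of_int (coef r k)) (\<lambda>r. of_int (rhs r)) x'"
    \<comment> \<open>Weak duality, multiplied by \<open>t\<close>: the cost of \<open>x'\<close> is
      the dual value plus nonnegative slack terms, and the dual value is the cost of the computed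
      \<open>x\<close>.\<close>
    have "(\<Sum>k\<in>?K. of_int (cost k) * x' k) * of_int t = (\<Sum>k\<in>?K. of_int (cost k * t) * x' k)"
      unfolding sum_distrib_right by (intro sum.cong refl) (simp add: mult_ac)
    also have "\<dots> = (\<Sum>k\<in>?K. (\<Sum>r\<in>?R. of_int (coef r k) * of_int (yd r) * x' k) + of_int (s k) * x' k)"
      by (intro sum.cong refl) (simp add: D distrib_right sum_distrib_right del: of_int_mult, simp)
    also have "\<dots> = (\<Sum>k\<in>?K. \<Sum>r\<in>?R. of_int (coef r k) * of_int (yd r) * x' k) + (\<Sum>k\<in>?K. of_int (s k) * x' k)"
      by (rule sum.distrib)
    also have "(\<Sum>k\<in>?K. \<Sum>r\<in>?R. of_int (coef r k) * of_int (yd r) * x' k) =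
        (\<Sum>r\<in>?R. \<Sum>k\<in>?K. of_int (coef r k) * of_int (yd r) * x' k)" by (rule sum.swap)
    also have "\<dots> = (\<Sum>r\<in>?R. (\<Sum>k\<in>?K. of_int (coef r k) * x' k) * of_int (yd r))"
      unfolding sum_distrib_right by (intro sum.cong refl) (simp add: mult_ac)
    also have "\<dots> = (\<Sum>r\<in>?R. of_int (rhs r) * of_int (yd r))" using x' by (simp add: lp_feasible_def)
    also have "\<dots> = real_of_int (\<Sum>k\<in>?K. cost k * x k)" unfolding C by simp
    finally have e: "(\<Sum>k\<in>?K. of_int (cost k) * x' k) * of_int t =
      real_of_int (\<Sum>k\<in>?K. cost k * x k) + (\<Sum>k\<in>?K. of_int (s k) * x' k)" .
    have "(\<Sum>k\<in>?K. of_int (s k) * x' k) \<ge> 0"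
      using pos x' by (intro sum_nonneg mult_nonneg_nonneg) (auto simp: lp_feasible_def)
    hence "real_of_int (\<Sum>k\<in>?K. cost k * x k) / of_int t \<le> (\<Sum>k\<in>?K. of_int (cost k) * x' k)"
      using e tr by (simp add: divide_le_eq)
    thus "(\<Sum>k\<in>?K. of_int (cost k) * (of_int (x k) / of_int t)) \<le> (\<Sum>k\<in>?K. of_int (cost k) * x' k)"
      by (simp add: sum_divide_distrib)
  qed
qed

type_synonym quad = "(nat \<times> nat) \<times> (nat \<times> nat)"

text \<open>\<open>coef\<close> and \<open>rhs\<close> are fixed functions of the names of rows and
  columns; only the cost depends on the instance, and it is compiled for keys that occur. Columns
  are quadruples of numbers because the slack block compares keys for equality.\<close>

lemma ptime_kkt_rows:
  fixes ks :: "'a::enc \<Rightarrow> quad list" and rs :: "'a \<Rightarrow> 'r::enc list"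
  assumes ks: "ptime D ks" and rs: "ptime D rs"
    and coef: "ptime UNIV (\<lambda>z. coef (fst z) (snd z))" and rhs: "ptime UNIV rhs"
    and cost: "ptime {z. fst z \<in> D \<and> snd z \<in> set (ks (fst z))} (\<lambda>z. cost (fst z) (snd z))"
  shows "ptime D (\<lambda>a. kkt_rows (ks a) (rs a) coef rhs (cost a))"
  unfolding kkt_rows_def
proof (intro ptime_append ptime_Cons ptime_Nil ptime_const)
  note comps = ptime_comp1[OF rhs] ptime_comp2[OF coef]
  show "ptime D (\<lambda>a. map (\<lambda>r. - rhs r # map (coef r) (ks a) @ map (\<lambda>_. 0) (rs a) @ map (\<lambda>_. 0) (rs a) @ map (\<lambda>_. 0) (ks a)) (rs a))"
    by (rule ptime_map[OF rs]) (intro pt comps ptime_comp[OF ks] ptime_comp[OF rs]; simp)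
  show "ptime D (\<lambda>a. map (\<lambda>k. - cost a k # map (\<lambda>_. 0) (ks a) @ map (\<lambda>r. coef r k) (rs a) @
      map (\<lambda>r. - coef r k) (rs a) @ map (\<lambda>k'. if k' = k then 1 else 0) (ks a)) (ks a))"
    by (rule ptime_map[OF ks]) (intro pt comps ptime_comp[OF ks] ptime_comp[OF rs] cost; simp)
  show "ptime D (\<lambda>a. map (cost a) (ks a))" by (rule ptime_map[OF ks cost])
  show "ptime D (\<lambda>a. map (\<lambda>r. - rhs r) (rs a))" "ptime D (\<lambda>a. map rhs (rs a))" "ptime D (\<lambda>a. map (\<lambda>_. 0 :: int) (ks a))"
    by (intro pt comps ks rs)+
qed

lemma ptime_lp_solve:
  fixes ks :: "'a::enc \<Rightarrow> quad list" and rs :: "'a \<Rightarrow> 'r::enc list"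
  assumes ks: "ptime D ks" and rs: "ptime D rs"
    and coef: "ptime UNIV (\<lambda>z. coef (fst z) (snd z))" and rhs: "ptime UNIV rhs"
    and cost: "ptime {z. fst z \<in> D \<and> snd z \<in> set (ks (fst z))} (\<lambda>z. cost (fst z) (snd z))"
  shows "ptime D (\<lambda>a. lp_solve (ks a) (rs a) coef rhs (cost a))"
  unfolding lp_solve_def
  by (intro ptime_cone_solve ptime_kkt_rows[OF assms] same_lengths_kkt)
    (intro pt ks rs)


section \<open>The local polytope as a linear program\<close>

text \<open>
  Since edges join distinct nodes, the key \<open>((u, u), (a, a))\<close> can stand for the component
  \<open>\<mu>\<^sub>u(a)\<close>, and \<open>((u, v), (a, b))\<close> with \<open>u \<noteq> v\<close> for \<open>\<mu>\<^sub>u\<^sub>v(a, b)\<close>.  The constraint \<open>((u, u), _)\<close> is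
  the normalization at \<open>u\<close>; \<open>((u, v), (True, a))\<close> and \<open>((u, v), (False, b))\<close> are the
  marginalizations to \<open>u\<close> and \<open>v\<close>.
\<close>

definition node_keys :: "('v, 'l) model \<Rightarrow> 'v set \<Rightarrow> (('v \<times> 'v) \<times> ('l \<times> 'l)) set" where
  "node_keys M A = (\<lambda>(u, a). ((u, u), (a, a))) ` (SIGMA u:A. labels M u)"

definition edge_keys :: "('v, 'l) model \<Rightarrow> 'v set \<Rightarrow> (('v \<times> 'v) \<times> ('l \<times> 'l)) set" where
  "edge_keys M A = (SIGMA e:edges_within M A. labels M (fst e) \<times> labels M (snd e))"

definition lp_keys :: "('v, 'l) model \<Rightarrow> 'v set \<Rightarrow> (('v \<times> 'v) \<times> ('l \<times> 'l)) set" where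
  "lp_keys M A = node_keys M A \<union> edge_keys M A"

text \<open>The normalization at \<open>u\<close> is listed once for every label of
  \<open>u\<close>, hence at least once because label sets are nonempty.\<close>

definition lp_constraints :: "('v, 'l) model \<Rightarrow> 'v set \<Rightarrow> (('v \<times> 'v) \<times> (bool \<times> 'l)) set" where
  "lp_constraints M A = (\<lambda>(u, a). ((u, u), (True, a))) ` (SIGMA u:A. labels M u) \<union>
     (SIGMA e:edges_within M A. Pair True ` labels M (fst e) \<union> Pair False ` labels M (snd e))"

text \<open>The matrix entry is computed from the two names alone, without the model: 1 at pairwise
  components and -1 at the unary one in a marginalization, 1 at all components of the node in a
  normalization.\<close>

definition lp_coef :: "('v \<times> 'v) \<times> (bool \<times> 'l) \<Rightarrow> ('v \<times> 'v) \<times> ('l \<times> 'l) \<Rightarrow> int" where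
  "lp_coef r k =
     (if fst (fst r) = snd (fst r) then (if fst k = fst r then 1 else 0)
      else if fst (snd r) then
        (if fst k = fst r \<and> fst (snd k) = snd (snd r) then 1
         else if k = ((fst (fst r), fst (fst r)), (snd (snd r), snd (snd r))) then - 1 else 0)
      else
        (if fst k = fst r \<and> snd (snd k) = snd (snd r) then 1
         else if k = ((snd (fst r), snd (fst r)), (snd (snd r), snd (snd r))) then - 1 else 0))"

definition lp_rhs :: "('v \<times> 'v) \<times> (bool \<times> 'l) \<Rightarrow> int" where
  "lp_rhs r = (if fst (fst r) = snd (fst r) then 1 else 0)"

definition flatten :: "('v, 'l) relaxed \<Rightarrow> ('v \<times> 'v) \<times> ('l \<times> 'l) \<Rightarrow> real" where
  "flatten \<mu> k = (if fst (fst k) = snd (fst k) then fst \<mu> (fst (fst k)) (fst (snd k))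
     else snd \<mu> (fst k) (fst (snd k)) (snd (snd k)))"

definition unflatten :: "(('v \<times> 'v) \<times> ('l \<times> 'l) \<Rightarrow> real) \<Rightarrow> ('v, 'l) relaxed" where
  "unflatten f = (\<lambda>u a. f ((u, u), (a, a)), \<lambda>e a b. f (e, (a, b)))"

text \<open>A boundary potential depends on the inner endpoint only, so it is part of the unary
  cost; the relaxed boundary energy is then a linear form in the keys.\<close>

definition lp_cost :: "('v, 'l) model \<Rightarrow> 'v set \<Rightarrow> ('v \<Rightarrow> 'l) \<Rightarrow> ('v \<times> 'v) \<times> ('l \<times> 'l) \<Rightarrow> real" where
  "lp_cost M A y k = (if fst (fst k) = snd (fst k)
     then unary M (fst (fst k)) (fst (snd k)) +
       (\<Sum>v\<in>{v\<in>nodes M - A. adjacent M (fst (fst k)) v}.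
          boundary_potential M (fst (fst k)) v (y (fst (fst k))) (fst (snd k)))
     else pairwise M (fst k) (fst (snd k)) (snd (snd k)))"

abbreviation lp_polytope :: "('v, 'l) model \<Rightarrow> 'v set \<Rightarrow> (('v \<times> 'v) \<times> ('l \<times> 'l) \<Rightarrow> real) \<Rightarrow> bool" where
  "lp_polytope M A \<equiv> lp_feasible (lp_keys M A) (lp_constraints M A) (\<lambda>r k. of_int (lp_coef r k)) (\<lambda>r. of_int (lp_rhs r))"

lemma lp_feasible_cong:
  "(\<And>k. k \<in> K \<Longrightarrow> f k = g k) \<Longrightarrow> lp_feasible K R A b f \<longleftrightarrow> lp_feasible K R A b g"
  unfolding lp_feasible_def by (auto cong: sum.cong)

context
  fixes M :: "('v, 'l) model" and A :: "'v set"
  assumes wf: "wf_model M" and A: "A \<subseteq> nodes M"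
begin

lemma finite_A: "finite A" and finite_edges: "finite (edges_within M A)"
  and finite_labels: "u \<in> A \<Longrightarrow> finite (labels M u)" and labels_nonempty: "u \<in> A \<Longrightarrow> labels M u \<noteq> {}"
  and edge_distinct: "(u, v) \<in> edges_within M A \<Longrightarrow> u \<noteq> v \<and> u \<in> A \<and> v \<in> A \<and> (v, u) \<notin> edges M"
proof -
  show "finite A" using wf A by (auto simp: wf_model_def intro: finite_subset)
  hence "finite (A \<times> A)" by simp
  thus "finite (edges_within M A)" by (rule finite_subset[rotated]) (auto simp: edges_within_def)
qed (use wf A in \<open>auto simp: wf_model_def edges_within_def\<close>)

lemma finite_keys: "finite (lp_keys M A)" and finite_constraints: "finite (lp_constraints M A)"
  using finite_A finite_edges finite_labels edge_distinct
  unfolding lp_keys_def node_keys_def edge_keys_def lp_constraints_def by auto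

lemma sum_keys:
  "(\<Sum>k\<in>lp_keys M A. h k) = (\<Sum>u\<in>A. \<Sum>a\<in>labels M u. h ((u, u), (a, a))) +
     (\<Sum>e\<in>edges_within M A. \<Sum>a\<in>labels M (fst e). \<Sum>b\<in>labels M (snd e). h (e, (a, b)))"
proof -
  have fin: "finite (node_keys M A)" "finite (edge_keys M A)"
    using finite_keys by (auto simp: lp_keys_def)
  have disj: "node_keys M A \<inter> edge_keys M A = {}"
    using edge_distinct by (fastforce simp: node_keys_def edge_keys_def)
  have inj: "inj_on (\<lambda>(u, a). ((u, u), (a, a))) (SIGMA u:A. labels M u)" by (auto simp: inj_on_def)
  have "(\<Sum>k\<in>node_keys M A. h k) = (\<Sum>u\<in>A. \<Sum>a\<in>labels M u. h ((u, u), (a, a)))"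
    unfolding node_keys_def sum.reindex[OF inj] using finite_A finite_labels
    by (subst sum.Sigma) (auto intro!: sum.cong)
  moreover have "(\<Sum>k\<in>edge_keys M A. h k) =
      (\<Sum>e\<in>edges_within M A. \<Sum>a\<in>labels M (fst e). \<Sum>b\<in>labels M (snd e). h (e, (a, b)))"
  proof -
    have "(\<Sum>k\<in>edge_keys M A. h k) = (\<Sum>e\<in>edges_within M A. \<Sum>p\<in>labels M (fst e) \<times> labels M (snd e). h (e, p))"
      unfolding edge_keys_def using finite_edges finite_labels edge_distinct
      by (subst sum.Sigma) (auto intro!: sum.cong)
    also have "\<dots> = (\<Sum>e\<in>edges_within M A. \<Sum>a\<in>labels M (fst e). \<Sum>b\<in>labels M (snd e). h (e, (a, b)))"
      by (intro sum.cong refl) (simp add: sum.cartesian_product)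
    finally show ?thesis .
  qed
  ultimately show ?thesis unfolding lp_keys_def sum.union_disjoint[OF fin disj] by simp
qed

lemma edges_within_no_loop: "e \<in> edges_within M A \<Longrightarrow> fst e \<noteq> snd e"
  using edge_distinct[of "fst e" "snd e"] by auto

lemma sum_node_constraint:
  assumes "u \<in> A"
  shows "(\<Sum>k\<in>lp_keys M A. of_int (lp_coef ((u, u), (i, c)) k) * f k) = (\<Sum>a\<in>labels M u. f ((u, u), (a, a)) :: real)"
proof -
  have "(\<Sum>k\<in>lp_keys M A. of_int (lp_coef ((u, u), (i, c)) k) * f k) =
      (\<Sum>u'\<in>A. if u' = u then \<Sum>a\<in>labels M u'. f ((u', u'), (a, a)) else 0) + (\<Sum>e\<in>edges_within M A. 0)"
    unfolding sum_keys
    by (intro arg_cong2[of _ _ _ _ "(+)"] sum.cong refl sum.neutral)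
       (auto simp: lp_coef_def dest: edges_within_no_loop)
  thus ?thesis using assms finite_A by simp
qed

lemma sum_edge_constraint:
  assumes e: "(u, v) \<in> edges_within M A"
  shows "a \<in> labels M u \<Longrightarrow> (\<Sum>k\<in>lp_keys M A. of_int (lp_coef ((u, v), (True, a)) k) * f k) =
      (\<Sum>b\<in>labels M v. f ((u, v), (a, b))) - (f ((u, u), (a, a)) :: real)"
    and "b \<in> labels M v \<Longrightarrow> (\<Sum>k\<in>lp_keys M A. of_int (lp_coef ((u, v), (False, b)) k) * f k) =
      (\<Sum>a\<in>labels M u. f ((u, v), (a, b))) - (f ((v, v), (b, b)) :: real)"
proof -
  have uv: "u \<noteq> v" "u \<in> A" "v \<in> A" using edge_distinct[OF e] by auto
  note fl = finite_labels[OF uv(2)] finite_labels[OF uv(3)]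
  have loop: "(w, w) \<notin> edges_within M A" for w using edges_within_no_loop[of "(w, w)"] by auto
  {
    assume a: "a \<in> labels M u"
    have "(\<Sum>k\<in>lp_keys M A. of_int (lp_coef ((u, v), (True, a)) k) * f k) =
      (\<Sum>u'\<in>A. if u' = u then (\<Sum>a'\<in>labels M u. if a' = a then - f ((u, u), (a, a)) else 0) else 0) +
      (\<Sum>e'\<in>edges_within M A. if e' = (u, v) then
         (\<Sum>a'\<in>labels M u. if a' = a then \<Sum>b\<in>labels M v. f ((u, v), (a, b)) else 0) else 0)"
      unfolding sum_keys using uv loop
      by (intro arg_cong2[of _ _ _ _ "(+)"] sum.cong refl)
         (auto simp: lp_coef_def intro!: sum.cong sum.neutral split: if_splits)
    also have "\<dots> = (\<Sum>b\<in>labels M v. f ((u, v), (a, b))) - f ((u, u), (a, a))"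
      using a uv e finite_A finite_edges fl by simp
    finally show "(\<Sum>k\<in>lp_keys M A. of_int (lp_coef ((u, v), (True, a)) k) * f k) =
      (\<Sum>b\<in>labels M v. f ((u, v), (a, b))) - (f ((u, u), (a, a)) :: real)" .
  }
  {
    assume b: "b \<in> labels M v"
    have "(\<Sum>k\<in>lp_keys M A. of_int (lp_coef ((u, v), (False, b)) k) * f k) =
      (\<Sum>u'\<in>A. if u' = v then (\<Sum>b'\<in>labels M v. if b' = b then - f ((v, v), (b, b)) else 0) else 0) +
      (\<Sum>e'\<in>edges_within M A. if e' = (u, v) then
         (\<Sum>a\<in>labels M u. \<Sum>b'\<in>labels M v. if b' = b then f ((u, v), (a, b)) else 0) else 0)"
      unfolding sum_keys using uv loop
      by (intro arg_cong2[of _ _ _ _ "(+)"] sum.cong refl)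
         (auto simp: lp_coef_def intro!: sum.cong sum.neutral split: if_splits)
    also have "\<dots> = (\<Sum>a\<in>labels M u. f ((u, v), (a, b))) - f ((v, v), (b, b))"
      using b uv e finite_A finite_edges fl by simp
    finally show "(\<Sum>k\<in>lp_keys M A. of_int (lp_coef ((u, v), (False, b)) k) * f k) =
      (\<Sum>a\<in>labels M u. f ((u, v), (a, b))) - (f ((v, v), (b, b)) :: real)" .
  }
qed

lemma local_polytope_flatten: "\<mu> \<in> local_polytope M A \<longleftrightarrow> lp_polytope M A (flatten \<mu>)"
proof -
  obtain \<mu>1 \<mu>2 where \<mu>: "\<mu> = (\<mu>1, \<mu>2)" by fastforce
  have n: "flatten \<mu> ((u, u), (a, a')) = \<mu>1 u a" for u a a' by (simp add: flatten_def \<mu>)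
  have e: "flatten \<mu> (e, (a, b)) = \<mu>2 e a b" if "e \<in> edges_within M A" for e a b
    using edges_within_no_loop[OF that] by (simp add: flatten_def \<mu>)
  have nonneg: "(\<forall>k\<in>lp_keys M A. flatten \<mu> k \<ge> 0) \<longleftrightarrow> (\<forall>u\<in>A. \<forall>a\<in>labels M u. 0 \<le> \<mu>1 u a) \<and>
      (\<forall>(u, v)\<in>edges_within M A. \<forall>a\<in>labels M u. \<forall>b\<in>labels M v. 0 \<le> \<mu>2 (u, v) a b)"
  proof -
    have "(\<forall>k\<in>node_keys M A. flatten \<mu> k \<ge> 0) \<longleftrightarrow> (\<forall>u\<in>A. \<forall>a\<in>labels M u. 0 \<le> \<mu>1 u a)"
      by (auto simp: node_keys_def n)
    moreover have "(\<forall>k\<in>edge_keys M A. flatten \<mu> k \<ge> 0) \<longleftrightarrow>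
        (\<forall>(u, v)\<in>edges_within M A. \<forall>a\<in>labels M u. \<forall>b\<in>labels M v. 0 \<le> \<mu>2 (u, v) a b)"
      unfolding edge_keys_def by (fastforce simp: e)
    ultimately show ?thesis unfolding lp_keys_def ball_Un by blast
  qed
  have con: "(\<forall>r\<in>lp_constraints M A. P r) \<longleftrightarrow> (\<forall>u\<in>A. \<forall>a\<in>labels M u. P ((u, u), (True, a))) \<and>
     (\<forall>(u, v)\<in>edges_within M A. (\<forall>a\<in>labels M u. P ((u, v), (True, a))) \<and> (\<forall>b\<in>labels M v. P ((u, v), (False, b))))" for P
    by (auto simp: lp_constraints_def ball_Un)
  have rhs: "lp_rhs ((u, v), p) = (if u = v then 1 else 0)" for u v and p :: "bool \<times> 'l" by (simp add: lp_rhs_def)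
  have cons: "(\<forall>r\<in>lp_constraints M A. (\<Sum>k\<in>lp_keys M A. of_int (lp_coef r k) * flatten \<mu> k) = of_int (lp_rhs r)) \<longleftrightarrow>
     (\<forall>u\<in>A. (\<Sum>a\<in>labels M u. \<mu>1 u a) = 1) \<and>
     (\<forall>(u, v)\<in>edges_within M A. (\<forall>a\<in>labels M u. (\<Sum>b\<in>labels M v. \<mu>2 (u, v) a b) = \<mu>1 u a) \<and>
        (\<forall>b\<in>labels M v. (\<Sum>a\<in>labels M u. \<mu>2 (u, v) a b) = \<mu>1 v b))"
    unfolding con
  proof (intro arg_cong2[of _ _ _ _ "(\<and>)"] ball_cong refl)
    fix u assume u: "u \<in> A"
    show "(\<forall>a\<in>labels M u. (\<Sum>k\<in>lp_keys M A. of_int (lp_coef ((u, u), (True, a)) k) * flatten \<mu> k) = of_int (lp_rhs ((u, u), (True, a)))) \<longleftrightarrow>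
      (\<Sum>a\<in>labels M u. \<mu>1 u a) = 1"
      unfolding sum_node_constraint[OF u] rhs n using labels_nonempty[OF u] by auto
  next
    fix p assume p: "p \<in> edges_within M A"
    obtain u v where uv: "p = (u, v)" by fastforce
    hence ed: "(u, v) \<in> edges_within M A" using p by simp
    note s = sum_edge_constraint[OF ed, of _ "flatten \<mu>"]
    have "u \<noteq> v" using edge_distinct[OF ed] by simp
    thus "(case p of (u, v) \<Rightarrow> (\<forall>a\<in>labels M u. (\<Sum>k\<in>lp_keys M A. of_int (lp_coef ((u, v), (True, a)) k) * flatten \<mu> k) = of_int (lp_rhs ((u, v), (True, a)))) \<and>
         (\<forall>b\<in>labels M v. (\<Sum>k\<in>lp_keys M A. of_int (lp_coef ((u, v), (False, b)) k) * flatten \<mu> k) = of_int (lp_rhs ((u, v), (False, b))))) \<longleftrightarrow>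
      (case p of (u, v) \<Rightarrow> (\<forall>a\<in>labels M u. (\<Sum>b\<in>labels M v. \<mu>2 (u, v) a b) = \<mu>1 u a) \<and>
        (\<forall>b\<in>labels M v. (\<Sum>a\<in>labels M u. \<mu>2 (u, v) a b) = \<mu>1 v b))"
      unfolding uv by (simp add: s rhs n e[OF ed])
  qed
  show ?thesis
    unfolding lp_feasible_def nonneg cons
    unfolding \<mu> local_polytope_def mem_Collect_eq case_prod_unfold fst_conv snd_conv ball_conj_distrib
    by (simp only: conj_ac prod.collapse)
qed

lemma flatten_unflatten: "k \<in> lp_keys M A \<Longrightarrow> flatten (unflatten f) k = f k"
  using edges_within_no_loop by (auto simp: lp_keys_def node_keys_def edge_keys_def flatten_def unflatten_def)

lemma relaxed_boundary_energy_flatten: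
  "relaxed_boundary_energy M A y \<mu> = (\<Sum>k\<in>lp_keys M A. lp_cost M A y k * flatten \<mu> k)"
proof -
  obtain \<mu>1 \<mu>2 where \<mu>: "\<mu> = (\<mu>1, \<mu>2)" by fastforce
  define N where "N u = {v\<in>nodes M - A. adjacent M u v}" for u
  have fN: "finite (N u)" for u using wf by (auto simp: N_def wf_model_def)
  have be: "boundary_edges M A = (SIGMA u:A. N u)" by (auto simp: boundary_edges_def N_def)
  have "(\<Sum>(u, v)\<in>boundary_edges M A. \<Sum>a\<in>labels M u. boundary_potential M u v (y u) a * \<mu>1 u a) =
      (\<Sum>u\<in>A. \<Sum>v\<in>N u. \<Sum>a\<in>labels M u. boundary_potential M u v (y u) a * \<mu>1 u a)"
    unfolding be using finite_A fN by (subst sum.Sigma) auto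
  also have "\<dots> = (\<Sum>u\<in>A. \<Sum>a\<in>labels M u. \<Sum>v\<in>N u. boundary_potential M u v (y u) a * \<mu>1 u a)"
    by (intro sum.cong refl sum.swap)
  finally have b: "(\<Sum>(u, v)\<in>boundary_edges M A. \<Sum>a\<in>labels M u. boundary_potential M u v (y u) a * \<mu>1 u a) = \<dots>" .
  have "(\<Sum>k\<in>lp_keys M A. lp_cost M A y k * flatten \<mu> k) =
     (\<Sum>u\<in>A. \<Sum>a\<in>labels M u. (unary M u a + (\<Sum>v\<in>N u. boundary_potential M u v (y u) a)) * \<mu>1 u a) +
     (\<Sum>e\<in>edges_within M A. \<Sum>a\<in>labels M (fst e). \<Sum>b\<in>labels M (snd e). pairwise M e a b * \<mu>2 e a b)"
    unfolding sum_keys by (intro arg_cong2[of _ _ _ _ "(+)"] sum.cong refl)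
      (auto simp: lp_cost_def flatten_def \<mu> N_def dest: edges_within_no_loop)
  also have "(\<Sum>u\<in>A. \<Sum>a\<in>labels M u. (unary M u a + (\<Sum>v\<in>N u. boundary_potential M u v (y u) a)) * \<mu>1 u a) =
     (\<Sum>u\<in>A. \<Sum>a\<in>labels M u. unary M u a * \<mu>1 u a) + (\<Sum>u\<in>A. \<Sum>a\<in>labels M u. \<Sum>v\<in>N u. boundary_potential M u v (y u) a * \<mu>1 u a)"
    by (simp add: distrib_right sum.distrib sum_distrib_right)
  finally show ?thesis
    using b unfolding relaxed_boundary_energy_def relaxed_energy_def \<mu> by (simp add: case_prod_unfold)
qed

lemma minimizers_iff: "x \<in> minimizers f S \<longleftrightarrow> x \<in> S \<and> (\<forall>y\<in>S. f x \<le> (f y :: real))"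
  by (auto simp: minimizers_def is_arg_min_def not_less)

text \<open>Every feasible point of the linear program is \<open>flatten (unflatten f)\<close> up to
  values off the keys, so minimality on either side transfers.\<close>

lemma minimizer_flatten:
  "\<mu> \<in> minimizers (relaxed_boundary_energy M A y) (local_polytope M A) \<longleftrightarrow> lp_polytope M A (flatten \<mu>) \<and>
    (\<forall>f. lp_polytope M A f \<longrightarrow> (\<Sum>k\<in>lp_keys M A. lp_cost M A y k * flatten \<mu> k) \<le> (\<Sum>k\<in>lp_keys M A. lp_cost M A y k * f k))"
  (is "?L \<longleftrightarrow> ?R")
proof
  assume R: ?R
  show ?L unfolding minimizers_iff
  proof (intro conjI ballI)
    show "\<mu> \<in> local_polytope M A" using R local_polytope_flatten[of \<mu>] by simp
    fix \<nu> assume "\<nu> \<in> local_polytope M A"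
    hence "lp_polytope M A (flatten \<nu>)" by (simp only: local_polytope_flatten)
    thus "relaxed_boundary_energy M A y \<mu> \<le> relaxed_boundary_energy M A y \<nu>"
      using R unfolding relaxed_boundary_energy_flatten by simp
  qed
next
  assume L: ?L
  have "(\<Sum>k\<in>lp_keys M A. lp_cost M A y k * flatten \<mu> k) \<le> (\<Sum>k\<in>lp_keys M A. lp_cost M A y k * f k)"
    if f: "lp_polytope M A f" for f
  proof -
    have "lp_polytope M A (flatten (unflatten f))"
      using f lp_feasible_cong[of "lp_keys M A" "flatten (unflatten f)" f] flatten_unflatten by blast
    hence "unflatten f \<in> local_polytope M A" by (simp only: local_polytope_flatten)
    hence "relaxed_boundary_energy M A y \<mu> \<le> relaxed_boundary_energy M A y (unflatten f)"
      using L unfolding minimizers_iff by blast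
    moreover have "(\<Sum>k\<in>lp_keys M A. lp_cost M A y k * flatten (unflatten f) k) = (\<Sum>k\<in>lp_keys M A. lp_cost M A y k * f k)"
      by (intro sum.cong refl) (simp add: flatten_unflatten)
    ultimately show ?thesis by (simp only: relaxed_boundary_energy_flatten)
  qed
  moreover have "lp_polytope M A (flatten \<mu>)"
    using L local_polytope_flatten[of \<mu>] by (simp add: minimizers_iff)
  ultimately show ?R by simp
qed

lemma indicator_in_polytope: "x \<in> labelings M A \<Longrightarrow> indicator_vector x \<in> local_polytope M A"
  using finite_labels edge_distinct unfolding local_polytope_def indicator_vector_def labelings_def
  by (fastforce simp: of_bool_def if_distrib if_distribR Pi_iff cong: if_cong conj_cong)

lemma exists_labeling: "\<exists>x. x \<in> labelings M A"
  using labels_nonempty unfolding labelings_def Pi_def by (auto intro!: exI[of _ "\<lambda>v. SOME a. a \<in> labels M v"] some_in_eq[THEN iffD2])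

text \<open>Unary components are bounded by the normalization, pairwise ones by the marginalization
  to \<open>u\<close>. This is the boundedness behind the existence of optima.\<close>

lemma polytope_le_1:
  assumes f: "lp_polytope M A f" and k: "k \<in> lp_keys M A"
  shows "f k \<le> 1"
proof -
  have nonneg: "\<And>k. k \<in> lp_keys M A \<Longrightarrow> f k \<ge> 0" and
    con: "\<And>r. r \<in> lp_constraints M A \<Longrightarrow> (\<Sum>k\<in>lp_keys M A. of_int (lp_coef r k) * f k) = of_int (lp_rhs r)"
    using f by (auto simp: lp_feasible_def)
  have node: "f ((u, u), (a, a)) \<le> 1" if "u \<in> A" "a \<in> labels M u" for u a
  proof -
    have "((u, u), (True, a)) \<in> lp_constraints M A" using that by (force simp: lp_constraints_def)
    from con[OF this] have "(\<Sum>a\<in>labels M u. f ((u, u), (a, a))) = 1"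
      unfolding sum_node_constraint[OF that(1)] by (simp add: lp_rhs_def)
    moreover have "f ((u, u), (a, a)) \<le> (\<Sum>a\<in>labels M u. f ((u, u), (a, a)))"
      using that finite_labels by (intro member_le_sum nonneg) (auto simp: lp_keys_def node_keys_def)
    ultimately show ?thesis by simp
  qed
  show ?thesis
  proof (cases "k \<in> node_keys M A")
    case True thus ?thesis using node by (auto simp: node_keys_def)
  next
    case False
    then obtain u v a b where k': "k = ((u, v), (a, b))" "(u, v) \<in> edges_within M A" "a \<in> labels M u" "b \<in> labels M v"
      using k by (auto simp: lp_keys_def edge_keys_def)
    have uv: "u \<noteq> v" "u \<in> A" "v \<in> A" using edge_distinct[OF k'(2)] by auto
    have "((u, v), (True, a)) \<in> lp_constraints M A" using k' by (force simp: lp_constraints_def)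
    from con[OF this] have "(\<Sum>b\<in>labels M v. f ((u, v), (a, b))) = f ((u, u), (a, a))"
      unfolding sum_edge_constraint(1)[OF k'(2,3)] using uv by (simp add: lp_rhs_def)
    moreover have "f k \<le> (\<Sum>b\<in>labels M v. f ((u, v), (a, b)))"
      unfolding k'(1) using k' finite_labels[OF uv(3)]
      by (intro member_le_sum[of b _ "\<lambda>b. f ((u, v), (a, b))"] nonneg) (auto simp: lp_keys_def edge_keys_def)
    ultimately show ?thesis using node[OF uv(2) k'(3)] by simp
  qed
qed

lemma lp_optimum_exists:
  "\<exists>f. lp_polytope M A f \<and> (\<forall>g. lp_polytope M A g \<longrightarrow> (\<Sum>k\<in>lp_keys M A. c k * f k) \<le> (\<Sum>k\<in>lp_keys M A. c k * (g k :: real)))"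
proof -
  let ?K = "lp_keys M A"
  \<comment> \<open>Coordinates off the keys are frozen at 0, which makes a product over the whole
    key type compact.\<close>
  define B where "B = PiE UNIV (\<lambda>k. if k \<in> ?K then {0..1::real} else {0})"
  define S where "S = B \<inter> {f. lp_polytope M A f}"
  have "compact B"
    unfolding B_def compactin_euclidean_iff[symmetric] euclidean_product_topology[symmetric] compactin_PiE
    by (auto simp: compactin_euclidean_iff)
  moreover have "closed {f. lp_polytope M A f}"
  proof -
    have "{f. lp_polytope M A f} = (\<Inter>k\<in>?K. {f. f k \<ge> 0}) \<inter>
       (\<Inter>r\<in>lp_constraints M A. {f. (\<Sum>k\<in>?K. of_int (lp_coef r k) * f k) = of_int (lp_rhs r)})"
      by (auto simp: lp_feasible_def)
    also have "closed \<dots>"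
      by (intro closed_Int closed_INT ballI closed_Collect_le closed_Collect_eq continuous_intros continuous_on_product_coordinates)
    finally show ?thesis .
  qed
  ultimately have "compact S" unfolding S_def by (rule compact_Int_closed)
  have restr: "\<exists>g\<in>S. \<forall>k\<in>?K. g k = f k" if "lp_polytope M A f" for f
  proof (rule bexI[of _ "\<lambda>k. if k \<in> ?K then f k else 0"])
    have "lp_polytope M A (\<lambda>k. if k \<in> ?K then f k else 0)"
      using that by (subst lp_feasible_cong[of _ _ f]) auto
    thus "(\<lambda>k. if k \<in> ?K then f k else 0) \<in> S"
      using that polytope_le_1[OF that] by (auto simp: S_def B_def lp_feasible_def)
  qed simp
  obtain x where "x \<in> labelings M A" using exists_labeling by blast
  hence "lp_polytope M A (flatten (indicator_vector x))"
    using indicator_in_polytope local_polytope_flatten by blast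
  with restr have "S \<noteq> {}" by blast
  moreover have "continuous_on S (\<lambda>f. \<Sum>k\<in>?K. c k * f k)"
    by (intro continuous_intros continuous_on_subset[OF continuous_on_product_coordinates]) auto
  ultimately obtain f where f: "f \<in> S" "\<forall>g\<in>S. (\<Sum>k\<in>?K. c k * f k) \<le> (\<Sum>k\<in>?K. c k * g k)"
    using continuous_attains_inf[OF \<open>compact S\<close>] by blast
  show ?thesis
  proof (intro exI[of _ f] conjI allI impI)
    show "lp_polytope M A f" using f by (simp add: S_def)
    fix g assume "lp_polytope M A g"
    then obtain g' where g': "g' \<in> S" "\<forall>k\<in>?K. g' k = g k" using restr by blast
    have "(\<Sum>k\<in>?K. c k * g' k) = (\<Sum>k\<in>?K. c k * g k)" using g'(2) by (intro sum.cong) auto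
    thus "(\<Sum>k\<in>?K. c k * f k) \<le> (\<Sum>k\<in>?K. c k * g k)" using f(2) g'(1) by fastforce
  qed
qed

lemma relaxed_minimizer_exists: "\<exists>\<mu>. \<mu> \<in> minimizers (relaxed_boundary_energy M A y) (local_polytope M A)"
proof -
  obtain f where f: "lp_polytope M A f"
    "\<And>g. lp_polytope M A g \<Longrightarrow> (\<Sum>k\<in>lp_keys M A. lp_cost M A y k * f k) \<le> (\<Sum>k\<in>lp_keys M A. lp_cost M A y k * g k)"
    using lp_optimum_exists[of "lp_cost M A y"] by blast
  have "lp_polytope M A (flatten (unflatten f))"
    using f(1) lp_feasible_cong[of "lp_keys M A" "flatten (unflatten f)" f] flatten_unflatten by blast
  moreover have "(\<Sum>k\<in>lp_keys M A. lp_cost M A y k * flatten (unflatten f) k) = (\<Sum>k\<in>lp_keys M A. lp_cost M A y k * f k)"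
    by (intro sum.cong refl) (simp add: flatten_unflatten)
  ultimately have "unflatten f \<in> minimizers (relaxed_boundary_energy M A y) (local_polytope M A)"
    unfolding minimizer_flatten using f(2) by auto
  thus ?thesis by blast
qed

end


section \<open>Correctness of the pruning algorithm\<close>

lemma relaxed_boundary_energy_nodes: "relaxed_boundary_energy M (nodes M) y = relaxed_energy M (nodes M)"
  by (rule ext) (simp add: relaxed_boundary_energy_def boundary_edges_def)

lemma polytope_sum: "\<mu> \<in> local_polytope M A \<Longrightarrow> u \<in> A \<Longrightarrow> (\<Sum>a\<in>labels M u. fst \<mu> u a) = 1"
  and polytope_nonneg: "\<mu> \<in> local_polytope M A \<Longrightarrow> u \<in> A \<Longrightarrow> a \<in> labels M u \<Longrightarrow> fst \<mu> u a \<ge> 0"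
  by (auto simp: local_polytope_def)

lemma polytope_label_unique:
  assumes wf: "wf_model M" "A \<subseteq> nodes M" and \<mu>: "\<mu> \<in> local_polytope M A" and u: "u \<in> A"
    and a: "a \<in> labels M u" "fst \<mu> u a = 1" and b: "b \<in> labels M u" "b \<noteq> a"
  shows "fst \<mu> u b = 0"
proof -
  have fin: "finite (labels M u)" using wf u by (auto simp: wf_model_def)
  have "(\<Sum>c\<in>{a, b}. fst \<mu> u c) \<le> (\<Sum>c\<in>labels M u. fst \<mu> u c)"
    using a b polytope_nonneg[OF \<mu> u] by (intro sum_mono2 fin) auto
  thus ?thesis using polytope_sum[OF \<mu> u] polytope_nonneg[OF \<mu> u b(1)] a b by simp
qed

lemma integral_label:
  assumes \<mu>: "\<mu> \<in> local_polytope M A" and u: "u \<in> integral_nodes M A \<mu>"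
  shows "\<exists>a\<in>labels M u. fst \<mu> u a = 1"
proof (rule ccontr)
  assume "\<not> ?thesis"
  hence "fst \<mu> u a = 0" if "a \<in> labels M u" for a using u that by (auto simp: integral_nodes_def)
  hence "(\<Sum>a\<in>labels M u. fst \<mu> u a) = 0" by (intro sum.neutral) auto
  thus False using polytope_sum[OF \<mu>, of u] u by (simp add: integral_nodes_def)
qed

lemma rounding_exists:
  assumes \<mu>: "\<mu> \<in> local_polytope M A" and B: "B \<subseteq> integral_nodes M A \<mu>"
  shows "\<exists>x. rounds_to M B \<mu> x"
proof -
  have "\<forall>u\<in>B. \<exists>a. a \<in> labels M u \<and> fst \<mu> u a = 1" using integral_label[OF \<mu>] B by blast
  then obtain x where "\<forall>u\<in>B. x u \<in> labels M u \<and> fst \<mu> u (x u) = 1" by metis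
  thus ?thesis by (auto simp: rounds_to_def labelings_def)
qed

text \<open>\<open>B\<close> is the set on which \<open>\<mu> t\<close> is a relaxed labeling: all
  nodes initially, \<open>A (t - 1)\<close> afterwards. That \<open>A t\<close> lies within its
  integral nodes is what makes the rounding \<open>x t\<close> exist.\<close>

lemma trace_invariant:
  assumes wf: "wf_model M" and tr: "pruning_trace M \<mu> A x n" and t: "t \<le> n"
  shows "A t \<subseteq> nodes M \<and> (\<exists>B\<subseteq>nodes M. \<mu> t \<in> local_polytope M B \<and> A t \<subseteq> integral_nodes M B (\<mu> t))"
  using t
proof (induction t)
  case 0
  have "\<mu> 0 \<in> local_polytope M (nodes M)" "A 0 = integral_nodes M (nodes M) (\<mu> 0)"
    using tr by (auto simp: pruning_trace_def pruning_init_def minimizers_iff[OF wf order_refl])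
  thus ?case by (auto simp: integral_nodes_def)
next
  case (Suc t)
  hence At: "A t \<subseteq> nodes M" and st: "pruning_step M (\<mu> t) (A t) (x t) (\<mu> (Suc t)) (A (Suc t))"
    using tr by (auto simp: pruning_trace_def)
  have "\<mu> (Suc t) \<in> local_polytope M (A t)" "A (Suc t) \<subseteq> integral_nodes M (A t) (\<mu> (Suc t))"
    using st by (auto simp: pruning_step_def minimizers_iff[OF wf order_refl])
  thus ?case using At by (auto simp: integral_nodes_def)
qed

lemma trace_decreasing:
  assumes "pruning_trace M \<mu> A x n" "t < n"
  shows "A (Suc t) \<subseteq> A t"
  using assms by (auto simp: pruning_trace_def pruning_step_def integral_nodes_def)

text \<open>A pass that does not halt removes at least one node.\<close>

lemma trace_card:
  assumes wf: "wf_model M" and tr: "pruning_trace M \<mu> A x n" and t: "t \<le> n" and nh: "\<And>s. s \<le> t \<Longrightarrow> \<not> halted A s"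
  shows "card (A t) + t \<le> card (nodes M)"
  using t nh
proof (induction t)
  case 0
  have "finite (nodes M)" using wf by (simp add: wf_model_def)
  thus ?case using trace_invariant[OF wf tr, of 0] by (simp add: card_mono)
next
  case (Suc t)
  have "A (Suc t) \<subseteq> A t" using trace_decreasing[OF tr] Suc.prems by simp
  moreover have "A (Suc t) \<noteq> A t" using Suc.prems(2)[of "Suc t"] by (simp add: halted_def)
  moreover have "finite (A t)"
    using trace_invariant[OF wf tr, of t] Suc.prems wf by (auto simp: wf_model_def intro: finite_subset)
  ultimately have "card (A (Suc t)) < card (A t)" by (simp add: psubset_card_mono psubset_eq)
  moreover have "card (A t) + t \<le> card (nodes M)" using Suc by simp
  ultimately show ?case by linarith
qed

text \<open>A run never gets stuck: integral nodes can be rounded, and the next subproblem has a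
  minimizer. The three sequences are changed only beyond the part already executed.\<close>

lemma trace_extend:
  assumes wf: "wf_model M" and tr: "pruning_trace M \<mu> A x n" and nh: "\<not> halted A n"
  shows "\<exists>\<mu>' A' x'. pruning_trace M \<mu>' A' x' (Suc n) \<and> (\<forall>t\<le>n. \<mu>' t = \<mu> t \<and> A' t = A t) \<and> (\<forall>t<n. x' t = x t)"
proof -
  obtain B where B: "\<mu> n \<in> local_polytope M B" "A n \<subseteq> integral_nodes M B (\<mu> n)" and An: "A n \<subseteq> nodes M"
    using trace_invariant[OF wf tr order_refl] by blast
  obtain y where y: "rounds_to M (A n) (\<mu> n) y" using rounding_exists[OF B] by blast
  obtain \<nu> where \<nu>: "\<nu> \<in> minimizers (relaxed_boundary_energy M (A n) y) (local_polytope M (A n))"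
    using relaxed_minimizer_exists[OF wf An] by blast
  define A1 where "A1 = integral_nodes M (A n) \<nu> - {u \<in> boundary_nodes M (A n). fst \<nu> u (y u) \<noteq> 1}"
  have "pruning_step M (\<mu> n) (A n) y \<nu> A1" using y \<nu> by (simp add: pruning_step_def A1_def)
  hence "pruning_trace M (\<mu>(Suc n := \<nu>)) (A(Suc n := A1)) (x(n := y)) (Suc n)"
    using tr nh by (auto simp: pruning_trace_def less_Suc_eq halted_def)
  thus ?thesis by (intro exI[of _ "\<mu>(Suc n := \<nu>)"] exI[of _ "A(Suc n := A1)"] exI[of _ "x(n := y)"]) auto
qed

lemma relaxed_boundary_energy_cong:
  assumes "\<And>u. u \<in> boundary_nodes M A \<Longrightarrow> y u = y' u"
  shows "relaxed_boundary_energy M A y = relaxed_boundary_energy M A y'"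
proof -
  have "y u = y' u" if "(u, v) \<in> boundary_edges M A" for u v
    using that by (intro assms) (auto simp: boundary_edges_def boundary_nodes_def)
  thus ?thesis unfolding relaxed_boundary_energy_def
    by (intro ext arg_cong2[of _ _ _ _ "(+)"] refl sum.cong) auto
qed

text \<open>A pairwise component is bounded by both of its marginals, so it vanishes unless both
  labels are the rounded ones; the marginal sum then makes the remaining one equal to 1.\<close>

lemma flatten_integral:
  assumes wf: "wf_model M" "A \<subseteq> nodes M" and \<mu>: "\<mu> \<in> local_polytope M A" and x: "rounds_to M A \<mu> x"
    and k: "k \<in> lp_keys M A"
  shows "flatten \<mu> k = flatten (indicator_vector x) k"
proof -
  have node: "fst \<mu> u a = of_bool (x u = a)" if "u \<in> A" "a \<in> labels M u" for u a
    using polytope_label_unique[OF wf \<mu> that(1), of "x u" a] that x by (auto simp: rounds_to_def labelings_def)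
  show ?thesis
  proof (cases "k \<in> node_keys M A")
    case True
    thus ?thesis using node by (auto simp: node_keys_def flatten_def indicator_vector_def)
  next
    case False
    then obtain u v a b where k': "k = ((u, v), (a, b))" "(u, v) \<in> edges_within M A" "a \<in> labels M u" "b \<in> labels M v"
      using k by (auto simp: lp_keys_def edge_keys_def)
    have uv: "u \<noteq> v" "u \<in> A" "v \<in> A" using edge_distinct[OF wf k'(2)] by auto
    have fin: "finite (labels M u)" "finite (labels M v)" using finite_labels[OF wf] uv by auto
    have nonneg: "\<And>a b. a \<in> labels M u \<Longrightarrow> b \<in> labels M v \<Longrightarrow> snd \<mu> (u, v) a b \<ge> 0"
      and mu: "\<And>a. a \<in> labels M u \<Longrightarrow> (\<Sum>b\<in>labels M v. snd \<mu> (u, v) a b) = fst \<mu> u a"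
      and mv: "\<And>b. b \<in> labels M v \<Longrightarrow> (\<Sum>a\<in>labels M u. snd \<mu> (u, v) a b) = fst \<mu> v b"
      using \<mu> k'(2) by (auto simp: local_polytope_def)
    have le_u: "snd \<mu> (u, v) a b \<le> fst \<mu> u a" if "a \<in> labels M u" "b \<in> labels M v" for a b
      unfolding mu[OF that(1), symmetric] using that fin nonneg by (intro member_le_sum) auto
    have le_v: "snd \<mu> (u, v) a b \<le> fst \<mu> v b" if "a \<in> labels M u" "b \<in> labels M v" for a b
      unfolding mv[OF that(2), symmetric] using that fin nonneg
      by (intro member_le_sum[of a _ "\<lambda>a. snd \<mu> (u, v) a b"]) auto
    have xu: "x u \<in> labels M u" "x v \<in> labels M v" using x uv by (auto simp: rounds_to_def labelings_def)
    have zero: "snd \<mu> (u, v) a b = 0" if "a \<in> labels M u" "b \<in> labels M v" "a \<noteq> x u \<or> b \<noteq> x v" for a b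
      using le_u[OF that(1,2)] le_v[OF that(1,2)] nonneg[OF that(1,2)] node uv that by auto
    have "(\<Sum>b\<in>labels M v. snd \<mu> (u, v) (x u) b) = (\<Sum>b\<in>labels M v. if b = x v then snd \<mu> (u, v) (x u) (x v) else 0)"
      using zero[OF xu(1)] by (intro sum.cong) auto
    hence one: "snd \<mu> (u, v) (x u) (x v) = 1" using mu[OF xu(1)] node[OF uv(2) xu(1)] xu fin by simp
    show ?thesis unfolding k'(1) using zero[OF k'(3,4)] one uv(1)
      by (cases "a = x u \<and> b = x v") (auto simp: flatten_def indicator_vector_def)
  qed
qed

lemma indicator_minimizer:
  assumes wf: "wf_model M" "A \<subseteq> nodes M"
    and \<mu>: "\<mu> \<in> minimizers (relaxed_boundary_energy M A y) (local_polytope M A)" and x: "rounds_to M A \<mu> x"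
    and y: "y \<in> labelings M A" "\<And>u. u \<in> boundary_nodes M A \<Longrightarrow> fst \<mu> u (y u) = 1"
  shows "indicator_vector x \<in> minimizers (relaxed_boundary_energy M A x) (local_polytope M A)"
proof -
  have \<mu>P: "\<mu> \<in> local_polytope M A" using \<mu> by (simp add: minimizers_iff[OF wf])
  have "y u = x u" if "u \<in> boundary_nodes M A" for u
  proof (rule ccontr)
    assume "y u \<noteq> x u"
    have u: "u \<in> A" using that by (simp add: boundary_nodes_def)
    hence "fst \<mu> u (y u) = 0"
      using polytope_label_unique[OF wf \<mu>P u, of "x u" "y u"] x y(1) \<open>y u \<noteq> x u\<close>
      by (auto simp: rounds_to_def labelings_def)
    thus False using y(2)[OF that] by simp
  qed
  hence E: "relaxed_boundary_energy M A y = relaxed_boundary_energy M A x" by (rule relaxed_boundary_energy_cong)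
  have "relaxed_boundary_energy M A x \<mu> = relaxed_boundary_energy M A x (indicator_vector x)"
    unfolding relaxed_boundary_energy_flatten[OF wf] using flatten_integral[OF wf \<mu>P x] by (intro sum.cong) auto
  moreover have "indicator_vector x \<in> local_polytope M A"
    using indicator_in_polytope[OF wf] x by (simp add: rounds_to_def)
  ultimately show ?thesis using \<mu> unfolding E minimizers_iff[OF wf] by simp
qed

section \<open>Persistence\<close>

lemma energy_minimizer_exists:
  assumes wf: "wf_model M"
  shows "\<exists>z. z \<in> minimizers (energy M (nodes M)) (labelings M (nodes M))"
proof -
  let ?V = "nodes M"
  \<comment> \<open>The minimum is taken over extensional functions, of which there are finitely
    many; restricting a labeling to the nodes leaves its energy unchanged.\<close>
  have fin: "finite (PiE ?V (labels M))" using wf by (intro finite_PiE) (auto simp: wf_model_def)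
  have ne: "PiE ?V (labels M) \<noteq> {}" using wf by (auto simp: PiE_eq_empty_iff wf_model_def)
  obtain z where z: "z \<in> PiE ?V (labels M)" "\<And>w. w \<in> PiE ?V (labels M) \<Longrightarrow> energy M ?V z \<le> energy M ?V w"
    using ex_is_arg_min_if_finite[OF fin ne, of "energy M ?V"] by (auto simp: is_arg_min_def not_less)
  have "energy M ?V (restrict w ?V) = energy M ?V w" for w
    unfolding energy_def by (intro arg_cong2[of _ _ _ _ "(+)"] sum.cong refl) (auto simp: edges_within_def)
  hence "energy M ?V z \<le> energy M ?V w" if "w \<in> labelings M ?V" for w
    using z(2)[of "restrict w ?V"] that by (auto simp: labelings_def)
  thus ?thesis using z(1) unfolding minimizers_iff[OF wf order_refl]
    by (auto simp: labelings_def PiE_def)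
qed

text \<open>Edges are stored in one orientation, while boundary edges are listed with the inner
  endpoint first: those leaving \<open>A\<close> are \<open>C1\<close>, those entering it are
  \<open>C2\<close> and have to be swapped. \<open>edge_potential\<close> undoes the swap.\<close>

lemma energy_split:
  assumes wf: "wf_model M" and A: "A \<subseteq> nodes M"
  shows "energy M (nodes M) z = energy M A z + energy M (nodes M - A) z +
    (\<Sum>(u, v)\<in>boundary_edges M A. edge_potential M u v (z u) (z v))"
proof -
  let ?V = "nodes M"
  have fV: "finite ?V" using wf by (simp add: wf_model_def)
  have fE: "finite (edges M)"
    using wf fV finite_subset[of "edges M" "?V \<times> ?V"] by (auto simp: wf_model_def)
  have asym: "(u, v) \<in> edges M \<Longrightarrow> (v, u) \<notin> edges M" and EV: "edges M \<subseteq> ?V \<times> ?V" for u v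
    using wf by (auto simp: wf_model_def)
  define C1 C2 where "C1 = {e \<in> edges M. fst e \<in> A \<and> snd e \<in> ?V - A}" and "C2 = {e \<in> edges M. fst e \<in> ?V - A \<and> snd e \<in> A}"
  define g where "g e = pairwise M e (z (fst e)) (z (snd e))" for e
  have all: "edges_within M ?V = edges_within M A \<union> edges_within M (?V - A) \<union> (C1 \<union> C2)"
    using EV A by (auto simp: edges_within_def C1_def C2_def)
  have fin: "finite (edges_within M A)" "finite (edges_within M (?V - A))" "finite C1" "finite C2"
    by (rule finite_subset[OF _ fE]; auto simp: edges_within_def C1_def C2_def)+
  have "(\<Sum>e\<in>edges_within M ?V. g e) = (\<Sum>e\<in>edges_within M A. g e) + (\<Sum>e\<in>edges_within M (?V - A). g e) +
      ((\<Sum>e\<in>C1. g e) + (\<Sum>e\<in>C2. g e))"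
    unfolding all using fin
    by (subst sum.union_disjoint, simp, simp, force simp: edges_within_def C1_def C2_def)
       (subst sum.union_disjoint, simp, simp, force simp: edges_within_def,
        subst sum.union_disjoint, simp, simp, force simp: C1_def C2_def, simp)
  moreover have "(\<Sum>(u, v)\<in>boundary_edges M A. edge_potential M u v (z u) (z v)) = (\<Sum>e\<in>C1. g e) + (\<Sum>e\<in>C2. g e)"
  proof -
    have be: "boundary_edges M A = C1 \<union> prod.swap ` C2"
      using A EV by (auto simp: boundary_edges_def C1_def C2_def adjacent_def image_iff)
    have disj: "C1 \<inter> prod.swap ` C2 = {}" using asym by (auto simp: C1_def C2_def)
    have "(\<Sum>(u, v)\<in>boundary_edges M A. edge_potential M u v (z u) (z v)) =
        (\<Sum>(u, v)\<in>C1. edge_potential M u v (z u) (z v)) + (\<Sum>(u, v)\<in>prod.swap ` C2. edge_potential M u v (z u) (z v))"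
      unfolding be using fin disj by (intro sum.union_disjoint) auto
    also have "(\<Sum>(u, v)\<in>C1. edge_potential M u v (z u) (z v)) = (\<Sum>e\<in>C1. g e)"
      by (intro sum.cong refl) (auto simp: C1_def edge_potential_def g_def)
    also have "(\<Sum>(u, v)\<in>prod.swap ` C2. edge_potential M u v (z u) (z v)) = (\<Sum>e\<in>C2. g e)"
      using asym by (subst sum.reindex) (auto simp: C2_def edge_potential_def g_def intro!: sum.cong)
    finally show ?thesis .
  qed
  moreover have "(\<Sum>u\<in>?V. unary M u (z u)) = (\<Sum>u\<in>A. unary M u (z u)) + (\<Sum>u\<in>?V - A. unary M u (z u))"
    using sum.subset_diff[OF A fV] by (simp add: add.commute)
  ultimately show ?thesis unfolding energy_def by (simp add: case_prod_unfold g_def)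
qed

lemma relaxed_boundary_energy_indicator:
  assumes wf: "wf_model M" "A \<subseteq> nodes M" and z: "z \<in> labelings M A"
  shows "relaxed_boundary_energy M A y (indicator_vector z) =
    energy M A z + (\<Sum>(u, v)\<in>boundary_edges M A. boundary_potential M u v (y u) (z u))"
proof -
  have fl: "finite (labels M u)" if "u \<in> A" for u using wf that by (auto simp: wf_model_def)
  have zl: "z u \<in> labels M u" if "u \<in> A" for u using z that by (auto simp: labelings_def)
  have pick: "(\<Sum>a\<in>labels M u. f a * of_bool (z u = a)) = f (z u)" if "u \<in> A" for u and f :: "'b \<Rightarrow> real"
  proof -
    have "(\<Sum>a\<in>labels M u. f a * of_bool (z u = a)) = (\<Sum>a\<in>labels M u. if a = z u then f a else 0)"
      by (intro sum.cong) auto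
    thus ?thesis using fl[OF that] zl[OF that] by simp
  qed
  have pick2: "(\<Sum>a\<in>labels M u. \<Sum>b\<in>labels M v. f a b * of_bool (z u = a \<and> z v = b)) = f (z u) (z v)"
    if "u \<in> A" "v \<in> A" for u v and f :: "'b \<Rightarrow> 'b \<Rightarrow> real"
  proof -
    have "(\<Sum>a\<in>labels M u. \<Sum>b\<in>labels M v. f a b * of_bool (z u = a \<and> z v = b)) =
       (\<Sum>a\<in>labels M u. (\<Sum>b\<in>labels M v. f a b * of_bool (z v = b)) * of_bool (z u = a))"
      by (intro sum.cong refl) (auto simp: of_bool_def)
    thus ?thesis using that by (simp add: pick)
  qed
  show ?thesis
    unfolding relaxed_boundary_energy_def relaxed_energy_def energy_def indicator_vector_def case_prod_unfold fst_conv snd_conv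
    by (intro arg_cong2[of _ _ _ _ "(+)"] sum.cong refl)
       (auto simp: pick pick2 edges_within_def boundary_edges_def)
qed

text \<open>The inequality for which the boundary potentials are designed: changing the inner label
  from \<open>a\<close> to \<open>y\<close> is charged the largest value at \<open>y\<close> against
  the smallest at \<open>a\<close>, whatever the outer label \<open>b\<close> is.\<close>

lemma boundary_potential_exchange:
  assumes wf: "wf_model M" and uv: "(u, v) \<in> boundary_edges M A" and b: "b \<in> labels M v"
  shows "edge_potential M u v y b - edge_potential M u v a b \<le> boundary_potential M u v y y - boundary_potential M u v y a"
proof (cases "a = y")
  case False
  have fin: "finite (labels M v)" using wf uv by (auto simp: wf_model_def boundary_edges_def)
  have "edge_potential M u v y b \<le> Max (edge_potential M u v y ` labels M v)"
    "Min (edge_potential M u v a ` labels M v) \<le> edge_potential M u v a b" using fin b by auto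
  thus ?thesis using False by (simp add: boundary_potential_def)
qed simp

lemma persistent_if_minimizer:
  assumes wf: "wf_model M" and A: "A \<subseteq> nodes M" and x: "x \<in> labelings M A"
    and min: "indicator_vector x \<in> minimizers (relaxed_boundary_energy M A x) (local_polytope M A)"
  shows "persistent M A x"
proof -
  let ?V = "nodes M"
  obtain z0 where z0: "z0 \<in> minimizers (energy M ?V) (labelings M ?V)" using energy_minimizer_exists[OF wf] by blast
  have z0l: "z0 \<in> labelings M ?V" using z0 by (simp add: minimizers_iff[OF wf A])
  define z where "z v = (if v \<in> A then x v else z0 v)" for v
  have zl: "z \<in> labelings M ?V" using z0l x by (auto simp: labelings_def z_def)
  have z0A: "z0 \<in> labelings M A" using z0l A by (auto simp: labelings_def)
  have EA: "energy M A z = energy M A x"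
    unfolding energy_def by (intro arg_cong2[of _ _ _ _ "(+)"] sum.cong refl) (auto simp: z_def edges_within_def)
  have EB: "energy M (?V - A) z = energy M (?V - A) z0"
    unfolding energy_def by (intro arg_cong2[of _ _ _ _ "(+)"] sum.cong refl) (auto simp: z_def edges_within_def)
  have "relaxed_boundary_energy M A x (indicator_vector x) \<le> relaxed_boundary_energy M A x (indicator_vector z0)"
    using min indicator_in_polytope[OF wf A z0A] by (simp add: minimizers_iff[OF wf A])
  hence "energy M A x + (\<Sum>(u, v)\<in>boundary_edges M A. boundary_potential M u v (x u) (x u)) \<le>
      energy M A z0 + (\<Sum>(u, v)\<in>boundary_edges M A. boundary_potential M u v (x u) (z0 u))"
    by (simp add: relaxed_boundary_energy_indicator[OF wf A] x z0A)
  \<comment> \<open>On each boundary edge the outer label \<open>z0 v\<close> stays and the inner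
    one changes from \<open>z0 u\<close> to \<open>x u\<close>.\<close>
  moreover have "(\<Sum>(u, v)\<in>boundary_edges M A. edge_potential M u v (z u) (z v)) -
        (\<Sum>(u, v)\<in>boundary_edges M A. edge_potential M u v (z0 u) (z0 v)) \<le>
      (\<Sum>(u, v)\<in>boundary_edges M A. boundary_potential M u v (x u) (x u)) -
        (\<Sum>(u, v)\<in>boundary_edges M A. boundary_potential M u v (x u) (z0 u))"
    unfolding sum_subtractf[symmetric]
  proof (rule sum_mono)
    fix e assume e: "e \<in> boundary_edges M A"
    obtain u v where uv: "e = (u, v)" by fastforce
    have "u \<in> A" "v \<in> ?V" "v \<notin> A" using e by (auto simp: boundary_edges_def uv)
    moreover have "z0 v \<in> labels M v" using z0l \<open>v \<in> ?V\<close> by (auto simp: labelings_def)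
    ultimately show "(case e of (u, v) \<Rightarrow> edge_potential M u v (z u) (z v)) - (case e of (u, v) \<Rightarrow> edge_potential M u v (z0 u) (z0 v)) \<le>
      (case e of (u, v) \<Rightarrow> boundary_potential M u v (x u) (x u)) - (case e of (u, v) \<Rightarrow> boundary_potential M u v (x u) (z0 u))"
      using boundary_potential_exchange[OF wf e[unfolded uv], of "z0 v" "x u" "z0 u"] by (simp add: uv z_def)
  qed
  ultimately have "energy M ?V z \<le> energy M ?V z0"
    unfolding energy_split[OF wf A] EA EB by linarith
  hence "z \<in> minimizers (energy M ?V) (labelings M ?V)"
    using z0 zl unfolding minimizers_iff[OF wf A] by fastforce
  thus ?thesis unfolding persistent_def by (intro bexI[of _ z]) (simp_all add: z_def)
qed

lemma pruning_output_correct: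
  assumes wf: "wf_model M" and out: "pruning_output M A' x'"
  shows "indicator_vector x' \<in> minimizers (relaxed_boundary_energy M A' x') (local_polytope M A')"
    and "persistent M A' x'"
proof -
  obtain \<mu> A x n where tr: "pruning_trace M \<mu> A x n" and h: "halted A n" and A': "A' = A n"
    and r: "rounds_to M (A n) (\<mu> n) x'" using out by (auto simp: pruning_output_def)
  define t where "t = n - 1"
  have n: "n = Suc t" and eq: "A (Suc t) = A t" using h by (auto simp: halted_def t_def)
  have st: "pruning_step M (\<mu> t) (A t) (x t) (\<mu> (Suc t)) (A (Suc t))" using tr n by (simp add: pruning_trace_def)
  have At: "A t \<subseteq> nodes M" using trace_invariant[OF wf tr, of t] n by simp
  show *: "indicator_vector x' \<in> minimizers (relaxed_boundary_energy M A' x') (local_polytope M A')"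
    unfolding A' n eq
  proof (rule indicator_minimizer[OF wf At])
    show "\<mu> (Suc t) \<in> minimizers (relaxed_boundary_energy M (A t) (x t)) (local_polytope M (A t))"
      "x t \<in> labelings M (A t)" using st by (auto simp: pruning_step_def rounds_to_def)
    show "rounds_to M (A t) (\<mu> (Suc t)) x'" using r by (simp add: n eq)
    fix u assume u: "u \<in> boundary_nodes M (A t)"
    \<comment> \<open>At termination \<open>A (Suc t) = A t\<close> contains all boundary nodes, so
      none of them was removed for disagreeing with the test labeling.\<close>
    hence "u \<in> A (Suc t)" unfolding eq by (simp add: boundary_nodes_def)
    thus "fst (\<mu> (Suc t)) u (x t u) = 1" using st u by (auto simp: pruning_step_def)
  qed
  show "persistent M A' x'"
  proof (rule persistent_if_minimizer[OF wf _ _ *])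
    show "A' \<subseteq> nodes M" using At by (simp add: A' n eq)
    show "x' \<in> labelings M A'" using r by (simp add: A' rounds_to_def)
  qed
qed

lemma pruning_run:
  assumes wf: "wf_model M"
  shows "\<exists>\<mu> A x. pruning_trace M \<mu> A x 0"
    and "pruning_trace M \<mu> A x n \<Longrightarrow>
        (\<forall>t<n. A (Suc t) \<subseteq> A t \<and> card (A (Suc t)) \<le> card (A t)) \<and>
        (\<not> halted A n \<longrightarrow>
           n \<le> card (nodes M) \<and>
           (\<exists>\<mu>' A' x'. pruning_trace M \<mu>' A' x' (Suc n) \<and>
              (\<forall>t\<le>n. \<mu>' t = \<mu> t \<and> A' t = A t) \<and> (\<forall>t<n. x' t = x t))) \<and>
        (halted A n \<longrightarrow>
           n - 1 \<le> card (nodes M) \<and> (A n \<noteq> {} \<longrightarrow> n \<le> card (nodes M)) \<and>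
           (\<exists>x'. rounds_to M (A n) (\<mu> n) x'))"
proof -
  obtain \<mu> where "\<mu> \<in> minimizers (relaxed_energy M (nodes M)) (local_polytope M (nodes M))"
    using relaxed_minimizer_exists[OF wf order_refl] by (auto simp: relaxed_boundary_energy_nodes)
  thus "\<exists>\<mu> A x. pruning_trace M \<mu> A x 0"
    by (intro exI[of _ "\<lambda>_. \<mu>"] exI[of _ "\<lambda>_. integral_nodes M (nodes M) \<mu>"])
       (simp add: pruning_trace_def pruning_init_def)
next
  assume tr: "pruning_trace M \<mu> A x n"
  have fin: "finite (A t)" if "t \<le> n" for t
    using trace_invariant[OF wf tr that] wf by (auto simp: wf_model_def intro: finite_subset)
  have 1: "\<forall>t<n. A (Suc t) \<subseteq> A t \<and> card (A (Suc t)) \<le> card (A t)"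
    using trace_decreasing[OF tr] fin by (meson card_mono less_imp_le)
  have nh: "\<not> halted A s" if "s < n" for s using tr that by (simp add: pruning_trace_def)
  have 2: "n \<le> card (nodes M)" if "\<not> halted A n"
    using trace_card[OF wf tr order_refl] nh that le_neq_implies_less by (metis add_leE)
  have 3: "n - 1 \<le> card (nodes M) \<and> (A n \<noteq> {} \<longrightarrow> n \<le> card (nodes M))" if "halted A n"
  proof -
    have n: "n \<ge> 1" "A n = A (n - 1)" using that by (auto simp: halted_def)
    have c: "card (A (n - 1)) + (n - 1) \<le> card (nodes M)"
    proof (rule trace_card[OF wf tr])
      show "\<not> halted A s" if "s \<le> n - 1" for s by (rule nh) (use that n in linarith)
    qed simp
    \<comment> \<open>A nonempty final set is worth one more unit in
      \<open>card (A (n - 1)) + (n - 1)\<close>; this pays for the pass that only detects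
      stability.\<close>
    have "card (A n) \<ge> 1" if "A n \<noteq> {}" using that fin[of n] by (simp add: Suc_leI card_gt_0_iff)
    hence "n \<le> card (nodes M)" if "A n \<noteq> {}" using that c n by fastforce
    thus ?thesis using c by linarith
  qed
  obtain B where "\<mu> n \<in> local_polytope M B" "A n \<subseteq> integral_nodes M B (\<mu> n)"
    using trace_invariant[OF wf tr order_refl] by blast
  from rounding_exists[OF this] have 4: "\<exists>x'. rounds_to M (A n) (\<mu> n) x'" .
  show "(\<forall>t<n. A (Suc t) \<subseteq> A t \<and> card (A (Suc t)) \<le> card (A t)) \<and>
        (\<not> halted A n \<longrightarrow>
           n \<le> card (nodes M) \<and>
           (\<exists>\<mu>' A' x'. pruning_trace M \<mu>' A' x' (Suc n) \<and>
              (\<forall>t\<le>n. \<mu>' t = \<mu> t \<and> A' t = A t) \<and> (\<forall>t<n. x' t = x t))) \<and>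
        (halted A n \<longrightarrow>
           n - 1 \<le> card (nodes M) \<and> (A n \<noteq> {} \<longrightarrow> n \<le> card (nodes M)) \<and>
           (\<exists>x'. rounds_to M (A n) (\<mu> n) x'))"
    using 1 2 3 4 trace_extend[OF wf tr] by blast
qed


section \<open>Solving the subproblems\<close>

lemma poly_time_solvableI:
  assumes "ptime D f" "\<And>a. a \<in> D \<Longrightarrow> R a (enc (f a))"
  shows "poly_time_solvable D enc R"
proof -
  from assms(1) obtain p T where T: "psize D T" "\<And>a. a\<in>D \<Longrightarrow> exec p (enc a) (enc (f a)) (T a)"
    unfolding ptime_def by blast
  from T(1) obtain b where "\<And>a. a \<in> D \<Longrightarrow> T a \<le> poly b (bits (enc a))" by (auto simp: psize_def)
  thus ?thesis unfolding poly_time_solvable_def using T(2) assms(2) by blast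
qed

section \<open>Rational data scaled to integers, and the lists of unknowns and constraints\<close>

lemma ptime_quotient_of [pt]: "ptime D f \<Longrightarrow> ptime D (\<lambda>a. quotient_of (f a))"
proof (rule ptime_enc_cong)
  show "enc (quotient_of (f a)) = enc (f a)" for a
    by (cases "quotient_of (f a)") (simp add: enc_rat_inst enc_rat_def enc_int_def)
qed

text \<open>Encoded rationals are in lowest terms, so the gcd has to be divided out; a positive
  denominator leaves no sign to normalize.\<close>

lemma ptime_Fract:
  assumes f: "ptime D f" and g: "ptime D g" and pos: "\<And>a. a \<in> D \<Longrightarrow> g a > 0"
  shows "ptime D (\<lambda>a. Fract (f a) (g a))"
proof (rule ptime_enc_cong)
  show "ptime D (\<lambda>a. (f a div gcd (f a) (g a), g a div gcd (f a) (g a)))" by (intro pt f g)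
  show "enc (Fract (f a) (g a)) = enc (f a div gcd (f a) (g a), g a div gcd (f a) (g a))" if "a \<in> D" for a
    using pos[OF that] by (simp add: enc_rat_inst enc_rat_def enc_int_def quotient_of_Fract Rat.normalize_def Let_def)
qed

definition all_rats :: "inst \<Rightarrow> rat list" where
  "all_rats I = concat (fst I) @ concat (concat (map snd (snd I)))"

text \<open>The product of all denominators instead of their least common multiple: its bit size is
  still bounded by that of the input, and a positive factor does not change the minimizers of the
  objective.\<close>

definition common_denom :: "inst \<Rightarrow> int" where
  "common_denom I = prod_list (map (\<lambda>q. snd (quotient_of q)) (all_rats I))"

definition to_int :: "inst \<Rightarrow> rat \<Rightarrow> int" where
  "to_int I q = fst (quotient_of q) * (common_denom I div snd (quotient_of q))"

lemma common_denom_pos: "common_denom I > 0"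
proof -
  have "prod_list (map (\<lambda>q. snd (quotient_of q)) qs) > 0" for qs
    by (induction qs) (auto simp: quotient_of_denom_pos')
  thus ?thesis by (simp add: common_denom_def)
qed

lemma to_int:
  assumes "q \<in> set (all_rats I)"
  shows "real_of_int (to_int I q) = real_of_int (common_denom I) * real_of_rat q"
proof -
  have "snd (quotient_of q) dvd common_denom I"
  proof -
    have "q \<in> set qs \<Longrightarrow> snd (quotient_of q) dvd prod_list (map (\<lambda>q. snd (quotient_of q)) qs)" for qs
      by (induction qs) auto
    thus ?thesis using assms by (simp add: common_denom_def)
  qed
  moreover have "q = of_int (fst (quotient_of q)) / of_int (snd (quotient_of q))"
    by (rule quotient_of_div) simp
  hence "real_of_rat q = of_int (fst (quotient_of q)) / of_int (snd (quotient_of q))"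
    by (metis of_rat_divide of_rat_of_int_eq)
  ultimately show ?thesis using quotient_of_denom_pos'[of q]
    by (auto simp: to_int_def real_of_int_div field_simps)
qed

text \<open>Row \<open>a\<close> or column \<open>a\<close> of the table, according to the end at
  which the stored edge has \<open>u\<close>.\<close>

definition edge_values :: "(nat \<times> nat) \<times> rat list list \<Rightarrow> nat \<Rightarrow> nat \<Rightarrow> rat list" where
  "edge_values p u a = (if fst (fst p) = u then snd p ! a else map (\<lambda>r. r ! a) (snd p))"

definition free_node :: "partial_labeling \<Rightarrow> nat \<Rightarrow> bool" where
  "free_node zs v \<longleftrightarrow> filter (\<lambda>z. fst z = v) zs = []"

definition cut_edges :: "inst \<times> partial_labeling \<Rightarrow> nat \<Rightarrow> ((nat \<times> nat) \<times> rat list list) list" where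
  "cut_edges J u = filter (\<lambda>p. (fst (fst p) = u \<and> free_node (snd J) (snd (fst p))) \<or>
     (snd (fst p) = u \<and> free_node (snd J) (fst (fst p)))) (snd (fst J))"

text \<open>The boundary potential scaled to an integer. That \<open>a\<close> is the test label of
  \<open>u\<close> is decided by searching the list for \<open>(u, a)\<close>.\<close>

definition cut_cost :: "inst \<times> partial_labeling \<Rightarrow> nat \<Rightarrow> nat \<Rightarrow> (nat \<times> nat) \<times> rat list list \<Rightarrow> int" where
  "cut_cost J u a p = (if filter (\<lambda>z. z = (u, a)) (snd J) \<noteq> [] then Max (set (map (to_int (fst J)) (edge_values p u a)))
     else Min (set (map (to_int (fst J)) (edge_values p u a))))"

definition int_cost :: "inst \<times> partial_labeling \<Rightarrow> quad \<Rightarrow> int" where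
  "int_cost J k = (if fst (fst k) = snd (fst k)
     then to_int (fst J) (fst (fst J) ! fst (fst k) ! fst (snd k)) +
       sum_list (map (cut_cost J (fst (fst k)) (fst (snd k))) (cut_edges J (fst (fst k))))
     else to_int (fst J) (snd (hd (filter (\<lambda>p. fst p = fst k) (snd (fst J)))) ! fst (snd k) ! snd (snd k)))"

definition inner_edges :: "inst \<times> partial_labeling \<Rightarrow> ((nat \<times> nat) \<times> rat list list) list" where
  "inner_edges J = filter (\<lambda>p. \<not> free_node (snd J) (fst (fst p)) \<and> \<not> free_node (snd J) (snd (fst p))) (snd (fst J))"

definition key_list :: "inst \<times> partial_labeling \<Rightarrow> quad list" where
  "key_list J =
     concat (map (\<lambda>z. map (\<lambda>a. ((fst z, fst z), (a, a))) [0..<length (fst (fst J) ! fst z)]) (snd J)) @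
     concat (map (\<lambda>p. concat (map (\<lambda>a. map (\<lambda>b. (fst p, (a, b))) [0..<length (fst (fst J) ! snd (fst p))])
        [0..<length (fst (fst J) ! fst (fst p))])) (inner_edges J))"

definition constraint_list :: "inst \<times> partial_labeling \<Rightarrow> ((nat \<times> nat) \<times> (bool \<times> nat)) list" where
  "constraint_list J =
     concat (map (\<lambda>z. map (\<lambda>a. ((fst z, fst z), (True, a))) [0..<length (fst (fst J) ! fst z)]) (snd J)) @
     concat (map (\<lambda>p. map (\<lambda>a. (fst p, (True, a))) [0..<length (fst (fst J) ! fst (fst p))] @
       map (\<lambda>b. (fst p, (False, b))) [0..<length (fst (fst J) ! snd (fst p))]) (inner_edges J))"

definition subproblem_vector :: "inst \<times> partial_labeling \<Rightarrow> int list" where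
  "subproblem_vector J = lp_solve (key_list J) (constraint_list J) lp_coef lp_rhs (int_cost J)"

text \<open>The head of the vector is the homogenizing variable and becomes the denominator;
  \<open>zip\<close> discards the dual values and slacks that follow the primal block.\<close>

definition solve_subproblem :: "inst \<times> partial_labeling \<Rightarrow> rational_relaxed" where
  "solve_subproblem J = (let v = subproblem_vector J; kx = zip (key_list J) (tl v) in
     (map (\<lambda>e. ((fst (fst (fst e)), fst (snd (fst e))), Fract (snd e) (hd v)))
        (filter (\<lambda>e. fst (fst (fst e)) = snd (fst (fst e))) kx),
      map (\<lambda>e. (fst e, Fract (snd e) (hd v))) kx))"

lemma ptime_to_int [pt]: "ptime D f \<Longrightarrow> ptime D g \<Longrightarrow> ptime D (\<lambda>a. to_int (f a) (g a))"
proof (rule ptime_comp2[of to_int])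
  show "ptime UNIV (\<lambda>x. to_int (fst x) (snd x))"
    unfolding to_int_def common_denom_def all_rats_def by (intro pt)
qed

lemma ptime_free_node [pt]: "ptime D f \<Longrightarrow> ptime D g \<Longrightarrow> ptime D (\<lambda>a. free_node (f a) (g a))"
  by (rule ptime_comp2[of free_node]) (auto simp: free_node_def[abs_def] intro!: pt)

lemma ptime_cut_edges [pt]: "ptime D f \<Longrightarrow> ptime D g \<Longrightarrow> ptime D (\<lambda>a. cut_edges (f a) (g a))"
  by (rule ptime_comp2[of cut_edges]) (auto simp: cut_edges_def[abs_def] intro!: pt)

lemma ptime_inner_edges [pt]: "ptime D f \<Longrightarrow> ptime D (\<lambda>a. inner_edges (f a))"
  by (rule ptime_comp1[of inner_edges]) (auto simp: inner_edges_def[abs_def] intro!: pt)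

lemma ptime_lp_coef: "ptime UNIV (\<lambda>z. lp_coef (fst z :: (nat \<times> nat) \<times> (bool \<times> nat)) (snd z))"
  unfolding lp_coef_def by (intro pt)

lemma ptime_lp_rhs: "ptime UNIV (lp_rhs :: (nat \<times> nat) \<times> (bool \<times> nat) \<Rightarrow> int)"
  unfolding lp_rhs_def[abs_def] by (intro pt)

context
  fixes U :: "rat list list" and P :: "((nat \<times> nat) \<times> rat list list) list" and zs :: partial_labeling
  assumes sub: "((U, P), zs) \<in> subproblem_instances"
begin

lemma sub_facts:
  shows sub_wf: "wf_model (model_of (U, P))" and sub_distinct: "distinct (map fst P)"
    and sub_zs: "distinct (map fst zs)" and sub_dom: "domain_of zs \<subseteq> nodes (model_of (U, P))"
    and sub_edge: "p \<in> set P \<Longrightarrow> fst (fst p) < length U \<and> snd (fst p) < length U \<and>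
      length (snd p) = length (U ! fst (fst p)) \<and> (\<forall>r\<in>set (snd p). length r = length (U ! snd (fst p)))"
    and sub_node: "z \<in> set zs \<Longrightarrow> fst z < length U \<and> snd z < length (U ! fst z)"
    and sub_labels: "u < length U \<Longrightarrow> U ! u \<noteq> []"
    and sub_asym: "p \<in> set P \<Longrightarrow> q \<in> set P \<Longrightarrow> fst (fst p) \<noteq> snd (fst p) \<and> fst q \<noteq> (snd (fst p), fst (fst p))"
proof -
  have I: "(U, P) \<in> instances" and z: "zs \<in> partial_labelings (U, P)"
    using sub by (auto simp: subproblem_instances_def)
  show wf: "wf_model (model_of (U, P))" and "distinct (map fst P)" using I by (auto simp: instances_def)
  show "distinct (map fst zs)" and dom: "domain_of zs \<subseteq> nodes (model_of (U, P))"
    using z by (auto simp: partial_labelings_def)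
  show "U ! u \<noteq> []" if "u < length U" using wf that by (auto simp: wf_model_def model_of_def lessThan_empty_iff)
  {
    assume p: "p \<in> set P"
    obtain u v T where p': "p = ((u, v), T)" by (metis surj_pair)
    have "(u, v) \<in> edges (model_of (U, P))" using p p' by (force simp: model_of_def)
    hence "u < length U" "v < length U" using wf by (auto simp: wf_model_def model_of_def)
    moreover have "length T = length (U ! u) \<and> (\<forall>r\<in>set T. length r = length (U ! v))"
      using I p p' by (auto simp: instances_def)
    ultimately show "fst (fst p) < length U \<and> snd (fst p) < length U \<and>
      length (snd p) = length (U ! fst (fst p)) \<and> (\<forall>r\<in>set (snd p). length r = length (U ! snd (fst p)))"
      by (simp add: p')
  }
  {
    assume pq: "p \<in> set P" "q \<in> set P"
    hence "fst p \<in> edges (model_of (U, P))" "fst q \<in> edges (model_of (U, P))" by (auto simp: model_of_def)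
    thus "fst (fst p) \<noteq> snd (fst p) \<and> fst q \<noteq> (snd (fst p), fst (fst p))"
      using wf unfolding wf_model_def by (metis prod.collapse)
  }
  assume zz: "z \<in> set zs"
  have "map_of zs (fst z) = Some (snd z)"
    using zz \<open>distinct (map fst zs)\<close> by (metis map_of_is_SomeI prod.collapse)
  hence "labeling_of zs (fst z) = snd z" by (simp add: labeling_of_def)
  moreover have fz: "fst z \<in> domain_of zs" using zz by (simp add: domain_of_def)
  moreover have "labeling_of zs \<in> labelings (model_of (U, P)) (domain_of zs)" using z by (simp add: partial_labelings_def)
  ultimately have "snd z \<in> labels (model_of (U, P)) (fst z)" by (metis Pi_mem labelings_def)
  moreover have "fst z \<in> nodes (model_of (U, P))" using fz dom by blast
  ultimately show "fst z < length U \<and> snd z < length (U ! fst z)" by (simp add: model_of_def)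
qed

lemma free_node_iff: "free_node zs v \<longleftrightarrow> v \<notin> domain_of zs"
  by (auto simp: free_node_def domain_of_def filter_empty_conv)

lemma labeling_iff: "u \<in> domain_of zs \<Longrightarrow> filter (\<lambda>z. z = (u, a)) zs \<noteq> [] \<longleftrightarrow> a = labeling_of zs u"
proof -
  assume u: "u \<in> domain_of zs"
  have "filter (\<lambda>z. z = (u, a)) zs \<noteq> [] \<longleftrightarrow> (u, a) \<in> set zs" by (auto simp: filter_empty_conv)
  also have "\<dots> \<longleftrightarrow> map_of zs u = Some a" using sub_zs by (simp add: map_of_eq_Some_iff)
  also have "\<dots> \<longleftrightarrow> a = labeling_of zs u"
    using u by (cases "map_of zs u") (auto simp: labeling_of_def domain_of_def map_of_eq_None_iff)
  finally show ?thesis .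
qed

lemma model_simps:
  "nodes (model_of (U, P)) = {..<length U}" "edges (model_of (U, P)) = fst ` set P"
  "labels (model_of (U, P)) u = {..<length (U ! u)}" "unary (model_of (U, P)) u a = real_of_rat (U ! u ! a)"
  "pairwise (model_of (U, P)) e a b = real_of_rat (the (map_of P e) ! a ! b)"
  by (auto simp: model_of_def)

lemma table_lookup: "p \<in> set P \<Longrightarrow> the (map_of P (fst p)) = snd p"
  using sub_distinct by (metis map_of_is_SomeI option.sel prod.collapse)

lemma hd_filter_table: "p \<in> set P \<Longrightarrow> snd (hd (filter (\<lambda>q. fst q = fst p) P)) = snd p"
  using map_of_conv_filter[of "fst p" P] table_lookup[of p] by simp

lemma edges_inner: "edges_within (model_of (U, P)) (domain_of zs) = fst ` set (inner_edges ((U, P), zs))"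
  by (auto simp: edges_within_def model_simps inner_edges_def free_node_iff image_iff)

lemma set_key_list: "set (key_list ((U, P), zs)) = lp_keys (model_of (U, P)) (domain_of zs)"
proof (rule set_eqI)
  fix k :: quad
  obtain u v a b where k: "k = ((u, v), (a, b))" by (metis surj_pair)
  have "k \<in> set (concat (map (\<lambda>z. map (\<lambda>a. ((fst z, fst z), (a, a))) [0..<length (U ! fst z)]) zs)) \<longleftrightarrow>
      u \<in> fst ` set zs \<and> v = u \<and> b = a \<and> a < length (U ! u)"
    unfolding k by (auto simp: image_iff; force)
  moreover have "k \<in> node_keys (model_of (U, P)) (domain_of zs) \<longleftrightarrow> u \<in> fst ` set zs \<and> v = u \<and> b = a \<and> a < length (U ! u)"
    unfolding k node_keys_def by (auto simp: model_simps domain_of_def)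
  moreover have "k \<in> set (concat (map (\<lambda>p. concat (map (\<lambda>a. map (\<lambda>b. (fst p, (a, b))) [0..<length (U ! snd (fst p))])
        [0..<length (U ! fst (fst p))])) (inner_edges ((U, P), zs)))) \<longleftrightarrow>
      (u, v) \<in> fst ` set (inner_edges ((U, P), zs)) \<and> a < length (U ! u) \<and> b < length (U ! v)"
    unfolding k by (auto simp: image_iff; force)
  moreover have "k \<in> edge_keys (model_of (U, P)) (domain_of zs) \<longleftrightarrow>
      (u, v) \<in> fst ` set (inner_edges ((U, P), zs)) \<and> a < length (U ! u) \<and> b < length (U ! v)"
    unfolding k edge_keys_def edges_inner by (auto simp: model_simps)
  ultimately show "k \<in> set (key_list ((U, P), zs)) \<longleftrightarrow> k \<in> lp_keys (model_of (U, P)) (domain_of zs)"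
    unfolding lp_keys_def key_list_def by simp
qed

lemma distinct_nodes: "z \<in> set zs \<Longrightarrow> z' \<in> set zs \<Longrightarrow> fst z = fst z' \<Longrightarrow> z = z'"
  and distinct_edges: "p \<in> set P \<Longrightarrow> p' \<in> set P \<Longrightarrow> fst p = fst p' \<Longrightarrow> p = p'"
  using sub_zs sub_distinct by (auto simp: distinct_map inj_on_def)

lemma distinct_zs: "distinct zs" and distinct_P: "distinct P" "distinct (inner_edges ((U, P), zs))"
  using sub_zs sub_distinct by (auto simp: distinct_map inner_edges_def)

lemma distinct_concat_map:
  assumes "distinct xs" "\<And>x. x \<in> set xs \<Longrightarrow> distinct (f x)"
    "\<And>x y. x \<in> set xs \<Longrightarrow> y \<in> set xs \<Longrightarrow> x \<noteq> y \<Longrightarrow> set (f x) \<inter> set (f y) = {}"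
  shows "distinct (concat (map f xs))"
  using assms by (induction xs) auto

lemma inner_edges_subset: "p \<in> set (inner_edges ((U, P), zs)) \<Longrightarrow> p \<in> set P"
  by (simp add: inner_edges_def)

lemma inner_edges_facts:
  assumes "p \<in> set (inner_edges ((U, P), zs))"
  shows "p \<in> set P" "fst p \<noteq> (w, w)"
    "p' \<in> set (inner_edges ((U, P), zs)) \<Longrightarrow> p \<noteq> p' \<Longrightarrow> fst p \<noteq> fst p'"
proof -
  show pP: "p \<in> set P" by (rule inner_edges_subset[OF assms])
  show "fst p \<noteq> (w, w)" using sub_asym[OF pP pP] by auto
  show "p' \<in> set (inner_edges ((U, P), zs)) \<Longrightarrow> p \<noteq> p' \<Longrightarrow> fst p \<noteq> fst p'"
    using distinct_edges[OF pP] inner_edges_subset by blast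
qed

lemma distinct_key_list: "distinct (key_list ((U, P), zs))"
proof -
  let ?L1 = "concat (map (\<lambda>z. map (\<lambda>a. ((fst z, fst z), (a, a))) [0..<length (U ! fst z)]) zs)"
  let ?L2 = "concat (map (\<lambda>p. concat (map (\<lambda>a. map (\<lambda>b. (fst p, (a, b))) [0..<length (U ! snd (fst p))])
        [0..<length (U ! fst (fst p))])) (inner_edges ((U, P), zs)))"
  have "distinct ?L1"
    by (rule distinct_concat_map[OF distinct_zs]) (auto simp: distinct_map inj_on_def dest: distinct_nodes)
  moreover have "distinct ?L2"
  proof (rule distinct_concat_map[OF distinct_P(2)])
    show "distinct (concat (map (\<lambda>a. map (\<lambda>b. (fst p, (a, b))) [0..<length (U ! snd (fst p))]) [0..<length (U ! fst (fst p))]))" for p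
      by (rule distinct_concat_map) (auto simp: distinct_map inj_on_def)
    fix p p' assume "p \<in> set (inner_edges ((U, P), zs))" "p' \<in> set (inner_edges ((U, P), zs))" "p \<noteq> p'"
    hence "fst p \<noteq> fst p'" by (rule inner_edges_facts(3))
    thus "set (concat (map (\<lambda>a. map (\<lambda>b. (fst p, (a, b))) [0..<length (U ! snd (fst p))]) [0..<length (U ! fst (fst p))])) \<inter>
        set (concat (map (\<lambda>a. map (\<lambda>b. (fst p', (a, b))) [0..<length (U ! snd (fst p'))]) [0..<length (U ! fst (fst p'))])) = {}"
      by auto
  qed
  moreover have "set ?L1 \<inter> set ?L2 = {}"
  proof -
    have 1: "fst k = (fst (fst k), fst (fst k))" if "k \<in> set ?L1" for k using that by auto
    have 2: "fst k \<noteq> (w, w)" if k: "k \<in> set ?L2" for k w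
    proof -
      obtain p where "p \<in> set (inner_edges ((U, P), zs))" "fst k = fst p" using k by auto
      thus ?thesis using inner_edges_facts(2) by simp
    qed
    show ?thesis using 1 2 by blast
  qed
  ultimately show ?thesis unfolding key_list_def by simp
qed

lemma set_constraint_list: "set (constraint_list ((U, P), zs)) = lp_constraints (model_of (U, P)) (domain_of zs)"
proof (rule set_eqI)
  fix r :: "(nat \<times> nat) \<times> (bool \<times> nat)"
  obtain u v i a where r: "r = ((u, v), (i, a))" by (metis surj_pair)
  have "r \<in> set (concat (map (\<lambda>z. map (\<lambda>a. ((fst z, fst z), (True, a))) [0..<length (U ! fst z)]) zs)) \<longleftrightarrow>
      u \<in> fst ` set zs \<and> v = u \<and> i \<and> a < length (U ! u)"
    unfolding r by (auto simp: image_iff; force)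
  moreover have "r \<in> set (concat (map (\<lambda>p. map (\<lambda>a. (fst p, (True, a))) [0..<length (U ! fst (fst p))] @
       map (\<lambda>b. (fst p, (False, b))) [0..<length (U ! snd (fst p))]) (inner_edges ((U, P), zs)))) \<longleftrightarrow>
      (u, v) \<in> fst ` set (inner_edges ((U, P), zs)) \<and> a < length (U ! (if i then u else v))"
    unfolding r by (auto simp: image_iff; force)
  moreover have "r \<in> lp_constraints (model_of (U, P)) (domain_of zs) \<longleftrightarrow>
      (u \<in> fst ` set zs \<and> v = u \<and> i \<and> a < length (U ! u)) \<or>
      ((u, v) \<in> fst ` set (inner_edges ((U, P), zs)) \<and> a < length (U ! (if i then u else v)))"
    unfolding r lp_constraints_def edges_inner by (auto simp: model_simps domain_of_def)
  ultimately show "r \<in> set (constraint_list ((U, P), zs)) \<longleftrightarrow> r \<in> lp_constraints (model_of (U, P)) (domain_of zs)"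
    unfolding constraint_list_def by simp
qed

lemma distinct_constraint_list: "distinct (constraint_list ((U, P), zs))"
proof -
  let ?L1 = "concat (map (\<lambda>z. map (\<lambda>a. ((fst z, fst z), (True, a))) [0..<length (U ! fst z)]) zs)"
  let ?L2 = "concat (map (\<lambda>p. map (\<lambda>a. (fst p, (True, a))) [0..<length (U ! fst (fst p))] @
       map (\<lambda>b. (fst p, (False, b))) [0..<length (U ! snd (fst p))]) (inner_edges ((U, P), zs)))"
  have "distinct ?L1"
    by (rule distinct_concat_map[OF distinct_zs]) (auto simp: distinct_map inj_on_def dest: distinct_nodes)
  moreover have "distinct ?L2"
  proof (rule distinct_concat_map[OF distinct_P(2)])
    fix p p' assume "p \<in> set (inner_edges ((U, P), zs))" "p' \<in> set (inner_edges ((U, P), zs))" "p \<noteq> p'"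
    hence "fst p \<noteq> fst p'" by (rule inner_edges_facts(3))
    thus "set (map (\<lambda>a. (fst p, (True, a))) [0..<length (U ! fst (fst p))] @ map (\<lambda>b. (fst p, (False, b))) [0..<length (U ! snd (fst p))]) \<inter>
       set (map (\<lambda>a. (fst p', (True, a))) [0..<length (U ! fst (fst p'))] @ map (\<lambda>b. (fst p', (False, b))) [0..<length (U ! snd (fst p'))]) = {}"
      by auto
  qed (auto simp: distinct_map inj_on_def)
  moreover have "set ?L1 \<inter> set ?L2 = {}"
  proof -
    have 1: "fst k = (fst (fst k), fst (fst k))" if "k \<in> set ?L1" for k using that by auto
    have 2: "fst k \<noteq> (w, w)" if k: "k \<in> set ?L2" for k w
    proof -
      obtain p where "p \<in> set (inner_edges ((U, P), zs))" "fst k = fst p" using k by auto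
      thus ?thesis using inner_edges_facts(2) by simp
    qed
    show ?thesis using 1 2 by blast
  qed
  ultimately show ?thesis unfolding constraint_list_def by simp
qed

lemma all_rats_mem:
  shows "u < length U \<Longrightarrow> a < length (U ! u) \<Longrightarrow> U ! u ! a \<in> set (all_rats (U, P))"
    and "p \<in> set P \<Longrightarrow> r \<in> set (snd p) \<Longrightarrow> q \<in> set r \<Longrightarrow> q \<in> set (all_rats (U, P))"
proof -
  assume "u < length U" "a < length (U ! u)"
  hence "U ! u \<in> set U" "U ! u ! a \<in> set (U ! u)" by simp_all
  thus "U ! u ! a \<in> set (all_rats (U, P))" unfolding all_rats_def by auto
qed (auto simp: all_rats_def)

lemma edge_values_potential:
  assumes p: "p \<in> set P" and u: "fst p = (u, v) \<or> fst p = (v, u)" and a: "a < length (U ! u)"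
  shows "edge_potential (model_of (U, P)) u v a ` labels (model_of (U, P)) v = real_of_rat ` set (edge_values p u a)"
    and "edge_values p u a \<noteq> []" and "set (edge_values p u a) \<subseteq> set (all_rats (U, P))"
proof -
  note e = sub_edge[OF p] and as = sub_asym[OF p p]
  have uv: "u \<noteq> v" "u < length U" "v < length U" using u e as by auto
  have "edge_values p u a \<noteq> [] \<and> set (edge_values p u a) \<subseteq> set (all_rats (U, P)) \<and>
    edge_potential (model_of (U, P)) u v a ` {..<length (U ! v)} = real_of_rat ` set (edge_values p u a)"
  proof (cases "fst p = (u, v)")
    case True
    have T: "snd p ! a \<in> set (snd p)" "length (snd p ! a) = length (U ! v)" using e True a by auto
    have ev: "edge_values p u a = snd p ! a" using True by (simp add: edge_values_def)
    have ep: "edge_potential (model_of (U, P)) u v a b = real_of_rat (snd p ! a ! b)" for b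
      using p True table_lookup[OF p] by (force simp: edge_potential_def model_simps)
    have "(\<lambda>b. snd p ! a ! b) ` {..<length (U ! v)} = set (snd p ! a)"
      unfolding T(2)[symmetric] by (auto simp: set_conv_nth)
    hence "real_of_rat ` (\<lambda>b. snd p ! a ! b) ` {..<length (U ! v)} = real_of_rat ` set (snd p ! a)" by simp
    hence "edge_potential (model_of (U, P)) u v a ` {..<length (U ! v)} = real_of_rat ` set (snd p ! a)"
      unfolding image_image ep .
    moreover have "snd p ! a \<noteq> []" using T(2) sub_labels[OF uv(3)] by auto
    moreover have "set (snd p ! a) \<subseteq> set (all_rats (U, P))" using all_rats_mem(2)[OF p T(1)] by blast
    ultimately show ?thesis unfolding ev by blast
  next
    case False
    hence F: "fst p = (v, u)" using u by simp
    have ev: "edge_values p u a = map (\<lambda>r. r ! a) (snd p)" using F uv by (simp add: edge_values_def)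
    have len: "length (snd p) = length (U ! v)" "\<And>r. r \<in> set (snd p) \<Longrightarrow> length r = length (U ! u)" using e F by auto
    have "(u, v) \<notin> fst ` set P" using sub_asym[OF p] F by force
    hence ep: "edge_potential (model_of (U, P)) u v a b = real_of_rat (snd p ! b ! a)" for b
      using table_lookup[OF p] F by (simp add: edge_potential_def model_simps)
    have "(\<lambda>b. snd p ! b ! a) ` {..<length (U ! v)} = (\<lambda>r. r ! a) ` set (snd p)"
      unfolding len(1)[symmetric] set_conv_nth[of "snd p"] by auto
    hence "real_of_rat ` (\<lambda>b. snd p ! b ! a) ` {..<length (U ! v)} = real_of_rat ` (\<lambda>r. r ! a) ` set (snd p)" by simp
    hence "edge_potential (model_of (U, P)) u v a ` {..<length (U ! v)} = real_of_rat ` set (map (\<lambda>r. r ! a) (snd p))"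
      unfolding image_image ep set_map .
    moreover have "map (\<lambda>r. r ! a) (snd p) \<noteq> []" using len(1) sub_labels[OF uv(3)] by auto
    moreover have "set (map (\<lambda>r. r ! a) (snd p)) \<subseteq> set (all_rats (U, P))"
    proof
      fix q assume "q \<in> set (map (\<lambda>r. r ! a) (snd p))"
      then obtain r where r: "r \<in> set (snd p)" "q = r ! a" by auto
      thus "q \<in> set (all_rats (U, P))" using all_rats_mem(2)[OF p r(1), of q] len(2)[OF r(1)] a by simp
    qed
    ultimately show ?thesis unfolding ev by blast
  qed
  thus "edge_potential (model_of (U, P)) u v a ` labels (model_of (U, P)) v = real_of_rat ` set (edge_values p u a)"
    "edge_values p u a \<noteq> []" "set (edge_values p u a) \<subseteq> set (all_rats (U, P))" by (simp_all add: model_simps)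
qed

lemma cut_cost:
  assumes p: "p \<in> set P" and u: "fst p = (u, v) \<or> fst p = (v, u)" and a: "a < length (U ! u)" and ud: "u \<in> domain_of zs"
  shows "real_of_int (cut_cost ((U, P), zs) u a p) =
    real_of_int (common_denom (U, P)) * boundary_potential (model_of (U, P)) u v (labeling_of zs u) a"
proof -
  note ev = edge_values_potential[OF p u a]
  let ?d = "real_of_int (common_denom (U, P))"
  let ?S = "real_of_rat ` set (edge_values p u a)"
  let ?T = "set (map (to_int (U, P)) (edge_values p u a))"
  have d: "?d > 0" using common_denom_pos by simp
  have fin: "finite ?S" "?S \<noteq> {}" "finite ?T" "?T \<noteq> {}" using ev(2) by auto
  have T: "real_of_int ` ?T = (\<lambda>x. ?d * x) ` ?S"
    using ev(3) by (force simp: image_image to_int subset_iff)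
  \<comment> \<open>Multiplication by a positive number and the embedding of the integers are
    monotone, so they commute with \<open>Max\<close> and \<open>Min\<close>.\<close>
  have mono: "mono (\<lambda>x. ?d * x)" "mono real_of_int" using d by (auto simp: mono_def)
  have "real_of_int (Max ?T) = Max (real_of_int ` ?T)" by (rule mono_Max_commute[OF mono(2) fin(3,4)])
  also have "\<dots> = ?d * Max ?S" unfolding T by (rule mono_Max_commute[OF mono(1) fin(1,2), symmetric])
  finally have Mx: "real_of_int (Max ?T) = ?d * Max ?S" .
  have "real_of_int (Min ?T) = Min (real_of_int ` ?T)" by (rule mono_Min_commute[OF mono(2) fin(3,4)])
  also have "\<dots> = ?d * Min ?S" unfolding T by (rule mono_Min_commute[OF mono(1) fin(1,2), symmetric])
  finally have Mn: "real_of_int (Min ?T) = ?d * Min ?S" .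
  show ?thesis
  proof (cases "a = labeling_of zs u")
    case True
    hence "filter (\<lambda>z. z = (u, a)) zs \<noteq> []" using labeling_iff[OF ud] by blast
    thus ?thesis unfolding cut_cost_def boundary_potential_def ev(1) snd_conv fst_conv
      using Mx True by (simp only: if_P refl not_False_eq_True if_True)
  next
    case False
    hence "\<not> filter (\<lambda>z. z = (u, a)) zs \<noteq> []" using labeling_iff[OF ud] by blast
    thus ?thesis unfolding cut_cost_def boundary_potential_def ev(1) snd_conv fst_conv
      using Mn False by (simp only: if_False refl not_True_eq_False)
  qed
qed

lemma int_cost:
  assumes k: "k \<in> lp_keys (model_of (U, P)) (domain_of zs)"
  shows "real_of_int (int_cost ((U, P), zs) k) =
    real_of_int (common_denom (U, P)) * lp_cost (model_of (U, P)) (domain_of zs) (labeling_of zs) k"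
proof (cases "k \<in> node_keys (model_of (U, P)) (domain_of zs)")
  case True
  then obtain u a where k': "k = ((u, u), (a, a))" and u: "u \<in> domain_of zs" and a: "a < length (U ! u)"
    by (auto simp: node_keys_def model_simps)
  have uU: "u < length U" using u sub_dom by (auto simp: model_simps)
  define C where "C = cut_edges ((U, P), zs) u"
  define N where "N = {v\<in>nodes (model_of (U, P)) - domain_of zs. adjacent (model_of (U, P)) u v}"
  define oth where "oth p = (if fst (fst p) = u then snd (fst p) else fst (fst p))" for p :: "(nat \<times> nat) \<times> rat list list"
  have C: "p \<in> set C \<longleftrightarrow> p \<in> set P \<and> ((fst (fst p) = u \<and> snd (fst p) \<notin> domain_of zs) \<or> (snd (fst p) = u \<and> fst (fst p) \<notin> domain_of zs))" for p
    by (simp add: C_def cut_edges_def free_node_iff)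
  have dC: "distinct C" using distinct_P by (simp add: C_def cut_edges_def)
  have ends: "fst p = (u, oth p) \<or> fst p = (oth p, u)" if "p \<in> set C" for p
    using that sub_asym[of p p] by (auto simp: C oth_def prod_eq_iff)
  \<comment> \<open>Since an edge is stored once and there are no loops, the cut edges at
    \<open>u\<close> correspond to its neighbours outside the domain; this turns the sum over a list
    of edges into the sum over nodes in \<open>lp_cost\<close>.\<close>
  have bij: "bij_betw oth (set C) N"
  proof (rule bij_betw_imageI)
    show "inj_on oth (set C)"
    proof (rule inj_onI)
      fix p q assume pq: "p \<in> set C" "q \<in> set C" "oth p = oth q"
      have "p \<in> set P" "q \<in> set P" using pq C by auto
      moreover have "fst p = fst q"
        using ends[OF pq(1)] ends[OF pq(2)] pq(3) sub_asym[of p q] sub_asym[of q p] calculation by auto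
      ultimately show "p = q" by (rule distinct_edges)
    qed
    show "oth ` set C = N"
    proof (intro equalityI subsetI)
      fix v assume "v \<in> oth ` set C"
      then obtain p where p: "p \<in> set C" "v = oth p" by blast
      have pP: "p \<in> set P" using p C by simp
      have "v \<notin> domain_of zs" using p C sub_asym[OF pP pP] by (auto simp: oth_def)
      moreover have "adjacent (model_of (U, P)) u v"
        using ends[OF p(1)] p(2) pP unfolding adjacent_def model_simps by (metis imageI)
      moreover have "v < length U" using sub_edge[OF pP] p(2) by (auto simp: oth_def)
      ultimately show "v \<in> N" by (simp add: N_def model_simps)
    next
      fix v assume v: "v \<in> N"
      then obtain p where p: "p \<in> set P" "fst p = (u, v) \<or> fst p = (v, u)"
        by (auto simp: N_def adjacent_def model_simps image_iff)
      have vd: "v \<notin> domain_of zs" using v by (simp add: N_def)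
      hence "p \<in> set C" using p by (auto simp: C)
      moreover have "u \<noteq> v" using p(2) sub_asym[OF p(1) p(1)] by (elim disjE) simp_all
      hence "oth p = v" using p(2) by (elim disjE) (simp_all add: oth_def)
      ultimately show "v \<in> oth ` set C" by blast
    qed
  qed
  have "real_of_int (sum_list (map (cut_cost ((U, P), zs) u a) C)) = (\<Sum>p\<in>set C. real_of_int (cut_cost ((U, P), zs) u a p))"
    by (simp add: sum_list_distinct_conv_sum_set[OF dC])
  also have "\<dots> = (\<Sum>p\<in>set C. real_of_int (common_denom (U, P)) * boundary_potential (model_of (U, P)) u (oth p) (labeling_of zs u) a)"
    using C by (intro sum.cong refl cut_cost ends a u) auto
  also have "\<dots> = (\<Sum>v\<in>N. real_of_int (common_denom (U, P)) * boundary_potential (model_of (U, P)) u v (labeling_of zs u) a)"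
    by (rule sum.reindex_bij_betw[OF bij])
  finally show ?thesis
    using to_int[OF all_rats_mem(1)[OF uU a]]
    by (simp add: int_cost_def lp_cost_def k' C_def N_def model_simps sum_distrib_left distrib_left)
next
  case False
  then obtain u v a b where k': "k = ((u, v), (a, b))" "(u, v) \<in> edges_within (model_of (U, P)) (domain_of zs)"
    "a < length (U ! u)" "b < length (U ! v)"
    using k by (auto simp: lp_keys_def edge_keys_def model_simps)
  obtain p where p: "p \<in> set P" "fst p = (u, v)" using k'(2) by (auto simp: edges_inner inner_edges_def)
  have uv: "u \<noteq> v" using sub_asym[OF p(1) p(1)] p(2) by simp
  have T: "snd p ! a \<in> set (snd p)" "b < length (snd p ! a)" using sub_edge[OF p(1)] p(2) k' by auto
  have "real_of_int (to_int (U, P) (snd p ! a ! b)) = real_of_int (common_denom (U, P)) * real_of_rat (snd p ! a ! b)"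
    by (rule to_int[OF all_rats_mem(2)[OF p(1) T(1) nth_mem[OF T(2)]]])
  thus ?thesis using uv hd_filter_table[OF p(1)] table_lookup[OF p(1)] p(2)
    by (simp add: int_cost_def lp_cost_def k' model_simps)
qed

lemma subproblem_vector_correct:
  obtains t x vs where "subproblem_vector ((U, P), zs) = t # map x (key_list ((U, P), zs)) @ vs" "t > 0"
    "lp_polytope (model_of (U, P)) (domain_of zs) (\<lambda>k. of_int (x k) / of_int t)"
    "\<And>f. lp_polytope (model_of (U, P)) (domain_of zs) f \<Longrightarrow>
      (\<Sum>k\<in>lp_keys (model_of (U, P)) (domain_of zs). lp_cost (model_of (U, P)) (domain_of zs) (labeling_of zs) k * (of_int (x k) / of_int t)) \<le>
      (\<Sum>k\<in>lp_keys (model_of (U, P)) (domain_of zs). lp_cost (model_of (U, P)) (domain_of zs) (labeling_of zs) k * f k)"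
proof -
  let ?M = "model_of (U, P)" and ?A = "domain_of zs" and ?d = "real_of_int (common_denom (U, P))"
  let ?J = "((U, P), zs)"
  have cost: "(\<Sum>k\<in>lp_keys ?M ?A. real_of_int (int_cost ?J k) * f k) = ?d * (\<Sum>k\<in>lp_keys ?M ?A. lp_cost ?M ?A (labeling_of zs) k * f k)" for f
    unfolding sum_distrib_left by (intro sum.cong refl) (simp add: int_cost)
  obtain x0 where x0: "lp_polytope ?M ?A x0"
    "\<And>f. lp_polytope ?M ?A f \<Longrightarrow> (\<Sum>k\<in>lp_keys ?M ?A. real_of_int (int_cost ?J k) * x0 k) \<le> (\<Sum>k\<in>lp_keys ?M ?A. real_of_int (int_cost ?J k) * f k)"
    using lp_optimum_exists[OF sub_wf sub_dom, of "\<lambda>k. real_of_int (int_cost ?J k)"] by blast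
  obtain t x vs where s: "lp_solve (key_list ?J) (constraint_list ?J) lp_coef lp_rhs (int_cost ?J) = t # map x (key_list ?J) @ vs" "t > 0"
    "lp_polytope ?M ?A (\<lambda>k. of_int (x k) / of_int t)"
    "\<And>f. lp_polytope ?M ?A f \<Longrightarrow>
      (\<Sum>k\<in>lp_keys ?M ?A. of_int (int_cost ?J k) * (of_int (x k) / of_int t)) \<le> (\<Sum>k\<in>lp_keys ?M ?A. of_int (int_cost ?J k) * f k)"
    by (rule lp_solve_correct[OF distinct_key_list distinct_constraint_list, unfolded set_key_list set_constraint_list, OF x0(1) x0(2)])
       (assumption | rule that)+
  show ?thesis
  proof (rule that[of t x vs])
    fix f assume f: "lp_polytope ?M ?A f"
    have "?d > 0" using common_denom_pos by simp
    thus "(\<Sum>k\<in>lp_keys ?M ?A. lp_cost ?M ?A (labeling_of zs) k * (of_int (x k) / of_int t)) \<le>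
       (\<Sum>k\<in>lp_keys ?M ?A. lp_cost ?M ?A (labeling_of zs) k * f k)"
      using s(4)[OF f] unfolding cost by simp
  qed (use s in \<open>auto simp: subproblem_vector_def\<close>)
qed

lemma zip_map_append: "zip ks (map x ks @ vs) = map (\<lambda>k. (k, x k)) ks"
  by (induction ks) auto

lemma map_of_zip_map: "distinct ks \<Longrightarrow> k \<in> set ks \<Longrightarrow> map_of (map (\<lambda>k. (k, g k)) ks) k = Some (g k)"
  by (simp add: map_of_map_restrict restrict_map_def)

lemma solve_subproblem_correct:
  "relaxed_of (solve_subproblem ((U, P), zs)) \<in> minimizers
       (relaxed_boundary_energy (model_of (U, P)) (domain_of zs) (labeling_of zs))
       (local_polytope (model_of (U, P)) (domain_of zs))"
proof -
  let ?M = "model_of (U, P)" and ?A = "domain_of zs" and ?J = "((U, P), zs)"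
  obtain t x vs where v: "subproblem_vector ?J = t # map x (key_list ?J) @ vs" "t > 0"
    and f: "lp_polytope ?M ?A (\<lambda>k. of_int (x k) / of_int t)"
    and opt: "\<And>f. lp_polytope ?M ?A f \<Longrightarrow>
      (\<Sum>k\<in>lp_keys ?M ?A. lp_cost ?M ?A (labeling_of zs) k * (of_int (x k) / of_int t)) \<le>
      (\<Sum>k\<in>lp_keys ?M ?A. lp_cost ?M ?A (labeling_of zs) k * f k)"
    by (rule subproblem_vector_correct) (rule that; assumption)
  define ks where "ks = key_list ?J"
  have kx: "zip ks (map x ks @ vs) = map (\<lambda>k. (k, x k)) ks"
    by (rule zip_map_append)
  have dk: "distinct ks" unfolding ks_def by (rule distinct_key_list)
  have sk: "set ks = lp_keys ?M ?A" unfolding ks_def by (rule set_key_list)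
  define ns where "ns = filter (\<lambda>k. fst (fst k) = snd (fst k)) ks"
  define m1 where "m1 = map (\<lambda>k. ((fst (fst k), fst (snd k)), Fract (x k) t)) ns"
  define m2 where "m2 = map (\<lambda>k. (k, Fract (x k) t)) ks"
  have sol: "solve_subproblem ?J = (m1, m2)"
    by (simp add: solve_subproblem_def v ks_def[symmetric] kx m1_def m2_def ns_def Let_def filter_map comp_def)
  have fr: "real_of_rat (Fract (x k) t) = of_int (x k) / of_int t" for k
    using v(2) by (simp add: of_rat_rat)
  have eq: "flatten (relaxed_of (m1, m2)) k = of_int (x k) / of_int t" if k: "k \<in> lp_keys ?M ?A" for k
  proof (cases "fst (fst k) = snd (fst k)")
    case False
    have "map_of m2 k = Some (Fract (x k) t)"
      unfolding m2_def using k dk sk by (intro map_of_zip_map) auto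
    thus ?thesis using False fr by (simp add: flatten_def relaxed_of_def lookup_entry_def)
  next
    case True
    \<comment> \<open>A key with equal ends is a node key, because edges are not loops; so it is
      determined by its node and label.\<close>
    have nk: "k' \<in> node_keys ?M ?A" if "k' \<in> set ns" for k'
      using that edges_within_no_loop[OF sub_wf sub_dom] by (auto simp: ns_def sk lp_keys_def edge_keys_def)
    have kn: "k \<in> set ns" using k True by (simp add: ns_def sk)
    have inj: "inj_on (\<lambda>k. (fst (fst k), fst (snd k))) (set ns)"
    proof (rule inj_onI)
      fix k k' assume "k \<in> set ns" "k' \<in> set ns" and e: "(fst (fst k), fst (snd k)) = (fst (fst k'), fst (snd k'))"
      hence "k \<in> node_keys ?M ?A" "k' \<in> node_keys ?M ?A" using nk by blast+
      thus "k = k'" using e by (auto simp: node_keys_def)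
    qed
    have "distinct (map fst m1)" unfolding m1_def using inj dk by (simp add: distinct_map ns_def comp_def)
    moreover have "((fst (fst k), fst (snd k)), Fract (x k) t) \<in> set m1" unfolding m1_def using kn by auto
    ultimately have "map_of m1 (fst (fst k), fst (snd k)) = Some (Fract (x k) t)" by simp
    thus ?thesis using True fr by (simp add: flatten_def relaxed_of_def lookup_entry_def)
  qed
  show ?thesis
    unfolding minimizer_flatten[OF sub_wf sub_dom] sol
  proof (intro conjI allI impI)
    show "lp_polytope ?M ?A (flatten (relaxed_of (m1, m2)))"
      using f lp_feasible_cong[of "lp_keys ?M ?A" "flatten (relaxed_of (m1, m2))" "\<lambda>k. of_int (x k) / of_int t"] eq by blast
    fix g assume "lp_polytope ?M ?A g"
    from opt[OF this] show "(\<Sum>k\<in>lp_keys ?M ?A. lp_cost ?M ?A (labeling_of zs) k * flatten (relaxed_of (m1, m2)) k) \<le>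
        (\<Sum>k\<in>lp_keys ?M ?A. lp_cost ?M ?A (labeling_of zs) k * g k)"
      using eq sum.cong[of "lp_keys ?M ?A" "lp_keys ?M ?A"
          "\<lambda>k. lp_cost ?M ?A (labeling_of zs) k * flatten (relaxed_of (m1, m2)) k"
          "\<lambda>k. lp_cost ?M ?A (labeling_of zs) k * (of_int (x k) / of_int t)"] by simp
  qed
qed

end


section \<open>Polynomial running time of the subproblem solver\<close>

lemma subproblem_node:
  "J \<in> subproblem_instances \<Longrightarrow> z \<in> set (snd J) \<Longrightarrow> fst z < length (fst (fst J)) \<and> snd z < length (fst (fst J) ! fst z)"
  using sub_node by (cases J, cases "fst J") auto

lemma subproblem_edge:
  assumes "J \<in> subproblem_instances" "p \<in> set (snd (fst J))"
  shows "fst (fst p) < length (fst (fst J))" "snd (fst p) < length (fst (fst J))"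
    "length (snd p) = length (fst (fst J) ! fst (fst p))"
    "r \<in> set (snd p) \<Longrightarrow> length r = length (fst (fst J) ! snd (fst p))"
    "snd (hd (filter (\<lambda>q. fst q = fst p) (snd (fst J)))) = snd p"
  using sub_edge[of "fst (fst J)" "snd (fst J)" "snd J"] hd_filter_table[of "fst (fst J)" "snd (fst J)" "snd J"] assms
  by auto

text \<open>Index bounds in projection form, as the side conditions of \<open>ptime_nth\<close> ask
  for them.\<close>

lemma subproblem_node_key:
  assumes J: "J \<in> subproblem_instances" and k: "k \<in> set (key_list J)" "fst (fst k) = snd (fst k)"
  shows "fst (fst k) < length (fst (fst J))" "fst (snd k) < length (fst (fst J) ! fst (fst k))"
proof -
  have "k \<in> lp_keys (model_of (fst J)) (domain_of (snd J))"
    using k set_key_list[of "fst (fst J)" "snd (fst J)" "snd J"] J by simp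
  moreover have "k \<notin> edge_keys (model_of (fst J)) (domain_of (snd J))"
  proof
    assume "k \<in> edge_keys (model_of (fst J)) (domain_of (snd J))"
    hence "fst k \<in> edges_within (model_of (fst J)) (domain_of (snd J))" by (auto simp: edge_keys_def)
    moreover obtain U P zs where J': "J = ((U, P), zs)" by (metis surj_pair)
    ultimately show False
      using edges_within_no_loop[OF sub_wf[OF J[unfolded J']] sub_dom[OF J[unfolded J']], of "fst k"] k(2) by simp
  qed
  ultimately have "k \<in> node_keys (model_of (fst J)) (domain_of (snd J))" by (simp add: lp_keys_def)
  thus "fst (fst k) < length (fst (fst J))" "fst (snd k) < length (fst (fst J) ! fst (fst k))"
    using sub_dom[of "fst (fst J)" "snd (fst J)" "snd J"] J by (auto simp: node_keys_def model_of_def case_prod_unfold)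
qed

lemma subproblem_edge_key:
  assumes J: "J \<in> subproblem_instances" and k: "k \<in> set (key_list J)" "fst (fst k) \<noteq> snd (fst k)"
  shows "\<exists>p\<in>set (snd (fst J)). fst p = fst k \<and> fst (snd k) < length (snd p) \<and> snd (snd k) < length (snd p ! fst (snd k))"
proof -
  have "k \<in> lp_keys (model_of (fst J)) (domain_of (snd J))"
    using k set_key_list[of "fst (fst J)" "snd (fst J)" "snd J"] J by simp
  hence "k \<in> edge_keys (model_of (fst J)) (domain_of (snd J))" using k(2) by (auto simp: lp_keys_def node_keys_def)
  hence ew: "fst k \<in> edges_within (model_of (fst J)) (domain_of (snd J))"
    and e: "fst (snd k) < length (fst (fst J) ! fst (fst k))" "snd (snd k) < length (fst (fst J) ! snd (fst k))"
    by (auto simp: edge_keys_def model_of_def case_prod_unfold)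
  have "fst k \<in> edges (model_of (fst J))" using ew by (cases "fst k") (simp add: edges_within_def)
  then obtain p where p: "p \<in> set (snd (fst J))" "fst p = fst k" by (auto simp: model_of_def case_prod_unfold)
  have "fst (snd k) < length (snd p)" using subproblem_edge(3)[OF J p(1)] e p(2) by simp
  thus ?thesis using p e subproblem_edge(4)[OF J p(1), of "snd p ! fst (snd k)"] by (intro bexI[of _ p]) auto
qed

lemma ptime_key_list: "ptime subproblem_instances key_list"
proof -
  let ?D = subproblem_instances
  have "ptime ?D (\<lambda>J. map (\<lambda>z. map (\<lambda>a. ((fst z, fst z), (a, a))) [0..<length (fst (fst J) ! fst z)]) (snd J))"
    by (rule ptime_map, (intro pt)[1]) (intro pt ptime_nth, use subproblem_node in blast)
  moreover have "ptime ?D (\<lambda>J. map (\<lambda>p. concat (map (\<lambda>a. map (\<lambda>b. (fst p, (a, b))) [0..<length (fst (fst J) ! snd (fst p))])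
        [0..<length (fst (fst J) ! fst (fst p))])) (inner_edges J))"
  proof (rule ptime_map, (intro pt)[1])
    let ?E = "{z. fst z \<in> ?D \<and> snd z \<in> set (inner_edges (fst z))}"
    have P: "snd z \<in> set (snd (fst (fst z)))" if "z \<in> ?E" for z using that by (auto simp: inner_edges_def)
    have 1: "ptime ?E (\<lambda>z. [0..<length (fst (fst (fst z)) ! fst (fst (snd z)))])"
      by (intro pt ptime_nth) (use P subproblem_edge(1) in blast)
    have 2: "ptime ?E (\<lambda>z. fst (fst (fst z)) ! snd (fst (snd z)))"
      by (intro pt ptime_nth) (use P subproblem_edge(2) in blast)
    show "ptime ?E (\<lambda>z. concat (map (\<lambda>a. map (\<lambda>b. (fst (snd z), (a, b))) [0..<length (fst (fst (fst z)) ! snd (fst (snd z)))])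
        [0..<length (fst (fst (fst z)) ! fst (fst (snd z)))]))"
      by (rule ptime_concat, rule ptime_map[OF 1]) (intro pt ptime_comp[OF 2]; simp)
  qed
  ultimately show ?thesis unfolding key_list_def[abs_def] by (intro ptime_append ptime_concat)
qed

lemma ptime_constraint_list: "ptime subproblem_instances constraint_list"
proof -
  let ?D = subproblem_instances
  have "ptime ?D (\<lambda>J. map (\<lambda>z. map (\<lambda>a. ((fst z, fst z), (True, a))) [0..<length (fst (fst J) ! fst z)]) (snd J))"
    by (rule ptime_map, (intro pt)[1]) (intro pt ptime_nth, use subproblem_node in blast)
  moreover have "ptime ?D (\<lambda>J. map (\<lambda>p. map (\<lambda>a. (fst p, (True, a))) [0..<length (fst (fst J) ! fst (fst p))] @
       map (\<lambda>b. (fst p, (False, b))) [0..<length (fst (fst J) ! snd (fst p))]) (inner_edges J))"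
  proof (rule ptime_map, (intro pt)[1])
    let ?E = "{z. fst z \<in> ?D \<and> snd z \<in> set (inner_edges (fst z))}"
    have P: "snd z \<in> set (snd (fst (fst z)))" if "z \<in> ?E" for z using that by (auto simp: inner_edges_def)
    have 1: "ptime ?E (\<lambda>z. fst (fst (fst z)) ! fst (fst (snd z)))"
      by (intro pt ptime_nth) (use P subproblem_edge(1) in blast)
    have 2: "ptime ?E (\<lambda>z. fst (fst (fst z)) ! snd (fst (snd z)))"
      by (intro pt ptime_nth) (use P subproblem_edge(2) in blast)
    show "ptime ?E (\<lambda>z. map (\<lambda>a. (fst (snd z), (True, a))) [0..<length (fst (fst (fst z)) ! fst (fst (snd z)))] @
       map (\<lambda>b. (fst (snd z), (False, b))) [0..<length (fst (fst (fst z)) ! snd (fst (snd z)))])"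
      by (intro pt 1 2)
  qed
  ultimately show ?thesis unfolding constraint_list_def[abs_def] by (intro ptime_append ptime_concat)
qed

text \<open>Node keys and edge keys are compiled in separate branches, because the lookups of each
  branch are known to be in range for keys of that kind.\<close>

lemma ptime_int_cost: "ptime {z. fst z \<in> subproblem_instances \<and> snd z \<in> set (key_list (fst z))} (\<lambda>z. int_cost (fst z) (snd z))"
  (is "ptime ?E _")
  unfolding int_cost_def
proof (rule ptime_if_strong)
  show "ptime ?E (\<lambda>z. fst (fst (snd z)) = snd (fst (snd z)))" by (intro pt)
next
  let ?N = "{z \<in> ?E. fst (fst (snd z)) = snd (fst (snd z))}"
  have u: "fst (fst (snd z)) < length (fst (fst (fst z)))" "fst (snd (snd z)) < length (fst (fst (fst z)) ! fst (fst (snd z)))"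
    if "z \<in> ?N" for z using that subproblem_node_key by blast+
  \<comment> \<open>Pairs of a node key with an edge cut at that node; the end at which the edge has
    the node decides whether a row or a column is read.\<close>
  let ?C = "{w. fst w \<in> ?N \<and> snd w \<in> set (cut_edges (fst (fst w)) (fst (fst (snd (fst w)))))}"
  have C: "fst (fst w) \<in> subproblem_instances" "snd w \<in> set (snd (fst (fst (fst w))))"
      "fst (fst (snd w)) \<noteq> fst (fst (snd (fst w))) \<Longrightarrow> snd (fst (snd w)) = fst (fst (snd (fst w)))"
      "fst (snd (snd (fst w))) < length (fst (fst (fst (fst w))) ! fst (fst (snd (fst w))))"
    if "w \<in> ?C" for w
    using that u[of "fst w"] by (auto simp: cut_edges_def)
  have ev: "ptime ?C (\<lambda>w. edge_values (snd w) (fst (fst (snd (fst w)))) (fst (snd (snd (fst w)))))"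
    unfolding edge_values_def
  proof (rule ptime_if_strong)
    show "ptime ?C (\<lambda>w. fst (fst (snd w)) = fst (fst (snd (fst w))))" by (intro pt)
    show "ptime {w \<in> ?C. fst (fst (snd w)) = fst (fst (snd (fst w)))} (\<lambda>w. snd (snd w) ! fst (snd (snd (fst w))))"
    proof (intro pt ptime_nth)
      fix w assume w: "w \<in> {w \<in> ?C. fst (fst (snd w)) = fst (fst (snd (fst w)))}"
      hence wC: "w \<in> ?C" by blast
      show "fst (snd (snd (fst w))) < length (snd (snd w))"
        using C(4)[OF wC] subproblem_edge(3)[OF C(1,2)[OF wC]] w by simp
    qed
    show "ptime {w \<in> ?C. fst (fst (snd w)) \<noteq> fst (fst (snd (fst w)))} (\<lambda>w. map (\<lambda>r. r ! fst (snd (snd (fst w)))) (snd (snd w)))"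
    proof (rule ptime_map, (intro pt)[1], intro pt ptime_nth)
      fix x assume x: "x \<in> {z. fst z \<in> {w \<in> ?C. fst (fst (snd w)) \<noteq> fst (fst (snd (fst w)))} \<and> snd z \<in> set (snd (snd (fst z)))}"
      hence wC: "fst x \<in> ?C" and ne: "fst (fst (snd (fst x))) \<noteq> fst (fst (snd (fst (fst x))))" by blast+
      show "fst (snd (snd (fst (fst x)))) < length (snd x)"
        using C(3,4)[OF wC] ne subproblem_edge(4)[OF C(1,2)[OF wC], of "snd x"] x by simp
    qed
  qed
  have ne: "edge_values (snd w) (fst (fst (snd (fst w)))) (fst (snd (snd (fst w)))) \<noteq> []" if "w \<in> ?C" for w
  proof -
    obtain U P zs where J: "fst (fst w) = ((U, P), zs)" by (metis surj_pair)
    note c = C[OF that, unfolded J fst_conv snd_conv]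
    have "fst (snd w) = (fst (fst (snd (fst w))), snd (fst (snd w))) \<or> fst (snd w) = (fst (fst (snd w)), fst (fst (snd (fst w))))"
      using c(3) by (metis prod.collapse)
    thus ?thesis using edge_values_potential(2)[OF c(1,2) _ c(4)] by blast
  qed
  let ?vals = "\<lambda>w. map (to_int (fst (fst (fst w)))) (edge_values (snd w) (fst (fst (snd (fst w)))) (fst (snd (snd (fst w)))))"
  have vals: "ptime ?C ?vals" by (intro pt ev)
  have vne: "?vals w \<noteq> []" if "w \<in> ?C" for w using ne[OF that] by simp
  have "ptime ?C (\<lambda>w. cut_cost (fst (fst w)) (fst (fst (snd (fst w)))) (fst (snd (snd (fst w)))) (snd w))"
    unfolding cut_cost_def
    by (rule ptime_if[OF _ ptime_Max_set[OF vals vne] ptime_Min_set[OF vals vne]]) (intro pt | assumption)+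
  hence "ptime ?N (\<lambda>z. map (cut_cost (fst z) (fst (fst (snd z))) (fst (snd (snd z)))) (cut_edges (fst z) (fst (fst (snd z)))))"
    by (rule ptime_map[rotated]) (intro pt)
  moreover have "ptime ?N (\<lambda>z. fst (fst (fst z)) ! fst (fst (snd z)) ! fst (snd (snd z)))"
    by (intro pt ptime_nth) (use u in blast)+
  ultimately show "ptime ?N (\<lambda>z. to_int (fst (fst z)) (fst (fst (fst z)) ! fst (fst (snd z)) ! fst (snd (snd z))) +
       sum_list (map (cut_cost (fst z) (fst (fst (snd z))) (fst (snd (snd z)))) (cut_edges (fst z) (fst (fst (snd z))))))"
    by (intro ptime_add_int ptime_to_int ptime_sum_list) (intro pt)
next
  let ?N = "{z \<in> ?E. fst (fst (snd z)) \<noteq> snd (fst (snd z))}"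
  have f: "filter (\<lambda>p. fst p = fst (snd z)) (snd (fst (fst z))) \<noteq> [] \<and>
      fst (snd (snd z)) < length (snd (hd (filter (\<lambda>p. fst p = fst (snd z)) (snd (fst (fst z)))))) \<and>
      snd (snd (snd z)) < length (snd (hd (filter (\<lambda>p. fst p = fst (snd z)) (snd (fst (fst z))))) ! fst (snd (snd z)))"
    if z: "z \<in> ?N" for z
  proof -
    have J: "fst z \<in> subproblem_instances" using z by simp
    obtain p where p: "p \<in> set (snd (fst (fst z)))" "fst p = fst (snd z)" "fst (snd (snd z)) < length (snd p)"
       "snd (snd (snd z)) < length (snd p ! fst (snd (snd z)))"
      using subproblem_edge_key[of "fst z" "snd z"] z by blast
    show ?thesis using subproblem_edge(5)[OF J p(1)] p by (auto simp: filter_empty_conv)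
  qed
  show "ptime ?N (\<lambda>z. to_int (fst (fst z)) (snd (hd (filter (\<lambda>p. fst p = fst (snd z)) (snd (fst (fst z))))) ! fst (snd (snd z)) ! snd (snd (snd z))))"
    by (intro ptime_to_int ptime_nth pt ptime_hd) (use f in blast)+
qed

lemma ptime_subproblem_vector: "ptime subproblem_instances subproblem_vector"
  unfolding subproblem_vector_def[abs_def]
  by (rule ptime_lp_solve[OF ptime_key_list ptime_constraint_list ptime_lp_coef ptime_lp_rhs ptime_int_cost])

lemma subproblem_vector_pos:
  assumes "J \<in> subproblem_instances"
  shows "subproblem_vector J \<noteq> []" "hd (subproblem_vector J) > 0"
proof -
  obtain U P zs where J: "J = ((U, P), zs)" by (metis surj_pair)
  have "subproblem_vector J \<noteq> [] \<and> hd (subproblem_vector J) > 0"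
    by (rule subproblem_vector_correct[of U P zs]) (use assms J in auto)
  thus "subproblem_vector J \<noteq> []" "hd (subproblem_vector J) > 0" by auto
qed

lemma ptime_solve_subproblem: "ptime subproblem_instances solve_subproblem"
proof -
  let ?D = subproblem_instances
  let ?kx = "\<lambda>J. zip (key_list J) (tl (subproblem_vector J))"
  have kx: "ptime ?D ?kx" by (intro pt ptime_key_list ptime_subproblem_vector)
  have hd: "ptime ?D (\<lambda>J. hd (subproblem_vector J))"
    by (intro ptime_hd ptime_subproblem_vector subproblem_vector_pos)
  have nk: "ptime ?D (\<lambda>J. filter (\<lambda>e. fst (fst (fst e)) = snd (fst (fst e))) (?kx J))" by (intro pt kx)
  have "ptime ?D (\<lambda>J. map (\<lambda>e. ((fst (fst (fst e)), fst (snd (fst e))), Fract (snd e) (hd (subproblem_vector J))))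
        (filter (\<lambda>e. fst (fst (fst e)) = snd (fst (fst e))) (?kx J)))"
    by (rule ptime_map[OF nk], intro ptime_Pair ptime_Fract ptime_comp[OF hd] ptime_fst ptime_snd ptime_id)
      (auto simp: subproblem_vector_pos)
  moreover have "ptime ?D (\<lambda>J. map (\<lambda>e. (fst e, Fract (snd e) (hd (subproblem_vector J)))) (?kx J))"
    by (rule ptime_map[OF kx], intro ptime_Pair ptime_Fract ptime_comp[OF hd] ptime_fst ptime_snd ptime_id)
      (auto simp: subproblem_vector_pos)
  ultimately show ?thesis unfolding solve_subproblem_def[abs_def] Let_def by (rule ptime_Pair)
qed

lemma enc_inst_enc: "enc_inst = enc" and enc_partial_labeling_enc: "enc_partial_labeling = enc"
  and enc_rational_relaxed_enc: "enc_rational_relaxed = enc"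
  by (simp_all add: enc_inst_def enc_partial_labeling_def enc_rational_relaxed_def enc_rat_enc enc_nat_enc
      enc_pair_enc enc_list_enc)

theorem subproblems_poly_time:
  "poly_time_solvable subproblem_instances (enc_pair enc_inst enc_partial_labeling) solves_subproblem"
  unfolding enc_inst_enc enc_partial_labeling_enc enc_pair_enc
proof (rule poly_time_solvableI[OF ptime_solve_subproblem])
  fix J assume J: "J \<in> subproblem_instances"
  obtain U P zs where J': "J = ((U, P), zs)" by (metis surj_pair)
  show "solves_subproblem J (enc (solve_subproblem J))"
    unfolding J' solves_subproblem_def prod.case enc_rational_relaxed_enc
    by (intro exI[of _ "solve_subproblem ((U, P), zs)"] conjI refl solve_subproblem_correct J[unfolded J'])
qed


section \<open>Running the pruning algorithm\<close>

text \<open>The conditional guards \<open>hd\<close>. A missing entry stands for 0, hence the value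
  \<open>False\<close>.\<close>

definition has_one :: "rational_relaxed \<Rightarrow> nat \<Rightarrow> nat \<Rightarrow> bool" where
  "has_one m u b \<longleftrightarrow> (if filter (\<lambda>e. fst e = (u, b)) (fst m) \<noteq> []
     then fst (quotient_of (snd (hd (filter (\<lambda>e. fst e = (u, b)) (fst m))))) = 1 \<and>
       snd (quotient_of (snd (hd (filter (\<lambda>e. fst e = (u, b)) (fst m))))) = 1
     else False)"

definition one_labels :: "inst \<times> partial_labeling \<Rightarrow> rational_relaxed \<Rightarrow> nat \<Rightarrow> nat list" where
  "one_labels J m u = filter (has_one m u) [0..<length (fst (fst J) ! u)]"

definition refine :: "inst \<times> partial_labeling \<Rightarrow> rational_relaxed \<Rightarrow> partial_labeling" where
  "refine J m = concat (map (\<lambda>z. if one_labels J m (fst z) \<noteq> []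
     then if cut_edges J (fst z) = [] \<or> hd (one_labels J m (fst z)) = snd z then [(fst z, hd (one_labels J m (fst z)))] else []
     else []) (snd J))"

definition prune_step :: "inst \<Rightarrow> partial_labeling \<times> rational_relaxed \<Rightarrow> partial_labeling \<times> rational_relaxed" where
  "prune_step I e = (refine (I, fst e) (solve_subproblem (I, fst e)), solve_subproblem (I, fst e))"

text \<open>
  On all nodes there are no boundary edges, so the label \<open>0\<close> is irrelevant and the first
  \<open>prune_step\<close> is the initialization of the algorithm.
\<close>

definition start_labeling :: "inst \<Rightarrow> partial_labeling" where
  "start_labeling I = map (\<lambda>u. (u, 0)) [0..<length (fst I)]"

definition prune_seq :: "inst \<Rightarrow> nat \<Rightarrow> partial_labeling \<times> rational_relaxed" where
  "prune_seq I t = (prune_step I ^^ Suc t) (start_labeling I, ([], []))"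

type_synonym run_state = "inst \<times> (partial_labeling \<times> rational_relaxed) list"

text \<open>Lengths are compared in place of sets: the domains are nested and their lists have
  distinct nodes, so equal length means equal sets. A history with one entry is live, because the
  loop body is executed at least once.\<close>

definition live :: "run_state \<Rightarrow> bool" where
  "live s \<longleftrightarrow> (if tl (snd s) \<noteq> [] then length (fst (hd (snd s))) \<noteq> length (fst (hd (tl (snd s)))) else True)"

definition run_step :: "run_state \<Rightarrow> run_state" where
  "run_step s = (fst s, prune_step (fst s) (hd (snd s)) # snd s)"

definition prune_run :: "inst \<Rightarrow> (partial_labeling \<times> rational_relaxed) list" where
  "prune_run I = rev (snd (run_until live run_step (I, [prune_seq I 0])))"

lemma has_one_iff: "has_one m u b \<longleftrightarrow> fst (relaxed_of m) u b = 1"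
proof -
  obtain m1 m2 where m: "m = (m1, m2)" by fastforce
  have one: "fst (quotient_of q) = 1 \<and> snd (quotient_of q) = 1 \<longleftrightarrow> q = 1" for q
    by (metis prod.collapse prod.inject quotient_of_inject_eq rat_one_code)
  show ?thesis
  proof (cases "(u, b) \<in> set (map fst m1)")
    case True
    then obtain q where "((u, b), q) \<in> set m1" by auto
    hence "filter (\<lambda>e. fst e = (u, b)) m1 \<noteq> []" by (force simp: filter_empty_conv)
    moreover have "map_of m1 (u, b) = Some (snd (hd (filter (\<lambda>e. fst e = (u, b)) m1)))"
      using map_of_conv_filter[OF True] True by (cases "map_of m1 (u, b)") (auto simp: map_of_eq_None_iff)
    ultimately show ?thesis unfolding has_one_def one
      by (simp add: m relaxed_of_def lookup_entry_def)
  next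
    case False
    hence "filter (\<lambda>e. fst e = (u, b)) m1 = []" "map_of m1 (u, b) = None"
      by (auto simp: filter_empty_conv map_of_eq_None_iff image_iff)
    thus ?thesis by (simp add: has_one_def m relaxed_of_def lookup_entry_def)
  qed
qed

lemma map_fst_concat:
  assumes "\<And>z. z \<in> set xs \<Longrightarrow> g z = [] \<or> (\<exists>b. g z = [(fst z, b)])"
  shows "map fst (concat (map g xs)) = map fst (filter (\<lambda>z. g z \<noteq> []) xs)"
  using assms by (induction xs) (auto, metis list.simps(8,9) append_Cons append_Nil fst_conv)

context
  fixes U :: "rat list list" and P :: "((nat \<times> nat) \<times> rat list list) list" and zs :: partial_labeling
    and m :: rational_relaxed
  assumes sub: "((U, P), zs) \<in> subproblem_instances"
    and \<mu>: "relaxed_of m \<in> local_polytope (model_of (U, P)) (domain_of zs)"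
begin

abbreviation "cur_model \<equiv> model_of (U, P)"
abbreviation "cur_nodes \<equiv> domain_of zs"
abbreviation "refined \<equiv> refine ((U, P), zs) m"

lemma one_labels_mem: "b \<in> set (one_labels ((U, P), zs) m u) \<longleftrightarrow> b < length (U ! u) \<and> fst (relaxed_of m) u b = 1"
  by (auto simp: one_labels_def has_one_iff)

lemma one_labels_unique:
  assumes "u \<in> cur_nodes" "b \<in> set (one_labels ((U, P), zs) m u)" "c \<in> set (one_labels ((U, P), zs) m u)"
  shows "b = c"
proof (rule ccontr)
  assume "b \<noteq> c"
  hence "fst (relaxed_of m) u b = 0"
    using assms by (intro polytope_label_unique[OF sub_wf[OF sub] sub_dom[OF sub] \<mu> assms(1), of c])
      (auto simp: one_labels_mem model_simps[OF sub])
  thus False using assms by (simp add: one_labels_mem)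
qed

lemma cut_edges_empty: "u \<in> cur_nodes \<Longrightarrow> cut_edges ((U, P), zs) u \<noteq> [] \<longleftrightarrow> u \<in> boundary_nodes cur_model cur_nodes"
proof -
  assume u: "u \<in> cur_nodes"
  have "cut_edges ((U, P), zs) u \<noteq> [] \<longleftrightarrow>
      (\<exists>p\<in>set P. (fst (fst p) = u \<and> snd (fst p) \<notin> cur_nodes) \<or> (snd (fst p) = u \<and> fst (fst p) \<notin> cur_nodes))"
    by (auto simp: cut_edges_def filter_empty_conv free_node_iff[OF sub])
  also have "\<dots> \<longleftrightarrow> (\<exists>v. v < length U \<and> v \<notin> cur_nodes \<and> ((u, v) \<in> fst ` set P \<or> (v, u) \<in> fst ` set P))"
  proof
    assume "\<exists>p\<in>set P. (fst (fst p) = u \<and> snd (fst p) \<notin> cur_nodes) \<or> (snd (fst p) = u \<and> fst (fst p) \<notin> cur_nodes)"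
    then obtain p where p: "p \<in> set P" "(fst (fst p) = u \<and> snd (fst p) \<notin> cur_nodes) \<or> (snd (fst p) = u \<and> fst (fst p) \<notin> cur_nodes)" by blast
    thus "\<exists>v. v < length U \<and> v \<notin> cur_nodes \<and> ((u, v) \<in> fst ` set P \<or> (v, u) \<in> fst ` set P)"
      using sub_edge[OF sub p(1)] by (metis imageI prod.collapse)
  next
    assume "\<exists>v. v < length U \<and> v \<notin> cur_nodes \<and> ((u, v) \<in> fst ` set P \<or> (v, u) \<in> fst ` set P)"
    thus "\<exists>p\<in>set P. (fst (fst p) = u \<and> snd (fst p) \<notin> cur_nodes) \<or> (snd (fst p) = u \<and> fst (fst p) \<notin> cur_nodes)" by force
  qed
  also have "\<dots> \<longleftrightarrow> u \<in> boundary_nodes cur_model cur_nodes"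
    using u by (auto simp: boundary_nodes_def adjacent_def model_simps[OF sub])
  finally show ?thesis .
qed

lemma refine_mem: "(u, b) \<in> set refined \<longleftrightarrow> u \<in> cur_nodes \<and> b \<in> set (one_labels ((U, P), zs) m u) \<and>
    (u \<in> boundary_nodes cur_model cur_nodes \<longrightarrow> b = labeling_of zs u)"
proof -
  have lab: "labeling_of zs (fst z) = snd z" if "z \<in> set zs" for z
    using labeling_iff[OF sub, of "fst z" "snd z"] that by (force simp: domain_of_def filter_empty_conv)
  have hd: "one_labels ((U, P), zs) m u \<noteq> [] \<and> b = hd (one_labels ((U, P), zs) m u) \<longleftrightarrow> b \<in> set (one_labels ((U, P), zs) m u)"
    if "u \<in> cur_nodes" for u b
    using one_labels_unique[OF that] hd_in_set[of "one_labels ((U, P), zs) m u"] by (metis empty_iff empty_set)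
  have "(u, b) \<in> set refined \<longleftrightarrow> (\<exists>z\<in>set zs. fst z = u \<and> (one_labels ((U, P), zs) m u \<noteq> [] \<and> b = hd (one_labels ((U, P), zs) m u)) \<and>
      (cut_edges ((U, P), zs) u = [] \<or> hd (one_labels ((U, P), zs) m u) = snd z))"
    by (auto simp: refine_def split: if_splits)
  also have "\<dots> \<longleftrightarrow> (\<exists>z\<in>set zs. fst z = u \<and> b \<in> set (one_labels ((U, P), zs) m u) \<and>
      (u \<in> boundary_nodes cur_model cur_nodes \<longrightarrow> b = labeling_of zs u))"
  proof (rule bex_cong[OF refl])
    fix z assume z: "z \<in> set zs"
    show "(fst z = u \<and> (one_labels ((U, P), zs) m u \<noteq> [] \<and> b = hd (one_labels ((U, P), zs) m u)) \<and>
      (cut_edges ((U, P), zs) u = [] \<or> hd (one_labels ((U, P), zs) m u) = snd z)) \<longleftrightarrow>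
      (fst z = u \<and> b \<in> set (one_labels ((U, P), zs) m u) \<and> (u \<in> boundary_nodes cur_model cur_nodes \<longrightarrow> b = labeling_of zs u))"
    proof (cases "fst z = u")
      case True
      hence u: "u \<in> cur_nodes" using z by (auto simp: domain_of_def)
      have "labeling_of zs u = snd z" using lab[OF z] True by simp
      thus ?thesis using hd[OF u, of b] cut_edges_empty[OF u] True by metis
    qed simp
  qed
  finally show ?thesis by (auto simp: domain_of_def)
qed

lemma refine_distinct: "distinct (map fst refined)" and refine_length: "length refined \<le> length zs"
proof -
  define g where "g z = (if one_labels ((U, P), zs) m (fst z) \<noteq> []
     then if cut_edges ((U, P), zs) (fst z) = [] \<or> hd (one_labels ((U, P), zs) m (fst z)) = snd z
       then [(fst z, hd (one_labels ((U, P), zs) m (fst z)))] else []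
     else [])" for z
  have refined: "refined = concat (map g zs)" by (simp add: refine_def g_def[abs_def])
  have g: "map fst refined = map fst (filter (\<lambda>z. g z \<noteq> []) zs)"
    unfolding refined by (rule map_fst_concat) (simp add: g_def)
  show "distinct (map fst refined)" unfolding g using sub_zs[OF sub] by (rule distinct_map_filter)
  have "length refined = length (map fst refined)" by simp
  also have "\<dots> \<le> length zs" unfolding g by simp
  finally show "length refined \<le> length zs" .
qed

lemma labeling_refine: "(u, b) \<in> set refined \<Longrightarrow> labeling_of refined u = b"
  using refine_distinct by (simp add: labeling_of_def)

text \<open>At a point of the local polytope, integrality at \<open>u\<close> is equivalent to some
  component being 1: the components are nonnegative with sum 1.\<close>

lemma domain_refine: "domain_of refined = integral_nodes cur_model cur_nodes (relaxed_of m) -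
    {u \<in> boundary_nodes cur_model cur_nodes. fst (relaxed_of m) u (labeling_of zs u) \<noteq> 1}"
proof -
  have int: "u \<in> integral_nodes cur_model cur_nodes (relaxed_of m) \<longleftrightarrow> (\<exists>b. b \<in> set (one_labels ((U, P), zs) m u))" if u: "u \<in> cur_nodes" for u
  proof
    assume "u \<in> integral_nodes cur_model cur_nodes (relaxed_of m)"
    from integral_label[OF \<mu> this] show "\<exists>b. b \<in> set (one_labels ((U, P), zs) m u)"
      by (auto simp: one_labels_mem model_simps[OF sub])
  next
    assume "\<exists>b. b \<in> set (one_labels ((U, P), zs) m u)"
    then obtain b where b: "b \<in> labels cur_model u" "fst (relaxed_of m) u b = 1" by (auto simp: one_labels_mem model_simps[OF sub])
    have "fst (relaxed_of m) u a \<in> {0, 1}" if "a \<in> labels cur_model u" for a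
      using polytope_label_unique[OF sub_wf[OF sub] sub_dom[OF sub] \<mu> u b that] b by (cases "a = b") auto
    thus "u \<in> integral_nodes cur_model cur_nodes (relaxed_of m)" using u by (auto simp: integral_nodes_def)
  qed
  have lab: "labeling_of zs u < length (U ! u)" if "u \<in> cur_nodes" for u
  proof -
    obtain z where z: "z \<in> set zs" "fst z = u" using \<open>u \<in> cur_nodes\<close> by (auto simp: domain_of_def)
    have "labeling_of zs u = snd z" using labeling_iff[OF sub that, of "snd z"] z by (force simp: filter_empty_conv)
    thus ?thesis using sub_node[OF sub z(1)] z(2) by simp
  qed
  have one: "(\<exists>b. b \<in> set (one_labels ((U, P), zs) m u) \<and> b = labeling_of zs u) \<longleftrightarrow> fst (relaxed_of m) u (labeling_of zs u) = 1"
    if "u \<in> cur_nodes" for u using lab[OF that] by (auto simp: one_labels_mem)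
  have one': "u \<in> integral_nodes cur_model cur_nodes (relaxed_of m)" if "u \<in> cur_nodes" "fst (relaxed_of m) u (labeling_of zs u) = 1" for u
    unfolding int[OF that(1)] using that lab[OF that(1)] by (auto simp: one_labels_mem)
  have "u \<in> domain_of refined \<longleftrightarrow> (\<exists>b. (u, b) \<in> set refined)" for u by (force simp: domain_of_def)
  moreover have "(\<exists>b. (u, b) \<in> set refined) \<longleftrightarrow> u \<in> integral_nodes cur_model cur_nodes (relaxed_of m) -
      {u \<in> boundary_nodes cur_model cur_nodes. fst (relaxed_of m) u (labeling_of zs u) \<noteq> 1}" for u
  proof (cases "u \<in> cur_nodes")
    case True
    show ?thesis
    proof (cases "u \<in> boundary_nodes cur_model cur_nodes")
      case b: True
      have "(\<exists>b. (u, b) \<in> set refined) \<longleftrightarrow> fst (relaxed_of m) u (labeling_of zs u) = 1"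
        unfolding refine_mem using True b one[OF True] by auto
      thus ?thesis using b one'[OF True] by auto
    next
      case False
      thus ?thesis unfolding refine_mem using True int[OF True] by auto
    qed
  next
    case False
    thus ?thesis by (auto simp: refine_mem integral_nodes_def)
  qed
  ultimately show ?thesis by blast
qed

lemma refine_partial: "refined \<in> partial_labelings (U, P)"
  and refine_rounds: "rounds_to cur_model (domain_of refined) (relaxed_of m) (labeling_of refined)"
proof -
  have *: "labeling_of refined u \<in> labels cur_model u \<and> fst (relaxed_of m) u (labeling_of refined u) = 1" if u: "u \<in> domain_of refined" for u
  proof -
    obtain b where b: "(u, b) \<in> set refined" using u by (force simp: domain_of_def)
    have "labeling_of refined u = b" by (rule labeling_refine[OF b])
    thus ?thesis using b unfolding refine_mem by (auto simp: one_labels_mem model_simps[OF sub])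
  qed
  have "domain_of refined \<subseteq> cur_nodes" unfolding domain_refine by (auto simp: integral_nodes_def)
  hence "domain_of refined \<subseteq> nodes cur_model" using sub_dom[OF sub] by blast
  thus "refined \<in> partial_labelings (U, P)"
    using * refine_distinct by (auto simp: partial_labelings_def labelings_def)
  show "rounds_to cur_model (domain_of refined) (relaxed_of m) (labeling_of refined)"
    using * by (auto simp: rounds_to_def labelings_def)
qed

end

lemma prune_step_correct:
  assumes I: "I \<in> instances" and z: "fst e \<in> partial_labelings I"
  defines "M \<equiv> model_of I" and "\<mu> \<equiv> relaxed_of (snd (prune_step I e))" and "z' \<equiv> fst (prune_step I e)"
  shows "z' \<in> partial_labelings I" "length z' \<le> length (fst e)"
    "\<mu> \<in> minimizers (relaxed_boundary_energy M (domain_of (fst e)) (labeling_of (fst e))) (local_polytope M (domain_of (fst e)))"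
    "domain_of z' = integral_nodes M (domain_of (fst e)) \<mu> -
       {u \<in> boundary_nodes M (domain_of (fst e)). fst \<mu> u (labeling_of (fst e) u) \<noteq> 1}"
    "rounds_to M (domain_of z') \<mu> (labeling_of z')"
proof -
  obtain U P where IUP: "I = (U, P)" by fastforce
  have sub: "((U, P), fst e) \<in> subproblem_instances" using I z IUP by (simp add: subproblem_instances_def)
  have mn: "relaxed_of (solve_subproblem ((U, P), fst e)) \<in> minimizers
      (relaxed_boundary_energy (model_of (U, P)) (domain_of (fst e)) (labeling_of (fst e)))
      (local_polytope (model_of (U, P)) (domain_of (fst e)))"
    by (rule solve_subproblem_correct[OF sub])
  hence pl: "relaxed_of (solve_subproblem ((U, P), fst e)) \<in> local_polytope (model_of (U, P)) (domain_of (fst e))"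
    by (simp add: minimizers_iff[OF sub_wf[OF sub] sub_dom[OF sub]])
  show "z' \<in> partial_labelings I" using refine_partial[OF sub pl] by (simp add: z'_def prune_step_def IUP)
  show "length z' \<le> length (fst e)" using refine_length[OF sub pl] by (simp add: z'_def prune_step_def IUP)
  show "\<mu> \<in> minimizers (relaxed_boundary_energy M (domain_of (fst e)) (labeling_of (fst e))) (local_polytope M (domain_of (fst e)))"
    using mn by (simp add: \<mu>_def M_def prune_step_def IUP)
  show "domain_of z' = integral_nodes M (domain_of (fst e)) \<mu> -
       {u \<in> boundary_nodes M (domain_of (fst e)). fst \<mu> u (labeling_of (fst e) u) \<noteq> 1}"
    using domain_refine[OF sub pl] by (simp add: z'_def \<mu>_def M_def prune_step_def IUP)
  show "rounds_to M (domain_of z') \<mu> (labeling_of z')"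
    using refine_rounds[OF sub pl] by (simp add: z'_def \<mu>_def M_def prune_step_def IUP)
qed

lemma start_labeling:
  assumes I: "I \<in> instances"
  shows "start_labeling I \<in> partial_labelings I" "domain_of (start_labeling I) = nodes (model_of I)"
    "length (start_labeling I) = length (fst I)"
proof -
  obtain U P where IUP: "I = (U, P)" by fastforce
  have mf: "map fst (start_labeling I) = [0..<length U]" by (simp add: start_labeling_def IUP comp_def)
  show dom: "domain_of (start_labeling I) = nodes (model_of I)"
    unfolding domain_of_def mf by (auto simp: model_of_def IUP)
  have "U ! u \<noteq> []" if "u < length U" for u
    using I that by (auto simp: IUP instances_def wf_model_def model_of_def lessThan_empty_iff)
  moreover have "labeling_of (start_labeling I) u = 0" if "u < length U" for u
  proof -
    have "map_of (start_labeling I) u = Some 0"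
      using that by (intro map_of_is_SomeI) (auto simp: mf, auto simp: start_labeling_def IUP)
    thus ?thesis by (simp add: labeling_of_def)
  qed
  ultimately have "labeling_of (start_labeling I) \<in> labelings (model_of I) (nodes (model_of I))"
    by (auto simp: labelings_def model_of_def IUP)
  thus "start_labeling I \<in> partial_labelings I" using dom by (simp add: partial_labelings_def mf)
  show "length (start_labeling I) = length (fst I)" by (simp add: start_labeling_def)
qed

lemma prune_seq_0: "prune_seq I 0 = prune_step I (start_labeling I, ([], []))"
  and prune_seq_Suc: "prune_seq I (Suc t) = prune_step I (prune_seq I t)"
  by (simp_all add: prune_seq_def)

lemma prune_seq_partial: "I \<in> instances \<Longrightarrow> fst (prune_seq I t) \<in> partial_labelings I"
  by (induction t) (auto simp: prune_seq_0 prune_seq_Suc start_labeling intro!: prune_step_correct(1))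

lemma prune_seq_trace:
  assumes I: "I \<in> instances" and live: "\<And>t. 0 < t \<Longrightarrow> t < n \<Longrightarrow> length (fst (prune_seq I t)) \<noteq> length (fst (prune_seq I (t - 1)))"
    and stop: "0 < n" "length (fst (prune_seq I n)) = length (fst (prune_seq I (n - 1)))"
  shows "solves_pruning I (enc (map (prune_seq I) [0..<Suc n]))"
proof -
  define \<mu> where "\<mu> t = relaxed_of (snd (prune_seq I t))" for t
  define A where "A t = domain_of (fst (prune_seq I t))" for t
  define x where "x t = labeling_of (fst (prune_seq I t))" for t
  define M where "M = model_of I"
  have s0: "fst (start_labeling I, ([], []) :: rational_relaxed) \<in> partial_labelings I" using start_labeling[OF I] by simp
  note st0 = prune_step_correct[OF I s0, folded prune_seq_0, unfolded fst_conv start_labeling(2)[OF I]]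
  note st = prune_step_correct[OF I prune_seq_partial[OF I], folded prune_seq_Suc]
  have bn: "boundary_nodes M (nodes M) = {}" by (auto simp: boundary_nodes_def)
  have init: "pruning_init M (\<mu> 0) (A 0)"
    using st0(3,4) unfolding pruning_init_def \<mu>_def A_def M_def[symmetric] relaxed_boundary_energy_nodes bn by simp
  have rounds: "rounds_to M (A t) (\<mu> t) (x t)" for t
    using st0(5) st(5) by (cases t) (auto simp: M_def A_def \<mu>_def x_def)
  have step: "pruning_step M (\<mu> t) (A t) (x t) (\<mu> (Suc t)) (A (Suc t))" for t
    unfolding pruning_step_def using rounds[of t] st(3,4)[of t] by (simp add: M_def A_def \<mu>_def x_def)
  have card: "card (A t) = length (fst (prune_seq I t))" for t
    using prune_seq_partial[OF I, of t] distinct_card[of "map fst (fst (prune_seq I t))"]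
    by (simp add: A_def domain_of_def partial_labelings_def)
  have sub: "A (Suc t) \<subseteq> A t" for t using step[of t] by (auto simp: pruning_step_def integral_nodes_def)
  have fin: "finite (A t)" for t by (simp add: A_def domain_of_def)
  have halted: "halted A t \<longleftrightarrow> 0 < t \<and> length (fst (prune_seq I t)) = length (fst (prune_seq I (t - 1)))" for t
  proof (cases t)
    case (Suc s)
    have "A (Suc s) = A s \<longleftrightarrow> card (A (Suc s)) = card (A s)"
      using card_subset_eq[OF fin sub] by auto
    thus ?thesis using Suc by (simp add: halted_def card)
  qed (simp add: halted_def)
  have tr: "pruning_trace M \<mu> A x n" unfolding pruning_trace_def
    using init step live halted by blast
  have hn: "halted A n" using stop by (simp add: halted)
  show ?thesis unfolding solves_pruning_def
  proof (intro exI conjI)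
    show "enc (map (prune_seq I) [0..<Suc n]) = enc_list (enc_pair enc_partial_labeling enc_rational_relaxed) (map (prune_seq I) [0..<Suc n])"
      by (simp add: enc_partial_labeling_enc enc_rational_relaxed_enc enc_pair_enc enc_list_enc)
    show "length (map (prune_seq I) [0..<Suc n]) = Suc n" by simp
    show "fst ` set (map (prune_seq I) [0..<Suc n]) \<subseteq> partial_labelings I" using prune_seq_partial[OF I] by auto
    show "\<forall>t\<le>n. \<mu> t = relaxed_of (snd (map (prune_seq I) [0..<Suc n] ! t)) \<and>
        A t = domain_of (fst (map (prune_seq I) [0..<Suc n] ! t)) \<and>
        x t = labeling_of (fst (map (prune_seq I) [0..<Suc n] ! t))"
      by (auto simp: \<mu>_def A_def x_def simp del: upt_Suc)
    show "pruning_trace (model_of I) \<mu> A x n" "halted A n" "rounds_to (model_of I) (A n) (\<mu> n) (x n)"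
      using tr hn rounds[of n] by (simp_all add: M_def)
  qed
qed

text \<open>While the loop is live each pass shortens the list, which bounds the number of passes by
  the number of nodes; the last pass shortens nothing and accounts for the extra 1. The history is
  kept latest first.\<close>

definition run_inv :: "run_state \<Rightarrow> run_state \<Rightarrow> bool" where
  "run_inv a s \<longleftrightarrow> (\<exists>I n. I \<in> instances \<and> a = (I, [prune_seq I 0]) \<and> s = (I, map (prune_seq I) (rev [0..<Suc n])) \<and>
     n + length (fst (prune_seq I n)) \<le> length (fst I) + (if live s then 0 else 1) \<and>
     (\<forall>t<n. 0 < t \<longrightarrow> length (fst (prune_seq I t)) \<noteq> length (fst (prune_seq I (t - 1)))))"

text \<open>\<open>Suc\<close> separates a live state with an empty list from a stopped one, so the
  last pass decreases the measure as well.\<close>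

definition run_measure :: "run_state \<Rightarrow> nat" where
  "run_measure s = (if live s then Suc (length (fst (hd (snd s)))) else 0)"

lemma live_seq: "live (I, map (prune_seq I) (rev [0..<Suc n])) \<longleftrightarrow>
    (0 < n \<longrightarrow> length (fst (prune_seq I n)) \<noteq> length (fst (prune_seq I (n - 1))))"
  by (cases n) (auto simp: live_def)

lemma prune_seq_length:
  assumes "I \<in> instances"
  shows "length (fst (prune_seq I 0)) \<le> length (fst I)" "length (fst (prune_seq I (Suc t))) \<le> length (fst (prune_seq I t))"
  using prune_step_correct(2)[OF assms prune_seq_partial[OF assms], of t]
    prune_step_correct(2)[OF assms, of "(start_labeling I, ([], []))"] start_labeling[OF assms]
  by (auto simp: prune_seq_0 prune_seq_Suc)

lemma run_inv_step:
  assumes "run_inv a s" "live s"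
  shows "run_inv a (run_step s)" "run_measure (run_step s) < run_measure s"
proof -
  obtain I n where I: "I \<in> instances" and a: "a = (I, [prune_seq I 0])" and s: "s = (I, map (prune_seq I) (rev [0..<Suc n]))"
    and le: "n + length (fst (prune_seq I n)) \<le> length (fst I)"
    and al: "\<forall>t<n. 0 < t \<longrightarrow> length (fst (prune_seq I t)) \<noteq> length (fst (prune_seq I (t - 1)))"
    using assms by (auto simp: run_inv_def)
  have step: "run_step s = (I, map (prune_seq I) (rev [0..<Suc (Suc n)]))"
    by (simp add: run_step_def s prune_seq_Suc)
  have len: "length (fst (prune_seq I (Suc n))) \<le> length (fst (prune_seq I n))" by (rule prune_seq_length(2)[OF I])
  have ls: "live (run_step s) \<longleftrightarrow> length (fst (prune_seq I (Suc n))) \<noteq> length (fst (prune_seq I n))"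
    unfolding step live_seq by simp
  have "0 < n \<longrightarrow> length (fst (prune_seq I n)) \<noteq> length (fst (prune_seq I (n - 1)))"
    using assms(2) unfolding s live_seq .
  hence al': "\<forall>t<Suc n. 0 < t \<longrightarrow> length (fst (prune_seq I t)) \<noteq> length (fst (prune_seq I (t - 1)))"
    using al by (auto simp: less_Suc_eq)
  have "Suc n + length (fst (prune_seq I (Suc n))) \<le> length (fst I) + (if live (run_step s) then 0 else 1)"
    using le len ls by auto
  thus "run_inv a (run_step s)" unfolding run_inv_def using I a step al' by blast
  have "hd (snd s) = prune_seq I n" by (simp add: s)
  moreover have "hd (snd (run_step s)) = prune_seq I (Suc n)" unfolding step by simp
  ultimately
  show "run_measure (run_step s) < run_measure s" using assms(2) ls len by (simp add: run_measure_def)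
qed

lemma run_inv_init: "I \<in> instances \<Longrightarrow> run_inv (I, [prune_seq I 0]) (I, [prune_seq I 0])"
  unfolding run_inv_def using prune_seq_length(1) by (intro exI[of _ I] exI[of _ 0]) (auto simp: live_def)

lemma prune_run_correct:
  assumes I: "I \<in> instances"
  shows "solves_pruning I (enc (prune_run I))"
proof -
  define s where "s = run_until live run_step (I, [prune_seq I 0])"
  from run_until_steps[of "run_inv (I, [prune_seq I 0])" live run_step run_measure "(I, [prune_seq I 0])",
      OF _ run_inv_init[OF I]] run_inv_step
  have inv: "run_inv (I, [prune_seq I 0]) s" and nl: "\<not> live s" unfolding s_def by auto
  obtain n where s: "s = (I, map (prune_seq I) (rev [0..<Suc n]))"
    and al: "\<forall>t<n. 0 < t \<longrightarrow> length (fst (prune_seq I t)) \<noteq> length (fst (prune_seq I (t - 1)))"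
    using inv by (auto simp: run_inv_def)
  have "prune_run I = map (prune_seq I) [0..<Suc n]"
    by (simp only: prune_run_def s_def[symmetric] s snd_conv rev_map rev_rev_ident)
  thus ?thesis using nl al unfolding s live_seq by (auto intro!: prune_seq_trace[OF I] simp del: upt_Suc)
qed

section \<open>Polynomial running time of the pruning algorithm\<close>

lemma ptime_has_one: "ptime UNIV (\<lambda>z. has_one (fst z) (fst (snd z)) (snd (snd z)))"
  unfolding has_one_def by (rule ptime_if_strong) (intro pt ptime_hd; simp)+

lemma ptime_refine: "ptime {z. fst z \<in> subproblem_instances} (\<lambda>z. refine (fst z) (snd z))"
  unfolding refine_def
proof (rule ptime_concat, rule ptime_map, (intro pt)[1])
  let ?E = "{z :: ((inst \<times> partial_labeling) \<times> rational_relaxed) \<times> nat \<times> nat.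
    fst z \<in> {z. fst z \<in> subproblem_instances} \<and> snd z \<in> set (snd (fst (fst z)))}"
  have l: "ptime ?E (\<lambda>z. one_labels (fst (fst z)) (snd (fst z)) (fst (snd z)))"
    unfolding one_labels_def
    by (intro ptime_filter' ptime_upt ptime_nth pt ptime_comp3[OF ptime_has_one]) (use subproblem_node in blast)
  show "ptime ?E (\<lambda>z. if one_labels (fst (fst z)) (snd (fst z)) (fst (snd z)) \<noteq> []
     then if cut_edges (fst (fst z)) (fst (snd z)) = [] \<or> hd (one_labels (fst (fst z)) (snd (fst z)) (fst (snd z))) = snd (snd z)
       then [(fst (snd z), hd (one_labels (fst (fst z)) (snd (fst z)) (fst (snd z))))] else []
     else [])"
    by (rule ptime_if_strong) (intro pt l ptime_hd ptime_subset[OF l]; blast)+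
qed

lemma ptime_prune_step: "ptime {z. (fst z, fst (snd z)) \<in> subproblem_instances} (\<lambda>z. prune_step (fst z) (snd z))"
proof -
  let ?E = "{z :: inst \<times> partial_labeling \<times> rational_relaxed. (fst z, fst (snd z)) \<in> subproblem_instances}"
  have s: "ptime ?E (\<lambda>z. solve_subproblem (fst z, fst (snd z)))"
    by (rule ptime_comp[OF ptime_solve_subproblem]) (intro pt | simp)+
  have "ptime ?E (\<lambda>z. ((fst z, fst (snd z)), solve_subproblem (fst z, fst (snd z))))" by (intro pt s)
  from ptime_comp[OF ptime_refine this]
  have "ptime ?E (\<lambda>z. refine (fst z, fst (snd z)) (solve_subproblem (fst z, fst (snd z))))" by simp
  thus ?thesis unfolding prune_step_def by (intro ptime_Pair s)
qed

text \<open>The bound refers to the instance only, whichever pass produced the labeling: at most one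
  entry per node, with numbers below list lengths of the instance.\<close>

lemma bits_partial_labeling:
  assumes I: "I \<in> instances" and z: "zs \<in> partial_labelings I"
  shows "length zs \<le> length (fst I)"
    "bits (enc zs) \<le> 1 + bits (enc I) * Suc (1 + Suc (bits (enc I)) + Suc (bits (enc I)))"
proof -
  obtain U P where IUP: "I = (U, P)" by fastforce
  have sub: "((U, P), zs) \<in> subproblem_instances" using I z IUP by (simp add: subproblem_instances_def)
  have UI: "bits (enc U) \<le> bits (enc I)" by (simp add: IUP)
  have "length zs = card (fst ` set zs)" using sub_zs[OF sub] distinct_card by fastforce
  also have "\<dots> \<le> card {..<length U}" using sub_node[OF sub] by (intro card_mono) auto
  finally show len: "length zs \<le> length (fst I)" by (simp add: IUP)
  have "bits (enc zs) \<le> 1 + length zs * Suc (1 + Suc (bits (enc I)) + Suc (bits (enc I)))"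
  proof (rule bits_list_le)
    fix z assume zz: "z \<in> set zs"
    note n = sub_node[OF sub zz]
    have "fst z \<le> bits (enc I)" using n length_le_bits[of U] UI by linarith
    moreover have "snd z \<le> bits (enc I)"
      using n length_le_bits[of "U ! fst z"] bits_in_set[of "U ! fst z" U] UI by fastforce
    ultimately show "bits (enc z) \<le> 1 + Suc (bits (enc I)) + Suc (bits (enc I))"
      using bits_of_nat[of "fst z"] bits_of_nat[of "snd z"] by (cases z) (simp add: enc_nat_simp)
  qed
  also have "\<dots> \<le> 1 + bits (enc I) * Suc (1 + Suc (bits (enc I)) + Suc (bits (enc I)))"
    using len length_le_bits[of U] UI by (intro add_mono mult_right_mono) (auto simp: IUP)
  finally show "bits (enc zs) \<le> 1 + bits (enc I) * Suc (1 + Suc (bits (enc I)) + Suc (bits (enc I)))" .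
qed

text \<open>Each relaxed labeling in the history is an output of the solver on the original
  instance, so its size is bounded once and for all; the polynomial bounds of successive passes are
  not composed with each other.\<close>

lemma prune_seq_snd:
  assumes "I \<in> instances"
  shows "\<exists>zs. (I, zs) \<in> subproblem_instances \<and> snd (prune_seq I t) = solve_subproblem (I, zs)"
  using prune_seq_partial[OF assms] start_labeling(1)[OF assms] assms
  by (cases t) (auto simp: prune_seq_0 prune_seq_Suc prune_step_def subproblem_instances_def)

lemma ptime_prune_run: "ptime instances prune_run"
proof -
  define D where "D = (\<lambda>I. (I, [prune_seq I 0])) ` instances"
  define E where "E = {s :: run_state. snd s \<noteq> [] \<and> (fst s, fst (hd (snd s))) \<in> subproblem_instances}"
  define N where "N a = bits (enc (fst a))" for a :: run_state
  define Z where "Z a = 1 + N a * Suc (1 + Suc (N a) + Suc (N a))" for a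
  have N: "psize D N" unfolding N_def by (rule ptime_psize) (intro pt)
  have Z: "psize D Z" unfolding Z_def by (intro ps N)
  have "psize D (\<lambda>a. 1 + N a + Z a)" by (intro ps N Z)
  \<comment> \<open>One polynomial bounds the solver output for all subproblems met during the
    run.\<close>
  from psize_uniform[OF ptime_psize[OF ptime_solve_subproblem] this] obtain S where S: "psize D S"
    "\<And>a J. a \<in> D \<Longrightarrow> J \<in> subproblem_instances \<Longrightarrow> bits (enc J) \<le> 1 + N a + Z a \<Longrightarrow> bits (enc (solve_subproblem J)) \<le> S a"
    by blast
  have run: "ptime D (run_until live run_step)"
  proof (rule ptime_run_until[of E _ _ _ run_measure "\<lambda>a. 1 + N a + (1 + (N a + 2) * Suc (1 + Z a + S a))" run_inv])
    show "ptime E live" unfolding live_def[abs_def]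
      by (rule ptime_if_strong) (intro pt ptime_hd; auto simp: E_def)+
    have h: "ptime E (\<lambda>s. (fst s, hd (snd s)))" by (intro pt ptime_hd) (simp add: E_def)
    have "ptime E (\<lambda>s. (\<lambda>z. prune_step (fst z) (snd z)) (fst s, hd (snd s)))"
      by (rule ptime_comp[OF ptime_prune_step h]) (simp add: E_def)
    thus "ptime E run_step" unfolding run_step_def[abs_def] fst_conv snd_conv by (intro pt)
    have "psize D (\<lambda>a. Suc (N a))" by (intro ps N)
    thus "psize D run_measure"
    proof (rule psize_mono)
      fix a assume "a \<in> D"
      then obtain I where I: "I \<in> instances" "a = (I, [prune_seq I 0])" by (auto simp: D_def)
      have "length (fst (prune_seq I 0)) \<le> bits (enc (fst I))"
        using prune_seq_length(1)[OF I(1)] length_le_bits[of "fst I"] by linarith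
      also have "\<dots> \<le> N a" by (cases I) (simp add: N_def I(2))
      finally show "run_measure a \<le> Suc (N a)" by (simp add: run_measure_def I(2))
    qed
    show "psize D (\<lambda>a. 1 + N a + (1 + (N a + 2) * Suc (1 + Z a + S a)))" by (intro ps N Z S)
    fix a assume aD: "a \<in> D"
    then obtain I where I: "I \<in> instances" "a = (I, [prune_seq I 0])" by (auto simp: D_def)
    show "run_inv a a" using run_inv_init[OF I(1)] I(2) by simp
    fix s
    show "run_inv a (run_step s) \<and> run_measure (run_step s) < run_measure s" if "run_inv a s" "live s"
      using run_inv_step[OF that] by blast
    assume "run_inv a s"
    then obtain n where s: "s = (I, map (prune_seq I) (rev [0..<Suc n]))" and n: "n \<le> Suc (length (fst I))"
      using I(2) by (auto simp: run_inv_def split: if_splits)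
    have nN: "length (fst I) \<le> N a"
      using length_le_bits[of "fst I"] by (cases I) (simp add: N_def I(2))
    have "s \<in> E" using prune_seq_partial[OF I(1), of n] I(1) by (simp add: E_def s subproblem_instances_def)
    moreover have "bits (enc s) \<le> 1 + N a + (1 + (N a + 2) * Suc (1 + Z a + S a))"
    proof -
      have "bits (enc (snd s)) \<le> 1 + length (snd s) * Suc (1 + Z a + S a)"
      proof (rule bits_list_le)
        fix e assume "e \<in> set (snd s)"
        then obtain t where t: "e = prune_seq I t" by (auto simp: s simp del: upt_Suc)
        have "bits (enc (fst e)) \<le> Z a"
          unfolding t Z_def N_def I(2) fst_conv by (rule bits_partial_labeling(2)[OF I(1) prune_seq_partial[OF I(1)]])
        moreover obtain zs where zs: "(I, zs) \<in> subproblem_instances" "snd e = solve_subproblem (I, zs)"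
          using prune_seq_snd[OF I(1), of t] t by blast
        have "bits (enc zs) \<le> Z a"
          using bits_partial_labeling(2)[OF I(1), of zs] zs(1) by (simp add: Z_def N_def I(2) subproblem_instances_def)
        hence "bits (enc (snd e)) \<le> S a"
          unfolding zs(2) by (intro S(2)[OF aD zs(1)]) (simp add: N_def I(2))
        ultimately show "bits (enc e) \<le> 1 + Z a + S a" by (cases e) simp
      qed
      also have "\<dots> \<le> 1 + (N a + 2) * Suc (1 + Z a + S a)"
        using n nN by (intro add_mono mult_right_mono) (auto simp: s)
      finally show ?thesis by (simp add: s N_def I(2))
    qed
    ultimately show "s \<in> E \<and> bits (enc s) \<le> 1 + N a + (1 + (N a + 2) * Suc (1 + Z a + S a))" by blast
  qed
  have st: "ptime instances (\<lambda>I. (I, (start_labeling I, ([], [])) :: partial_labeling \<times> rational_relaxed))"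
    unfolding start_labeling_def by (intro pt)
  have "ptime instances (\<lambda>I. (\<lambda>z. prune_step (fst z) (snd z)) (I, (start_labeling I, ([], []))))"
    by (rule ptime_comp[OF ptime_prune_step st]) (simp add: subproblem_instances_def start_labeling)
  hence "ptime instances (\<lambda>I. (I, [prune_seq I 0]))" unfolding prune_seq_0 by (intro pt) simp
  from ptime_comp[OF run this] have "ptime instances (\<lambda>I. run_until live run_step (I, [prune_seq I 0]))"
    by (auto simp: D_def)
  thus ?thesis unfolding prune_run_def[abs_def] by (intro pt)
qed

theorem pruning_poly_time: "poly_time_solvable instances enc_inst solves_pruning"
  unfolding enc_inst_enc
proof (rule poly_time_solvableI[OF ptime_prune_run])
  show "solves_pruning I (enc (prune_run I))" if "I \<in> instances" for I by (rule prune_run_correct[OF that])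
qed

text \<open>Existence, continuation and length of runs and the persistence of the output are shown
  for arbitrary real potentials. The complexity statements concern rational potentials in binary
  encoding, and for the subproblems arbitrary test labelings, not only those that arise in a
  run.\<close>

theorem mainTheorem3:
  fixes M :: "('v, 'l) model"
  assumes "wf_model M"
  shows
    "(\<exists>\<mu> A x. pruning_trace M \<mu> A x 0) \<and>
     (\<forall>\<mu> A x n. pruning_trace M \<mu> A x n \<longrightarrow>
        (\<forall>t<n. A (Suc t) \<subseteq> A t \<and> card (A (Suc t)) \<le> card (A t)) \<and>
        (\<not> halted A n \<longrightarrow>
           n \<le> card (nodes M) \<and>
           (\<exists>\<mu>' A' x'. pruning_trace M \<mu>' A' x' (Suc n) \<and>
              (\<forall>t\<le>n. \<mu>' t = \<mu> t \<and> A' t = A t) \<and> (\<forall>t<n. x' t = x t))) \<and>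
        (halted A n \<longrightarrow>
           n - 1 \<le> card (nodes M) \<and> (A n \<noteq> {} \<longrightarrow> n \<le> card (nodes M)) \<and>
           (\<exists>x'. rounds_to M (A n) (\<mu> n) x'))) \<and>
     (\<forall>A x. pruning_output M A x \<longrightarrow>
        indicator_vector x \<in> minimizers (relaxed_boundary_energy M A x) (local_polytope M A) \<and>
        persistent M A x) \<and>
     poly_time_solvable subproblem_instances (enc_pair enc_inst enc_partial_labeling)
       solves_subproblem \<and>
     poly_time_solvable instances enc_inst solves_pruning"
proof (intro conjI)
  show "\<exists>\<mu> A x. pruning_trace M \<mu> A x 0" by (rule pruning_run(1)[OF assms])
  show "\<forall>\<mu> A x n. pruning_trace M \<mu> A x n \<longrightarrow>
        (\<forall>t<n. A (Suc t) \<subseteq> A t \<and> card (A (Suc t)) \<le> card (A t)) \<and>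
        (\<not> halted A n \<longrightarrow>
           n \<le> card (nodes M) \<and>
           (\<exists>\<mu>' A' x'. pruning_trace M \<mu>' A' x' (Suc n) \<and>
              (\<forall>t\<le>n. \<mu>' t = \<mu> t \<and> A' t = A t) \<and> (\<forall>t<n. x' t = x t))) \<and>
        (halted A n \<longrightarrow>
           n - 1 \<le> card (nodes M) \<and> (A n \<noteq> {} \<longrightarrow> n \<le> card (nodes M)) \<and>
           (\<exists>x'. rounds_to M (A n) (\<mu> n) x'))"
    by (intro allI impI) (rule pruning_run(2)[OF assms])
  show "\<forall>A x. pruning_output M A x \<longrightarrow>
        indicator_vector x \<in> minimizers (relaxed_boundary_energy M A x) (local_polytope M A) \<and>
        persistent M A x"
    using pruning_output_correct[OF assms] by blast
  show "poly_time_solvable subproblem_instances (enc_pair enc_inst enc_partial_labeling) solves_subproblem"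
    by (rule subproblems_poly_time)
  show "poly_time_solvable instances enc_inst solves_pruning"
    by (rule pruning_poly_time)
qed

end
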